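(* Let $\Omega\subset\mathbb{R}^n$ be a bounded open subset. Let $f:\mathbb{R}^n\setminus\Omega\to\mathbb{R}^m$ be a continuous map that is constant along each connected component of the boundary $\Sigma=\partial\Omega$ and asymptotically flat in $\mathbb{R}^n\setminus\bar\Omega$. Assume that the graph $M$ of $f$ (with its natural metric $g$) extends $C^2$ up to its boundary $\partial M$. Assume further that $\lim_{x\to\partial\Omega}S^\perp=0$ and that, along each connected component of $\partial M$, corresponding to the connected component $\Sigma_i$ of $\Sigma$, the manifold $\bar M$ is tangent to the cylinder $\Sigma_i\times\ell_i$, where $\ell_i$ is a straight line of $\mathbb{R}^m$. Then $$m_{ADM}=\frac{1}{2(n-1)\omega_{n-1}}\left(\int_M (S+S^\perp)\,\frac{1}{\sqrt{G}}\,dM+\int_\Sigma H^\Sigma\,d\Sigma\right),$$ where $m_{ADM}$ is the ADM mass of $M$, $G=\det(g_{ij})$, and $H^\Sigma$ is the mean curvature of the hypersurface $\Sigma\subset\mathbb{R}^n$ in the direction of the unit normal $\nu$ pointing inward to $\Omega$.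
   Context: Here $n\ge 2$, $m\ge 1$; repeated indices are summed, with $i,j,k,\dots\in\{1,\dots,n\}$ and $\alpha,\beta,\dots\in\{1,\dots,m\}$; $\omega_{n-1}$ is the volume of the unit sphere in $\mathbb{R}^n$. Since $f$ is constant along each component $\Sigma_i$ of $\Sigma$, the boundary $\partial M$ is the union of the sets $\Sigma_i\times\{f(\Sigma_i)\}$, and its components are identified with those of $\Sigma$. Tangency of $\bar M$ to the cylinder means that at each point $(x,f(x))$ with $x\in\Sigma_i$, the tangent space of $\bar M$ is $T_x\Sigma_i\times L_i$, where $L_i\subset\mathbb{R}^m$ is the direction of $\ell_i$. Mean curvature: $H^\Sigma=-\mathrm{div}_{\mathbb{R}^n}\nu$ (the sum of the principal curvatures), so that with $\nu$ pointing into $\Omega$ the sphere of radius $r$ bounding a ball has $H^\Sigma=(n-1)/r$. Asymptotically flat map: a $C^2$ map $f=(f^1,\dots,f^m)$ defined on the complement in $\mathbb{R}^n$ of a subset (here of $\bar\Omega$) is asymptotically flat if the scalar curvature $S$ of its graph with the natural metric, viewed as a function of $x$, is integrable over the domain, and there is a constant $p>\frac{n-2}{2}$ such that $f^\alpha_i=\partial f^\alpha/\partial x_i=O(|x|^{-p/2})$ and $f^\alpha_{ij}=\partial^2 f^\alpha/\partial x_i\partial x_j=O(|x|^{-p/2-1})$ at infinity, for all $\alpha,i,j$. Natural metric: the metric induced from $\mathbb{R}^{n+m}$ on $M=\{(x,f(x))\}$; in the graph coordinates $x$, $g_{ij}=\delta_{ij}+f^\alpha_i f^\alpha_j$. $dM$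 is its volume element; $d\Sigma$ is the Euclidean area element of $\Sigma$. Functions on the domain of $f$ and on $M$ are identified via the projection $(x,f(x))\mapsto x$. ADM mass (computed in the graph coordinates $x$): $$m_{ADM}=\lim_{r\to\infty}\frac{1}{2(n-1)\omega_{n-1}}\int_{S_r}(g_{iji}-g_{iij})\,\nu_j\,d\mu,$$ where $g_{ijk}=\partial g_{ij}/\partial x_k$, $S_r=\{|x|=r\}$, in this formula $\nu=x/r$, and $d\mu$ is the Euclidean area element of $S_r$. Function $S^\perp$: let $\eta^\alpha=(-Df^\alpha,e_\alpha)$, where $Df^\alpha$ is the Euclidean gradient and $e_\alpha$ the canonical basis of $\mathbb{R}^m$ (these $\eta^\alpha$ form a basis of the normal bundle of $M$), and let $\nabla f^\alpha$ be the gradient of $f^\alpha$ on $(M,g)$. Then $S^\perp=\langle R^\perp(\nabla f^\alpha,\nabla f^\beta)\eta^\beta,\eta^\alpha\rangle$ (summed over $\alpha,\beta$), where $R^\perp$ is the normal curvature tensor of $M\subset\mathbb{R}^{n+m}$, $R^\perp(X,Y)\xi=\nabla^\perp_X\nabla^\perp_Y\xi-\nabla^\perp_Y\nabla^\perp_X\xi-\nabla^\perp_{[X,Y]}\xi$. By Ricci's equation, equivalently $S^\perp=g(A^\alpha\nabla f^\alpha,A^\beta\nabla f^\beta)-g(A^\alpha\nabla f^\beta,A^\beta\nabla f^\alpha)$, where $A^\alpha$ is the shape operator in the direction $\eta^\alpha$ (this makes sense for $C^2$ maps). *)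

theory Defs
  imports "HOL-Analysis.Analysis" "HOL-Library.Landau_Symbols"
begin

section \<open>Differentiability\<close>

definition C1_on :: "'a set \<Rightarrow> ('a::real_normed_vector \<Rightarrow> 'b::real_normed_vector) \<Rightarrow> bool" where
  "C1_on U h \<longleftrightarrow> open U \<and>
     (\<exists>h' :: 'a \<Rightarrow> 'a \<Rightarrow>\<^sub>L 'b.
        (\<forall>x\<in>U. (h has_derivative blinfun_apply (h' x)) (at x)) \<and> continuous_on U h')"

definition C2_on :: "'a set \<Rightarrow> ('a::real_normed_vector \<Rightarrow> 'b::real_normed_vector) \<Rightarrow> bool" where
  "C2_on U h \<longleftrightarrow> open U \<and>
     (\<exists>h' :: 'a \<Rightarrow> 'a \<Rightarrow>\<^sub>L 'b.
        (\<forall>x\<in>U. (h has_derivative blinfun_apply (h' x)) (at x)) \<and> C1_on U h')"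

definition pd :: "'n::finite \<Rightarrow> (real^'n \<Rightarrow> real) \<Rightarrow> real^'n \<Rightarrow> real" where
  "pd i h x = frechet_derivative h (at x) (axis i 1)"


section \<open>Submanifolds and tangent spaces\<close>

text \<open>
  \<open>M\<close> is an embedded \<open>C\<^sup>2\<close> submanifold with boundary \<open>B\<close>, of dimension \<open>CARD('n)\<close>.
  Charts \<open>\<psi>\<close> are \<open>C\<^sup>2\<close> on a full open set \<open>U\<close> and are restricted to a closed half-space.  One
  clause covers both kinds of points: around a point outside \<open>B\<close> the set \<open>U\<close> can be taken inside
  the open half-space.
\<close>

definition C2_submanifold_with_boundary ::
    "((real^'n::finite) \<times> (real^'m::finite)) set \<Rightarrow> ((real^'n) \<times> (real^'m)) set \<Rightarrow> bool" where
  "C2_submanifold_with_boundary M B \<longleftrightarrow> B \<subseteq> M \<and>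
     (\<forall>q\<in>M. \<exists>(U :: (real^'n) set) V \<psi> \<phi> e.
        open V \<and> q \<in> V \<and> e \<noteq> 0 \<and> C2_on U \<psi> \<and>
        (\<forall>y\<in>U. inj (frechet_derivative \<psi> (at y))) \<and>
        homeomorphism (U \<inter> {y. 0 \<le> e \<bullet> y}) (M \<inter> V) \<psi> \<phi> \<and>
        \<psi> ` (U \<inter> {y. e \<bullet> y = 0}) = B \<inter> V)"

text \<open>
  The linear span is taken because at a boundary point the initial velocities of curves
  fill only a half-space.
\<close>

definition tangent_space :: "'a::real_normed_vector set \<Rightarrow> 'a \<Rightarrow> 'a set" where
  "tangent_space X q = span {v. \<exists>c :: real \<Rightarrow> 'a. c 0 = q \<and> (\<forall>t\<ge>0. c t \<in> X) \<and>
     (c has_vector_derivative v) (at 0 within {0..})}"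

definition graph_over :: "'a set \<Rightarrow> ('a \<Rightarrow> 'b) \<Rightarrow> ('a \<times> 'b) set" where
  "graph_over D f = (\<lambda>x. (x, f x)) ` D"


section \<open>Area and mean curvature of hypersurfaces\<close>

definition set_coord :: "'n::finite \<Rightarrow> real \<Rightarrow> real^'n \<Rightarrow> real^'n" where
  "set_coord k t x = (\<chi> j. if j = k then t else x $ j)"

text \<open>
  \<open>graph_patch k U u\<close>: a \<open>C\<^sup>1\<close> function of the coordinates \<open>x\<^sub>j\<close>, \<open>j \<noteq> k\<close>.  Both \<open>U\<close> and
  \<open>u\<close> are encoded as objects on the full space that do not depend on \<open>x\<^sub>k\<close>.
\<close>

definition graph_patch :: "'n::finite \<Rightarrow> (real^'n) set \<Rightarrow> (real^'n \<Rightarrow> real) \<Rightarrow> bool" where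
  "graph_patch k U u \<longleftrightarrow> C1_on U u \<and>
     (\<forall>x\<in>U. \<forall>t. set_coord k t x \<in> U \<and> u (set_coord k t x) = u x)"

text \<open>
  The Euclidean area measure of a \<open>C\<^sup>1\<close> hypersurface \<open>X\<close>: the Borel measure carried by \<open>X\<close> whose
  area element is \<open>\<surd>(1 + \<bar>Du\<bar>\<^sup>2) dx'\<close> wherever \<open>X\<close> is a graph \<open>x\<^sub>k = u(x')\<close> over a coordinate
  hyperplane.  Such patches cover \<open>X\<close>, so this determines the measure.  Integration over
  the hyperplane, \<open>dx'\<close>, is Lebesgue integration over the slab \<open>0 \<le> x\<^sub>k \<le> 1\<close>, since
  the integrand does not depend on \<open>x\<^sub>k\<close>.
\<close>

definition is_area_measure :: "(real^'n::finite) set \<Rightarrow> (real^'n) measure \<Rightarrow> bool" where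
  "is_area_measure X \<sigma> \<longleftrightarrow> sets \<sigma> = sets borel \<and> emeasure \<sigma> (- X) = 0 \<and>
     (\<forall>k U u. graph_patch k U u \<and> (\<lambda>x. set_coord k (u x) x) ` U \<subseteq> X \<longrightarrow>
        (\<forall>A\<in>sets borel. A \<subseteq> (\<lambda>x. set_coord k (u x) x) ` U \<longrightarrow>
           emeasure \<sigma> A =
             (\<integral>\<^sup>+x. ennreal (indicator {x\<in>U. 0 \<le> x $ k \<and> x $ k \<le> 1 \<and> set_coord k (u x) x \<in> A} x *
                             sqrt (1 + (\<Sum>j\<in>UNIV. (pd j u x)\<^sup>2))) \<partial>lborel)))"

definition area_measure :: "(real^'n::finite) set \<Rightarrow> (real^'n) measure" where
  "area_measure X = (THE \<sigma>. is_area_measure X \<sigma>)"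

definition unit_sphere_area :: "'n::finite itself \<Rightarrow> real" where
  "unit_sphere_area _ = measure (area_measure (sphere (0 :: real^'n) 1)) (sphere 0 1)"

definition inward_unit_normal :: "(real^'n::finite) set \<Rightarrow> real^'n \<Rightarrow> real^'n \<Rightarrow> bool" where
  "inward_unit_normal \<Omega> x v \<longleftrightarrow> norm v = 1 \<and>
     (\<forall>w\<in>tangent_space (frontier \<Omega>) x. v \<bullet> w = 0) \<and>
     (\<forall>\<^sub>F t in at_right 0. x + t *\<^sub>R v \<in> \<Omega>)"

text \<open>
  \<open>H = - div \<nu>\<close>, where \<open>\<nu>\<close> is extended to a \<open>C\<^sup>1\<close> field \<open>N\<close> of unit vectors near the point.  Because
  \<open>N\<close> has unit length, the divergence does not depend on the extension.
\<close>

definition mean_curvature :: "(real^'n::finite) set \<Rightarrow> real^'n \<Rightarrow> real" where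
  "mean_curvature \<Omega> x = (THE h. \<exists>U (N :: real^'n \<Rightarrow> real^'n).
     x \<in> U \<and> C1_on U N \<and> (\<forall>y\<in>U. norm (N y) = 1) \<and>
     (\<forall>y\<in>U \<inter> frontier \<Omega>. inward_unit_normal \<Omega> y (N y)) \<and>
     h = - (\<Sum>i\<in>UNIV. pd i (\<lambda>y. N y $ i) x))"


section \<open>Geometry of a graph in the graph coordinates\<close>

definition D1 :: "(real^'n::finite \<Rightarrow> real^'m::finite) \<Rightarrow> 'm \<Rightarrow> 'n \<Rightarrow> real^'n \<Rightarrow> real" where
  "D1 f \<alpha> i = pd i (\<lambda>y. f y $ \<alpha>)"

definition D2 :: "(real^'n::finite \<Rightarrow> real^'m::finite) \<Rightarrow> 'm \<Rightarrow> 'n \<Rightarrow> 'n \<Rightarrow> real^'n \<Rightarrow> real" where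
  "D2 f \<alpha> i j = pd j (D1 f \<alpha> i)"

definition graph_metric :: "(real^'n::finite \<Rightarrow> real^'m::finite) \<Rightarrow> real^'n \<Rightarrow> real^'n^'n" where
  "graph_metric f x = (\<chi> i j. (if i = j then 1 else 0) + (\<Sum>\<alpha>\<in>UNIV. D1 f \<alpha> i x * D1 f \<alpha> j x))"

definition tangent_frame ::
    "(real^'n::finite \<Rightarrow> real^'m::finite) \<Rightarrow> 'n \<Rightarrow> real^'n \<Rightarrow> (real^'n) \<times> (real^'m)" where
  "tangent_frame f i x = (axis i 1, \<chi> \<alpha>. D1 f \<alpha> i x)"

definition normal_frame ::
    "(real^'n::finite \<Rightarrow> real^'m::finite) \<Rightarrow> 'm \<Rightarrow> real^'n \<Rightarrow> (real^'n) \<times> (real^'m)" where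
  "normal_frame f \<alpha> x = (- (\<chi> i. D1 f \<alpha> i x), axis \<alpha> 1)"

definition normal_part ::
    "(real^'n::finite \<Rightarrow> real^'m::finite) \<Rightarrow> real^'n \<Rightarrow> (real^'n) \<times> (real^'m) \<Rightarrow> (real^'n) \<times> (real^'m)" where
  "normal_part f x v = v -
     (\<Sum>k\<in>UNIV. \<Sum>l\<in>UNIV. (matrix_inv (graph_metric f x) $ k $ l * (v \<bullet> tangent_frame f l x))
        *\<^sub>R tangent_frame f k x)"

text \<open>
  The second fundamental form on coordinate fields: the normal part of the second derivative
  \<open>\<partial>\<^sub>i\<partial>\<^sub>j (x, f x) = (0, f\<^sub>i\<^sub>j)\<close>.
\<close>

definition second_fundamental_form ::
    "(real^'n::finite \<Rightarrow> real^'m::finite) \<Rightarrow> 'n \<Rightarrow> 'n \<Rightarrow> real^'n \<Rightarrow> (real^'n) \<times> (real^'m)" where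
  "second_fundamental_form f i j x = normal_part f x (0, \<chi> \<alpha>. D2 f \<alpha> i j x)"

text \<open>
  The curvature tensor \<open>R\<^sub>i\<^sub>j\<^sub>k\<^sub>l = g(R(\<partial>\<^sub>i,\<partial>\<^sub>j)\<partial>\<^sub>k, \<partial>\<^sub>l)\<close>, where
  \<open>R(X,Y) = \<nabla>\<^sub>X\<nabla>\<^sub>Y - \<nabla>\<^sub>Y\<nabla>\<^sub>X - \<nabla>\<^bsub>[X,Y]\<^esub>\<close>.  For a map that is only \<open>C\<^sup>2\<close> the induced metric is
  only \<open>C\<^sup>1\<close>, so the intrinsic formula (which differentiates the Christoffel symbols) is
  not available; curvature is then given by the Gauss equation, which needs no more than two
  derivatives of \<open>f\<close> and agrees with the intrinsic one for smoother maps.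
\<close>

definition riemann ::
    "(real^'n::finite \<Rightarrow> real^'m::finite) \<Rightarrow> 'n \<Rightarrow> 'n \<Rightarrow> 'n \<Rightarrow> 'n \<Rightarrow> real^'n \<Rightarrow> real" where
  "riemann f i j k l x =
     second_fundamental_form f i l x \<bullet> second_fundamental_form f j k x -
     second_fundamental_form f i k x \<bullet> second_fundamental_form f j l x"

definition scalar_curvature :: "(real^'n::finite \<Rightarrow> real^'m::finite) \<Rightarrow> real^'n \<Rightarrow> real" where
  "scalar_curvature f x =
     (\<Sum>i\<in>UNIV. \<Sum>j\<in>UNIV. \<Sum>k\<in>UNIV. \<Sum>l\<in>UNIV.
        matrix_inv (graph_metric f x) $ i $ l * matrix_inv (graph_metric f x) $ j $ k * riemann f i j k l x)"

text \<open>
  Tangent vectors of the graph are represented by their components with respect to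
  \<open>tangent_frame\<close>.  The shape operator \<open>A\<^sup>\<alpha>\<close> is determined by
  \<open>g(A\<^sup>\<alpha> \<partial>\<^sub>j, \<partial>\<^sub>i) = \<langle>B(\<partial>\<^sub>i,\<partial>\<^sub>j), \<eta>\<^sup>\<alpha>\<rangle>\<close>, with \<open>\<eta>\<^sup>\<alpha>\<close> not normalised.
\<close>

definition metric_inner ::
    "(real^'n::finite \<Rightarrow> real^'m::finite) \<Rightarrow> real^'n \<Rightarrow> real^'n \<Rightarrow> real^'n \<Rightarrow> real" where
  "metric_inner f x v w = v \<bullet> (graph_metric f x *v w)"

definition graph_gradient ::
    "(real^'n::finite \<Rightarrow> real^'m::finite) \<Rightarrow> 'm \<Rightarrow> real^'n \<Rightarrow> real^'n" where
  "graph_gradient f \<alpha> x = matrix_inv (graph_metric f x) *v (\<chi> i. D1 f \<alpha> i x)"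

definition shape_operator ::
    "(real^'n::finite \<Rightarrow> real^'m::finite) \<Rightarrow> 'm \<Rightarrow> real^'n \<Rightarrow> real^'n^'n" where
  "shape_operator f \<alpha> x = matrix_inv (graph_metric f x) **
     (\<chi> i j. second_fundamental_form f i j x \<bullet> normal_frame f \<alpha> x)"

text \<open>
  \<open>S\<^sup>\<bottom>\<close> is the sum of \<open>\<langle>R\<^sup>\<bottom>(\<nabla>f\<^sup>\<alpha>,\<nabla>f\<^sup>\<beta>)\<eta>\<^sup>\<beta>, \<eta>\<^sup>\<alpha>\<rangle>\<close>, with the normal curvature expressed by Ricci's
  equation (again because \<open>f\<close> is only \<open>C\<^sup>2\<close>).
\<close>

definition S_perp :: "(real^'n::finite \<Rightarrow> real^'m::finite) \<Rightarrow> real^'n \<Rightarrow> real" where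
  "S_perp f x = (\<Sum>\<alpha>\<in>UNIV. \<Sum>\<beta>\<in>UNIV.
     metric_inner f x (shape_operator f \<alpha> x *v graph_gradient f \<alpha> x)
                      (shape_operator f \<beta> x *v graph_gradient f \<beta> x) -
     metric_inner f x (shape_operator f \<alpha> x *v graph_gradient f \<beta> x)
                      (shape_operator f \<beta> x *v graph_gradient f \<alpha> x))"

text \<open>The volume element \<open>dM = \<surd>G dx\<close> of the graph over \<open>D\<close>, on the coordinate domain.\<close>

definition graph_volume ::
    "(real^'n::finite) set \<Rightarrow> (real^'n \<Rightarrow> real^'m::finite) \<Rightarrow> (real^'n) measure" where
  "graph_volume D f =
     density lborel (\<lambda>x. ennreal (indicator D x * sqrt (det (graph_metric f x))))"


section \<open>Asymptotic flatness and mass\<close>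

definition asymptotically_flat ::
    "(real^'n::finite) set \<Rightarrow> (real^'n \<Rightarrow> real^'m::finite) \<Rightarrow> bool" where
  "asymptotically_flat D f \<longleftrightarrow> C2_on D f \<and>
     set_integrable lborel D (scalar_curvature f) \<and>
     (\<exists>p > (real CARD('n) - 2) / 2.
        (\<forall>\<alpha> i. D1 f \<alpha> i \<in> O[at_infinity](\<lambda>x. norm x powr (- p / 2))) \<and>
        (\<forall>\<alpha> i j. D2 f \<alpha> i j \<in> O[at_infinity](\<lambda>x. norm x powr (- p / 2 - 1))))"

definition ADM_flux :: "(real^'n::finite \<Rightarrow> real^'m::finite) \<Rightarrow> real \<Rightarrow> real" where
  "ADM_flux f r = 1 / (2 * (real CARD('n) - 1) * unit_sphere_area TYPE('n)) *
     (LINT x:sphere 0 r|area_measure (sphere 0 r). (\<Sum>i\<in>UNIV. \<Sum>j\<in>UNIV.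
             (pd i (\<lambda>y. graph_metric f y $ i $ j) x - pd j (\<lambda>y. graph_metric f y $ i $ i) x) *
             (x $ j / r)))"

definition ADM_mass :: "(real^'n::finite \<Rightarrow> real^'m::finite) \<Rightarrow> real" where
  "ADM_mass f = Lim at_top (ADM_flux f)"

end

theory Submission
 imports Defs "HOL-Real_Asymp.Real_Asymp"
begin

text \<open>
 Write \<open>H\<^sub>\<alpha>\<close> for the Hessian of \<open>f\<^sup>\<alpha>\<close>, \<open>g\<close> for the graph metric and \<open>p\<^sub>\<alpha> = g\<^sup>-\<^sup>1 Df\<^sup>\<alpha>\<close>.  The field
 \<open>X = \<Sum>\<^sub>\<alpha> tr(g\<^sup>-\<^sup>1 H\<^sub>\<alpha>) p\<^sub>\<alpha> - g\<^sup>-\<^sup>1 H\<^sub>\<alpha> p\<^sub>\<alpha>\<close> (\<open>flux_field\<close>) has Euclidean divergence \<open>S + S\<^sup>\<bottom>\<close>, and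
 \<open>dM / \<surd>G\<close> is Lebesgue measure.  So the formula is the divergence theorem for \<open>X\<close> on the part of the
 exterior of \<open>\<Omega>\<close> in a large ball: the flux through the sphere tends to a multiple of the
 mass, and the flux through \<open>\<Sigma>\<close> into the exterior is the integral of the mean curvature.

 Interior.  As \<open>f\<close> is only \<open>C\<^sup>2\<close>, \<open>X\<close> is merely continuous.  But \<open>X\<^sub>j = \<Sum> c\<^sub>i\<^sub>j \<partial>\<^sub>i h\<close> with first
 derivatives \<open>h\<close> of \<open>f\<close> and \<open>C\<^sup>1\<close> coefficients antisymmetric in \<open>i, j\<close>, so the second derivatives of
 \<open>h\<close> cancel and the divergence exists weakly (\<open>weak_divergence_antisymmetric\<close>).  Its value follows
 by pointwise algebra from the Gauss and Ricci equations (\<open>curvature_divergence\<close>).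

 Boundary.  The tangent spaces of the graph become vertical at \<open>\<Sigma>\<close>, so \<open>Df\<close> blows up.  The closed
 graph is parametrized by \<open>y \<mapsto> (set_coord k (w y) y, z y)\<close>, \<open>y\<^sub>k \<ge> 0\<close>, with \<open>C\<^sup>2\<close> functions
 \<open>w, z\<close>, and tangency to the cylinder says \<open>\<partial>\<^sub>k w = 0\<close> where \<open>y\<^sub>k = 0\<close> (\<open>boundary_chart_exists\<close>).
 In these coordinates the vector density of \<open>X\<close> is an expression in \<open>w\<close> and \<open>z\<close> that is continuous
 up to \<open>y\<^sub>k = 0\<close>; its \<open>k\<close>-th component there is the mean curvature times the area factor
 (\<open>chart_flux_mean_curvature\<close>).  Cutting off at height \<open>y\<^sub>k = \<epsilon>\<close> turns the weak identity into a
 boundary term (locale \<open>collar\<close>), and a partition argument makes it global (\<open>divergence_theorem\<close>).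
 Spheres are treated in the same way.  The area measure exists because two graph patches agree on
 the area of their overlap (\<open>transition_patch_area\<close>).

 Infinity.  The mass is defined by the flux of \<open>X\<close> with \<open>g\<^sup>-\<^sup>1\<close> replaced by \<open>1\<close>.  With \<open>p\<close> the
 exponent of asymptotic flatness, the difference is \<open>O(\<bar>x\<bar>\<^sup>-\<^sup>2\<^sup>p\<^sup>-\<^sup>1)\<close> on spheres of area \<open>O(r\<^sup>n\<^sup>-\<^sup>1)\<close>, and \<open>2p > n - 2\<close>.  Similarly
 \<open>S\<^sup>\<bottom> = O(\<bar>x\<bar>\<^sup>-\<^sup>2\<^sup>p\<^sup>-\<^sup>2)\<close>; as it tends to \<open>0\<close> at \<open>\<Sigma>\<close>, it is integrable.
\<close>

text \<open>Sums over a whole finite index type are written without a range.\<close>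

no_notation suminf (binder "\<Sum>" 10)
abbreviation univ_sum :: "('a::finite => 'b::comm_monoid_add) => 'b" (binder "\<Sum>" 10)
 where "univ_sum f \<equiv> sum f UNIV"

section \<open>Calculus with partial derivatives\<close>

lemma pd_eqI:
 "(h has_derivative h') (at x) ==> pd i h x = h' (axis i 1)"
 unfolding pd_def by (metis frechet_derivative_at)

lemma has_derivative_pd:
 fixes h :: "real^'n => real"
 assumes "h differentiable (at x)"
 shows "(h has_derivative (\<lambda>v. \<Sum>i. v $ i * pd i h x)) (at x)"
proof -
 let ?h' = "frechet_derivative h (at x)"
 have d: "(h has_derivative ?h') (at x)"
  using assms frechet_derivative_works by blast
 hence lin: "linear ?h'" by (rule has_derivative_linear)
 have "?h' = (\<lambda>v. \<Sum>i. v $ i * pd i h x)"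
 proof (rule ext)
  fix v
  have "?h' v = ?h' (\<Sum>i. v $ i *s axis i 1)" by (simp add: basis_expansion)
  also have "... = (\<Sum>i. ?h' ((v $ i) *\<^sub>R axis i 1))"
   by (simp add: linear_sum[OF lin] scalar_mult_eq_scaleR)
  also have "... = (\<Sum>i. v $ i * pd i h x)"
   by (simp add: linear_scale[OF lin] pd_def)
  finally show "?h' v = (\<Sum>i. v $ i * pd i h x)" .
 qed
 with d show ?thesis by simp
qed

lemma pd_eqI_sum:
 fixes h :: "real^'n => real"
 assumes "(h has_derivative (\<lambda>v. \<Sum>i. v $ i * d i)) (at x)"
 shows "pd i h x = d i"
 using pd_eqI[OF assms, of i] by (simp add: axis_def if_distrib[of "\<lambda>a. a * _"] cong: if_cong)

lemma C1_on_openD: "C1_on U h ==> open U"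
 by (auto simp: C1_on_def)

lemma C1_on_differentiable: "C1_on U h ==> x \<in> U ==> h differentiable (at x)"
 unfolding C1_on_def differentiable_def by blast

lemma C1_on_continuous: "C1_on U h ==> continuous_on U h"
 by (meson C1_on_differentiable continuous_at_imp_continuous_on differentiable_imp_continuous_within)

lemma C1_on_has_derivative_pd:
 fixes h :: "real^'n => real"
 shows "C1_on U h ==> x \<in> U ==> (h has_derivative (\<lambda>v. \<Sum>i. v $ i * pd i h x)) (at x)"
 by (rule has_derivative_pd[OF C1_on_differentiable])

text \<open>The derivative, as an operator, is a finite combination of the partial derivatives.\<close>

lemma C1_on_iff:
 fixes h :: "real^'n => real"
 shows "C1_on U h \<longleftrightarrow> open U \<and> (\<forall>x\<in>U. h differentiable (at x)) \<and> (\<forall>i. continuous_on U (pd i h))"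
  (is "?L \<longleftrightarrow> ?R")
proof
 assume L: ?L
 then obtain h' :: "real^'n => (real^'n) \<Rightarrow>\<^sub>L real" where
  h': "\<forall>x\<in>U. (h has_derivative blinfun_apply (h' x)) (at x)" "continuous_on U h'"
  unfolding C1_on_def by blast
 have "continuous_on U (pd i h)" for i
 proof -
  have "continuous_on U (\<lambda>x. blinfun_apply (h' x) (axis i 1))"
   by (intro continuous_intros h')
  thus ?thesis
   by (rule continuous_on_eq) (use h' pd_eqI in metis)
 qed
 thus ?R using L C1_on_differentiable C1_on_openD by blast
next
 assume R: ?R
 define h' where "h' x = (\<Sum>i. pd i h x *\<^sub>R blinfun_inner_left (axis i 1 :: real^'n))" for x
 have ap: "blinfun_apply (h' x) = (\<lambda>v. \<Sum>i. v $ i * pd i h x)" for x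
  by (auto simp: h'_def blinfun.sum_left blinfun.scaleR_left inner_axis fun_eq_iff mult.commute)
 have "continuous_on U h'"
  unfolding h'_def using R by (intro continuous_intros) auto
 moreover have "\<forall>x\<in>U. (h has_derivative blinfun_apply (h' x)) (at x)"
  unfolding ap using R has_derivative_pd by blast
 ultimately show ?L unfolding C1_on_def using R by blast
qed

lemma C1_on_pd_continuous:
 fixes h :: "real^'n => real"
 shows "C1_on U h ==> continuous_on U (pd i h)"
 by (simp add: C1_on_iff)

lemma C1_onI:
 fixes h :: "real^'n => real"
 assumes "open U" "\<And>x. x \<in> U ==> (h has_derivative (\<lambda>v. \<Sum>i. v $ i * d i x)) (at x)"
  "\<And>i. continuous_on U (d i)"
 shows "C1_on U h"
 unfolding C1_on_iff
proof (intro conjI ballI allI)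
 show "h differentiable (at x)" if "x \<in> U" for x
  using assms(2)[OF that] by (auto simp: differentiable_def)
 show "continuous_on U (pd i h)" for i
  using assms(3)[of i] by (rule continuous_on_eq) (rule pd_eqI_sum[OF assms(2), symmetric])
qed (fact assms)

lemma has_derivative_cong_open:
 assumes "open U" "x \<in> U" "\<And>y. y \<in> U ==> h y = k y"
 shows "(h has_derivative h') (at x) \<longleftrightarrow> (k has_derivative h') (at x)"
 using has_derivative_transform_within_open[OF _ assms(1,2)] assms(3) by metis

lemma pd_cong:
 assumes "open U" "x \<in> U" "\<And>y. y \<in> U ==> h y = k y"
 shows "pd i h x = pd i k x"
 unfolding pd_def frechet_derivative_def using has_derivative_cong_open[OF assms] by simp

lemma C1_on_cong:
 assumes "\<And>y. y \<in> U ==> h y = k y"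
 shows "C1_on U h \<longleftrightarrow> C1_on U k"
proof -
 have "open U ==> x \<in> U ==> (h has_derivative h') (at x) \<longleftrightarrow> (k has_derivative h') (at x)" for x h'
  by (rule has_derivative_cong_open) (use assms in auto)
 thus ?thesis unfolding C1_on_def by auto
qed

lemma C1_on_subset: "C1_on U h ==> open V ==> V \<subseteq> U ==> C1_on V h"
 unfolding C1_on_def by (meson continuous_on_subset subsetD)

lemma C1_on_locally:
 fixes h :: "real^'n => real"
 assumes "open U" "\<And>x. x \<in> U ==> \<exists>V. x \<in> V \<and> C1_on V h"
 shows "C1_on U h"
 unfolding C1_on_iff
proof (intro conjI ballI allI)
 show "h differentiable (at x)" if "x \<in> U" for x
  using assms(2)[OF that] C1_on_differentiable by blast
 have "isCont (pd i h) x" if "x \<in> U" for x i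
  using assms(2)[OF that]
  by (auto simp: C1_on_iff continuous_on_eq_continuous_at)
 thus "continuous_on U (pd i h)" for i
  by (simp add: continuous_at_imp_continuous_on)
qed (fact assms)

lemma C1_on_const [simp]: "open U ==> C1_on U (\<lambda>x. c)"
 unfolding C1_on_def by (auto simp: zero_blinfun.rep_eq intro!: exI[of _ "\<lambda>x. 0"])

lemma has_derivative_nth: "((\<lambda>x::real^'n. x $ i) has_derivative (\<lambda>v. v $ i)) (at x)"
 by (rule bounded_linear.has_derivative[OF bounded_linear_vec_nth has_derivative_ident])

lemma pd_nth [simp]: "pd i (\<lambda>x::real^'n. x $ j) x = (if i = j then 1 else 0)"
 using pd_eqI[OF has_derivative_nth, of i j x] by (auto simp: axis_def)

lemma pd_const [simp]: "pd i (\<lambda>x. c) x = 0"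
 using pd_eqI[OF has_derivative_const] by fastforce

lemma C1_on_nth [simp]: "open U ==> C1_on U (\<lambda>x::real^'n. x $ i)"
 by (rule C1_onI[where d = "\<lambda>j x. if j = i then 1 else 0"])
  (auto simp: has_derivative_nth if_distrib cong: if_cong)

lemmas frechetD = frechet_derivative_works[THEN iffD1]

lemma pd_add:
 assumes "h differentiable (at x)" "k differentiable (at x)"
 shows "pd i (\<lambda>x. h x + k x) x = pd i h x + pd i k x"
 using pd_eqI[OF has_derivative_add[OF assms[THEN frechetD]], of i] by (simp add: pd_def)

lemma pd_minus:
 assumes "h differentiable (at x)"
 shows "pd i (\<lambda>x. - h x) x = - pd i h x"
 using pd_eqI[OF has_derivative_minus[OF assms[THEN frechetD]], of i] by (simp add: pd_def)

lemma pd_diff: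
 assumes "h differentiable (at x)" "k differentiable (at x)"
 shows "pd i (\<lambda>x. h x - k x) x = pd i h x - pd i k x"
 using pd_eqI[OF has_derivative_diff[OF assms[THEN frechetD]], of i] by (simp add: pd_def)

lemma pd_mult:
 assumes "h differentiable (at x)" "k differentiable (at x)"
 shows "pd i (\<lambda>x. h x * k x) x = pd i h x * k x + h x * pd i k x"
 using pd_eqI[OF has_derivative_mult[OF assms[THEN frechetD]], of i] by (simp add: pd_def)

lemma pd_sum:
 assumes "\<And>a. a \<in> A ==> h a differentiable (at x)"
 shows "pd i (\<lambda>x. \<Sum>a\<in>A. h a x) x = (\<Sum>a\<in>A. pd i (h a) x)"
 using assms
proof (induction A rule: infinite_finite_induct)
 case (insert a A)
 hence "pd i (\<lambda>x. h a x + (\<Sum>a\<in>A. h a x)) x = pd i (h a) x + pd i (\<lambda>x. \<Sum>a\<in>A. h a x) x"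
  by (intro pd_add) auto
 with insert show ?case by simp
qed auto

lemma pd_comp_real:
 assumes "h differentiable (at x)" "(g has_real_derivative g') (at (h x))"
 shows "pd i (\<lambda>x. g (h x)) x = g' * pd i h x"
 using pd_eqI[OF has_derivative_compose[OF frechetD[OF assms(1)] assms(2)[unfolded has_field_derivative_def]], of i]
 by (simp add: pd_def)

lemma differentiable_comp_real:
 assumes "h differentiable (at x)" "(g has_real_derivative g') (at (h x))"
 shows "(\<lambda>x. g (h x)) differentiable (at x)"
 using has_derivative_compose[OF frechetD[OF assms(1)] assms(2)[unfolded has_field_derivative_def]] by (rule differentiableI)

context
 fixes U :: "(real^'n) set"
begin

lemma C1_on_add:
 "C1_on U h ==> C1_on U k ==> C1_on U (\<lambda>x. h x + k x :: real)"
 unfolding C1_on_iff by (auto simp: pd_add cong: continuous_on_cong intro!: continuous_intros)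

lemma C1_on_diff:
 "C1_on U h ==> C1_on U k ==> C1_on U (\<lambda>x. h x - k x :: real)"
 unfolding C1_on_iff by (auto simp: pd_diff cong: continuous_on_cong intro!: continuous_intros)

lemma C1_on_mult:
 "C1_on U h ==> C1_on U k ==> C1_on U (\<lambda>x. h x * k x :: real)"
 using C1_on_continuous[of U h] C1_on_continuous[of U k]
 unfolding C1_on_iff by (auto simp: pd_mult cong: continuous_on_cong intro!: continuous_intros)

lemma C1_on_sum:
 "open U ==> (\<And>a. a \<in> A ==> C1_on U (h a)) ==> C1_on U (\<lambda>x. \<Sum>a\<in>A. h a x :: real)"
 by (induction A rule: infinite_finite_induct) (auto intro!: C1_on_add)

lemma C1_on_prod:
 "open U ==> (\<And>a. a \<in> A ==> C1_on U (h a)) ==> C1_on U (\<lambda>x. \<Prod>a\<in>A. h a x :: real)"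
 by (induction A rule: infinite_finite_induct) (auto intro!: C1_on_mult)

lemma C1_on_comp_real:
 assumes "C1_on U h" "\<And>x. x \<in> U ==> (g has_real_derivative g' (h x)) (at (h x))"
  "continuous_on U (\<lambda>x. g' (h x))"
 shows "C1_on U (\<lambda>x. g (h x))"
 unfolding C1_on_iff
proof (intro conjI ballI allI)
 show "open U" using assms(1) by (rule C1_on_openD)
 show "(\<lambda>x. g (h x)) differentiable (at x)" if "x \<in> U" for x
  using differentiable_comp_real[OF C1_on_differentiable[OF assms(1) that] assms(2)[OF that]] .
 have "continuous_on U (\<lambda>x. g' (h x) * pd i h x)" for i
  using assms by (intro continuous_intros C1_on_pd_continuous)
 thus "continuous_on U (pd i (\<lambda>x. g (h x)))" for i
  by (rule continuous_on_eq)
   (rule pd_comp_real[OF C1_on_differentiable[OF assms(1)] assms(2), symmetric])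
qed

lemma C1_on_inverse:
 assumes "C1_on U h" "\<And>x. x \<in> U ==> h x \<noteq> 0"
 shows "C1_on U (\<lambda>x. inverse (h x) :: real)"
proof (rule C1_on_comp_real[OF assms(1), where g = inverse and g' = "\<lambda>y. - (inverse y ^ Suc (Suc 0))"])
 show "continuous_on U (\<lambda>x. - (inverse (h x) ^ Suc (Suc 0)))"
  using assms C1_on_continuous[OF assms(1)] by (intro continuous_intros) auto
 show "(inverse has_real_derivative - (inverse (h x) ^ Suc (Suc 0))) (at (h x))" if "x \<in> U" for x
  by (rule DERIV_inverse) (use assms that in auto)
qed

lemma C1_on_divide:
 assumes "C1_on U h" "C1_on U k" "\<And>x. x \<in> U ==> k x \<noteq> 0"
 shows "C1_on U (\<lambda>x. h x / k x :: real)"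
 unfolding divide_inverse using assms by (intro C1_on_mult C1_on_inverse)

lemma C1_on_power:
 "C1_on U h ==> C1_on U (\<lambda>x. h x ^ n :: real)"
 using C1_on_openD[of U h] by (induction n) (auto intro: C1_on_mult)

lemma C1_on_sqrt:
 assumes "C1_on U h" "\<And>x. x \<in> U ==> h x > 0"
 shows "C1_on U (\<lambda>x. sqrt (h x))"
proof (rule C1_on_comp_real[OF assms(1), where g = sqrt and g' = "\<lambda>y. inverse (sqrt y) / 2"])
 show "continuous_on U (\<lambda>x. inverse (sqrt (h x)) / 2)"
  using assms C1_on_continuous[OF assms(1)] by (fastforce intro!: continuous_intros)
qed (use assms in \<open>auto intro!: DERIV_real_sqrt\<close>)

end

lemma has_derivative_vec_components:
 fixes F :: "real^'a => real^'b"
 assumes "\<And>j. ((\<lambda>x. F x $ j) has_derivative (\<lambda>v. F' v $ j)) (at x)"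
 shows "(F has_derivative F') (at x)"
 using assms
 by (subst has_derivative_componentwise_within) (auto simp: Basis_vec_def inner_axis)

lemma has_derivative_comp_pd:
 fixes F :: "real^'a => real^'b"
 assumes "h differentiable (at (F x))" "\<And>j. (\<lambda>x. F x $ j) differentiable (at x)"
 shows "((\<lambda>x. h (F x)) has_derivative
  (\<lambda>v. \<Sum>i. v $ i * (\<Sum>j. pd j h (F x) * pd i (\<lambda>x. F x $ j) x))) (at x)"
proof -
 have "(F has_derivative (\<lambda>v. \<chi> j. \<Sum>i. v $ i * pd i (\<lambda>x. F x $ j) x)) (at x)"
  by (rule has_derivative_vec_components) (simp add: has_derivative_pd assms)
 from has_derivative_compose[OF this has_derivative_pd[OF assms(1)]]
 have "((\<lambda>x. h (F x)) has_derivative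
  (\<lambda>v. \<Sum>j. (\<Sum>i. v $ i * pd i (\<lambda>x. F x $ j) x) * pd j h (F x))) (at x)" by simp
 also have "(\<lambda>v::real^'a. \<Sum>j. (\<Sum>i. v $ i * pd i (\<lambda>x. F x $ j) x) * pd j h (F x))
  = (\<lambda>v. \<Sum>i. v $ i * (\<Sum>j. pd j h (F x) * pd i (\<lambda>x. F x $ j) x))"
  unfolding sum_distrib_left sum_distrib_right
  by (rule ext, subst sum.swap) (simp add: mult_ac)
 finally show ?thesis .
qed

lemma pd_comp:
 fixes F :: "real^'a => real^'b"
 assumes "h differentiable (at (F x))" "\<And>j. (\<lambda>x. F x $ j) differentiable (at x)"
 shows "pd i (\<lambda>x. h (F x)) x = (\<Sum>j. pd j h (F x) * pd i (\<lambda>x. F x $ j) x)"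
 by (rule pd_eqI_sum[OF has_derivative_comp_pd[OF assms]])

lemma differentiable_set_coord:
 assumes "w differentiable (at y)"
 shows "(\<lambda>y. set_coord k (w y) y $ i) differentiable (at y)"
 using assms by (cases "i = k") (auto simp: set_coord_def intro!: has_derivative_nth[THEN differentiableI])

lemma pd_comp_set_coord:
 assumes "h differentiable (at (set_coord k (w y) y))" "w differentiable (at y)"
 shows "pd j (\<lambda>y. h (set_coord k (w y) y)) y =
  (if j = k then 0 else pd j h (set_coord k (w y) y)) + pd k h (set_coord k (w y) y) * pd j w y"
proof -
 let ?P = "\<lambda>y. set_coord k (w y) y"
 have "pd j (\<lambda>y. h (?P y)) y = (\<Sum>i. pd i h (?P y) * pd j (\<lambda>y. ?P y $ i) y)"
  by (intro pd_comp differentiable_set_coord assms)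
 also have "... = pd k h (?P y) * pd j w y + (\<Sum>i\<in>UNIV - {k}. pd i h (?P y) * pd j (\<lambda>y. ?P y $ i) y)"
  by (subst sum.remove[of _ k]) (auto simp: set_coord_def)
 also have "(\<Sum>i\<in>UNIV - {k}. pd i h (?P y) * pd j (\<lambda>y. ?P y $ i) y) = (\<Sum>i\<in>UNIV - {k}. if i = j then pd j h (?P y) else 0)"
  by (intro sum.cong) (auto simp: set_coord_def)
 finally show ?thesis by simp
qed

lemma C1_vec_continuous:
 fixes F :: "real^'a => real^'b"
 assumes "\<And>j. C1_on U (\<lambda>x. F x $ j)"
 shows "continuous_on U F"
proof -
 have "continuous_on U (\<lambda>x. \<chi> j. F x $ j)"
  by (intro continuous_on_vec_lambda C1_on_continuous[OF assms])
 thus ?thesis by simp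
qed

lemma C1_on_comp:
 fixes F :: "real^'a => real^'b"
 assumes "C1_on V h" "\<And>j. C1_on U (\<lambda>x. F x $ j)" "F ` U \<subseteq> V"
 shows "C1_on U (\<lambda>x. h (F x) :: real)"
proof (rule C1_onI)
 show "open U" using assms(2) C1_on_openD by blast
 show "((\<lambda>x. h (F x)) has_derivative
  (\<lambda>v. \<Sum>i. v $ i * (\<Sum>j. pd j h (F x) * pd i (\<lambda>x. F x $ j) x))) (at x)"
  if "x \<in> U" for x
  using assms that by (intro has_derivative_comp_pd C1_on_differentiable) auto
 show "continuous_on U (\<lambda>x. \<Sum>j. pd j h (F x) * pd i (\<lambda>x. F x $ j) x)" for i
  by (intro continuous_intros C1_on_pd_continuous assms
    continuous_on_compose2[OF C1_on_pd_continuous[OF assms(1)] C1_vec_continuous[OF assms(2)]])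
qed

lemma C1_on_bounded_linear:
 assumes "C1_on U h" "bounded_linear L"
 shows "C1_on U (\<lambda>x. L (h x))"
proof -
 obtain h' where h': "\<And>x. x\<in>U ==> (h has_derivative blinfun_apply (h' x)) (at x)" "continuous_on U h'"
  using assms(1) unfolding C1_on_def by blast
 have "continuous_on U (\<lambda>x. Blinfun L o\<^sub>L h' x)"
  by (intro continuous_intros h')
 moreover have "((\<lambda>x. L (h x)) has_derivative blinfun_apply (Blinfun L o\<^sub>L h' x)) (at x)" if "x \<in> U" for x
  using bounded_linear.has_derivative[OF assms(2) h'(1)[OF that]]
  by (simp add: bounded_linear_Blinfun_apply[OF assms(2)] o_def blinfun_compose.rep_eq)
 ultimately show ?thesis using C1_on_openD[OF assms(1)] unfolding C1_on_def
  by (intro conjI exI[of _ "\<lambda>x. Blinfun L o\<^sub>L h' x"] ballI)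
qed

lemma C1_on_vec:
 fixes N :: "real^'n => real^'m"
 assumes "\<And>j. C1_on U (\<lambda>x. N x $ j)"
 shows "C1_on U N"
proof -
 define N' where "N' x = Blinfun (\<lambda>v. \<chi> j. \<Sum>i. v $ i * pd i (\<lambda>x. N x $ j) x)" for x
 have bl: "bounded_linear (\<lambda>v::real^'n. (\<chi> j. \<Sum>i. v $ i * pd i (\<lambda>x. N x $ j) x)::real^'m)" for x
  by (intro linear_conv_bounded_linear[THEN iffD1] linearI)
    (auto simp: vec_eq_iff sum.distrib distrib_right sum_distrib_left mult_ac)
 have ap: "blinfun_apply (N' x) = (\<lambda>v. \<chi> j. \<Sum>i. v $ i * pd i (\<lambda>x. N x $ j) x)" for x
  unfolding N'_def by (simp add: bounded_linear_Blinfun_apply[OF bl])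
 have "continuous_on U N'"
  by (rule continuous_on_blinfun_componentwise)
    (use assms in \<open>auto simp: ap C1_on_iff intro!: continuous_intros continuous_on_vec_lambda\<close>)
 moreover have "(N has_derivative blinfun_apply (N' x)) (at x)" if "x \<in> U" for x
  unfolding ap using C1_on_has_derivative_pd[OF assms that]
  by (intro has_derivative_vec_components) simp
 ultimately show ?thesis using C1_on_openD[OF assms] unfolding C1_on_def
  by (intro conjI exI[of _ N'] ballI)
qed

section \<open>Twice differentiable functions\<close>

definition C2_scalar :: "(real^'n) set => (real^'n => real) => bool" where
 "C2_scalar U h \<longleftrightarrow> C1_on U h \<and> (\<forall>i. C1_on U (pd i h))"

lemma C2_on_component:
 fixes h :: "real^'n => 'b::real_normed_vector"
 assumes "C2_on U h" "bounded_linear L"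
 shows "C2_scalar U (\<lambda>x. L (h x))"
proof -
 obtain h' where h': "\<And>x. x\<in>U ==> (h has_derivative blinfun_apply (h' x)) (at x)" "C1_on U h'"
  using assms(1) unfolding C2_on_def by blast
 have C1: "C1_on U h" using h' C1_on_continuous[OF h'(2)] assms(1)
  unfolding C1_on_def C2_on_def by blast
 have "C1_on U (pd i (\<lambda>x. L (h x)))" for i
 proof -
  have bl: "bounded_linear (\<lambda>A :: (real^'n) \<Rightarrow>\<^sub>L 'b. L (blinfun_apply A (axis i 1)))"
   by (rule bounded_linear_compose[OF assms(2)]) (rule blinfun.bounded_linear_left)
  have "pd i (\<lambda>x. L (h x)) x = L (blinfun_apply (h' x) (axis i 1))" if "x \<in> U" for x
   using pd_eqI[OF bounded_linear.has_derivative[OF assms(2) h'(1)[OF that]]] .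
  thus ?thesis using C1_on_bounded_linear[OF h'(2) bl] by (simp cong: C1_on_cong)
 qed
 with C1_on_bounded_linear[OF C1 assms(2)] show ?thesis by (simp add: C2_scalar_def)
qed

lemma C2_scalar_C1: "C2_scalar U h ==> C1_on U h"
 and C2_scalar_pd: "C2_scalar U h ==> C1_on U (pd i h)"
 by (auto simp: C2_scalar_def)

lemmas C2_scalar_differentiable = C1_on_differentiable[OF C2_scalar_C1]

lemma C2_scalar_subset: "C2_scalar U h ==> open V ==> V \<subseteq> U ==> C2_scalar V h"
 unfolding C2_scalar_def by (blast intro: C1_on_subset)

lemma C2_scalar_nth: "open U ==> C2_scalar U (\<lambda>x. x $ i)"
 unfolding C2_scalar_def by (simp add: pd_nth[abs_def])

lemma C2_scalar_comp:
 fixes F :: "real^'a => real^'b"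
 assumes h: "C2_scalar V h" and F: "\<And>j. C2_scalar U (\<lambda>x. F x $ j)" and sub: "F ` U \<subseteq> V"
 shows "C2_scalar U (\<lambda>x. h (F x))"
 unfolding C2_scalar_def
proof (intro conjI allI)
 note F1 = C2_scalar_C1[OF F]
 show "C1_on U (\<lambda>x. h (F x))" by (rule C1_on_comp[OF C2_scalar_C1[OF h] F1 sub])
 fix i
 have "pd i (\<lambda>x. h (F x)) x = (\<Sum>j. pd j h (F x) * pd i (\<lambda>x. F x $ j) x)" if "x \<in> U" for x
  using that sub by (intro pd_comp C2_scalar_differentiable[OF h] C1_on_differentiable[OF F1]) auto
 moreover have "C1_on U (\<lambda>x. \<Sum>j. pd j h (F x) * pd i (\<lambda>x. F x $ j) x)"
  using C1_on_openD[OF F1] by (intro C1_on_sum C1_on_mult C2_scalar_pd[OF F] C1_on_comp[OF C2_scalar_pd[OF h] F1 sub])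
 ultimately show "C1_on U (pd i (\<lambda>x. h (F x)))"
  by (simp cong: C1_on_cong)
qed

section \<open>Inverse matrices, inverse maps and second derivatives\<close>

lemma matrix_inv_mult:
 fixes A :: "real^'n^'n"
 assumes "invertible A"
 shows "A ** matrix_inv A = mat 1" "matrix_inv A ** A = mat 1"
 using someI_ex[of "\<lambda>A'. A ** A' = mat 1 \<and> A' ** A = mat 1"] assms
 unfolding matrix_inv_def invertible_def by auto

lemma matrix_inv_unique:
 fixes A :: "real^'n^'n"
 assumes "A ** B = mat 1"
 shows "matrix_inv A = B"
proof -
 have "B ** A = mat 1" using assms matrix_left_right_inverse by blast
 hence "invertible A" using assms unfolding invertible_def by blast
 thus ?thesis
  by (metis assms matrix_inv_mult(2) matrix_mul_assoc matrix_mul_lid matrix_mul_rid)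
qed

lemma transpose_matrix_inv:
 fixes A :: "real^'n^'n"
 assumes "invertible A"
 shows "transpose (matrix_inv A) = matrix_inv (transpose A)"
 using matrix_inv_unique[of "transpose A" "transpose (matrix_inv A)"]
 by (metis assms matrix_inv_mult(2) matrix_transpose_mul transpose_mat)

text \<open>Cramer's rule: the inverse is a quotient of polynomials in the entries, hence depends on them smoothly.\<close>

lemma matrix_inv_entry:
 fixes A :: "real^'n^'n"
 assumes "invertible A"
 shows "matrix_inv A $ k $ c = det (\<chi> i j. if j = k then axis c 1 $ i else A $ i $ j) / det A"
proof -
 have "A *v (matrix_inv A *v axis c 1) = axis c 1"
  by (simp add: matrix_vector_mul_assoc matrix_inv_mult[OF assms])
 hence "matrix_inv A *v axis c 1 =
   (\<chi> k. det (\<chi> i j. if j = k then axis c 1 $ i else A $ i $ j) / det A)"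
  using cramer[of A] assms by (simp add: invertible_det_nz)
 hence "(matrix_inv A *v axis c 1) $ k = det (\<chi> i j. if j = k then axis c 1 $ i else A $ i $ j) / det A"
  by simp
 thus ?thesis by (simp add: matrix_vector_mul_component inner_axis matrix_vector_mult_basis column_def)
qed

lemma C1_on_det:
 fixes A :: "real^'a => real^'n^'n"
 assumes "open U" "\<And>i j. C1_on U (\<lambda>x. A x $ i $ j)"
 shows "C1_on U (\<lambda>x. det (A x))"
 unfolding det_def using assms by (intro C1_on_sum C1_on_mult C1_on_prod C1_on_const)

lemma C1_on_matrix_inv:
 fixes A :: "real^'a => real^'n^'n"
 assumes "open U" "\<And>i j. C1_on U (\<lambda>x. A x $ i $ j)" "\<And>x. x \<in> U ==> invertible (A x)"
 shows "C1_on U (\<lambda>x. matrix_inv (A x) $ i $ j)"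
proof -
 have "C1_on U (\<lambda>x. det (\<chi> i' j'. if j' = i then axis j 1 $ i' else A x $ i' $ j') / det (A x))"
 proof (intro C1_on_divide C1_on_det)
  show "C1_on U (\<lambda>x. (\<chi> i' j'. if j' = i then axis j 1 $ i' else A x $ i' $ j') $ i' $ j')" for i' j'
   using assms by (cases "j' = i") simp_all
 qed (use assms in \<open>auto simp: invertible_det_nz\<close>)
 thus ?thesis
  by (rule C1_on_cong[THEN iffD1, rotated]) (simp add: matrix_inv_entry assms(3))
qed

text \<open>Differentiate \<open>A A\<^sup>-\<^sup>1 = 1\<close>.\<close>

lemma pd_matrix_inv:
 fixes A :: "real^'a => real^'n^'n"
 assumes A: "\<And>i j. C1_on U (\<lambda>x. A x $ i $ j)" and inv: "\<And>x. x \<in> U ==> invertible (A x)" and x: "x \<in> U"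
 shows "pd l (\<lambda>x. matrix_inv (A x) $ i $ j) x =
  - (\<Sum>c d. matrix_inv (A x) $ i $ c * pd l (\<lambda>x. A x $ c $ d) x * matrix_inv (A x) $ d $ j)"
proof -
 have op: "open U" using A C1_on_openD by blast
 note I = C1_on_matrix_inv[OF op A inv]
 define A' where "A' = (\<chi> c d. pd l (\<lambda>x. A x $ c $ d) x)"
 define B' where "B' = (\<chi> c d. pd l (\<lambda>x. matrix_inv (A x) $ c $ d) x)"
 have "A' ** matrix_inv (A x) + A x ** B' = 0"
 proof -
  have "(\<Sum>d. pd l (\<lambda>x. A x $ c $ d) x * matrix_inv (A x) $ d $ j + A x $ c $ d * pd l (\<lambda>x. matrix_inv (A x) $ d $ j) x) = 0" for c j
  proof -
   have eq: "(\<Sum>d. A y $ c $ d * matrix_inv (A y) $ d $ j) = mat 1 $ c $ j" if "y \<in> U" for y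
    using matrix_inv_mult(1)[OF inv[OF that]] by (simp add: matrix_matrix_mult_def vec_eq_iff)
   have "pd l (\<lambda>y. \<Sum>d. A y $ c $ d * matrix_inv (A y) $ d $ j) x = pd l (\<lambda>y. mat 1 $ c $ j) x"
    by (rule pd_cong[OF op x]) (rule eq)
   moreover have "pd l (\<lambda>y. \<Sum>d. A y $ c $ d * matrix_inv (A y) $ d $ j) x =
    (\<Sum>d. pd l (\<lambda>y. A y $ c $ d * matrix_inv (A y) $ d $ j) x)"
    by (intro pd_sum C1_on_differentiable[OF C1_on_mult[OF A I]] x)
   ultimately show ?thesis
    by (simp add: pd_mult C1_on_differentiable[OF A x] C1_on_differentiable[OF I x])
  qed
  thus ?thesis by (simp add: vec_eq_iff matrix_matrix_mult_def A'_def B'_def sum.distrib)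
 qed
 hence "matrix_inv (A x) ** (A x ** B') = - (matrix_inv (A x) ** (A' ** matrix_inv (A x)))"
  by (metis (no_types, opaque_lifting) add.commute add_eq_0_iff matrix_add_ldistrib times0_right)
 hence "B' = - (matrix_inv (A x) ** A' ** matrix_inv (A x))"
  by (metis matrix_mul_assoc matrix_mul_lid matrix_inv_mult(2)[OF inv[OF x]])
 hence "B' $ i $ j = - (matrix_inv (A x) ** A' ** matrix_inv (A x)) $ i $ j" by simp
 thus ?thesis
  unfolding A'_def B'_def matrix_matrix_mult_def
  by (simp add: sum_distrib_right sum_distrib_left) (rule sum.swap)
qed

text \<open>A local inverse of a \<open>C\<^sup>2\<close> map is \<open>C\<^sup>2\<close>: its Jacobian is the inverse matrix of the original
 Jacobian, which depends on the point in a \<open>C\<^sup>1\<close> way because inversion of matrices is smooth.\<close>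

lemma C2_inverse_function:
 fixes F :: "real^'n => real^'n"
 assumes F: "\<And>j. C2_scalar U (\<lambda>x. F x $ j)" and x0: "x0 \<in> U"
  and inj: "\<And>v. (\<forall>j. (\<Sum>i. v $ i * pd i (\<lambda>x. F x $ j) x0) = 0) ==> v = 0"
 obtains U' V G where "open U'" "U' \<subseteq> U" "x0 \<in> U'" "open V" "F x0 \<in> V" "homeomorphism U' V F G"
  "\<And>j. C2_scalar V (\<lambda>y. G y $ j)"
proof -
 have C1: "C1_on U F" using C2_scalar_C1[OF F] by (rule C1_on_vec)
 then obtain F' where F': "\<And>x. x\<in>U ==> (F has_derivative blinfun_apply (F' x)) (at x)" "continuous_on U F'"
  unfolding C1_on_def by blast
 have F'c: "blinfun_apply (F' x) v $ j = (\<Sum>i. v $ i * pd i (\<lambda>x. F x $ j) x)" if "x \<in> U" for x v j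
 proof -
  have "((\<lambda>x. F x $ j) has_derivative (\<lambda>v. blinfun_apply (F' x) v $ j)) (at x)"
   using bounded_linear.has_derivative[OF bounded_linear_vec_nth F'(1)[OF that]] .
  from has_derivative_unique[OF this C1_on_has_derivative_pd[OF C2_scalar_C1[OF F] that]]
  show ?thesis by meson
 qed
 have "inj (blinfun_apply (F' x0))"
  using linear_injective_0[OF bounded_linear.linear[OF blinfun.bounded_linear_right], of "F' x0"] inj
  by (metis F'c[OF x0] zero_index)
 then obtain g where g: "linear g" "g \<circ> blinfun_apply (F' x0) = id"
  using linear_injective_left_inverse blinfun.bounded_linear_right bounded_linear.linear by metis
 have "Blinfun g o\<^sub>L F' x0 = id_blinfun"
  using g by (intro blinfun_eqI) (auto simp: bounded_linear_Blinfun_apply linear_conv_bounded_linear fun_eq_iff)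
 from inverse_function_theorem[OF C1_on_openD[OF C1] F' x0 this]
 obtain U' V G G' where *: "open U'" "U' \<subseteq> U" "x0 \<in> U'" "open V" "F x0 \<in> V" "homeomorphism U' V F G"
  "\<And>y. y \<in> V ==> (G has_derivative (G' y)) (at y)"
  by (metis (no_types, lifting))
 have GU: "G y \<in> U" "F (G y) = y" if "y \<in> V" for y
  using * that unfolding homeomorphism_def by auto
 have Gd: "(\<lambda>y. G y $ j) differentiable (at y)" if "y \<in> V" for y j
  using bounded_linear.has_derivative[OF bounded_linear_vec_nth *(7)[OF that]] unfolding differentiable_def by blast
 have Gc: "continuous_on V G" using * unfolding homeomorphism_def by auto
 define A where "A x = (\<chi> j i. pd i (\<lambda>x. F x $ j) x)" for x
 define B where "B y = (\<chi> j i. pd i (\<lambda>y. G y $ j) y)" for y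
 have AB: "A (G y) ** B y = mat 1" if y: "y \<in> V" for y
 proof -
  have "(\<Sum>b. pd b (\<lambda>x. F x $ a) (G y) * pd i (\<lambda>y. G y $ b) y) = (if a = i then 1 else 0)" for a i
  proof -
   have "pd i (\<lambda>y. F (G y) $ a) y = (\<Sum>b. pd b (\<lambda>x. F x $ a) (G y) * pd i (\<lambda>y. G y $ b) y)"
    using GU[OF y] by (intro pd_comp[where h = "\<lambda>x. F x $ a"] Gd[OF y] C2_scalar_differentiable[OF F])
   moreover have "pd i (\<lambda>y. F (G y) $ a) y = pd i (\<lambda>y. y $ a) y"
    by (rule pd_cong[OF *(4) y]) (simp add: GU)
   ultimately show ?thesis by auto
  qed
  thus ?thesis by (simp add: A_def B_def matrix_matrix_mult_def vec_eq_iff mat_def)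
 qed
 have inv: "invertible (A (G y))" and Beq: "B y = matrix_inv (A (G y))" if "y \<in> V" for y
  using AB[OF that] matrix_inv_unique matrix_left_right_inverse unfolding invertible_def by metis+
 define W where "W = {x\<in>U. det (A x) \<noteq> 0}"
 have AC1: "C1_on U (\<lambda>x. A x $ i $ j)" for i j unfolding A_def using F by (simp add: C2_scalar_def)
 have oW: "open W"
 proof -
  have "continuous_on U (\<lambda>x. det (A x))" by (rule C1_on_continuous[OF C1_on_det[OF C1_on_openD[OF C1] AC1]])
  moreover have "open (- {0 :: real})" by auto
  ultimately have "open ({x\<in>U. det (A x) \<in> - {0}})" using C1_on_openD[OF C1]
   by (simp add: continuous_on_open_vimage[of U] Int_def vimage_def conj_commute del: Compl_iff)
  thus ?thesis by (simp add: W_def)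
 qed
 have invW: "C1_on W (\<lambda>x. matrix_inv (A x) $ i $ j)" for i j
  using oW by (intro C1_on_matrix_inv C1_on_subset[OF AC1]) (auto simp: W_def invertible_det_nz)
 have GW: "G ` V \<subseteq> W" using GU inv by (auto simp: W_def invertible_det_nz)
 have Gpd: "pd i (\<lambda>y. G y $ j) y = matrix_inv (A (G y)) $ j $ i" if "y \<in> V" for i j y
  using Beq[OF that] by (simp add: B_def vec_eq_iff)
 have GC1: "C1_on V (\<lambda>y. G y $ j)" for j
  unfolding C1_on_iff
 proof (intro conjI ballI allI)
  show "continuous_on V (pd i (\<lambda>y. G y $ j))" for i
   by (rule continuous_on_eq[OF continuous_on_compose2[OF C1_on_continuous[OF invW[of j i]] Gc GW]])
    (simp add: Gpd)
 qed (use * Gd in auto)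
 have "C1_on V (pd i (\<lambda>y. G y $ j))" for i j
  by (rule C1_on_cong[THEN iffD1, OF _ C1_on_comp[OF invW[of j i] GC1 GW]]) (simp add: Gpd)
 hence "C2_scalar V (\<lambda>y. G y $ j)" for j using GC1 by (simp add: C2_scalar_def)
 with * show ?thesis using that by blast
qed

lemma has_real_derivative_along_axis:
 fixes h :: "real^'n => real"
 assumes "h differentiable (at (x + t *\<^sub>R axis i 1))"
 shows "((\<lambda>t. h (x + t *\<^sub>R axis i 1)) has_real_derivative pd i h (x + t *\<^sub>R axis i 1)) (at t)"
proof -
 obtain h' where d: "(h has_derivative h') (at (x + t *\<^sub>R axis i 1))"
  using assms unfolding differentiable_def by blast
 have "((\<lambda>t. x + t *\<^sub>R axis i 1) has_derivative (\<lambda>s. s *\<^sub>R axis i 1)) (at t)"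
  by (auto intro!: derivative_eq_intros)
 from has_derivative_compose[OF this d]
 have "((\<lambda>t. h (x + t *\<^sub>R axis i 1)) has_derivative (\<lambda>s. h' (s *\<^sub>R axis i 1))) (at t)" .
 moreover have "h' (s *\<^sub>R axis i 1) = pd i h (x + t *\<^sub>R axis i 1) * s" for s
  using linear_scale[OF has_derivative_linear[OF d]] pd_eqI[OF d, of i] by simp
 ultimately show ?thesis by (simp add: has_field_derivative_def)
qed

text \<open>Two applications of the mean value theorem to the second difference over a small square.\<close>

lemma pd_symmetric_aux:
 fixes h :: "real^'n => real"
 assumes "C2_scalar (ball x (3 * s)) h" "s > 0"
 shows "\<exists>\<xi>\<in>cball x (2 * s). h (x + s *\<^sub>R axis i 1 + s *\<^sub>R axis j 1) - h (x + s *\<^sub>R axis i 1) - h (x + s *\<^sub>R axis j 1) + h x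
  = s\<^sup>2 * pd j (pd i h) \<xi>"
proof -
 have near: "x + a *\<^sub>R axis i 1 + b *\<^sub>R axis j 1 \<in> cball x (2 * s)" if "0 \<le> a" "a \<le> s" "0 \<le> b" "b \<le> s" for a b
 proof -
  have "norm (a *\<^sub>R axis i 1 + b *\<^sub>R axis j (1::real)) \<le> norm (a *\<^sub>R axis i (1::real)) + norm (b *\<^sub>R axis j (1::real))"
   by (rule norm_triangle_ineq)
  hence "norm (a *\<^sub>R axis i 1 + b *\<^sub>R axis j (1::real)) \<le> 2 * s" using that by simp
  moreover have "dist x (x + (a *\<^sub>R axis i 1 + b *\<^sub>R axis j 1)) = norm (a *\<^sub>R axis i 1 + b *\<^sub>R axis j (1::real))"
   by (simp add: dist_norm norm_minus_commute add.commute)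
  ultimately show ?thesis by (simp add: add.assoc)
 qed
 have sub: "cball x (2 * s) \<subseteq> ball x (3 * s)" using assms by auto
 note d1 = C2_scalar_differentiable[OF assms(1)] and d2 = C1_on_differentiable[OF C2_scalar_pd[OF assms(1)]]
 define k where "k t = h (x + s *\<^sub>R axis j 1 + t *\<^sub>R axis i 1) - h (x + t *\<^sub>R axis i 1)" for t
 have "(k has_real_derivative (pd i h (x + s *\<^sub>R axis j 1 + t *\<^sub>R axis i 1) - pd i h (x + t *\<^sub>R axis i 1))) (at t)"
  if "0 \<le> t" "t \<le> s" for t
  unfolding k_def using near[of t s] near[of t 0] that assms(2) sub
  by (intro DERIV_diff has_real_derivative_along_axis d1) (auto simp: algebra_simps)
 from MVT2[OF assms(2) this] obtain t where t: "0 < t" "t < s"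
  "k s - k 0 = s * (pd i h (x + s *\<^sub>R axis j 1 + t *\<^sub>R axis i 1) - pd i h (x + t *\<^sub>R axis i 1))" by auto
 have "((\<lambda>r. pd i h ((x + t *\<^sub>R axis i 1) + r *\<^sub>R axis j 1)) has_real_derivative
   pd j (pd i h) ((x + t *\<^sub>R axis i 1) + r *\<^sub>R axis j 1)) (at r)" if "0 \<le> r" "r \<le> s" for r
  using near[of t r] that t sub by (intro has_real_derivative_along_axis d2) auto
 from MVT2[OF assms(2) this] obtain r where r: "0 < r" "r < s"
  "pd i h ((x + t *\<^sub>R axis i 1) + s *\<^sub>R axis j 1) - pd i h (x + t *\<^sub>R axis i 1) = s * pd j (pd i h) ((x + t *\<^sub>R axis i 1) + r *\<^sub>R axis j 1)"
  by auto
 show ?thesis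
 proof (rule bexI[OF _ near[of t r]])
  show "h (x + s *\<^sub>R axis i 1 + s *\<^sub>R axis j 1) - h (x + s *\<^sub>R axis i 1) - h (x + s *\<^sub>R axis j 1) + h x
   = s\<^sup>2 * pd j (pd i h) (x + t *\<^sub>R axis i 1 + r *\<^sub>R axis j 1)"
   using t(3) r(3) unfolding k_def by (simp add: algebra_simps power2_eq_square)
 qed (use t r in auto)
qed

lemma pd_symmetric:
 fixes h :: "real^'n => real"
 assumes "C2_scalar U h" "x \<in> U"
 shows "pd i (pd j h) x = pd j (pd i h) x"
proof -
 have c: "isCont (pd i (pd j h)) x" "isCont (pd j (pd i h)) x"
  using assms by (auto simp: C2_scalar_def C1_on_iff continuous_on_eq_continuous_at)
 obtain e where e: "e > 0" "ball x e \<subseteq> U"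
  using assms C1_on_openD[OF C2_scalar_C1[OF assms(1)]] openE by blast
 define s where "s n = e / (3 * real (Suc n))" for n
 have s: "s n > 0" "ball x (3 * s n) \<subseteq> U" for n
 proof -
  have "3 * s n \<le> e" using e by (simp add: s_def field_simps)
  thus "ball x (3 * s n) \<subseteq> U" using e(2) by (meson order_trans subset_ball)
 qed (use e in \<open>auto simp: s_def\<close>)
 have lim: "s \<longlonglongrightarrow> 0" unfolding s_def by real_asymp
 have "\<exists>\<xi>\<in>cball x (2 * s n). \<exists>\<eta>\<in>cball x (2 * s n). pd j (pd i h) \<xi> = pd i (pd j h) \<eta>" for n
 proof -
  have C2: "C2_scalar (ball x (3 * s n)) h" by (rule C2_scalar_subset[OF assms(1)]) (use s in auto)
  from pd_symmetric_aux[OF C2 s(1), of i j] pd_symmetric_aux[OF C2 s(1), of j i]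
  obtain \<xi> \<eta> where "\<xi>\<in>cball x (2 * s n)" "\<eta>\<in>cball x (2 * s n)" "(s n)\<^sup>2 * pd j (pd i h) \<xi> = (s n)\<^sup>2 * pd i (pd j h) \<eta>"
   by (auto simp: algebra_simps)
  thus ?thesis using s(1)[of n] by (intro bexI[of _ \<xi>] bexI[of _ \<eta>]) simp_all
 qed
 then obtain \<xi> \<eta> where xe: "\<And>n. \<xi> n \<in> cball x (2 * s n)" "\<And>n. \<eta> n \<in> cball x (2 * s n)"
  "\<And>n. pd j (pd i h) (\<xi> n) = pd i (pd j h) (\<eta> n)" by metis
 have to_x: "z \<longlonglongrightarrow> x" if "\<And>n. z n \<in> cball x (2 * s n)" for z
 proof -
  have "(\<lambda>n. dist (z n) x) \<longlonglongrightarrow> 0"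
  proof (rule tendsto_sandwich[of "\<lambda>n. 0" _ _ "\<lambda>n. 2 * s n"])
   show "(\<lambda>n. 2 * s n) \<longlonglongrightarrow> 0" using tendsto_mult_right_zero[OF lim] .
   show "\<forall>\<^sub>F n in sequentially. dist (z n) x \<le> 2 * s n" using that by (simp add: dist_commute)
  qed auto
  thus ?thesis using tendsto_dist_iff by blast
 qed
 have "(\<lambda>n. pd j (pd i h) (\<xi> n)) \<longlonglongrightarrow> pd j (pd i h) x" "(\<lambda>n. pd i (pd j h) (\<eta> n)) \<longlonglongrightarrow> pd i (pd j h) x"
  using isCont_tendsto_compose c to_x xe(1,2) by blast+
 thus ?thesis using xe(3) LIMSEQ_unique by simp
qed

section \<open>Lebesgue measure and a distinguished coordinate\<close>

lemma set_coord_nth [simp]: "set_coord k t x $ j = (if j = k then t else x $ j)"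
 by (simp add: set_coord_def)

lemma set_coord_set_coord [simp]: "set_coord k t (set_coord k s x) = set_coord k t x"
 by (simp add: vec_eq_iff)

lemma set_coord_same [simp]: "set_coord k (x $ k) x = x"
 by (simp add: vec_eq_iff)

lemma continuous_on_set_coord [continuous_intros]:
 assumes "continuous_on S g" "continuous_on S h"
 shows "continuous_on S (\<lambda>x. set_coord k (g x) (h x))"
 unfolding set_coord_def
proof (intro continuous_on_vec_lambda)
 show "continuous_on S (\<lambda>x. if j = k then g x else h x $ j)" for j
  by (cases "j = k") (use assms in \<open>auto intro!: continuous_intros\<close>)
qed

text \<open>The slab stands for the hyperplane orthogonal to the \<open>k\<close>-th axis: a function that does not depend
 on \<open>x\<^sub>k\<close> has the same integral over both.\<close>

definition slab :: "'n::finite => (real^'n) set" where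
 "slab k = {x. 0 \<le> x $ k \<and> x $ k \<le> 1}"

lemma slab_borel [measurable]: "slab k \<in> sets borel"
 unfolding slab_def by (intro borel_closed closed_Collect_conj closed_Collect_le continuous_intros)

lemma set_coord_measurable [measurable]:
 assumes [measurable]: "g \<in> borel_measurable M" "h \<in> M \<rightarrow>\<^sub>M borel"
 shows "(\<lambda>x. set_coord k (g x) (h x)) \<in> M \<rightarrow>\<^sub>M borel"
 by (rule borel_measurable_continuous_Pair[OF assms]) (intro continuous_intros)

lemma prod_Basis_vec: "(\<Prod>b\<in>Basis. (u - l) \<bullet> b) = (\<Prod>i\<in>UNIV. u $ i - l $ i)" for l u :: "real^'n"
proof -
 have inj: "inj (\<lambda>i::'n. axis i (1::real))" and B: "(Basis :: (real^'n) set) = (\<lambda>i. axis i 1) ` UNIV"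
  by (auto simp: inj_on_def axis_eq_axis Basis_vec_def)
 show ?thesis unfolding B by (subst prod.reindex[OF inj]) (simp add: inner_axis)
qed

lemma emeasure_lborel_box_vec:
 fixes l u :: "real^'n"
 assumes "\<And>i. l $ i \<le> u $ i"
 shows "emeasure lborel (box l u) = (\<Prod>i\<in>UNIV. u $ i - l $ i)"
  "emeasure lborel (cbox l u) = (\<Prod>i\<in>UNIV. u $ i - l $ i)"
 unfolding prod_Basis_vec[symmetric] using assms
 by (intro emeasure_lborel_box emeasure_lborel_cbox; force simp: Basis_vec_def inner_axis)+

lemma lborel_vec_eqI:
 fixes M :: "(real^'n) measure"
 assumes "\<And>l u. (\<And>i. l $ i \<le> u $ i) ==> emeasure M (box l u) = (\<Prod>i\<in>UNIV. u $ i - l $ i)"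
  and "sets M = sets borel"
 shows "lborel = M"
proof (rule lborel_eqI)
 fix l u :: "real^'n" assume "\<And>b. b \<in> Basis ==> l \<bullet> b \<le> u \<bullet> b"
 hence "l \<bullet> axis i 1 \<le> u \<bullet> axis i 1" for i by (simp add: axis_in_Basis_iff)
 thus "emeasure M (box l u) = (\<Prod>b\<in>Basis. (u - l) \<bullet> b)"
  unfolding prod_Basis_vec by (intro assms(1)) (simp add: inner_axis)
qed (fact assms)

lemma box_vec: "x \<in> box l u \<longleftrightarrow> (\<forall>i. l $ i < x $ i \<and> x $ i < u $ i)"
 for x :: "real^'n"
 by (auto simp: mem_box_cart)

text \<open>Fubini's theorem in one coordinate: Lebesgue measure is the product of Lebesgue measure
 on the \<open>k\<close>-th axis with Lebesgue measure on the slab.  Both agree on boxes.\<close>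

lemma lborel_slab:
 "(lborel :: (real^'n) measure) =
  distr (density (lborel \<Otimes>\<^sub>M lborel) (\<lambda>p. indicator (slab k) (snd p))) borel (\<lambda>p. set_coord k (fst p) (snd p))"
 (is "_ = ?M")
proof (rule lborel_vec_eqI)
 fix l u :: "real^'n" assume le: "\<And>i. l $ i \<le> u $ i"
 let ?E = "slab k \<inter> {x. \<forall>i. i \<noteq> k --> l $ i < x $ i \<and> x $ i < u $ i}"
 let ?f = "\<lambda>p. set_coord k (fst p) (snd p :: real^'n)"
 have [measurable]: "?f \<in> lborel \<Otimes>\<^sub>M lborel \<rightarrow>\<^sub>M borel" by measurable
 define l' u' where "l' = set_coord k 0 l" and "u' = set_coord k 1 u"
 have le': "l' $ i \<le> u' $ i" for i using le by (simp add: l'_def u'_def)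
 have "emeasure ?M (box l u) = (\<integral>\<^sup>+p. indicator (slab k) (snd p) * indicator (?f -` box l u) p \<partial>(lborel \<Otimes>\<^sub>M lborel))"
  using measurable_sets[of ?f "lborel \<Otimes>\<^sub>M lborel" borel "box l u"]
  by (subst emeasure_distr, simp_all add: space_pair_measure emeasure_density del: measurable_lborel1)
 also have "... = (\<integral>\<^sup>+p. indicator ({l $ k<..<u $ k} \<times> ?E) p \<partial>(lborel \<Otimes>\<^sub>M lborel))"
  by (intro nn_integral_cong) (auto simp: indicator_def box_vec split: if_splits)
 also have "... = emeasure (lborel \<Otimes>\<^sub>M lborel) ({l $ k<..<u $ k} \<times> ?E)"
  by (intro nn_integral_indicator) measurable
 also have "... = emeasure lborel {l $ k<..<u $ k} * emeasure lborel ?E"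
  by (intro lborel.emeasure_pair_measure_Times) measurable
 also have "emeasure lborel ?E = (\<Prod>i\<in>UNIV. u' $ i - l' $ i)"
 proof (rule antisym)
  have "emeasure lborel ?E \<le> emeasure lborel (cbox l' u')"
   by (intro emeasure_mono) (auto simp: mem_box_cart l'_def u'_def slab_def less_imp_le)
  thus "emeasure lborel ?E \<le> (\<Prod>i\<in>UNIV. u' $ i - l' $ i)"
   using emeasure_lborel_box_vec(2)[OF le'] by simp
  have "emeasure lborel (box l' u') \<le> emeasure lborel ?E"
   by (intro emeasure_mono, force simp: box_vec l'_def u'_def slab_def less_imp_le split: if_splits) measurable
  thus "(\<Prod>i\<in>UNIV. u' $ i - l' $ i) \<le> emeasure lborel ?E"
   using emeasure_lborel_box_vec(1)[OF le'] by simp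
 qed
 also have "(\<Prod>i\<in>UNIV. u' $ i - l' $ i) = (\<Prod>i\<in>UNIV-{k}. u $ i - l $ i)"
  by (subst prod.remove[of _ k]) (auto simp: l'_def u'_def intro!: prod.cong)
 also have "emeasure lborel {l $ k<..<u $ k} * ennreal (\<Prod>i\<in>UNIV-{k}. u $ i - l $ i) = (\<Prod>i\<in>UNIV. u $ i - l $ i)"
  using le by (simp add: prod.remove[of UNIV k] ennreal_mult' prod_nonneg)
 finally show "emeasure ?M (box l u) = (\<Prod>i\<in>UNIV. u $ i - l $ i)" .
qed simp

lemma nn_integral_slab:
 fixes h :: "real^'n => ennreal"
 assumes [measurable]: "h \<in> borel_measurable borel"
 shows "(\<integral>\<^sup>+x. h x \<partial>lborel) = (\<integral>\<^sup>+x. indicator (slab k) x * (\<integral>\<^sup>+t. h (set_coord k t x) \<partial>lborel) \<partial>lborel)"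
proof -
 have "(\<integral>\<^sup>+x. h x \<partial>lborel) = (\<integral>\<^sup>+p. indicator (slab k) (snd p) * h (set_coord k (fst p) (snd p)) \<partial>(lborel \<Otimes>\<^sub>M lborel))"
  by (subst lborel_slab[of k], subst nn_integral_distr, simp_all, subst nn_integral_density, simp_all)
 also have "... = (\<integral>\<^sup>+x. (\<integral>\<^sup>+t. indicator (slab k) x * h (set_coord k t x) \<partial>lborel) \<partial>lborel)"
  by (subst lborel_pair.nn_integral_snd[symmetric]) simp_all
 also have "... = (\<integral>\<^sup>+x. indicator (slab k) x * (\<integral>\<^sup>+t. h (set_coord k t x) \<partial>lborel) \<partial>lborel)"
  by (subst nn_integral_cmult) simp_all
 finally show ?thesis .
qed

lemma integral_slab:
 fixes h :: "real^'n => real"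
 assumes h: "integrable lborel h"
 shows "(LINT x|lborel. h x) = (LINT x|lborel. indicator (slab k) x * (LINT t|lborel. h (set_coord k t x)))"
proof -
 have [measurable]: "h \<in> borel_measurable borel" using h by auto
 have "integrable lborel h \<longleftrightarrow> integrable (lborel \<Otimes>\<^sub>M lborel) (\<lambda>p. indicator (slab k) (snd p) *\<^sub>R h (set_coord k (fst p) (snd p)))"
  by (subst lborel_slab[of k], subst integrable_distr_eq, simp, simp, subst ennreal_indicator[symmetric], subst integrable_density, simp_all)
 with h have i: "integrable (lborel \<Otimes>\<^sub>M lborel) (\<lambda>(t, x). indicator (slab k) x * h (set_coord k t x))"
  by (simp add: case_prod_unfold)
 have "(LINT x|lborel. h x) = (LINT p|(lborel \<Otimes>\<^sub>M lborel). indicator (slab k) (snd p) *\<^sub>R h (set_coord k (fst p) (snd p)))"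
  by (subst lborel_slab[of k], subst integral_distr, simp, simp, subst ennreal_indicator[symmetric], subst integral_density, simp_all)
 also have "... = (LINT x|lborel. LINT t|lborel. indicator (slab k) x * h (set_coord k t x))"
  using lborel_pair.integral_snd[OF i] by (simp add: case_prod_unfold)
 finally show ?thesis by simp
qed

definition swap_coord :: "'n::finite => 'n => real^'n => real^'n" where
 "swap_coord k l x = (\<chi> j. x $ (Transposition.transpose k l j))"

lemma continuous_on_swap_coord: "continuous_on S (swap_coord k l)"
 unfolding swap_coord_def by (intro continuous_on_vec_lambda continuous_intros)

lemma swap_coord_measurable [measurable]: "swap_coord k l \<in> borel \<rightarrow>\<^sub>M borel"
 by (rule borel_measurable_continuous_onI[OF continuous_on_swap_coord])

lemma swap_coord_swap_coord [simp]: "swap_coord k l (swap_coord k l x) = x"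
 by (simp add: swap_coord_def vec_eq_iff)

lemma swap_coord_nth [simp]: "swap_coord k l x $ j = x $ (Transposition.transpose k l j)"
 by (simp add: swap_coord_def)

lemma lborel_swap_coord: "distr lborel borel (swap_coord k l) = lborel"
proof (rule lborel_vec_eqI[symmetric])
 fix a b :: "real^'a" assume le: "\<And>i. a $ i \<le> b $ i"
 have "swap_coord k l -` box a b = box (swap_coord k l a) (swap_coord k l b)"
  by (auto simp: box_vec) (metis Transposition.transpose_involutory)+
 hence "emeasure (distr lborel borel (swap_coord k l)) (box a b) = emeasure lborel (box (swap_coord k l a) (swap_coord k l b))"
  by (simp add: emeasure_distr)
 also have "... = (\<Prod>i\<in>UNIV. b $ Transposition.transpose k l i - a $ Transposition.transpose k l i)"
  using le by (subst emeasure_lborel_box_vec) auto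
 also have "(\<Prod>i\<in>UNIV. b $ Transposition.transpose k l i - a $ Transposition.transpose k l i) = (\<Prod>i\<in>UNIV. b $ i - a $ i)"
  by (rule prod.reindex_bij_betw[where h = "Transposition.transpose k l" and g = "\<lambda>i. b $ i - a $ i"])
   (rule bij_transpose)
 finally show "emeasure (distr lborel borel (swap_coord k l)) (box a b) = (\<Prod>i\<in>UNIV. b $ i - a $ i)" .
qed simp


section \<open>Changing one coordinate\<close>

lemma emeasure_eq_on_countable_cover:
 assumes "sets M = sets N" "\<And>i::nat. B i \<in> sets M" "A \<in> sets M" "A \<subseteq> (\<Union>i. B i)"
  and eq: "\<And>i A'. A' \<in> sets M ==> A' \<subseteq> A \<inter> B i ==> emeasure M A' = emeasure N A'"
 shows "emeasure M A = emeasure N A"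
proof -
 define D where "D i = A \<inter> disjointed B i" for i
 have D: "D i \<in> sets M" for i
  unfolding D_def using assms(2,3) by (auto intro!: sets.Int simp: disjointed_def)
 have dis: "disjoint_family D"
  using disjoint_family_disjointed[of B] by (auto simp: disjoint_family_on_def D_def)
 have A: "A = (\<Union>i. D i)" using assms(4) UN_disjointed_eq[of B] by (auto simp: D_def)
 have "emeasure M A = (suminf (\<lambda>i. emeasure M (D i)))"
  unfolding A using D dis by (intro suminf_emeasure[symmetric]) auto
 also have "... = (suminf (\<lambda>i. emeasure N (D i)))"
  using D disjointed_subset[of B] by (intro suminf_cong eq) (auto simp: D_def)
 also have "... = emeasure N A"
  unfolding A using D dis assms(1) by (intro suminf_emeasure) auto
 finally show ?thesis .
qed

text \<open>The substitution rule for finite integrals applies to the bounded pieces of \<open>B\<close>.\<close>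

lemma emeasure_injective_image:
 fixes g :: "real => real"
 assumes S: "open S" and d: "\<And>t. t \<in> S ==> (g has_real_derivative g' t) (at t)"
  and c: "continuous_on S g'" and inj: "inj_on g S" and B: "B \<in> sets borel"
 shows "emeasure lborel (B \<inter> g ` S) = (\<integral>\<^sup>+t. indicator S t * indicator B (g t) * ennreal \<bar>g' t\<bar> \<partial>lborel)"
proof -
 have gc: "continuous_on S g" using d by (meson DERIV_isCont continuous_at_imp_continuous_on)
 have Sb [measurable]: "S \<in> sets borel" "g ` S \<in> sets borel"
  using S invariance_of_domain[OF gc S inj] by auto
 define G G' where "G t = indicator S t *\<^sub>R g t" and "G' t = indicator S t *\<^sub>R g' t" for t
 have [measurable]: "G \<in> borel_measurable borel" "G' \<in> borel_measurable borel"
  unfolding G_def[abs_def] G'_def[abs_def] using borel_measurable_continuous_on_indicator[OF Sb(1)] gc c by blast+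
 define N where "N = distr (density lborel (\<lambda>t. indicator S t * ennreal \<bar>G' t\<bar>)) borel G"
 have N: "emeasure N A = (\<integral>\<^sup>+t. indicator S t * indicator A (g t) * ennreal \<bar>g' t\<bar> \<partial>lborel)" if [measurable]: "A \<in> sets borel" for A
  unfolding N_def using measurable_sets[of G borel borel A]
  by (subst emeasure_distr, simp, simp, subst emeasure_density, measurable)
   (auto intro!: nn_integral_cong simp: indicator_def G_def G'_def)
 have M: "emeasure (density lborel (indicator (g ` S))) A = emeasure lborel (A \<inter> g ` S)" if [measurable]: "A \<in> sets borel" for A
  by (subst emeasure_density, simp, simp) (simp add: indicator_inter_arith[symmetric] Int_commute)
 have "emeasure (density lborel (indicator (g ` S))) B = emeasure N B"
 proof (rule emeasure_eq_on_countable_cover[where B = "\<lambda>n. cball 0 (real n)"])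
  show "B \<subseteq> (\<Union>n. cball 0 (real n))" by (auto intro: real_arch_simple)
  fix n A assume A: "A \<in> sets (density lborel (indicator (g ` S)))" "A \<subseteq> B \<inter> cball 0 (real n)"
  hence Ab [measurable]: "A \<in> sets borel" by simp
  have bd: "bounded (A \<inter> g ` S)" by (rule bounded_subset[OF bounded_cball[of 0 "real n"]]) (use A(2) in blast)
  let ?f = "\<lambda>x. if x \<in> A then 1 else 0 :: real" and ?m = "measure lborel (A \<inter> g ` S)"
  have "((\<lambda>x. 1) has_integral ?m) (A \<inter> g ` S)"
   using emeasure_bounded_finite[OF bd] by (intro has_integral_measure_lborel) auto
  hence f: "(?f has_integral ?m) (g ` S)" by (simp add: has_integral_restrict_Int)
  hence "?f absolutely_integrable_on g ` S" by (intro nonnegative_absolutely_integrable_1) auto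
  with f have "(\<lambda>t. \<bar>g' t\<bar> * ?f (g t)) absolutely_integrable_on S \<and> integral S (\<lambda>t. \<bar>g' t\<bar> * ?f (g t)) = ?m"
   using d inj by (subst has_absolute_integral_change_of_variables_1')
    (auto intro: DERIV_subset simp: integral_unique)
  hence "((\<lambda>t. if t \<in> S then \<bar>g' t\<bar> * ?f (g t) else 0) has_integral ?m) UNIV"
   unfolding has_integral_restrict_UNIV
   using integrable_integral absolutely_integrable_on_def by metis
  also have "(\<lambda>t. if t \<in> S then \<bar>g' t\<bar> * ?f (g t) else 0) = (\<lambda>t. indicator S t * indicator A (G t) * \<bar>G' t\<bar>)"
   by (auto simp: fun_eq_iff indicator_def G_def G'_def)
  finally have "(\<integral>\<^sup>+t. ennreal (indicator S t * indicator A (G t) * \<bar>G' t\<bar>) \<partial>lborel) = ennreal ?m"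
   by (intro nn_integral_has_integral_lborel) auto
  also have "(\<integral>\<^sup>+t. ennreal (indicator S t * indicator A (G t) * \<bar>G' t\<bar>) \<partial>lborel) = emeasure N A"
   unfolding N[OF Ab] by (intro nn_integral_cong) (auto simp: indicator_def G_def G'_def)
  also have "ennreal ?m = emeasure (density lborel (indicator (g ` S))) A"
   unfolding M[OF Ab] using emeasure_bounded_finite[OF bd] by (simp add: emeasure_eq_ennreal_measure less_top)
  finally show "emeasure (density lborel (indicator (g ` S))) A = emeasure N A" by simp
 qed (use B in \<open>auto simp: N_def\<close>)
 thus ?thesis using N[OF B] M[OF B] by simp
qed

text \<open>Change of variables for a map that alters the \<open>k\<close>-th coordinate only: in every line parallel
 to the axis it is a substitution in one variable.\<close>

locale shear =
 fixes k :: "'n::finite" and S :: "(real^'n) set" and w w' :: "real^'n => real"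
 assumes open_S: "open S" and inj_S: "inj_on (\<lambda>y. set_coord k (w y) y) S"
  and w_deriv: "\<And>y. y \<in> S ==> ((\<lambda>t. w (set_coord k t y)) has_real_derivative w' y) (at (y $ k))"
  and w_cont: "continuous_on S w" and w'_cont: "continuous_on S w'"
begin

definition "\<Phi> y = set_coord k (w y) y"

lemma inj_on_\<Phi>: "inj_on \<Phi> S"
 using inj_S by (simp add: \<Phi>_def[abs_def])

lemma open_\<Phi>_image: "open (\<Phi> ` S)"
 unfolding \<Phi>_def[abs_def] by (intro invariance_of_domain inj_S open_S continuous_intros w_cont)

lemma shear_measurable [measurable]:
 "S \<in> sets borel" "\<Phi> ` S \<in> sets borel" "(\<lambda>y. indicator S y * w y) \<in> borel_measurable borel"
 "(\<lambda>y. indicator S y * \<bar>w' y\<bar>) \<in> borel_measurable borel"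
 using open_S open_\<Phi>_image borel_measurable_continuous_on_indicator[of S w] w_cont
  borel_measurable_continuous_on_indicator[of S "\<lambda>y. \<bar>w' y\<bar>"] continuous_on_rabs[OF w'_cont] by simp_all

lemma emeasure_\<Phi>_image:
 assumes A [measurable]: "A \<in> sets borel"
 shows "emeasure lborel (A \<inter> \<Phi> ` S) = (\<integral>\<^sup>+y. indicator S y * indicator A (\<Phi> y) * ennreal \<bar>w' y\<bar> \<partial>lborel)"
proof -
 \<comment> \<open>the indicator makes \<open>w\<close> measurable on the whole space\<close>
 let ?W = "\<lambda>y. indicator S y * w y" and ?W' = "\<lambda>y. indicator S y * \<bar>w' y\<bar>"
 have "emeasure lborel (A \<inter> \<Phi> ` S) = (\<integral>\<^sup>+x. indicator (A \<inter> \<Phi> ` S) x \<partial>lborel)" by simp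
 also have "... = (\<integral>\<^sup>+x. indicator (slab k) x * (\<integral>\<^sup>+t. indicator (A \<inter> \<Phi> ` S) (set_coord k t x) \<partial>lborel) \<partial>lborel)"
  by (rule nn_integral_slab) measurable
 also have "... = (\<integral>\<^sup>+x. indicator (slab k) x * (\<integral>\<^sup>+t. indicator A (set_coord k (?W (set_coord k t x)) (set_coord k t x)) *
   ennreal (?W' (set_coord k t x)) \<partial>lborel) \<partial>lborel)"
 proof (rule nn_integral_cong, rule arg_cong2[where f = "(*)"], rule refl)
  fix x
  define B T g where "B = {t. set_coord k t x \<in> A}" and "T = {t. set_coord k t x \<in> S}" and "g t = w (set_coord k t x)" for t
  have B: "B \<in> sets borel" unfolding B_def by measurable
  have T: "open T" unfolding T_def using open_vimage[OF open_S, of "\<lambda>t. set_coord k t x"] by (simp add: vimage_def continuous_on_set_coord)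
  have img: "set_coord k t x \<in> \<Phi> ` S \<longleftrightarrow> t \<in> g ` T" for t
  proof
   assume "set_coord k t x \<in> \<Phi> ` S"
   then obtain y where y: "y \<in> S" "set_coord k t x = set_coord k (w y) y" by (auto simp: \<Phi>_def)
   hence "y = set_coord k (y $ k) x" "t = w y" by (auto simp: vec_eq_iff split: if_splits)
   thus "t \<in> g ` T" using y unfolding g_def T_def by (metis (mono_tags) image_eqI mem_Collect_eq)
  qed (auto simp: g_def T_def \<Phi>_def intro!: image_eqI[where x = "set_coord k _ x"])
  have "(\<integral>\<^sup>+t. indicator (A \<inter> \<Phi> ` S) (set_coord k t x) \<partial>lborel) = (\<integral>\<^sup>+t. indicator (B \<inter> g ` T) t \<partial>lborel)"
   by (intro nn_integral_cong) (auto simp: indicator_def img B_def)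
  also have "... = emeasure lborel (B \<inter> g ` T)"
  proof (intro nn_integral_indicator)
   have "{t. set_coord k t x \<in> \<Phi> ` S} \<in> sets borel" by measurable
   thus "B \<inter> g ` T \<in> sets lborel" using B unfolding img by auto
  qed
  also have "... = (\<integral>\<^sup>+t. indicator T t * indicator B (g t) * ennreal \<bar>w' (set_coord k t x)\<bar> \<partial>lborel)"
  proof (rule emeasure_injective_image[OF T _ _ _ B])
   show "(g has_real_derivative w' (set_coord k t x)) (at t)" if "t \<in> T" for t
    unfolding g_def using w_deriv[of "set_coord k t x"] that by (simp add: T_def)
   show "continuous_on T (\<lambda>t. w' (set_coord k t x))"
    by (rule continuous_on_compose2[OF w'_cont]) (auto simp: T_def intro!: continuous_intros)
   show "inj_on g T"
   proof (rule inj_onI)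
    fix s t assume "s \<in> T" "t \<in> T" "g s = g t"
    hence "set_coord k s x = set_coord k t x"
     using inj_onD[OF inj_S, of "set_coord k s x" "set_coord k t x"] by (simp add: T_def g_def)
    thus "s = t" using set_coord_nth[of k s x k] by simp
   qed
  qed
  also have "... = (\<integral>\<^sup>+t. indicator A (set_coord k (?W (set_coord k t x)) (set_coord k t x)) * ennreal (?W' (set_coord k t x)) \<partial>lborel)"
   by (intro nn_integral_cong) (auto simp: indicator_def T_def g_def B_def)
  finally show "(\<integral>\<^sup>+t. indicator (A \<inter> \<Phi> ` S) (set_coord k t x) \<partial>lborel) = ..." .
 qed
 also have "... = (\<integral>\<^sup>+y. indicator A (set_coord k (?W y) y) * ennreal (?W' y) \<partial>lborel)"
  by (rule nn_integral_slab[symmetric]) measurable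
 also have "... = (\<integral>\<^sup>+y. indicator S y * indicator A (\<Phi> y) * ennreal \<bar>w' y\<bar> \<partial>lborel)"
  by (intro nn_integral_cong) (auto simp: indicator_def \<Phi>_def)
 finally show ?thesis .
qed

lemma distr_\<Phi>:
 "distr (density lborel (\<lambda>y. ennreal (indicator S y * \<bar>w' y\<bar>))) borel (\<lambda>y. set_coord k (indicator S y * w y) y)
  = density lborel (\<lambda>x. ennreal (indicator (\<Phi> ` S) x))" (is "distr ?D _ ?f = ?R")
proof (rule measure_eqI)
 fix A assume "A \<in> sets (distr ?D borel ?f)"
 hence A [measurable]: "A \<in> sets borel" by simp
 have "emeasure (distr ?D borel ?f) A = (\<integral>\<^sup>+y. ennreal (indicator S y * \<bar>w' y\<bar>) * indicator (?f -` A) y \<partial>lborel)"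
  using measurable_sets[of ?f lborel borel A] by (subst emeasure_distr, simp, simp, subst emeasure_density) simp_all
 also have "... = (\<integral>\<^sup>+y. indicator S y * indicator A (\<Phi> y) * ennreal \<bar>w' y\<bar> \<partial>lborel)"
  by (intro nn_integral_cong) (auto simp: indicator_def \<Phi>_def)
 also have "... = emeasure lborel (A \<inter> \<Phi> ` S)" by (rule emeasure_\<Phi>_image[symmetric]) fact
 also have "... = emeasure ?R A"
  by (subst emeasure_density, simp, simp) (simp add: ennreal_indicator indicator_inter_arith[symmetric] Int_commute)
 finally show "emeasure (distr ?D borel ?f) A = emeasure ?R A" .
qed simp

lemma nn_integral_\<Phi>:
 fixes h :: "real^'n => ennreal"
 assumes [measurable]: "h \<in> borel_measurable borel"
 shows "(\<integral>\<^sup>+y. indicator S y * h (\<Phi> y) * ennreal \<bar>w' y\<bar> \<partial>lborel) = (\<integral>\<^sup>+x. indicator (\<Phi> ` S) x * h x \<partial>lborel)"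
proof -
 let ?f = "\<lambda>y. set_coord k (indicator S y * w y) y" and ?D = "density lborel (\<lambda>y. ennreal (indicator S y * \<bar>w' y\<bar>))"
 have "(\<integral>\<^sup>+y. indicator S y * h (\<Phi> y) * ennreal \<bar>w' y\<bar> \<partial>lborel) = (\<integral>\<^sup>+y. ennreal (indicator S y * \<bar>w' y\<bar>) * h (?f y) \<partial>lborel)"
  by (intro nn_integral_cong) (auto simp: indicator_def \<Phi>_def mult.commute)
 also have "... = (\<integral>\<^sup>+y. h (?f y) \<partial>?D)" by (rule nn_integral_density[symmetric]) simp_all
 also have "... = (\<integral>\<^sup>+x. h x \<partial>distr ?D borel ?f)" by (rule nn_integral_distr[symmetric]) simp_all
 also have "... = (\<integral>\<^sup>+x. indicator (\<Phi> ` S) x * h x \<partial>lborel)"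
  unfolding distr_\<Phi> by (subst nn_integral_density) (simp_all add: ennreal_indicator)
 finally show ?thesis .
qed

lemma integral_\<Phi>:
 fixes g :: "real^'n => real"
 assumes [measurable]: "g \<in> borel_measurable borel"
 shows "integrable lborel (\<lambda>x. indicator (\<Phi> ` S) x * g x) \<longleftrightarrow> integrable lborel (\<lambda>y. indicator S y * \<bar>w' y\<bar> * g (\<Phi> y))" (is ?I)
  and "(LINT x|lborel. indicator (\<Phi> ` S) x * g x) = (LINT y|lborel. indicator S y * \<bar>w' y\<bar> * g (\<Phi> y))" (is ?E)
proof -
 let ?f = "\<lambda>y. set_coord k (indicator S y * w y) y" and ?D = "density lborel (\<lambda>y. ennreal (indicator S y * \<bar>w' y\<bar>))"
  and ?R = "density lborel (\<lambda>x. ennreal (indicator (\<Phi> ` S) x))"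
 have eq: "(\<lambda>y. (indicator S y * \<bar>w' y\<bar>) *\<^sub>R g (?f y)) = (\<lambda>y. indicator S y * \<bar>w' y\<bar> * g (\<Phi> y))"
  by (auto simp: fun_eq_iff indicator_def \<Phi>_def)
 have "integrable lborel (\<lambda>x. indicator (\<Phi> ` S) x * g x) \<longleftrightarrow> integrable ?R g" by (subst integrable_density) simp_all
 also have "... \<longleftrightarrow> integrable ?D (\<lambda>y. g (?f y))" unfolding distr_\<Phi>[symmetric] by (rule integrable_distr_eq) simp_all
 also have "... \<longleftrightarrow> integrable lborel (\<lambda>y. (indicator S y * \<bar>w' y\<bar>) *\<^sub>R g (?f y))" by (rule integrable_density) simp_all
 finally show ?I unfolding eq .
 have "(LINT x|lborel. indicator (\<Phi> ` S) x * g x) = integral\<^sup>L ?R g" by (subst integral_density) simp_all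
 also have "... = (LINT y|?D. g (?f y))" unfolding distr_\<Phi>[symmetric] by (rule integral_distr) simp_all
 also have "... = (LINT y|lborel. (indicator S y * \<bar>w' y\<bar>) *\<^sub>R g (?f y))" by (rule integral_density) simp_all
 finally show ?E unfolding eq .
qed

end

lemma compact_continuous_bounded:
 fixes h :: "'a::topological_space => real"
 assumes "compact K" "continuous_on K h"
 shows "\<exists>C\<ge>0. \<forall>x\<in>K. \<bar>h x\<bar> \<le> C"
proof -
 have "compact (h ` K)" by (intro compact_continuous_image assms)
 then obtain C where "\<forall>s\<in>h ` K. norm s \<le> C" using compact_imp_bounded bounded_iff by metis
 thus ?thesis by (intro exI[of _ "max 0 C"]) (auto simp: le_max_iff_disj)
qed

lemma compact_support_bounded:
 fixes h :: "'a::topological_space => real"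
 assumes "compact K" "continuous_on K h" "\<And>x. x \<notin> K ==> h x = 0"
 obtains C where "\<And>x. \<bar>h x\<bar> \<le> C"
 using compact_continuous_bounded[OF assms(1,2)] assms(3) by (metis abs_zero)

lemma integrable_bounded_support:
 fixes h :: "real^'n => real"
 assumes "h \<in> borel_measurable borel" "\<And>x. x \<in> A ==> \<bar>h x\<bar> \<le> B" "\<And>x. x \<notin> A ==> h x = 0" "A \<in> sets borel" "bounded A"
 shows "integrable lborel h"
 by (rule integrableI_bounded_set[of A _ _ B]) (use assms emeasure_bounded_finite in auto)

text \<open>The substitution \<open>y\<^sub>k = \<epsilon> s\<close> moves the kernel \<open>\<kappa>(y\<^sub>k / \<epsilon>) / \<epsilon>\<close> to the fixed interval \<open>1 \<le> s \<le> 2\<close>, while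
 the other factor converges to its boundary values; dominated convergence.\<close>

lemma slab_concentration:
 fixes g :: "real^'n => real" and \<kappa> :: "real => real"
 assumes g [measurable]: "g \<in> borel_measurable borel" and bd: "\<And>y. \<bar>g y\<bar> \<le> C"
  and supp: "\<And>y. y \<notin> cbox a b ==> g y = 0"
  and lim: "\<And>y. ((\<lambda>t. g (set_coord k t y)) \<longlongrightarrow> g0 y) (at_right 0)"
  and \<kappa>: "continuous_on UNIV \<kappa>" "\<And>t. t \<notin> {1..2} ==> \<kappa> t = 0" "(LINT t|lborel. \<kappa> t) = 1"
  and \<epsilon>: "\<And>m. \<epsilon> m > 0" "\<epsilon> \<longlonglongrightarrow> 0"
 shows "(\<lambda>m. LINT y|lborel. \<kappa> (y $ k / \<epsilon> m) / \<epsilon> m * g y) \<longlonglongrightarrow> (LINT y|lborel. indicator (slab k) y * g0 y)"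
proof -
 have [measurable]: "\<kappa> \<in> borel_measurable borel" using \<kappa>(1) by (rule borel_measurable_continuous_onI)
 obtain K where K: "\<And>t. \<bar>\<kappa> t\<bar> \<le> K"
  by (rule compact_support_bounded[OF compact_Icc continuous_on_subset[OF \<kappa>(1)] \<kappa>(2)]) auto
 have C: "0 \<le> C" and K0: "0 \<le> K" using bd[of 0] K[of 0] by linarith+
 define G where "G m y = \<kappa> (y $ k) * g (set_coord k (\<epsilon> m * y $ k) y)" for m y
 let ?Q = "cbox (set_coord k 1 a) (set_coord k 2 b)"
 have G0: "G m y = 0" if "y \<notin> ?Q" for m y
 proof (cases "y $ k \<in> {1..2}")
  case True
  hence "set_coord k (\<epsilon> m * y $ k) y \<notin> cbox a b" using that by (auto simp: mem_box_cart split: if_splits)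
  thus ?thesis by (simp add: G_def supp)
 qed (simp add: G_def \<kappa>(2))
 have Gb: "\<bar>G m y\<bar> \<le> K * C" for m y
  unfolding G_def abs_mult using K bd K0 by (intro mult_mono) auto
 have Gm [measurable]: "G m \<in> borel_measurable borel" for m unfolding G_def[abs_def] by measurable
 have scale: "(LINT y|lborel. \<kappa> (y $ k / \<epsilon> m) / \<epsilon> m * g y) = (LINT y|lborel. G m y)" for m
 proof -
  have "integrable lborel (\<lambda>y. \<kappa> (y $ k / \<epsilon> m) / \<epsilon> m * g y)"
  proof (rule integrable_bounded_support[of _ "cbox a b" "K / \<epsilon> m * C"])
   show "\<bar>\<kappa> (y $ k / \<epsilon> m) / \<epsilon> m * g y\<bar> \<le> K / \<epsilon> m * C" for y
    unfolding abs_mult abs_divide using K bd K0 \<epsilon>(1)[of m] by (intro mult_mono divide_mono) auto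
  qed (auto simp: supp)
  hence "(LINT y|lborel. \<kappa> (y $ k / \<epsilon> m) / \<epsilon> m * g y) =
   (LINT x|lborel. indicator (slab k) x * (LINT t|lborel. \<kappa> (t / \<epsilon> m) / \<epsilon> m * g (set_coord k t x)))"
   by (subst integral_slab[where k = k]) simp_all
  moreover have inner: "(LINT t|lborel. \<kappa> (t / \<epsilon> m) / \<epsilon> m * g (set_coord k t x)) = (LINT s|lborel. G m (set_coord k s x))" for x
   by (subst lborel_integral_real_affine[of "\<epsilon> m" _ 0])
    (use \<epsilon>(1)[of m] in \<open>simp_all add: G_def mult.assoc\<close>)
  moreover have "(LINT x|lborel. indicator (slab k) x * (LINT s|lborel. G m (set_coord k s x))) = (LINT y|lborel. G m y)"
   by (rule integral_slab[symmetric], rule integrable_bounded_support[OF Gm Gb G0]) auto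
  ultimately show ?thesis by (simp only: inner)
 qed
 have dct: "integrable lborel (\<lambda>y. \<kappa> (y $ k) * g0 y)" "(\<lambda>m. LINT y|lborel. G m y) \<longlonglongrightarrow> (LINT y|lborel. \<kappa> (y $ k) * g0 y)"
 proof -
  have Glim: "(\<lambda>m. G m y) \<longlonglongrightarrow> \<kappa> (y $ k) * g0 y" for y
  proof (cases "y $ k \<in> {1..2}")
   case True
   have "filterlim (\<lambda>m. \<epsilon> m * y $ k) (at_right 0) sequentially"
    using True \<epsilon>(1) less_imp_neq[OF \<epsilon>(1)] tendsto_mult_left_zero[OF \<epsilon>(2), of "y $ k"] by (auto simp: filterlim_at)
   from filterlim_compose[OF lim this] show ?thesis unfolding G_def by (intro tendsto_intros)
  qed (simp add: G_def \<kappa>(2))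
  have w: "integrable lborel (\<lambda>y. indicator ?Q y * (K * C))"
   by (rule integrable_bounded_support[of _ ?Q "K * C"]) (use K0 C in auto)
  have b: "AE y in lborel. norm (G m y) \<le> indicator ?Q y * (K * C)" for m
   using Gb G0 by (intro AE_I2) (auto simp: indicator_def)
  have l: "AE y in lborel. (\<lambda>m. G m y) \<longlonglongrightarrow> \<kappa> (y $ k) * g0 y" by (simp add: Glim)
  have m: "(\<lambda>y. \<kappa> (y $ k) * g0 y) \<in> borel_measurable lborel"
   by (rule borel_measurable_LIMSEQ_real[of _ G]) (auto intro: Glim)
  show "integrable lborel (\<lambda>y. \<kappa> (y $ k) * g0 y)" "(\<lambda>m. LINT y|lborel. G m y) \<longlonglongrightarrow> (LINT y|lborel. \<kappa> (y $ k) * g0 y)"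
   by (rule integrable_dominated_convergence[OF m _ w l b], simp) (rule integral_dominated_convergence[OF m _ w l b], simp)
 qed
 have "g0 (set_coord k t y) = g0 y" for t y
  using tendsto_unique[OF _ lim[of "set_coord k t y"]] lim[of y] by simp
 hence "(LINT y|lborel. \<kappa> (y $ k) * g0 y) = (LINT y|lborel. indicator (slab k) y * g0 y)"
  using integral_slab[OF dct(1), of k] \<kappa>(3) by simp
 thus ?thesis using dct(2) unfolding scale by simp
qed

section \<open>Area of hypersurfaces\<close>

definition area_factor :: "(real^'n => real) => real^'n => real" where
 "area_factor u x = sqrt (1 + (\<Sum>j. (pd j u x)\<^sup>2))"

definition patch_image :: "'n::finite => (real^'n) set => (real^'n => real) => (real^'n) set" where
 "patch_image k U u = (\<lambda>x. set_coord k (u x) x) ` U"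

definition patch_area :: "'n::finite => (real^'n) set => (real^'n => real) => (real^'n) set => ennreal" where
 "patch_area k U u A = (\<integral>\<^sup>+x. ennreal (indicator {x\<in>U. 0 \<le> x $ k \<and> x $ k \<le> 1 \<and> set_coord k (u x) x \<in> A} x *
               sqrt (1 + (\<Sum>j. (pd j u x)\<^sup>2))) \<partial>lborel)"

lemma is_area_measure_patch:
 assumes "is_area_measure X \<sigma>" "graph_patch k U u" "patch_image k U u \<subseteq> X" "A \<in> sets borel" "A \<subseteq> patch_image k U u"
 shows "emeasure \<sigma> A = patch_area k U u A"
 using assms unfolding is_area_measure_def patch_image_def patch_area_def by blast

lemma area_factor_pos: "area_factor u x > 0"
 and area_factor_sq: "(area_factor u x)\<^sup>2 = 1 + (\<Sum>j. (pd j u x)\<^sup>2)"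
proof -
 have *: "(\<Sum>j. (pd j u x)\<^sup>2) \<ge> 0" by (simp add: sum_nonneg)
 thus "area_factor u x > 0" "(area_factor u x)\<^sup>2 = 1 + (\<Sum>j. (pd j u x)\<^sup>2)"
  unfolding area_factor_def by auto
qed

context
 fixes k :: "'n::finite" and U u
 assumes gp: "graph_patch k U u"
begin

lemma graph_patch_open: "open U" and graph_patch_C1: "C1_on U u"
 using gp by (auto simp: graph_patch_def C1_on_openD)

lemma graph_patch_cylinder: "set_coord k t x \<in> U \<longleftrightarrow> x \<in> U"
proof
 assume "set_coord k t x \<in> U"
 hence "set_coord k (x $ k) (set_coord k t x) \<in> U" using gp unfolding graph_patch_def by blast
 thus "x \<in> U" by simp
qed (use gp in \<open>auto simp: graph_patch_def\<close>)

lemma graph_patch_indep: "x \<in> U ==> u (set_coord k t x) = u x"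
 using gp by (auto simp: graph_patch_def)

lemma patch_image_iff: "y \<in> patch_image k U u \<longleftrightarrow> y \<in> U \<and> y $ k = u y"
proof
 assume "y \<in> patch_image k U u"
 then obtain x where "x \<in> U" "y = set_coord k (u x) x" by (auto simp: patch_image_def)
 thus "y \<in> U \<and> y $ k = u y" using graph_patch_cylinder graph_patch_indep by auto
next
 assume "y \<in> U \<and> y $ k = u y"
 hence "y = set_coord k (u y) y" "y \<in> U" by (auto simp: vec_eq_iff)
 thus "y \<in> patch_image k U u" by (auto simp: patch_image_def)
qed

lemma pd_graph_patch_eq:
 assumes x: "x \<in> U"
 shows "pd j u x = (if j = k then 0 else pd j u (set_coord k t x))"
proof -
 have "pd j u x = pd j (\<lambda>x. u (set_coord k t x)) x"
  by (rule pd_cong[OF graph_patch_open x]) (simp add: graph_patch_indep)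
 also have "... = (if j = k then 0 else pd j u (set_coord k t x))"
  using x graph_patch_cylinder by (subst pd_comp_set_coord) (auto intro: C1_on_differentiable[OF graph_patch_C1])
 finally show ?thesis .
qed

lemma pd_graph_patch: "x \<in> U ==> pd k u x = 0"
 "x \<in> U ==> pd j u (set_coord k t x) = pd j u x"
proof -
 show 0: "pd k u x = 0" if "x \<in> U" for x using pd_graph_patch_eq[OF that, of k] by simp
 show "x \<in> U ==> pd j u (set_coord k t x) = pd j u x"
  using pd_graph_patch_eq[of x j t] 0 graph_patch_cylinder by (cases "j = k") auto
qed

lemma area_factor_indep: "x \<in> U ==> area_factor u (set_coord k t x) = area_factor u x"
 by (simp add: area_factor_def pd_graph_patch)

lemma area_factor_continuous: "continuous_on U (area_factor u)"
 unfolding area_factor_def by (intro continuous_intros C1_on_pd_continuous) (rule graph_patch_C1)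

lemma patch_image_borel: "patch_image k U u \<in> sets borel"
proof -
 have "open (U \<inter> (\<lambda>y. y $ k - u y) -` (- {0}))"
  by (intro continuous_open_preimage[OF _ graph_patch_open] continuous_intros C1_on_continuous[OF graph_patch_C1] open_Compl closed_singleton)
 moreover have "patch_image k U u = U - (U \<inter> (\<lambda>y. y $ k - u y) -` (- {0}))" by (auto simp: patch_image_iff)
 ultimately show ?thesis using graph_patch_open by auto
qed

lemma graph_patch_measurable:
 "(\<lambda>x. indicator U x * u x) \<in> borel_measurable borel"
 "(\<lambda>x. indicator (U \<inter> slab k) x * area_factor u x) \<in> borel_measurable borel"
 "A \<in> sets borel ==> (\<lambda>x. ennreal (indicator {x\<in>U. 0 \<le> x $ k \<and> x $ k \<le> 1 \<and> set_coord k (u x) x \<in> A} x * area_factor u x)) \<in> borel_measurable borel"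
proof -
 have [measurable]: "U \<in> sets borel" using graph_patch_open by auto
 show u [measurable]: "(\<lambda>x. indicator U x * u x) \<in> borel_measurable borel"
  using borel_measurable_continuous_on_indicator[OF _ C1_on_continuous[OF graph_patch_C1]] by simp
 have [measurable]: "(\<lambda>x. indicator U x * area_factor u x) \<in> borel_measurable borel"
  using borel_measurable_continuous_on_indicator[OF _ area_factor_continuous] by simp
 have "(\<lambda>x. indicator (slab k) x * (indicator U x * area_factor u x)) \<in> borel_measurable borel" by measurable
 thus f [measurable]: "(\<lambda>x. indicator (U \<inter> slab k) x * area_factor u x) \<in> borel_measurable borel"
  by (simp add: indicator_inter_arith mult_ac)
 assume [measurable]: "A \<in> sets borel"
 have "(\<lambda>x. ennreal (indicator (U \<inter> slab k) x * area_factor u x) * indicator A (set_coord k (indicator U x * u x) x)) \<in> borel_measurable borel" by measurable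
 thus "(\<lambda>x. ennreal (indicator {x\<in>U. 0 \<le> x $ k \<and> x $ k \<le> 1 \<and> set_coord k (u x) x \<in> A} x * area_factor u x)) \<in> borel_measurable borel"
  by (rule subst[of _ _ "\<lambda>f. f \<in> _", rotated]) (auto simp: fun_eq_iff indicator_def slab_def)
qed

end

definition patch_measure :: "'n::finite => (real^'n) set => (real^'n => real) => (real^'n) measure" where
 "patch_measure k U u = distr (density lborel (\<lambda>x. ennreal (indicator (U \<inter> slab k) x * area_factor u x))) borel
   (\<lambda>x. set_coord k (indicator U x * u x) x)"

lemma sets_patch_measure [simp]: "sets (patch_measure k U u) = sets borel"
 by (simp add: patch_measure_def)

lemma emeasure_patch_measure:
 assumes gp: "graph_patch k U u" and A: "A \<in> sets borel"
 shows "emeasure (patch_measure k U u) A = patch_area k U u A"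
proof -
 note [measurable] = graph_patch_measurable[OF gp]
 let ?f = "\<lambda>x. set_coord k (indicator U x * u x) x"
 have "emeasure (patch_measure k U u) A = (\<integral>\<^sup>+x. ennreal (indicator (U \<inter> slab k) x * area_factor u x) * indicator (?f -` A) x \<partial>lborel)"
  unfolding patch_measure_def
  using A measurable_sets[of ?f lborel borel A] by (subst emeasure_distr, simp, simp, subst emeasure_density) simp_all
 also have "... = patch_area k U u A"
  unfolding patch_area_def by (intro nn_integral_cong) (auto simp: indicator_def area_factor_def slab_def)
 finally show ?thesis .
qed

text \<open>Two patches that describe the same piece of a hypersurface as graphs in different
 directions \<open>k\<close> and \<open>l\<close> assign it the same area.  After the coordinates \<open>k\<close> and \<open>l\<close> are exchanged,
 the transition map alters the \<open>l\<close>-th coordinate only; its Jacobian is \<open>\<partial>\<^sub>k v\<close>, and implicit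
 differentiation shows that it is the quotient of the two area factors.\<close>

context
 fixes k l :: "'n::finite" and U V u v
 assumes gu: "graph_patch k U u" and gv: "graph_patch l V v"
  and sub: "patch_image l V v \<subseteq> patch_image k U u" and kl: "k \<noteq> l"
begin

lemma transition_point:
 assumes y: "y \<in> V"
 shows "set_coord l (v y) y \<in> U" "u (set_coord l (v y) y) = y $ k"
proof -
 have "set_coord l (v y) y \<in> patch_image k U u" using sub y by (auto simp: patch_image_def)
 thus "set_coord l (v y) y \<in> U" "u (set_coord l (v y) y) = y $ k"
  using kl by (simp_all add: patch_image_iff[OF gu])
qed

lemma transition_pd:
 assumes y: "y \<in> V"
 shows "pd l u (set_coord l (v y) y) * pd k v y = 1"
  "i \<noteq> k ==> i \<noteq> l ==> pd i u (set_coord l (v y) y) = - pd l u (set_coord l (v y) y) * pd i v y"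
proof -
 let ?P = "\<lambda>y. set_coord l (v y) y"
 have eq: "(if i = k then 1 else 0) = (if i = l then 0 else pd i u (?P y)) + pd l u (?P y) * pd i v y" for i
 proof -
  have "pd i (\<lambda>y. u (?P y)) y = pd i (\<lambda>y. y $ k) y"
   by (rule pd_cong[OF graph_patch_open[OF gv] y]) (simp add: transition_point)
  thus ?thesis
   using transition_point[OF y] C1_on_differentiable[OF graph_patch_C1[OF gv] y]
   by (subst (asm) pd_comp_set_coord) (auto intro: C1_on_differentiable[OF graph_patch_C1[OF gu]])
 qed
 show "pd l u (?P y) * pd k v y = 1"
  using eq[of k] kl pd_graph_patch(1)[OF gu transition_point(1)[OF y]] by simp
 show "i \<noteq> k ==> i \<noteq> l ==> pd i u (?P y) = - pd l u (?P y) * pd i v y"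
  using eq[of i] by simp
qed

lemma transition_area_factor:
 assumes y: "y \<in> V"
 shows "area_factor u (set_coord l (v y) y) * \<bar>pd k v y\<bar> = area_factor v y"
proof -
 let ?p = "set_coord l (v y) y"
 define c where "c = pd l u ?p"
 define R where "R = (\<Sum>j\<in>UNIV - {k, l}. (pd j v y)\<^sup>2)"
 have c: "c * pd k v y = 1" using transition_pd(1)[OF y] by (simp add: c_def)
 have "(\<Sum>j. (pd j u ?p)\<^sup>2) = c\<^sup>2 + c\<^sup>2 * R"
 proof -
  have "(\<Sum>j. (pd j u ?p)\<^sup>2) =
   (pd k u ?p)\<^sup>2 + ((pd l u ?p)\<^sup>2 + (\<Sum>j\<in>UNIV - {k, l}. (pd j u ?p)\<^sup>2))"
   using kl by (subst sum.remove[of _ k], simp, simp, subst sum.remove[of _ l]) (auto simp: insert_Diff_if Diff_insert2[symmetric] insert_commute)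
  also have "(\<Sum>j\<in>UNIV - {k, l}. (pd j u ?p)\<^sup>2) = c\<^sup>2 * R"
   unfolding R_def sum_distrib_left
   by (intro sum.cong) (auto simp: transition_pd(2)[OF y] c_def power_mult_distrib)
  finally show ?thesis using pd_graph_patch(1)[OF gu transition_point(1)[OF y]] by (simp add: c_def)
 qed
 moreover have "(\<Sum>j. (pd j v y)\<^sup>2) = (pd k v y)\<^sup>2 + R"
 proof -
  have "(\<Sum>j. (pd j v y)\<^sup>2) = (pd l v y)\<^sup>2 + ((pd k v y)\<^sup>2 + R)"
   using kl unfolding R_def by (subst sum.remove[of _ l], simp, simp, subst sum.remove[of _ k]) (auto simp: insert_Diff_if Diff_insert2[symmetric] insert_commute)
  thus ?thesis using pd_graph_patch(1)[OF gv y] by simp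
 qed
 moreover have "(1 + (c\<^sup>2 + c\<^sup>2 * R)) * (pd k v y)\<^sup>2 = 1 + ((pd k v y)\<^sup>2 + R)"
 proof -
  have "(1 + (c\<^sup>2 + c\<^sup>2 * R)) * (pd k v y)\<^sup>2 = (pd k v y)\<^sup>2 + (c * pd k v y)\<^sup>2 * (1 + R)"
   by (simp add: algebra_simps power2_eq_square)
  thus ?thesis unfolding c by simp
 qed
 ultimately show ?thesis
  unfolding area_factor_def by (simp add: real_sqrt_mult[symmetric] real_sqrt_abs[symmetric] del: real_sqrt_abs)
qed

lemma transition_patch_area:
 assumes A: "A \<in> sets borel" "A \<subseteq> patch_image l V v"
 shows "patch_area l V v A = patch_area k U u A"
proof -
 define S w w' where "S = swap_coord k l -` V" and "w y = v (swap_coord k l y)" and "w' y = pd k v (swap_coord k l y)" for y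
 let ?\<Phi> = "\<lambda>y. set_coord l (w y) y"
 have zP: "set_coord k (u (?\<Phi> y)) (?\<Phi> y) = set_coord l (v (swap_coord k l y)) (swap_coord k l y)"
  "?\<Phi> y \<in> U" "area_factor u (?\<Phi> y) * \<bar>w' y\<bar> = area_factor v (swap_coord k l y)" if y: "y \<in> S" for y
 proof -
  let ?q = "swap_coord k l y" let ?p = "set_coord l (v ?q) ?q"
  have q: "?q \<in> V" using y by (simp add: S_def)
  have \<Phi>: "?\<Phi> y = set_coord k (y $ k) ?p"
   using kl by (auto simp: vec_eq_iff w_def Transposition.transpose_def)
  note t = transition_point[OF q]
  show U: "?\<Phi> y \<in> U" using t graph_patch_cylinder[OF gu] by (simp add: \<Phi>)
  have "u (?\<Phi> y) = ?q $ k" using graph_patch_indep[OF gu t(1)] t(2) by (simp add: \<Phi>)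
  thus "set_coord k (u (?\<Phi> y)) (?\<Phi> y) = ?p" unfolding \<Phi> using kl by (auto simp: vec_eq_iff)
  show "area_factor u (?\<Phi> y) * \<bar>w' y\<bar> = area_factor v ?q"
   using transition_area_factor[OF q] area_factor_indep[OF gu t(1)] by (simp add: \<Phi> w'_def)
 qed
 interpret shear l S w w'
 proof unfold_locales
  show "open S" unfolding S_def by (rule open_vimage[OF graph_patch_open[OF gv] continuous_on_swap_coord])
  show "continuous_on S w" "continuous_on S w'"
   unfolding w_def w'_def S_def
   by (rule continuous_on_compose2[OF _ continuous_on_swap_coord], rule C1_on_continuous C1_on_pd_continuous, rule graph_patch_C1[OF gv], auto)+
  show "inj_on ?\<Phi> S"
  proof (rule inj_onI)
   fix y z assume yz: "y \<in> S" "z \<in> S" "?\<Phi> y = ?\<Phi> z"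
   hence "swap_coord k l y $ k = swap_coord k l z $ k"
    using arg_cong[OF zP(1)[OF yz(1)], of "\<lambda>p. p $ k"] arg_cong[OF zP(1)[OF yz(2)], of "\<lambda>p. p $ k"] kl by (simp del: swap_coord_nth)
   moreover have "y $ j = z $ j" if "j \<noteq> l" for j using arg_cong[OF yz(3), of "\<lambda>p. p $ j"] that by simp
   ultimately show "y = z" by (metis swap_coord_nth transpose_apply_first vec_eq_iff)
  qed
  fix y assume y: "y \<in> S"
  have e: "swap_coord k l (set_coord l 0 y) + t *\<^sub>R axis k 1 = swap_coord k l (set_coord l t y)" for t
   using kl by (auto simp: vec_eq_iff axis_def Transposition.transpose_def)
  have "((\<lambda>t. v (swap_coord k l (set_coord l 0 y) + t *\<^sub>R axis k 1)) has_real_derivative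
   pd k v (swap_coord k l (set_coord l 0 y) + y $ l *\<^sub>R axis k 1)) (at (y $ l))"
   by (rule has_real_derivative_along_axis[OF C1_on_differentiable[OF graph_patch_C1[OF gv]]]) (use y in \<open>simp add: e S_def\<close>)
  thus "((\<lambda>t. w (set_coord l t y)) has_real_derivative w' y) (at (y $ l))" unfolding e by (simp add: w_def w'_def)
 qed
 note [measurable] = graph_patch_measurable(3)[OF gu A(1)] graph_patch_measurable(3)[OF gv A(1)]
 let ?S = "{x \<in> V. 0 \<le> x $ l \<and> x $ l \<le> 1 \<and> set_coord l (v x) x \<in> A}"
 let ?B = "{x \<in> U. 0 \<le> x $ k \<and> x $ k \<le> 1 \<and> set_coord k (u x) x \<in> A}"
 have "patch_area l V v A = (\<integral>\<^sup>+x. ennreal (indicator ?S x * area_factor v x) \<partial>distr lborel borel (swap_coord k l))"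
  unfolding patch_area_def area_factor_def lborel_swap_coord ..
 also have "... = (\<integral>\<^sup>+y. ennreal (indicator ?S (swap_coord k l y) * area_factor v (swap_coord k l y)) \<partial>lborel)"
  by (rule nn_integral_distr) simp_all
 also have "... = (\<integral>\<^sup>+y. indicator S y * ennreal (indicator ?B (\<Phi> y) * area_factor u (\<Phi> y)) * ennreal \<bar>w' y\<bar> \<partial>lborel)"
 proof (rule nn_integral_cong)
  fix y
  show "ennreal (indicator ?S (swap_coord k l y) * area_factor v (swap_coord k l y)) =
   indicator S y * ennreal (indicator ?B (\<Phi> y) * area_factor u (\<Phi> y)) * ennreal \<bar>w' y\<bar>"
  proof (cases "y \<in> S")
   case True
   have "\<Phi> y \<in> ?B \<longleftrightarrow> swap_coord k l y \<in> ?S"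
    using zP[OF True] True kl by (simp add: \<Phi>_def S_def)
   thus ?thesis using True zP(3)[OF True] area_factor_pos[of u "\<Phi> y"]
    by (auto simp: indicator_def ennreal_mult'[symmetric] less_imp_le \<Phi>_def)
  qed (auto simp: S_def)
 qed
 also have "... = (\<integral>\<^sup>+x. indicator (\<Phi> ` S) x * ennreal (indicator ?B x * area_factor u x) \<partial>lborel)"
  by (rule nn_integral_\<Phi>) simp
 also have "... = (\<integral>\<^sup>+x. ennreal (indicator ?B x * area_factor u x) \<partial>lborel)"
 proof (rule nn_integral_cong)
  fix x
  have "x \<in> \<Phi> ` S" if xB: "x \<in> ?B"
  proof -
   define p where "p = set_coord k (u x) x"
   have "p \<in> patch_image l V v" using that A(2) unfolding p_def by blast
   hence p: "p \<in> V" "p $ l = v p" by (simp_all add: patch_image_iff[OF gv])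
   define q where "q = set_coord l (x $ k) p"
   have q: "q \<in> V" "v q = x $ l" using p graph_patch_cylinder[OF gv] graph_patch_indep[OF gv p(1)] kl by (auto simp: q_def p_def)
   hence "x = \<Phi> (swap_coord k l q)" "swap_coord k l q \<in> S"
    using kl by (auto simp: vec_eq_iff \<Phi>_def w_def S_def q_def p_def Transposition.transpose_def)
   thus ?thesis by blast
  qed
  thus "indicator (\<Phi> ` S) x * ennreal (indicator ?B x * area_factor u x) = ennreal (indicator ?B x * area_factor u x)"
   by (auto simp: indicator_def)
 qed
 also have "... = patch_area k U u A" unfolding patch_area_def area_factor_def ..
 finally show ?thesis .
qed

end

lemma patch_area_overlap_subset:
 assumes gu: "graph_patch k U u" and gv: "graph_patch l V v"
  and sub: "patch_image l V v \<subseteq> patch_image k U u"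
  and A: "A \<in> sets borel" "A \<subseteq> patch_image l V v"
 shows "patch_area l V v A = patch_area k U u A"
proof (cases "k = l")
 case True
 have uv: "y \<in> U \<and> u y = v y" if "y \<in> V" for y
 proof -
  have "set_coord k (v y) y \<in> patch_image k U u" using sub that True by (auto simp: patch_image_def)
  thus ?thesis using graph_patch_cylinder[OF gu] graph_patch_indep[OF gu] by (auto simp: patch_image_iff[OF gu])
 qed
 have pd: "pd j u y = pd j v y" if "y \<in> V" for j y
  by (rule pd_cong[OF graph_patch_open[OF gv] that]) (simp add: uv)
 have iff: "x \<in> U \<and> set_coord k (u x) x \<in> A \<longleftrightarrow> x \<in> V \<and> set_coord l (v x) x \<in> A" for x
 proof
  assume "x \<in> U \<and> set_coord k (u x) x \<in> A"
  moreover hence "x \<in> V" using A(2) graph_patch_cylinder[OF gv] True by (auto simp: patch_image_iff[OF gv])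
  ultimately show "x \<in> V \<and> set_coord l (v x) x \<in> A" using uv True by auto
 qed (use uv True in auto)
 show ?thesis unfolding patch_area_def
 proof (rule nn_integral_cong)
  fix x
  show "ennreal (indicator {x \<in> V. 0 \<le> x $ l \<and> x $ l \<le> 1 \<and> set_coord l (v x) x \<in> A} x * sqrt (1 + (\<Sum>j. (pd j v x)\<^sup>2))) =
   ennreal (indicator {x \<in> U. 0 \<le> x $ k \<and> x $ k \<le> 1 \<and> set_coord k (u x) x \<in> A} x * sqrt (1 + (\<Sum>j. (pd j u x)\<^sup>2)))"
   using iff[of x] pd[of x] True by (auto simp: indicator_def)
 qed
qed (rule transition_patch_area[OF gu gv sub _ A])

text \<open>Only the part of the second patch that lies in the region \<open>W\<close>, where the first patch
 describes the whole hypersurface, has to be compared.\<close>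

lemma patch_area_overlap:
 assumes gu: "graph_patch k U u" and gv: "graph_patch l V v"
  and W: "open W" "W \<inter> patch_image l V v \<subseteq> patch_image k U u"
  and A: "A \<in> sets borel" "A \<subseteq> patch_image l V v" "A \<subseteq> W"
 shows "patch_area l V v A = patch_area k U u A"
proof -
 define V' where "V' = {y\<in>V. set_coord l (v y) y \<in> W}"
 have "open V'"
 proof -
  have "open (V \<inter> (\<lambda>y. set_coord l (v y) y) -` W)"
   by (intro continuous_open_preimage[OF _ graph_patch_open[OF gv] W(1)] continuous_intros C1_on_continuous[OF graph_patch_C1[OF gv]])
  thus ?thesis by (simp add: V'_def Int_def vimage_def)
 qed
 hence gv': "graph_patch l V' v"
  using C1_on_subset[OF graph_patch_C1[OF gv]] graph_patch_cylinder[OF gv] graph_patch_indep[OF gv]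
  by (auto simp: graph_patch_def V'_def)
 have "patch_area l V v A = patch_area l V' v A"
  unfolding patch_area_def
 proof (rule nn_integral_cong)
  fix x
  have "x \<in> V \<and> set_coord l (v x) x \<in> A \<longleftrightarrow> x \<in> V' \<and> set_coord l (v x) x \<in> A" using A(3) by (auto simp: V'_def)
  thus "ennreal (indicator {x \<in> V. 0 \<le> x $ l \<and> x $ l \<le> 1 \<and> set_coord l (v x) x \<in> A} x * sqrt (1 + (\<Sum>j. (pd j v x)\<^sup>2))) =
   ennreal (indicator {x \<in> V'. 0 \<le> x $ l \<and> x $ l \<le> 1 \<and> set_coord l (v x) x \<in> A} x * sqrt (1 + (\<Sum>j. (pd j v x)\<^sup>2)))"
   by (auto simp: indicator_def)
 qed
 also have "... = patch_area k U u A"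
 proof (rule patch_area_overlap_subset[OF gu gv' _ A(1)])
  show "patch_image l V' v \<subseteq> patch_image k U u" using W(2) by (auto simp: patch_image_def V'_def)
  show "A \<subseteq> patch_image l V' v" using A(2,3) by (auto simp: patch_image_def V'_def)
 qed
 finally show ?thesis .
qed

definition C1_hypersurface :: "(real^'n) set => bool" where
 "C1_hypersurface X \<longleftrightarrow> (\<forall>p\<in>X. \<exists>W k U u. open W \<and> p \<in> W \<and> graph_patch k U u \<and>
   patch_image k U u \<subseteq> X \<and> X \<inter> W \<subseteq> patch_image k U u)"

definition is_patch_cover where
 "is_patch_cover X N W k U u \<longleftrightarrow> X \<subseteq> (\<Union>i<(N::nat). W i) \<and> (\<forall>i<N. open (W i) \<and> graph_patch (k i) (U i) (u i) \<and>
  patch_image (k i) (U i) (u i) \<subseteq> X \<and> X \<inter> W i \<subseteq> patch_image (k i) (U i) (u i))"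

lemma finite_patch_cover:
 assumes "compact X" "C1_hypersurface X"
 shows "\<exists>N W k U u. is_patch_cover X N W k U u"
proof -
 obtain W k U u where *: "\<And>p. p \<in> X ==> open (W p) \<and> p \<in> W p \<and> graph_patch (k p) (U p) (u p) \<and>
   patch_image (k p) (U p) (u p) \<subseteq> X \<and> X \<inter> W p \<subseteq> patch_image (k p) (U p) (u p)"
  using assms(2) unfolding C1_hypersurface_def by metis
 have "X \<subseteq> (\<Union>p\<in>X. W p)" using * by blast
 then obtain F where F: "F \<subseteq> X" "finite F" "X \<subseteq> (\<Union>p\<in>F. W p)"
  using compactE_image[OF assms(1), of X W] * by metis
 obtain f where f: "bij_betw f {..<card F} F" using F(2) ex_bij_betw_nat_finite atLeast0LessThan by metis
 have fF: "f i \<in> X" if "i < card F" for i using f that F(1) by (auto simp: bij_betw_def)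
 show ?thesis
 proof (intro exI)
  have "(\<Union>i<card F. W (f i)) = (\<Union>p\<in>f ` {..<card F}. W p)" by blast
  also have "f ` {..<card F} = F" using f by (simp add: bij_betw_def)
  finally have "X \<subseteq> (\<Union>i<card F. W (f i))" using F(3) by simp
  thus "is_patch_cover X (card F) (\<lambda>i. W (f i)) (\<lambda>i. k (f i)) (\<lambda>i. U (f i)) (\<lambda>i. u (f i))"
   unfolding is_patch_cover_def using *[OF fF] by simp
 qed
qed

text \<open>Disjoint pieces \<open>B i\<close> of a finite patch cover carry the measures of their patches.  On any further
 patch the result is right because overlapping patches agree.\<close>

theorem area_measure_exists:
 assumes X: "compact X" "C1_hypersurface X"
 shows "\<exists>\<sigma>. is_area_measure X \<sigma>"
proof -
 obtain N W k U u where "is_patch_cover X N W k U u" using finite_patch_cover[OF X] by blast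
 hence c: "X \<subseteq> (\<Union>i<N. W i)"
  "\<And>i. i < N ==> open (W i)" "\<And>i. i < N ==> graph_patch (k i) (U i) (u i)"
  "\<And>i. i < N ==> patch_image (k i) (U i) (u i) \<subseteq> X"
  "\<And>i. i < N ==> X \<inter> W i \<subseteq> patch_image (k i) (U i) (u i)"
  by (simp_all add: is_patch_cover_def)
 have Xm [measurable]: "X \<in> sets borel" by (rule borel_closed[OF compact_imp_closed[OF X(1)]])
 define B where "B i = X \<inter> (if i < N then W i - (\<Union>j<i. if j < N then W j else {}) else {})" for i
 have Bm: "B i \<in> sets borel" for i unfolding B_def using c(2) by auto
 have BX: "X = (\<Union>i<N. B i)"
 proof (intro antisym subsetI)
  fix x assume x: "x \<in> X"
  define i where "i = (LEAST i. i < N \<and> x \<in> W i)"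
  have "\<exists>i. i < N \<and> x \<in> W i" using c(1) x by blast
  hence i: "i < N \<and> x \<in> W i" unfolding i_def by (rule LeastI_ex)
  have "\<not> (j < N \<and> x \<in> W j)" if "j < i" for j using not_less_Least that unfolding i_def by blast
  thus "x \<in> (\<Union>i<N. B i)" using i x by (auto simp: B_def)
 qed (auto simp: B_def)
 have dis: "disjoint_family_on B {..<N}"
  unfolding disjoint_family_on_def
 proof (intro ballI impI)
  fix m n assume mn: "m \<in> {..<N}" "n \<in> {..<N}" "m \<noteq> n"
  have *: "B m \<inter> B n = {}" if "m < n" "n < N" for m n using that by (auto simp: B_def)
  show "B m \<inter> B n = {}" using *[of m n] *[of n m] mn by (auto simp: neq_iff)
 qed
 let ?M = "\<lambda>i. patch_measure (k i) (U i) (u i)"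
 define \<sigma> where "\<sigma> = measure_of UNIV (sets borel) (\<lambda>A. \<Sum>i<N. emeasure (?M i) (A \<inter> B i))"
 have \<sigma>: "emeasure \<sigma> A = (\<Sum>i<N. emeasure (?M i) (A \<inter> B i))" if "A \<in> sets borel" for A
 proof (rule emeasure_measure_of[OF \<sigma>_def])
  show "positive (sets \<sigma>) (\<lambda>A. \<Sum>i<N. emeasure (?M i) (A \<inter> B i))" by (simp add: positive_def)
  show "countably_additive (sets \<sigma>) (\<lambda>A. \<Sum>i<N. emeasure (?M i) (A \<inter> B i))"
  proof (rule countably_additiveI)
   fix A :: "nat => _" assume A: "range A \<subseteq> sets \<sigma>" "disjoint_family A"
   have sA: "A n \<in> sets borel" for n using A(1) by (auto simp: \<sigma>_def sets.sigma_sets_eq[of borel, simplified])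
   have "(suminf (\<lambda>n. \<Sum>i<N. emeasure (?M i) (A n \<inter> B i))) = (\<Sum>i<N. (suminf (\<lambda>n. emeasure (?M i) (A n \<inter> B i))))"
    by (rule suminf_sum) simp
   also have "... = (\<Sum>i<N. emeasure (?M i) (\<Union>(range A) \<inter> B i))"
   proof (intro sum.cong refl)
    fix i
    have "(suminf (\<lambda>n. emeasure (?M i) (A n \<inter> B i))) = emeasure (?M i) (\<Union>n. A n \<inter> B i)"
     using A(2) sA Bm by (intro suminf_emeasure) (auto simp: disjoint_family_on_def)
    also have "(\<Union>n. A n \<inter> B i) = \<Union>(range A) \<inter> B i" by blast
    finally show "(suminf (\<lambda>n. emeasure (?M i) (A n \<inter> B i))) = emeasure (?M i) (\<Union>(range A) \<inter> B i)" .
   qed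
   finally show "(suminf (\<lambda>n. \<Sum>i<N. emeasure (?M i) (A n \<inter> B i))) = (\<Sum>i<N. emeasure (?M i) (\<Union>(range A) \<inter> B i))" .
  qed
 qed (use that sets.space_closed[of "borel :: (real^'a) measure"] in \<open>auto simp: \<sigma>_def sets.sigma_sets_eq[of borel, simplified]\<close>)
 have s\<sigma>: "sets \<sigma> = sets borel" by (simp add: \<sigma>_def sets.sigma_sets_eq[of borel, simplified])
 have "is_area_measure X \<sigma>"
  unfolding is_area_measure_def
 proof (intro conjI allI impI ballI)
  have "(- X) \<inter> B i = {}" for i by (auto simp: B_def)
  thus "emeasure \<sigma> (- X) = 0" using \<sigma>[of "- X"] by auto
  fix l V v A
  assume "graph_patch l V v \<and> (\<lambda>x. set_coord l (v x) x) ` V \<subseteq> X"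
   and A [measurable]: "A \<in> sets borel" and "A \<subseteq> (\<lambda>x. set_coord l (v x) x) ` V"
  hence v: "graph_patch l V v" "patch_image l V v \<subseteq> X" "A \<subseteq> patch_image l V v"
   by (auto simp: patch_image_def)
  have "emeasure \<sigma> A = (\<Sum>i<N. emeasure (?M i) (A \<inter> B i))" by (rule \<sigma>) fact
  also have "... = (\<Sum>i<N. emeasure (patch_measure l V v) (A \<inter> B i))"
  proof (rule sum.cong[OF refl])
   fix i assume "i \<in> {..<N}"
   hence i: "i < N" by simp
   have AB: "A \<inter> B i \<in> sets borel" using A Bm by auto
   have "patch_area l V v (A \<inter> B i) = patch_area (k i) (U i) (u i) (A \<inter> B i)"
   proof (rule patch_area_overlap[OF c(3)[OF i] v(1) c(2)[OF i] _ AB])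
    show "W i \<inter> patch_image l V v \<subseteq> patch_image (k i) (U i) (u i)" using c(5)[OF i] v(2) by blast
   qed (use v i in \<open>auto simp: B_def\<close>)
   thus "emeasure (?M i) (A \<inter> B i) = emeasure (patch_measure l V v) (A \<inter> B i)"
    by (simp add: emeasure_patch_measure[OF c(3)[OF i] AB] emeasure_patch_measure[OF v(1) AB])
  qed
  also have "... = emeasure (patch_measure l V v) (\<Union>i<N. A \<inter> B i)"
   using Bm dis by (intro sum_emeasure) (auto simp: disjoint_family_on_def)
  also have "(\<Union>i<N. A \<inter> B i) = A" using v BX by blast
  also have "emeasure (patch_measure l V v) A = patch_area l V v A"
   by (rule emeasure_patch_measure[OF v(1) A])
  finally show "emeasure \<sigma> A = (\<integral>\<^sup>+x. ennreal (indicator {x \<in> V. 0 \<le> x $ l \<and> x $ l \<le> 1 \<and> set_coord l (v x) x \<in> A} x *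
   sqrt (1 + (\<Sum>j. (pd j v x)\<^sup>2))) \<partial>lborel)" by (simp add: patch_area_def)
 qed (rule s\<sigma>)
 thus ?thesis by blast
qed

text \<open>Two area measures agree on the subsets of each patch of a cover and vanish off \<open>X\<close>.\<close>

lemma area_measure_unique:
 assumes X: "compact X" "C1_hypersurface X" and s: "is_area_measure X \<sigma>" "is_area_measure X \<tau>"
 shows "\<sigma> = \<tau>"
proof -
 obtain N W k U u where "is_patch_cover X N W k U u" using finite_patch_cover[OF X] by blast
 hence c: "X \<subseteq> (\<Union>i<N. W i)"
  "\<And>i. i < N ==> open (W i)" "\<And>i. i < N ==> graph_patch (k i) (U i) (u i)"
  "\<And>i. i < N ==> patch_image (k i) (U i) (u i) \<subseteq> X"
  "\<And>i. i < N ==> X \<inter> W i \<subseteq> patch_image (k i) (U i) (u i)"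
  by (simp_all add: is_patch_cover_def)
 have Xm: "- X \<in> sets borel" by (rule borel_comp[OF borel_closed[OF compact_imp_closed[OF X(1)]]])
 have ss: "sets \<sigma> = sets borel" "sets \<tau> = sets borel" using s by (auto simp: is_area_measure_def)
 define B where "B i = (if i < N then patch_image (k i) (U i) (u i) else - X)" for i
 show ?thesis
 proof (rule measure_eqI)
  fix A assume A: "A \<in> sets \<sigma>"
  show "emeasure \<sigma> A = emeasure \<tau> A"
  proof (rule emeasure_eq_on_countable_cover[where B = B, OF _ _ A])
   show "B i \<in> sets \<sigma>" for i using Xm patch_image_borel[OF c(3)] by (auto simp: B_def ss)
   show "A \<subseteq> (\<Union>i. B i)"
   proof
    fix x
    show "x \<in> (\<Union>i. B i)"
    proof (cases "x \<in> X")
     case True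
     then obtain i where "i < N" "x \<in> W i" using c(1) by blast
     hence "x \<in> B i" using c(5)[of i] True by (auto simp: B_def)
     thus ?thesis by blast
    next
     case False
     hence "x \<in> B N" by (simp add: B_def)
     thus ?thesis by blast
    qed
   qed
   fix i A' assume A': "A' \<in> sets \<sigma>" "A' \<subseteq> A \<inter> B i"
   show "emeasure \<sigma> A' = emeasure \<tau> A'"
   proof (cases "i < N")
    case True
    thus ?thesis
     using is_area_measure_patch[OF s(1) c(3)[OF True] c(4)[OF True], of A']
      is_area_measure_patch[OF s(2) c(3)[OF True] c(4)[OF True], of A'] A' by (auto simp: B_def ss)
   next
    case False
    hence "A' \<subseteq> - X" using A' by (auto simp: B_def)
    hence "emeasure \<sigma> A' \<le> 0" "emeasure \<tau> A' \<le> 0"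
     using emeasure_mono[of A' "- X" \<sigma>] emeasure_mono[of A' "- X" \<tau>] s Xm ss by (auto simp: is_area_measure_def)
    thus ?thesis by simp
   qed
  qed (use ss in auto)
 qed (use ss in auto)
qed

lemma is_area_measure_area_measure:
 assumes "compact X" "C1_hypersurface X"
 shows "is_area_measure X (area_measure X)"
 unfolding area_measure_def
 using area_measure_exists[OF assms] area_measure_unique[OF assms] by (metis theI')

text \<open>Restricted to the patch, the area measure is the image of a measure with a density on the slab.\<close>

lemma area_integral_patch:
 fixes g :: "real^'n => real"
 assumes \<sigma>: "is_area_measure X \<sigma>" and gp: "graph_patch k U u" and sub: "patch_image k U u \<subseteq> X"
  and g: "(\<lambda>x. indicator (patch_image k U u) x * g x) \<in> borel_measurable borel"
  and zero: "\<And>x. x \<in> X ==> x \<notin> patch_image k U u ==> g x = 0"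
 shows "set_integrable \<sigma> X g \<longleftrightarrow>
   integrable lborel (\<lambda>y. indicator (U \<inter> slab k) y * (area_factor u y * g (set_coord k (u y) y)))" (is ?I)
  and "(LINT x:X|\<sigma>. g x) = (LINT y|lborel. indicator (U \<inter> slab k) y * (area_factor u y * g (set_coord k (u y) y)))" (is ?E)
proof -
 let ?Z = "patch_image k U u" and ?f = "\<lambda>x. set_coord k (indicator U x * u x) x"
 let ?D = "density lborel (\<lambda>x. ennreal (indicator (U \<inter> slab k) x * area_factor u x))"
 note [measurable] = graph_patch_measurable[OF gp] patch_image_borel[OF gp] g
 have s: "sets \<sigma> = sets borel" using \<sigma> by (simp add: is_area_measure_def)
 have sp: "space \<sigma> = UNIV" using sets_eq_imp_space_eq[OF s] by simp
 have eq: "density \<sigma> (indicator ?Z) = patch_measure k U u"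
 proof (rule measure_eqI)
  fix A assume "A \<in> sets (density \<sigma> (indicator ?Z))"
  hence A [measurable]: "A \<in> sets borel" by (simp add: s)
  have "emeasure (density \<sigma> (indicator ?Z)) A = emeasure \<sigma> (?Z \<inter> A)"
   using A patch_image_borel[OF gp] s by (subst emeasure_density) (auto simp: indicator_inter_arith[symmetric])
  also have "... = patch_area k U u (?Z \<inter> A)"
   by (rule is_area_measure_patch[OF \<sigma> gp sub]) auto
  also have "... = patch_area k U u A"
   unfolding patch_area_def by (rule nn_integral_cong) (auto simp: indicator_def patch_image_def)
  also have "... = emeasure (patch_measure k U u) A" by (rule emeasure_patch_measure[OF gp A, symmetric])
  finally show "emeasure (density \<sigma> (indicator ?Z)) A = emeasure (patch_measure k U u) A" .
 qed (simp add: s)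
 define g' where "g' x = indicator ?Z x * g x" for x
 have [measurable]: "g' \<in> borel_measurable borel" using g by (simp add: g'_def[abs_def])
 have g'\<sigma>: "g' \<in> borel_measurable \<sigma>" using measurable_cong_sets[OF s refl] \<open>g' \<in> borel_measurable borel\<close> by blast
 have ind: "(\<lambda>x. indicator X x *\<^sub>R g x) = (\<lambda>x. indicator ?Z x *\<^sub>R g' x)"
  using zero sub by (auto simp: fun_eq_iff indicator_def g'_def)
 have Im: "indicator ?Z \<in> borel_measurable \<sigma>" using patch_image_borel[OF gp] s by auto
 have e: "(\<lambda>y. (indicator (U \<inter> slab k) y * area_factor u y) *\<^sub>R g' (?f y)) =
   (\<lambda>y. indicator (U \<inter> slab k) y * (area_factor u y * g (set_coord k (u y) y)))"
  by (auto simp: fun_eq_iff indicator_def g'_def patch_image_def)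
 have nn: "AE y in lborel. 0 \<le> indicator (U \<inter> slab k) y * area_factor u y"
  by (auto intro!: AE_I2 simp: area_factor_pos[THEN less_imp_le] indicator_def)
 have "set_integrable \<sigma> X g \<longleftrightarrow> integrable (density \<sigma> (\<lambda>x. ennreal (indicator ?Z x))) g'"
  unfolding set_integrable_def ind using g'\<sigma> Im by (subst integrable_density) auto
 also have "... \<longleftrightarrow> integrable (distr ?D borel ?f) g'" by (simp add: eq ennreal_indicator patch_measure_def)
 also have "... \<longleftrightarrow> integrable ?D (\<lambda>y. g' (?f y))" by (rule integrable_distr_eq) simp_all
 also have "... \<longleftrightarrow> integrable lborel (\<lambda>y. (indicator (U \<inter> slab k) y * area_factor u y) *\<^sub>R g' (?f y))"
  by (rule integrable_density) (use nn in simp_all)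
 finally show ?I unfolding e .
 have "(LINT x:X|\<sigma>. g x) = integral\<^sup>L (density \<sigma> (\<lambda>x. ennreal (indicator ?Z x))) g'"
  unfolding set_lebesgue_integral_def ind using g'\<sigma> Im by (subst integral_density) auto
 also have "... = integral\<^sup>L (distr ?D borel ?f) g'" by (simp add: eq ennreal_indicator patch_measure_def)
 also have "... = (LINT y|?D. g' (?f y))" by (rule integral_distr) simp_all
 also have "... = (LINT y|lborel. (indicator (U \<inter> slab k) y * area_factor u y) *\<^sub>R g' (?f y))"
  by (rule integral_density) (use nn in simp_all)
 finally show ?E unfolding e .
qed

section \<open>Spheres\<close>

text \<open>For \<open>s = \<plusminus>1\<close> the graph of this function over its shadow is an open hemisphere.\<close>

definition sphere_height :: "real => 'n::finite => real => real^'n => real" where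
 "sphere_height r k s x = s * sqrt (r\<^sup>2 - (\<Sum>j\<in>UNIV - {k}. (x $ j)\<^sup>2))"

definition sphere_shadow :: "real => 'n::finite => (real^'n) set" where
 "sphere_shadow r k = {x. (\<Sum>j\<in>UNIV - {k}. (x $ j)\<^sup>2) < r\<^sup>2}"

lemma open_sphere_shadow: "open (sphere_shadow r k)"
 unfolding sphere_shadow_def by (intro open_Collect_less continuous_intros)

lemma sphere_height_C1:
 "C1_on (sphere_shadow r k) (sphere_height r k s)"
 unfolding sphere_height_def
 by (intro C1_on_mult C1_on_const C1_on_sqrt C1_on_diff C1_on_sum C1_on_power C1_on_nth open_sphere_shadow)
  (auto simp: sphere_shadow_def)

lemma sphere_height_sq:
 "x \<in> sphere_shadow r k ==> s\<^sup>2 = 1 ==> (sphere_height r k s x)\<^sup>2 = r\<^sup>2 - (\<Sum>j\<in>UNIV - {k}. (x $ j)\<^sup>2)"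
 by (simp add: sphere_height_def power_mult_distrib sphere_shadow_def less_imp_le)

lemma sphere_height_sgn:
 "x \<in> sphere_shadow r k ==> s\<^sup>2 = 1 ==> s * sphere_height r k s x > 0"
 by (simp add: sphere_height_def power2_eq_square[symmetric] mult.assoc[symmetric] sphere_shadow_def)

lemma sphere_height_pd:
 assumes x: "x \<in> sphere_shadow r k" and s: "s\<^sup>2 = 1"
 shows "pd j (sphere_height r k s) x = (if j = k then 0 else - x $ j / sphere_height r k s x)"
proof -
 have pos: "r\<^sup>2 - (\<Sum>j\<in>UNIV - {k}. (x $ j)\<^sup>2) > 0" using x by (simp add: sphere_shadow_def)
 let ?q = "\<lambda>x. r\<^sup>2 - (\<Sum>j\<in>UNIV - {k}. (x $ j)\<^sup>2)"
 have d: "((\<lambda>x. (x $ i)\<^sup>2) has_derivative (\<lambda>v. 2 * x $ i * v $ i)) (at x)" for i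
  using has_derivative_mult[OF has_derivative_nth has_derivative_nth, of i i x] by (simp add: power2_eq_square algebra_simps)
 have "(?q has_derivative (\<lambda>v. 0 - (\<Sum>i\<in>UNIV - {k}. 2 * x $ i * v $ i))) (at x)"
  by (intro has_derivative_diff has_derivative_const has_derivative_sum d)
 hence q: "?q differentiable (at x)" "pd j ?q x = - (\<Sum>i\<in>UNIV - {k}. 2 * x $ i * axis j 1 $ i)"
  using pd_eqI[of ?q _ x j] by (auto simp: differentiable_def)
 have "(\<Sum>i\<in>UNIV - {k}. 2 * x $ i * axis j 1 $ i) = (\<Sum>i\<in>UNIV - {k}. if i = j then 2 * x $ j else 0)"
  by (intro sum.cong) (auto simp: axis_def)
 also have "... = (if j = k then 0 else 2 * x $ j)" by (simp add: sum.delta)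
 finally have q2: "pd j ?q x = - (if j = k then 0 else 2 * x $ j)" using q(2) by simp
 have "((\<lambda>y. s * sqrt y) has_real_derivative s * (inverse (sqrt (?q x)) / 2)) (at (?q x))"
  using pos by (intro DERIV_cmult DERIV_real_sqrt)
 from pd_comp_real[OF q(1) this, of j]
 have "pd j (sphere_height r k s) x = s * (inverse (sqrt (?q x)) / 2) * pd j ?q x"
  by (simp add: sphere_height_def[abs_def])
 moreover have "s = 1 \<or> s = -1" using s by (simp add: power2_eq_1_iff)
 moreover have "pd j ?q x = - 2 * (if j = k then 0 else x $ j)" using q2 by simp
 ultimately show ?thesis using pos by (auto simp: sphere_height_def field_simps)
qed

lemma sphere_height_indep: "sphere_height r k s (set_coord k t x) = sphere_height r k s x"
 and sphere_shadow_indep: "set_coord k t x \<in> sphere_shadow r k \<longleftrightarrow> x \<in> sphere_shadow r k"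
 by (auto simp: sphere_height_def sphere_shadow_def)

lemma sphere_patch: "graph_patch k (sphere_shadow r k) (sphere_height r k s)"
 unfolding graph_patch_def by (auto simp: sphere_height_indep sphere_shadow_indep sphere_height_C1)

lemma norm_sq_split: "(norm x)\<^sup>2 = (x $ k)\<^sup>2 + (\<Sum>j\<in>UNIV - {k}. (x $ j)\<^sup>2)"
 for x :: "real^'n"
proof -
 have "(norm x)\<^sup>2 = (\<Sum>j. (x $ j)\<^sup>2)" unfolding power2_norm_eq_inner by (simp add: inner_vec_def power2_eq_square)
 thus ?thesis by (subst (asm) sum.remove[of _ k]) auto
qed

lemma sphere_patch_image:
 assumes s: "s\<^sup>2 = (1::real)" and r: "r > 0"
 shows "patch_image k (sphere_shadow r k) (sphere_height r k s) = {x \<in> sphere 0 r. s * x $ k > 0}"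
proof (intro set_eqI iffI)
 fix x assume "x \<in> patch_image k (sphere_shadow r k) (sphere_height r k s)"
 hence x: "x \<in> sphere_shadow r k" "x $ k = sphere_height r k s x" by (auto simp: patch_image_iff[OF sphere_patch])
 hence "(norm x)\<^sup>2 = r\<^sup>2" using norm_sq_split[of x k] sphere_height_sq[OF x(1) s] by simp
 hence "norm x = r" using r by (simp add: power2_eq_iff_nonneg)
 thus "x \<in> {x \<in> sphere 0 r. s * x $ k > 0}" using sphere_height_sgn[OF x(1) s] x(2) by simp
next
 fix x assume x: "x \<in> {x \<in> sphere 0 r. s * x $ k > 0}"
 hence n: "(norm x)\<^sup>2 = r\<^sup>2" "x $ k \<noteq> 0" by auto
 hence sh: "x \<in> sphere_shadow r k" using norm_sq_split[of x k] by (simp add: sphere_shadow_def) (smt (verit) zero_less_power2)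
 have "(x $ k)\<^sup>2 = (sphere_height r k s x)\<^sup>2" using norm_sq_split[of x k] n sphere_height_sq[OF sh s] by simp
 hence "x $ k = sphere_height r k s x \<or> x $ k = - sphere_height r k s x" by (simp add: power2_eq_iff)
 hence "x $ k = sphere_height r k s x" using sphere_height_sgn[OF sh s] x by auto
 thus "x \<in> patch_image k (sphere_shadow r k) (sphere_height r k s)" using sh by (auto simp: patch_image_iff[OF sphere_patch])
qed

lemma C1_hypersurface_sphere:
 assumes r: "r > 0"
 shows "C1_hypersurface (sphere (0 :: real^'n) r)"
 unfolding C1_hypersurface_def
proof
 fix p :: "real^'n" assume p: "p \<in> sphere 0 r"
 hence "p \<noteq> 0" using r by auto
 then obtain k where k: "p $ k \<noteq> 0" by (metis vec_eq_iff zero_index)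
 define s where "s = sgn (p $ k)"
 have s: "s\<^sup>2 = 1" "s * p $ k > 0" using k by (auto simp: s_def sgn_real_def)
 let ?W = "{x :: real^'n. s * x $ k > 0}"
 have "open ?W" by (intro open_Collect_less continuous_intros)
 thus "\<exists>W k U u. open W \<and> p \<in> W \<and> graph_patch k U u \<and>
   patch_image k U u \<subseteq> sphere 0 r \<and> sphere 0 r \<inter> W \<subseteq> patch_image k U u"
 proof (intro exI conjI)
  show "p \<in> ?W" using s by simp
  show "patch_image k (sphere_shadow r k) (sphere_height r k s) \<subseteq> sphere 0 r"
   "sphere 0 r \<inter> ?W \<subseteq> patch_image k (sphere_shadow r k) (sphere_height r k s)"
   unfolding sphere_patch_image[OF s(1) r] by blast+
 qed (auto intro: sphere_patch)
qed

lemma is_area_measure_sphere: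
 "r > 0 ==> is_area_measure (sphere (0 :: real^'n) r) (area_measure (sphere 0 r))"
 by (intro is_area_measure_area_measure C1_hypersurface_sphere) auto

lemma sphere_area_factor:
 assumes x: "x \<in> sphere_shadow r k" and s: "s\<^sup>2 = 1" and r: "r > 0"
 shows "area_factor (sphere_height r k s) x = r / \<bar>sphere_height r k s x\<bar>"
proof -
 let ?h = "sphere_height r k s x"
 have h: "?h \<noteq> 0" using sphere_height_sgn[OF x s] by auto
 have "(\<Sum>j. (pd j (sphere_height r k s) x)\<^sup>2) = (\<Sum>j\<in>UNIV - {k}. (x $ j)\<^sup>2) / ?h\<^sup>2"
  unfolding sphere_height_pd[OF x s]
  by (subst sum.remove[of _ k]) (auto simp: power_divide sum_divide_distrib intro!: sum.cong)
 also have "... = (r\<^sup>2 - ?h\<^sup>2) / ?h\<^sup>2" by (simp add: sphere_height_sq[OF x s])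
 finally have "area_factor (sphere_height r k s) x = sqrt ((r / \<bar>?h\<bar>)\<^sup>2)"
  unfolding area_factor_def using h by (simp add: field_simps)
 thus ?thesis using r by simp
qed

section \<open>Cut-off functions and localization\<close>

text \<open>A \<open>C\<^sup>1\<close> function that vanishes on a half-line, the building block of cut-offs.\<close>

definition pos_sq :: "real => real" where
 "pos_sq t = (max 0 t)\<^sup>2"

lemma DERIV_pos_sq: "(pos_sq has_real_derivative 2 * max 0 t) (at t)"
proof -
 consider "t > 0" | "t < 0" | "t = 0" by linarith
 thus ?thesis
 proof cases
  case 1
  have "((\<lambda>t. t\<^sup>2) has_real_derivative 2 * t) (at t)" by (auto intro!: derivative_eq_intros)
  hence "(pos_sq has_real_derivative 2 * t) (at t)"
   by (rule has_field_derivative_transform_within_open[where S = "{0<..}"]) (use 1 in \<open>auto simp: pos_sq_def\<close>)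
  thus ?thesis using 1 by simp
 next
  case 2
  have "((\<lambda>t. 0) has_real_derivative 0) (at t)" by simp
  hence "(pos_sq has_real_derivative 0) (at t)"
   by (rule has_field_derivative_transform_within_open[where S = "{..<0}"]) (use 2 in \<open>auto simp: pos_sq_def\<close>)
  thus ?thesis using 2 by simp
 next
  case 3
  have "((\<lambda>h. (pos_sq (0 + h) - pos_sq 0) / h) \<longlongrightarrow> 0) (at 0)"
  proof (rule Lim_null_comparison)
   show "\<forall>\<^sub>F h in at 0. norm ((pos_sq (0 + h) - pos_sq 0) / h) \<le> \<bar>h\<bar>"
    by (auto simp: eventually_at pos_sq_def max_def power2_eq_square abs_mult intro!: exI[of _ 1])
   show "((\<lambda>h::real. \<bar>h\<bar>) \<longlongrightarrow> 0) (at 0)" by (auto intro!: tendsto_eq_intros)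
  qed
  thus ?thesis using 3 by (simp add: DERIV_def)
 qed
qed

lemma continuous_on_pos_sq: "continuous_on S pos_sq"
 unfolding pos_sq_def by (intro continuous_intros)

text \<open>A \<open>C\<^sup>1\<close> transition from \<open>1\<close> (for \<open>t \<le> 0\<close>) to \<open>0\<close> (for \<open>t \<ge> 1\<close>).\<close>

definition ramp :: "real => real" where
 "ramp t = pos_sq (1 - pos_sq t)"

definition ramp' :: "real => real" where
 "ramp' t = - (4 * max 0 (1 - pos_sq t) * max 0 t)"

lemma DERIV_ramp: "(ramp has_real_derivative ramp' t) (at t)"
proof -
 have "((\<lambda>t. pos_sq (1 - pos_sq t)) has_real_derivative 2 * max 0 (1 - pos_sq t) * (0 - 2 * max 0 t)) (at t)"
  by (intro DERIV_chain2[OF DERIV_pos_sq] DERIV_diff DERIV_const DERIV_pos_sq)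
 thus ?thesis by (simp add: ramp_def[abs_def] ramp'_def mult.assoc)
qed

lemma continuous_on_ramp': "continuous_on S ramp'"
 unfolding ramp'_def by (intro continuous_intros continuous_on_pos_sq)

lemma ramp_eq: "t \<le> 0 ==> ramp t = 1" "t \<ge> 1 ==> ramp t = 0"
proof -
 show "ramp t = 1" if "t \<le> 0" using that by (simp add: ramp_def pos_sq_def)
 show "ramp t = 0" if "t \<ge> 1"
 proof -
  have "1 \<le> t\<^sup>2" using that by simp
  thus ?thesis using that by (simp add: ramp_def pos_sq_def)
 qed
qed

lemma ramp_bounds: "0 \<le> ramp t" "ramp t \<le> 1"
proof -
 show "0 \<le> ramp t" by (simp add: ramp_def pos_sq_def)
 have "max 0 (1 - pos_sq t) \<le> 1" by (simp add: pos_sq_def)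
 hence "(max 0 (1 - pos_sq t))\<^sup>2 \<le> 1" by (intro power_le_one) auto
 thus "ramp t \<le> 1" by (simp add: ramp_def pos_sq_def)
qed

lemma ramp'_eq: "t \<notin> {0..1} ==> ramp' t = 0"
proof -
 assume "t \<notin> {0..1}"
 then consider "t < 0" | "t > 1" by fastforce
 thus "ramp' t = 0"
 proof cases
  case 2
  hence "1 \<le> t\<^sup>2" by simp
  thus ?thesis using 2 by (simp add: ramp'_def pos_sq_def)
 qed (simp add: ramp'_def)
qed

lemma C1_on_ramp:
 fixes h :: "real^'n => real"
 assumes "C1_on U h"
 shows "C1_on U (\<lambda>x. ramp (h x))"
 using DERIV_ramp continuous_on_compose2[OF continuous_on_ramp'[of UNIV] C1_on_continuous[OF assms]]
 by (intro C1_on_comp_real[OF assms]) auto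

text \<open>The argument of \<open>ramp\<close> is \<open>0\<close> at distance \<open>r / 2\<close> from \<open>x0\<close> and \<open>1\<close> at distance \<open>r\<close>.\<close>

definition bump :: "real^'n => real => real^'n => real" where
 "bump x0 r x = ramp ((4 * (\<Sum>i. (x $ i - x0 $ i)\<^sup>2) / r\<^sup>2 - 1) / 3)"

lemma C1_on_bump: "C1_on UNIV (bump x0 r)"
 unfolding bump_def divide_inverse
 by (intro C1_on_ramp C1_on_mult C1_on_diff C1_on_const C1_on_sum C1_on_power C1_on_nth) auto

lemma dist_sq_vec: "(dist x y)\<^sup>2 = (\<Sum>i. (x $ i - y $ i)\<^sup>2)" for x y :: "real^'n"
 unfolding dist_norm power2_norm_eq_inner by (simp add: inner_vec_def power2_eq_square)

lemma bump_eq_1: "x \<in> cball x0 (r / 2) ==> r > 0 ==> bump x0 r x = 1"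
proof -
 assume "x \<in> cball x0 (r / 2)" "r > 0"
 hence "(dist x x0)\<^sup>2 \<le> (r / 2)\<^sup>2" by (simp add: dist_commute power_mono)
 thus "bump x0 r x = 1" using \<open>r > 0\<close>
  unfolding bump_def dist_sq_vec[symmetric] by (intro ramp_eq) (simp add: field_simps)
qed

lemma bump_eq_0: "x \<notin> ball x0 r ==> r > 0 ==> bump x0 r x = 0"
proof -
 assume "x \<notin> ball x0 r" "r > 0"
 hence "(dist x x0)\<^sup>2 \<ge> r\<^sup>2" by (simp add: dist_commute power_mono)
 thus "bump x0 r x = 0" using \<open>r > 0\<close>
  unfolding bump_def dist_sq_vec[symmetric] by (intro ramp_eq) (simp add: field_simps)
qed

text \<open>Localization: \<open>\<phi> = \<phi> (1 - \<Prod> (1 - \<eta>\<^sub>i))\<close> once every point of \<open>K\<close> has some \<open>\<eta>\<^sub>i = 1\<close>, and this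
 product telescopes into functions that are supported where a single \<open>\<eta>\<^sub>i\<close> is.\<close>

lemma C1_local_to_global:
 fixes \<phi> :: "real^'n => real"
 assumes K: "compact K" and \<phi>: "C1_on UNIV \<phi>" "\<And>x. x \<notin> K ==> \<phi> x = 0"
  and zero: "P (\<lambda>x. 0)"
  and add: "\<And>\<phi> \<psi>. C1_on UNIV \<phi> ==> C1_on UNIV \<psi> ==> P \<phi> ==> P \<psi> ==> P (\<lambda>x. \<phi> x + \<psi> x)"
  and loc: "\<And>x. x \<in> K ==> \<exists>r>0. \<forall>\<phi>. C1_on UNIV \<phi> --> (\<forall>y. y \<notin> K \<inter> cball x r --> \<phi> y = 0) --> P \<phi>"
 shows "P \<phi>"
proof -
 obtain r where r: "\<And>x. x \<in> K ==> r x > 0"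
  "\<And>x \<phi>. x \<in> K ==> C1_on UNIV \<phi> ==> (\<And>y. y \<notin> K \<inter> cball x (r x) ==> \<phi> y = 0) ==> P \<phi>"
  using loc by metis
 have "K \<subseteq> (\<Union>x\<in>K. ball x (r x / 2))" using r(1) by force
 then obtain F where F: "F \<subseteq> K" "finite F" "K \<subseteq> (\<Union>x\<in>F. ball x (r x / 2))"
  using compactE_image[OF K, of K "\<lambda>x. ball x (r x / 2)"] by auto
 define G where "G F y = (\<Prod>x\<in>F. 1 - bump x (r x) y)" for F y
 have GC1: "C1_on UNIV (G F)" for F
  unfolding G_def by (intro C1_on_prod C1_on_diff C1_on_const C1_on_bump) auto
 have "F \<subseteq> K ==> P (\<lambda>y. \<phi> y * (1 - G F y))"
  using F(2)
 proof (induction F)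
  case empty
  thus ?case using zero by (simp add: G_def)
 next
  case (insert x F)
  have "P (\<lambda>y. \<phi> y * (1 - G F y) + \<phi> y * (bump x (r x) y * G F y))"
  proof (rule add)
   show "P (\<lambda>y. \<phi> y * (1 - G F y))" using insert by simp
   show C: "C1_on UNIV (\<lambda>y. \<phi> y * (bump x (r x) y * G F y))" by (intro C1_on_mult \<phi> C1_on_bump GC1)
   show "C1_on UNIV (\<lambda>y. \<phi> y * (1 - G F y))" by (intro C1_on_mult C1_on_diff C1_on_const \<phi> GC1) auto
   show "P (\<lambda>y. \<phi> y * (bump x (r x) y * G F y))"
   proof (rule r(2)[OF _ C])
    fix y assume "y \<notin> K \<inter> cball x (r x)"
    thus "\<phi> y * (bump x (r x) y * G F y) = 0"
     using \<phi>(2)[of y] bump_eq_0[of y x "r x"] r(1)[of x] insert by (cases "y \<in> K") auto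
   qed (use insert in auto)
  qed
  moreover have "(\<lambda>y. \<phi> y * (1 - G (insert x F) y)) = (\<lambda>y. \<phi> y * (1 - G F y) + \<phi> y * (bump x (r x) y * G F y))"
   using insert by (simp add: G_def algebra_simps)
  ultimately show ?case by simp
 qed
 moreover have "\<phi> y * (1 - G F y) = \<phi> y" for y
 proof (cases "y \<in> K")
  case True
  then obtain x where x: "x \<in> F" "y \<in> ball x (r x / 2)" using F(3) by blast
  hence "bump x (r x) y = 1" using r(1) F(1) by (intro bump_eq_1) auto
  hence "G F y = 0" unfolding G_def using x(1) by (intro prod_zero[OF F(2)] bexI[of _ x]) simp_all
  thus ?thesis by simp
 qed (simp add: \<phi>(2))
 ultimately show ?thesis using F(1) by simp
qed

lemma C1_cutoff:
 fixes K :: "(real^'n) set"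
 assumes K: "compact K" and D: "open D" "K \<subseteq> D"
 obtains \<eta> :: "real^'n => real" and N L where "C1_on UNIV \<eta>" "open N" "K \<subseteq> N" "\<And>x. x \<in> N ==> \<eta> x = 1"
  "compact L" "L \<subseteq> D" "\<And>x. x \<notin> L ==> \<eta> x = 0"
proof -
 obtain r where r: "\<And>x. x \<in> K ==> r x > 0" "\<And>x. x \<in> K ==> cball x (r x) \<subseteq> D"
  using D open_contains_cball by (metis subsetD)
 have "K \<subseteq> (\<Union>x\<in>K. ball x (r x / 2))" using r(1) by force
 then obtain F where F: "F \<subseteq> K" "finite F" "K \<subseteq> (\<Union>x\<in>F. ball x (r x / 2))"
  using compactE_image[OF K, of K "\<lambda>x. ball x (r x / 2)"] by auto
 show thesis
 proof (rule that)
  show "C1_on UNIV (\<lambda>y. 1 - (\<Prod>x\<in>F. 1 - bump x (r x) y))"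
   by (intro C1_on_prod C1_on_diff C1_on_const C1_on_bump) auto
  show "open (\<Union>x\<in>F. ball x (r x / 2))" by blast
  show "compact (\<Union>x\<in>F. cball x (r x))" using F(2) by (intro compact_UN) auto
  show "(\<Union>x\<in>F. cball x (r x)) \<subseteq> D" using r(2) F(1) by blast
  fix y
  show "1 - (\<Prod>x\<in>F. 1 - bump x (r x) y) = 1" if "y \<in> (\<Union>x\<in>F. ball x (r x / 2))"
   using that bump_eq_1[of y _ "r _"] r(1) F(1) by (auto intro!: prod_zero[OF F(2)] bexI simp: less_imp_le subset_iff)
  show "1 - (\<Prod>x\<in>F. 1 - bump x (r x) y) = 0" if "y \<notin> (\<Union>x\<in>F. cball x (r x))"
   using that bump_eq_0[of y _ "r _"] r(1) F(1) by (auto intro!: prod.neutral simp: subset_iff less_imp_le)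
 qed (rule F(3))
qed

lemma C1_on_zero_extension:
 fixes h :: "real^'n => real"
 assumes "C1_on D h" "closed K" "K \<subseteq> D" "\<And>x. x \<notin> K ==> h x = 0"
 shows "C1_on UNIV h"
proof (rule C1_on_locally)
 fix x :: "real^'n"
 have "C1_on (- K) h"
  using assms(2,4) by (subst C1_on_cong[where k = "\<lambda>x. 0"]) (auto intro: C1_on_const)
 thus "\<exists>V. x \<in> V \<and> C1_on V h"
  using assms(1,3) by (cases "x \<in> D") blast+
qed auto

lemma pd_zero_outside:
 assumes "closed K" "\<And>x. x \<notin> K ==> h x = 0" "x \<notin> K"
 shows "pd i h x = 0"
proof -
 have "pd i h x = pd i (\<lambda>x. 0) x"
  by (rule pd_cong[where U = "- K"]) (use assms in auto)
 thus ?thesis by simp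
qed

lemma integrable_compact_support:
 fixes g :: "real^'n => real"
 assumes "compact K" "continuous_on K g" "\<And>x. x \<notin> K ==> g x = 0"
 shows "integrable lborel g"
proof -
 have "g = (\<lambda>x. indicator K x *\<^sub>R g x)" using assms(3) by (auto simp: fun_eq_iff indicator_def)
 thus ?thesis using borel_integrable_compact[OF assms(1,2)] by simp
qed

section \<open>Weak divergence of antisymmetric fields\<close>

lemma integral_lborel_shift:
 fixes g :: "real^'n => real"
 assumes "g \<in> borel_measurable borel"
 shows "(LINT x|lborel. g (x + c)) = (LINT x|lborel. g x)"
proof -
 have "(LINT x|lborel. g x) = (LINT x|distr lborel borel ((+) c). g x)" by (simp add: lborel_distr_plus)
 also have "... = (LINT x|lborel. g (c + x))" using assms by (intro integral_distr) auto
 finally show ?thesis by (simp add: add.commute)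
qed

definition diff_quot :: "real => 'n::finite => (real^'n => real) => real^'n => real" where
 "diff_quot h i a x = (a (x + h *\<^sub>R axis i 1) - a x) / h"

context
 fixes a :: "real^'n => real" and K
 assumes a: "C1_on UNIV a" "compact K" "\<And>x. x \<notin> K ==> a x = 0"
begin

lemma diff_quot_bounded: "\<exists>C. \<forall>x h. \<bar>diff_quot h i a x\<bar> \<le> C"
proof -
 obtain C where C: "\<And>x. \<bar>pd i a x\<bar> \<le> C"
  by (rule compact_support_bounded[OF a(2) continuous_on_subset[OF C1_on_pd_continuous[OF a(1)]] pd_zero_outside[OF compact_imp_closed[OF a(2)] a(3)]]) auto
 have d: "((\<lambda>t. a (x + t *\<^sub>R axis i 1)) has_real_derivative pd i a (x + t *\<^sub>R axis i 1)) (at t)" for x t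
  by (rule has_real_derivative_along_axis[OF C1_on_differentiable[OF a(1)]]) simp
 have "\<bar>diff_quot h i a x\<bar> \<le> C" for x h
 proof (cases "h = 0")
  case True
  thus ?thesis using C[of x] by (simp add: diff_quot_def)
 next
  case False
  have "\<bar>a (x + h *\<^sub>R axis i 1) - a (x + 0 *\<^sub>R axis i 1)\<bar> \<le> C * \<bar>h - 0\<bar>"
   using field_differentiable_bound[of UNIV "\<lambda>t. a (x + t *\<^sub>R axis i 1)" "\<lambda>t. pd i a (x + t *\<^sub>R axis i 1)" C 0 h] d C
   by (auto simp: has_field_derivative_at_within)
  thus ?thesis using False by (simp add: diff_quot_def field_simps abs_mult)
 qed
 thus ?thesis by blast
qed

lemma diff_quot_tendsto:
 assumes "h \<longlonglongrightarrow> 0" "\<And>n. h n \<noteq> 0"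
 shows "(\<lambda>n. diff_quot (h n) i a x) \<longlonglongrightarrow> pd i a x"
proof -
 have "((\<lambda>t. a (x + t *\<^sub>R axis i 1)) has_real_derivative pd i a (x + 0 *\<^sub>R axis i 1)) (at 0)"
  by (rule has_real_derivative_along_axis[OF C1_on_differentiable[OF a(1)]]) simp
 hence "((\<lambda>t. diff_quot t i a x) \<longlongrightarrow> pd i a x) (at 0)"
  by (simp add: DERIV_def diff_quot_def)
 moreover have "filterlim h (at 0) sequentially" using assms by (simp add: filterlim_at)
 ultimately show ?thesis by (rule filterlim_compose)
qed

lemma compact_support_shift: "\<exists>K'. compact K' \<and> (\<forall>x h. \<bar>h\<bar> \<le> 1 --> x \<notin> K' --> a (x + h *\<^sub>R axis i 1) = 0 \<and> a x = 0)"
proof (intro exI conjI allI impI)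
 let ?K = "{x + y |x y. x \<in> K \<and> y \<in> cball 0 1}"
 show "compact ?K" by (intro compact_sums a compact_cball)
 fix x h assume h: "\<bar>h\<bar> \<le> (1::real)" and x: "x \<notin> ?K"
 have *: "x + z \<notin> K" if "norm z \<le> 1" for z
 proof
  assume "x + z \<in> K"
  moreover have "x = (x + z) + (- z)" by simp
  moreover have "- z \<in> cball 0 1" using that by simp
  ultimately have "x \<in> ?K" by blast
  thus False using x by blast
 qed
 show "a (x + h *\<^sub>R axis i 1) = 0" using *[of "h *\<^sub>R axis i 1"] h a(3) by simp
 show "a x = 0" using *[of 0] a(3) by simp
qed

end

text \<open>By the mean value theorem the quotients are bounded, and their supports stay in a compact set.\<close>

lemma diff_quot_product_limit:
 fixes a b :: "real^'n => real"
 assumes a: "C1_on UNIV a" "compact K" "\<And>x. x \<notin> K ==> a x = 0"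
  and b: "C1_on UNIV b" "compact L" "\<And>x. x \<notin> L ==> b x = 0"
  and h: "h \<longlonglongrightarrow> 0" "\<And>n. h n \<noteq> 0" "\<And>n. \<bar>h n\<bar> \<le> 1"
 shows "(\<lambda>n. LINT x|lborel. diff_quot (h n) i a x * diff_quot (h n) j b x) \<longlonglongrightarrow> (LINT x|lborel. pd i a x * pd j b x)"
proof -
 obtain A where A: "\<And>x h. \<bar>diff_quot h i a x\<bar> \<le> A" using diff_quot_bounded[OF a] by blast
 obtain B where B: "\<And>x h. \<bar>diff_quot h j b x\<bar> \<le> B" using diff_quot_bounded[OF b] by blast
 obtain K' where K': "compact K'" "\<And>x h. \<bar>h\<bar> \<le> 1 ==> x \<notin> K' ==> a (x + h *\<^sub>R axis i 1) = 0 \<and> a x = 0"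
  using compact_support_shift[OF a] by blast
 have [measurable]: "a \<in> borel_measurable borel" "b \<in> borel_measurable borel"
  using C1_on_continuous[OF a(1)] C1_on_continuous[OF b(1)] by (auto intro: borel_measurable_continuous_onI)
 have [measurable]: "pd i a \<in> borel_measurable borel" "pd j b \<in> borel_measurable borel"
  using C1_on_pd_continuous[OF a(1)] C1_on_pd_continuous[OF b(1)] by (auto intro: borel_measurable_continuous_onI)
 show ?thesis
 proof (rule integral_dominated_convergence[where w = "\<lambda>x. indicator K' x * (A * B)"])
  show "AE x in lborel. (\<lambda>n. diff_quot (h n) i a x * diff_quot (h n) j b x) \<longlonglongrightarrow> pd i a x * pd j b x"
   by (intro AE_I2 tendsto_mult diff_quot_tendsto[OF a h(1,2)] diff_quot_tendsto[OF b h(1,2)])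
  show "integrable lborel (\<lambda>x. indicator K' x * (A * B))"
   using emeasure_bounded_finite[OF compact_imp_bounded[OF K'(1)]] compact_imp_closed[OF K'(1)]
   by (intro integrable_mult_left integrable_real_indicator) (auto simp: less_top)
  show "AE x in lborel. norm (diff_quot (h n) i a x * diff_quot (h n) j b x) \<le> indicator K' x * (A * B)" for n
  proof (rule AE_I2)
   fix x
   have "\<bar>diff_quot (h n) i a x\<bar> * \<bar>diff_quot (h n) j b x\<bar> \<le> A * B"
    using A B by (intro mult_mono) (auto intro: order_trans[OF abs_ge_zero])
   moreover have "diff_quot (h n) i a x = 0" if "x \<notin> K'" using K'(2)[OF h(3) that, of n] by (simp add: diff_quot_def)
   ultimately show "norm (diff_quot (h n) i a x * diff_quot (h n) j b x) \<le> indicator K' x * (A * B)"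
    by (auto simp: indicator_def abs_mult)
  qed
 qed (simp_all add: diff_quot_def)
qed

text \<open>Second derivatives commute in the weak sense even for functions that are only \<open>C\<^sup>1\<close>:
 a translation turns the product of a forward difference quotient of \<open>a\<close> in direction \<open>i\<close> and one
 of \<open>b\<close> in direction \<open>j\<close> into the product of backward quotients with \<open>i\<close> and \<open>j\<close> exchanged.\<close>

lemma integral_pd_swap_global:
 fixes a b :: "real^'n => real"
 assumes a: "C1_on UNIV a" "compact K" "\<And>x. x \<notin> K ==> a x = 0"
  and b: "C1_on UNIV b" "compact L" "\<And>x. x \<notin> L ==> b x = 0"
 shows "(LINT x|lborel. pd i a x * pd j b x) = (LINT x|lborel. pd j a x * pd i b x)"
proof -
 have ca: "continuous_on UNIV a" and cb: "continuous_on UNIV b" using C1_on_continuous a b by blast+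
 have int: "integrable lborel (\<lambda>x. a x * b (x + c))" for c
  using a by (intro integrable_compact_support[of K]) (auto intro!: continuous_intros continuous_on_subset[OF ca] continuous_on_compose2[OF cb])
 have [measurable]: "a \<in> borel_measurable borel" "b \<in> borel_measurable borel"
  using ca cb by (auto intro: borel_measurable_continuous_onI)
 define I where "I c = (LINT x|lborel. a x * b (x + c))" for c
 have sh: "integrable lborel (\<lambda>x. a (x + c) * b (x + d))" "(LINT x|lborel. a (x + c) * b (x + d)) = I (d - c)" for c d
 proof -
  have e: "a (x + c) * b (x + d) = (\<lambda>x. a x * b (x + (d - c))) (x + c)" for x by (simp add: algebra_simps)
  show "(LINT x|lborel. a (x + c) * b (x + d)) = I (d - c)"
   unfolding e I_def by (rule integral_lborel_shift) measurable
  have "integrable (distr lborel borel ((+) c)) (\<lambda>x. a x * b (x + (d - c)))" using int by (simp add: lborel_distr_plus)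
  hence "integrable lborel (\<lambda>x. a (c + x) * b ((c + x) + (d - c)))" by (subst (asm) integrable_distr_eq) auto
  thus "integrable lborel (\<lambda>x. a (x + c) * b (x + d))" by (simp add: algebra_simps)
 qed
 have dq: "(LINT x|lborel. diff_quot h i a x * diff_quot h j b x) =
   (I (h *\<^sub>R axis j 1 - h *\<^sub>R axis i 1) - I (- (h *\<^sub>R axis i 1)) - I (h *\<^sub>R axis j 1) + I 0) / h\<^sup>2" for h i j
 proof -
  let ?i = "h *\<^sub>R axis i (1::real)" and ?j = "h *\<^sub>R axis j (1::real)"
  define P where "P c d x = a (x + c) * b (x + d)" for c d x
  have P: "integrable lborel (P c d)" "(LINT x|lborel. P c d x) = I (d - c)" for c d
   using sh by (simp_all add: P_def[abs_def])
  have "(\<lambda>x. diff_quot h i a x * diff_quot h j b x) = (\<lambda>x. (P ?i ?j x - P ?i 0 x - P 0 ?j x + P 0 0 x) / h\<^sup>2)"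
   by (auto simp: fun_eq_iff diff_quot_def P_def power2_eq_square algebra_simps diff_divide_distrib add_divide_distrib)
  thus ?thesis by (simp add: P)
 qed
 define h where "h n = 1 / real (Suc n)" for n
 have h: "h \<longlonglongrightarrow> 0" "h n \<noteq> 0" "\<bar>h n\<bar> \<le> 1" for n unfolding h_def by real_asymp (auto)
 have h': "(\<lambda>n. - h n) \<longlonglongrightarrow> 0" "- h n \<noteq> 0" "\<bar>- h n\<bar> \<le> 1" for n using h tendsto_minus[OF h(1)] by auto
 have "(LINT x|lborel. diff_quot (h n) i a x * diff_quot (h n) j b x) = (LINT x|lborel. diff_quot (- h n) j a x * diff_quot (- h n) i b x)" for n
  unfolding dq by (simp add: algebra_simps)
 thus ?thesis
  using LIMSEQ_unique[OF diff_quot_product_limit[OF a b h, of i j]] diff_quot_product_limit[OF a b h', of j i] by simp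
qed

text \<open>Only the values of \<open>h\<close> near the support of \<open>a\<close> enter, so \<open>h\<close> may be cut off.\<close>

lemma integral_pd_swap:
 fixes a h :: "real^'n => real"
 assumes a: "C1_on UNIV a" and h: "C1_on D h" and K: "compact K" "K \<subseteq> D" "\<And>x. x \<notin> K ==> a x = 0"
 shows "(LINT x|lborel. pd j a x * pd i h x) = (LINT x|lborel. pd i a x * pd j h x)"
proof -
 have oD: "open D" using h by (rule C1_on_openD)
 obtain \<eta> :: "real^'n => real" and N L where \<eta>: "C1_on UNIV \<eta>" "open N" "K \<subseteq> N" "\<And>x. x \<in> N ==> \<eta> x = 1"
   "compact L" "L \<subseteq> D" "\<And>x. x \<notin> L ==> \<eta> x = 0"
  by (rule C1_cutoff[OF K(1) oD K(2)]) (rule that)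
 define b where "b x = \<eta> x * h x" for x
 have b: "C1_on UNIV b" "\<And>x. x \<notin> L ==> b x = 0" unfolding b_def
  using C1_on_zero_extension[OF C1_on_mult[OF C1_on_subset[OF \<eta>(1) oD] h] compact_imp_closed[OF \<eta>(5)] \<eta>(6)] \<eta>(7) by auto
 have e: "pd l a x * pd m h x = pd l a x * pd m b x" for l m x
 proof (cases "x \<in> K")
  case True
  have "pd m b x = pd m h x" by (rule pd_cong[OF \<eta>(2)]) (use True \<eta>(3,4) in \<open>auto simp: b_def\<close>)
  thus ?thesis by simp
 qed (simp add: pd_zero_outside[OF compact_imp_closed[OF K(1)] K(3)])
 show ?thesis unfolding e by (rule integral_pd_swap_global[OF a K(1,3) b(1) \<eta>(5) b(2)])
qed

text \<open>The field with components \<open>\<Sum>\<^sub>i c\<^sub>i\<^sub>j \<partial>\<^sub>i h\<close>, with \<open>c\<close> antisymmetric in \<open>i\<close> and \<open>j\<close>, has the weak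
 divergence \<open>\<Sum>\<^sub>i\<^sub>j \<partial>\<^sub>j c\<^sub>i\<^sub>j \<partial>\<^sub>i h\<close>; the second derivatives of \<open>h\<close> drop out and need not exist.\<close>

lemma weak_divergence_antisymmetric:
 fixes c :: "'k => 'n::finite => 'n => real^'n => real" and h :: "'k => real^'n => real"
 assumes c: "\<And>a i j. a \<in> A ==> C1_on D (c a i j)" and h: "\<And>a. a \<in> A ==> C1_on D (h a)" and D: "open D"
  and anti: "\<And>a i j x. a \<in> A ==> x \<in> D ==> c a i j x = - c a j i x"
  and \<phi>: "C1_on UNIV \<phi>" and K: "compact K" "K \<subseteq> D" "\<And>x. x \<notin> K ==> \<phi> x = 0"
 shows "integrable lborel (\<lambda>x. \<Sum>j. (\<Sum>a\<in>A. \<Sum>i. c a i j x * pd i (h a) x) * pd j \<phi> x)" (is "integrable _ ?L")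
  and "integrable lborel (\<lambda>x. (\<Sum>a\<in>A. \<Sum>i j. pd j (c a i j) x * pd i (h a) x) * \<phi> x)" (is "integrable _ ?R")
  and "(LINT x|lborel. (\<Sum>j. (\<Sum>a\<in>A. \<Sum>i. c a i j x * pd i (h a) x) * pd j \<phi> x)) =
   - (LINT x|lborel. (\<Sum>a\<in>A. \<Sum>i j. pd j (c a i j) x * pd i (h a) x) * \<phi> x)"
proof -
 have clK: "closed K" using K(1) by (rule compact_imp_closed)
 note pd\<phi>0 = pd_zero_outside[OF clK K(3)]
 note K\<phi>c = continuous_on_subset[OF C1_on_pd_continuous[OF \<phi>] subset_UNIV, of K] continuous_on_subset[OF C1_on_continuous[OF \<phi>] subset_UNIV, of K]
 note Kcc = continuous_on_subset[OF C1_on_continuous[OF c] K(2)] continuous_on_subset[OF C1_on_pd_continuous[OF c] K(2)]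
  continuous_on_subset[OF C1_on_pd_continuous[OF h] K(2)]
 show iL: "integrable lborel ?L"
  by (rule integrable_compact_support[OF K(1)]) (auto intro!: continuous_intros Kcc K\<phi>c simp: pd\<phi>0)
 show iR: "integrable lborel ?R"
  by (rule integrable_compact_support[OF K(1)]) (auto intro!: continuous_intros Kcc K\<phi>c simp: K(3))
 have cC1: "C1_on UNIV (\<lambda>x. c a i j x * \<phi> x)" if "a \<in> A" for a i j
  by (rule C1_on_zero_extension[OF C1_on_mult[OF c[OF that] C1_on_subset[OF \<phi> D]] clK K(2)]) (use K(3) in auto)
 have c0: "pd l (\<lambda>x. c a i j x * \<phi> x) x = 0" if "x \<notin> K" for l a i j x
  by (rule pd_zero_outside[OF clK _ that]) (simp add: K(3))
 \<comment> \<open>with \<open>\<phi>\<close> moved into the coefficients these integrals are antisymmetric in \<open>i\<close> and \<open>j\<close>\<close>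
 define T where "T a i j = (LINT x|lborel. pd j (\<lambda>x. c a i j x * \<phi> x) x * pd i (h a) x)" for a i j
 have int: "integrable lborel (\<lambda>x. pd l (\<lambda>x. c a i j x * \<phi> x) x * pd m (h a) x)" if "a \<in> A" for a l m i j
  by (rule integrable_compact_support[OF K(1)])
   (auto intro!: continuous_on_mult continuous_on_subset[OF C1_on_pd_continuous[OF cC1[OF that]]] Kcc that simp: c0)
 have Tanti: "T a i j = - T a j i" if a: "a \<in> A" for a i j
 proof -
  have "T a i j = (LINT x|lborel. pd i (\<lambda>x. c a i j x * \<phi> x) x * pd j (h a) x)"
   unfolding T_def by (rule integral_pd_swap[OF cC1[OF a] h[OF a] K(1,2)]) (simp add: K(3))
  also have "(\<lambda>x. c a i j x * \<phi> x) = (\<lambda>x. - (c a j i x * \<phi> x))"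
   using anti[OF a, of _ i j] K(2,3) by (intro ext) (metis minus_zero mult_minus_left mult_zero_right subsetD)
  also have "(LINT x|lborel. pd i (\<lambda>x. - (c a j i x * \<phi> x)) x * pd j (h a) x) = - T a j i"
   by (simp add: T_def pd_minus C1_on_differentiable[OF cC1[OF a]])
  finally show ?thesis .
 qed
 have "(\<Sum>a\<in>A. \<Sum>i j. T a i j) = 0"
 proof (rule sum.neutral, rule ballI)
  fix a assume a: "a \<in> A"
  have "(\<Sum>i j. T a i j) = (\<Sum>j i. T a i j)" by (rule sum.swap)
  also have "... = (\<Sum>j i. - T a j i)" by (intro sum.cong refl Tanti[OF a])
  finally show "(\<Sum>i j. T a i j) = 0" by (simp add: sum_negf)
 qed
 moreover have "(\<Sum>a\<in>A. \<Sum>i j. T a i j) =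
  (LINT x|lborel. (\<Sum>a\<in>A. \<Sum>i j. pd j (\<lambda>x. c a i j x * \<phi> x) x * pd i (h a) x))"
  unfolding T_def using int by (simp add: Bochner_Integration.integral_sum)
 moreover have "(\<Sum>a\<in>A. \<Sum>i j. pd j (\<lambda>x. c a i j x * \<phi> x) x * pd i (h a) x) = ?L x + ?R x" for x
 proof (cases "x \<in> D")
  case True
  have "(\<Sum>a\<in>A. \<Sum>i j. pd j (\<lambda>x. c a i j x * \<phi> x) x * pd i (h a) x) =
   (\<Sum>a\<in>A. \<Sum>i j. pd j (c a i j) x * pd i (h a) x * \<phi> x + c a i j x * pd i (h a) x * pd j \<phi> x)"
   using C1_on_differentiable[OF c _] C1_on_differentiable[OF \<phi>] True
   by (intro sum.cong refl) (simp add: pd_mult algebra_simps)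
  also have "... = ?R x + (\<Sum>a\<in>A. \<Sum>i j. c a i j x * pd i (h a) x * pd j \<phi> x)"
   by (simp add: sum.distrib sum_distrib_right)
  also have "(\<Sum>a\<in>A. \<Sum>i j. c a i j x * pd i (h a) x * pd j \<phi> x) = ?L x"
   unfolding sum_distrib_right
   by (subst sum.swap[of _ UNIV UNIV], subst sum.swap[of _ UNIV A]) (rule refl)
  finally show ?thesis by simp
 next
  case False
  hence "x \<notin> K" using K(2) by blast
  thus ?thesis by (simp add: c0 pd\<phi>0 K(3))
 qed
 ultimately have "(LINT x|lborel. ?L x + ?R x) = 0" by simp
 thus "(LINT x|lborel. ?L x) = - (LINT x|lborel. ?R x)"
  using iL iR by (subst (asm) Bochner_Integration.integral_add) auto
qed

section \<open>Linear algebra of the graph metric\<close>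

definition grad_vec :: "(real^'n => real^'m) => 'm => real^'n => real^'n" where
 "grad_vec f \<alpha> x = (\<chi> i. D1 f \<alpha> i x)"

abbreviation inv_metric :: "(real^'n => real^'m) => real^'n => real^'n^'n" where
 "inv_metric f x \<equiv> matrix_inv (graph_metric f x)"

definition hess :: "(real^'n => real^'m) => 'm => real^'n => real^'n^'n" where
 "hess f \<alpha> x = (\<chi> i j. D2 f \<alpha> i j x)"

text \<open>The matrices \<open>1 + \<Sum>\<^sub>\<alpha> d\<^sub>\<alpha> d\<^sub>\<alpha>\<^sup>T\<close>.\<close>

definition gram :: "('m::finite => real^'n) => real^'n^'n" where
 "gram d = (\<chi> i j. (if i = j then 1 else 0) + (\<Sum>\<alpha>. d \<alpha> $ i * d \<alpha> $ j))"

lemma graph_metric_gram: "graph_metric f x = gram (\<lambda>\<alpha>. grad_vec f \<alpha> x)"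
 by (simp add: graph_metric_def gram_def grad_vec_def)

lemma transpose_gram: "transpose (gram d) = gram d"
 by (simp add: gram_def transpose_def vec_eq_iff mult.commute)

lemma gram_mult_vec: "gram d *v v = v + (\<Sum>\<alpha>. (d \<alpha> \<bullet> v) *\<^sub>R d \<alpha>)"
proof -
 have "(gram d *v v) $ i = v $ i + (\<Sum>\<alpha>. (d \<alpha> \<bullet> v) * d \<alpha> $ i)" for i
 proof -
  have "(gram d *v v) $ i = (\<Sum>j. (if i = j then v $ j else 0)) + (\<Sum>j \<alpha>. d \<alpha> $ i * d \<alpha> $ j * v $ j)"
   unfolding gram_def matrix_vector_mult_def sum.distrib[symmetric]
   by (auto simp: distrib_right sum_distrib_right intro!: sum.cong)
  also have "(\<Sum>j \<alpha>. d \<alpha> $ i * d \<alpha> $ j * v $ j) = (\<Sum>\<alpha>. (d \<alpha> \<bullet> v) * d \<alpha> $ i)"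
   by (subst sum.swap) (simp add: inner_vec_def sum_distrib_right sum_distrib_left mult_ac)
  finally show ?thesis by simp
 qed
 thus ?thesis by (simp add: vec_eq_iff)
qed

lemma gram_inner: "v \<bullet> (gram d *v v) = v \<bullet> v + (\<Sum>\<alpha>. (d \<alpha> \<bullet> v)\<^sup>2)"
 by (simp add: gram_mult_vec inner_right_distrib inner_sum_right power2_eq_square inner_commute)

lemma gram_inner_ge: "v \<bullet> v \<le> v \<bullet> (gram d *v v)"
 by (simp add: gram_inner sum_nonneg)

lemma invertible_gram: "invertible (gram d)"
proof -
 have "v = 0" if "gram d *v v = 0" for v
 proof -
  have "v \<bullet> v = 0" using gram_inner_ge[of v d] inner_ge_zero[of v] that by simp
  thus ?thesis by simp
 qed
 thus ?thesis using matrix_left_invertible_ker[of "gram d"] invertible_left_inverse by blast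
qed

lemma matrix_inv_gram: "gram d ** matrix_inv (gram d) = mat 1" "matrix_inv (gram d) ** gram d = mat 1"
 by (rule matrix_inv_mult[OF invertible_gram])+

lemma transpose_matrix_inv_gram: "transpose (matrix_inv (gram d)) = matrix_inv (gram d)"
 by (simp add: transpose_matrix_inv[OF invertible_gram] transpose_gram)

text \<open>On the segment from \<open>0\<close> to \<open>d\<close> the determinant has no zero, and it starts at \<open>1\<close>.\<close>

lemma det_gram_pos: "det (gram d) > 0"
proof (rule ccontr)
 assume neg: "\<not> det (gram d) > 0"
 define F where "F t = det (gram (\<lambda>\<alpha>. t *\<^sub>R d \<alpha>))" for t
 have "continuous_on {0..1} F"
  unfolding F_def det_def gram_def by (auto intro!: continuous_intros)
 moreover have "F 0 = 1"
 proof -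
  have "gram (\<lambda>\<alpha>. 0 *\<^sub>R d \<alpha>) = mat 1" by (simp add: gram_def mat_def vec_eq_iff)
  thus ?thesis by (simp add: F_def)
 qed
 moreover have "F 1 \<le> 0" using neg by (simp add: F_def)
 ultimately obtain t where "F t = 0" using IVT2'[of F 1 0 0] by auto
 thus False using invertible_gram invertible_det_nz unfolding F_def by blast
qed

text \<open>Since \<open>g \<ge> 1\<close>, the inverse is a contraction; this bounds its entries without any condition on \<open>f\<close>.\<close>

lemma matrix_inv_gram_norm: "norm (matrix_inv (gram d) *v v) \<le> norm v"
proof -
 let ?u = "matrix_inv (gram d) *v v"
 have "gram d *v ?u = v" by (simp add: matrix_vector_mul_assoc matrix_inv_gram)
 hence "(norm ?u)\<^sup>2 \<le> norm ?u * norm v"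
  using gram_inner_ge[of ?u d] norm_cauchy_schwarz[of ?u v] by (simp add: power2_norm_eq_inner)
 thus ?thesis by (cases "norm ?u = 0") (auto simp: power2_eq_square)
qed

lemma matrix_inv_gram_entry: "\<bar>matrix_inv (gram d) $ i $ j\<bar> \<le> 1"
proof -
 have "matrix_inv (gram d) $ i $ j = (matrix_inv (gram d) *v axis j 1) $ i"
  by (simp add: matrix_vector_mult_basis column_def)
 thus ?thesis
  using component_le_norm_cart[of "matrix_inv (gram d) *v axis j 1" i] matrix_inv_gram_norm[of d "axis j 1"] by simp
qed

lemma matrix_sym_inner:
 fixes A :: "real^'n^'n"
 assumes "transpose A = A"
 shows "(A *v v) \<bullet> w = v \<bullet> (A *v w)"
 using dot_lmul_matrix[of v A w] assms by (metis transpose_matrix_vector)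

lemma transpose_nth_sym: "transpose A = A ==> A $ i $ j = A $ j $ i"
 by (metis (no_types) transpose_def vec_lambda_beta)

section \<open>The flux field and its divergence\<close>

context
 fixes G :: "real^'n^'n" and H :: "'m::finite => real^'n^'n" and d :: "'m => real^'n"
begin

text \<open>Data at one point: \<open>G = g\<^sup>-\<^sup>1\<close>, the Hessians \<open>H\<close> and the Euclidean gradients \<open>d\<close> of the components of \<open>f\<close>.  Then
 \<open>pv\<close> are the gradients with respect to \<open>g\<close>, \<open>Mm\<close> the shape operators and \<open>Uc\<close> is the Gram matrix of the
 normal parts of the vertical basis vectors; \<open>dpv\<close> and \<open>dG\<close> express the derivatives of \<open>pv\<close> and \<open>G\<close>.\<close>

definition "pv \<alpha> = G *v d \<alpha>"
definition "Mm \<alpha> = G ** H \<alpha>"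
definition "Uc \<alpha> \<beta> = (if \<alpha> = \<beta> then 1 else 0) - d \<alpha> \<bullet> pv \<beta>"
definition "dpv \<alpha> i j = (\<Sum>\<beta>. Uc \<alpha> \<beta> * Mm \<beta> $ i $ j - pv \<beta> $ i * (H \<beta> *v pv \<alpha>) $ j)"
definition "dG j i k = - (\<Sum>\<beta>. Mm \<beta> $ i $ j * pv \<beta> $ k + pv \<beta> $ i * Mm \<beta> $ k $ j)"

context
 assumes symG: "transpose G = G" and symH: "\<And>\<alpha>. transpose (H \<alpha>) = H \<alpha>"
begin

lemma trace_sum: "(\<Sum>k i. A $ i $ k * B $ k $ i) = trace (A ** B)"
 for A B :: "real^'n^'n"
 unfolding trace_def matrix_matrix_mult_def by (subst sum.swap) simp

lemma triple_sum_1: "(\<Sum>k i j. a $ j * (A $ i $ j * b $ k) * H \<alpha> $ k $ i) = (A *v a) \<bullet> (H \<alpha> *v b)"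
proof -
 have "(A *v a) \<bullet> (H \<alpha> *v b) = (\<Sum>i j k. a $ j * (A $ i $ j * b $ k) * H \<alpha> $ k $ i)"
  unfolding inner_vec_def matrix_vector_mult_def
  by (simp add: sum_product mult_ac transpose_nth_sym[OF symH])
 also have "... = (\<Sum>i k j. a $ j * (A $ i $ j * b $ k) * H \<alpha> $ k $ i)"
  by (intro sum.cong refl sum.swap)
 also have "... = (\<Sum>k i j. a $ j * (A $ i $ j * b $ k) * H \<alpha> $ k $ i)"
  by (rule sum.swap)
 finally show ?thesis ..
qed

lemma triple_sum_2: "(\<Sum>k i j. a $ j * (b $ i * A $ k $ j) * H \<alpha> $ k $ i) = (A *v a) \<bullet> (H \<alpha> *v b)"
proof -
 have "(A *v a) \<bullet> (H \<alpha> *v b) = (\<Sum>k j i. a $ j * (b $ i * A $ k $ j) * H \<alpha> $ k $ i)"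
  unfolding inner_vec_def matrix_vector_mult_def
  by (simp add: sum_product mult_ac)
 also have "... = (\<Sum>k i j. a $ j * (b $ i * A $ k $ j) * H \<alpha> $ k $ i)"
  by (intro sum.cong refl sum.swap)
 finally show ?thesis ..
qed

lemma H_sym: "(H \<alpha> *v v) \<bullet> w = v \<bullet> (H \<alpha> *v w)" by (rule matrix_sym_inner[OF symH])

lemma M_H_sym: "(Mm \<alpha> *v v) \<bullet> (H \<beta> *v w) = (H \<alpha> *v v) \<bullet> (Mm \<beta> *v w)"
 unfolding Mm_def matrix_vector_mul_assoc[symmetric] by (rule matrix_sym_inner[OF symG])

text \<open>This and the next three lemmas evaluate the products that arise when the coefficients of the flux
 field are differentiated.\<close>

lemma div_term_1:
 "(\<Sum>k i j. dpv \<alpha> j j * G $ i $ k * H \<alpha> $ k $ i) =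
  (\<Sum>\<beta>. Uc \<alpha> \<beta> * (trace (Mm \<alpha>) * trace (Mm \<beta>)) - trace (Mm \<alpha>) * (pv \<beta> \<bullet> (H \<beta> *v pv \<alpha>)))"
proof -
 have "(\<Sum>j. dpv \<alpha> j j) = (\<Sum>\<beta>. Uc \<alpha> \<beta> * trace (Mm \<beta>) - pv \<beta> \<bullet> (H \<beta> *v pv \<alpha>))"
  unfolding dpv_def by (subst sum.swap) (simp add: sum_subtractf sum_distrib_left trace_def inner_vec_def)
 moreover have "(\<Sum>k i j. dpv \<alpha> j j * G $ i $ k * H \<alpha> $ k $ i) = (\<Sum>j. dpv \<alpha> j j) * (\<Sum>k i. G $ i $ k * H \<alpha> $ k $ i)"
  by (simp add: sum_distrib_left sum_distrib_right mult_ac)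
 ultimately have "(\<Sum>k i j. dpv \<alpha> j j * G $ i $ k * H \<alpha> $ k $ i) =
   (\<Sum>\<beta>. Uc \<alpha> \<beta> * trace (Mm \<beta>) - pv \<beta> \<bullet> (H \<beta> *v pv \<alpha>)) * trace (Mm \<alpha>)"
  by (simp add: trace_sum Mm_def)
 thus ?thesis
  unfolding sum_distrib_right by (simp add: algebra_simps)
qed

lemma div_term_2:
 "(\<Sum>k i j. pv \<alpha> $ j * dG j i k * H \<alpha> $ k $ i) =
  - (\<Sum>\<beta>. 2 * ((Mm \<beta> *v pv \<alpha>) \<bullet> (H \<alpha> *v pv \<beta>)))"
proof -
 have "(\<Sum>k i j. pv \<alpha> $ j * dG j i k * H \<alpha> $ k $ i) =
  - (\<Sum>k i j \<beta>. pv \<alpha> $ j * (Mm \<beta> $ i $ j * pv \<beta> $ k) * H \<alpha> $ k $ i + pv \<alpha> $ j * (pv \<beta> $ i * Mm \<beta> $ k $ j) * H \<alpha> $ k $ i)"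
  unfolding dG_def by (simp add: sum_distrib_left sum_distrib_right sum_negf[symmetric] algebra_simps)
 also have "(\<Sum>k i j \<beta>. pv \<alpha> $ j * (Mm \<beta> $ i $ j * pv \<beta> $ k) * H \<alpha> $ k $ i + pv \<alpha> $ j * (pv \<beta> $ i * Mm \<beta> $ k $ j) * H \<alpha> $ k $ i)
  = (\<Sum>\<beta> k i j. pv \<alpha> $ j * (Mm \<beta> $ i $ j * pv \<beta> $ k) * H \<alpha> $ k $ i + pv \<alpha> $ j * (pv \<beta> $ i * Mm \<beta> $ k $ j) * H \<alpha> $ k $ i)"
  by (simp only: sum.swap[of _ "UNIV :: 'm set"])
 also have "... = (\<Sum>\<beta>. 2 * ((Mm \<beta> *v pv \<alpha>) \<bullet> (H \<alpha> *v pv \<beta>)))"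
  unfolding sum.distrib triple_sum_1 triple_sum_2 by (simp add: sum_distrib_left)
 finally show ?thesis .
qed

lemma div_term_3:
 "(\<Sum>k i j. dpv \<alpha> i j * G $ j $ k * H \<alpha> $ k $ i) =
  (\<Sum>\<beta>. Uc \<alpha> \<beta> * trace (Mm \<alpha> ** Mm \<beta>) - (H \<beta> *v pv \<alpha>) \<bullet> (Mm \<alpha> *v pv \<beta>))"
proof -
 have "(\<Sum>k i j. dpv \<alpha> i j * G $ j $ k * H \<alpha> $ k $ i) = (\<Sum>i j k. dpv \<alpha> i j * G $ j $ k * H \<alpha> $ k $ i)"
  by (subst sum.swap) (intro sum.cong refl sum.swap)
 also have "... = (\<Sum>i j. dpv \<alpha> i j * Mm \<alpha> $ j $ i)"
  unfolding Mm_def matrix_matrix_mult_def by (simp add: sum_distrib_left mult_ac)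
 also have "... = (\<Sum>i j \<beta>. Uc \<alpha> \<beta> * (Mm \<alpha> $ j $ i * Mm \<beta> $ i $ j) - (H \<beta> *v pv \<alpha>) $ j * (Mm \<alpha> $ j $ i * pv \<beta> $ i))"
  unfolding dpv_def sum_distrib_right by (intro sum.cong refl) (simp add: algebra_simps)
 also have "... = (\<Sum>\<beta> i j. Uc \<alpha> \<beta> * (Mm \<alpha> $ j $ i * Mm \<beta> $ i $ j) - (H \<beta> *v pv \<alpha>) $ j * (Mm \<alpha> $ j $ i * pv \<beta> $ i))"
  by (simp only: sum.swap[of _ "UNIV :: 'm set"])
 also have "... = (\<Sum>\<beta>. Uc \<alpha> \<beta> * trace (Mm \<alpha> ** Mm \<beta>) - (H \<beta> *v pv \<alpha>) \<bullet> (Mm \<alpha> *v pv \<beta>))"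
 proof (intro sum.cong refl)
  fix \<beta>
  have "(H \<beta> *v pv \<alpha>) \<bullet> (Mm \<alpha> *v pv \<beta>) = (\<Sum>j i. (H \<beta> *v pv \<alpha>) $ j * (Mm \<alpha> $ j $ i * pv \<beta> $ i))"
   unfolding inner_vec_def by (subst (2) matrix_vector_mult_def) (simp add: sum_distrib_left)
  also have "... = (\<Sum>i j. (H \<beta> *v pv \<alpha>) $ j * (Mm \<alpha> $ j $ i * pv \<beta> $ i))" by (rule sum.swap)
  finally show "(\<Sum>i j. Uc \<alpha> \<beta> * (Mm \<alpha> $ j $ i * Mm \<beta> $ i $ j) - (H \<beta> *v pv \<alpha>) $ j * (Mm \<alpha> $ j $ i * pv \<beta> $ i)) =
   Uc \<alpha> \<beta> * trace (Mm \<alpha> ** Mm \<beta>) - (H \<beta> *v pv \<alpha>) \<bullet> (Mm \<alpha> *v pv \<beta>)"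
   by (simp add: sum_subtractf sum_distrib_left trace_sum[symmetric])
 qed
 finally show ?thesis .
qed

lemma div_term_4:
 "(\<Sum>k i j. pv \<alpha> $ i * dG j j k * H \<alpha> $ k $ i) =
  - (\<Sum>\<beta>. trace (Mm \<beta>) * (pv \<beta> \<bullet> (H \<alpha> *v pv \<alpha>)) + (Mm \<beta> *v pv \<beta>) \<bullet> (H \<alpha> *v pv \<alpha>))"
proof -
 have "(\<Sum>k i j. pv \<alpha> $ i * dG j j k * H \<alpha> $ k $ i) =
  - (\<Sum>k i j \<beta>. pv \<alpha> $ i * (Mm \<beta> $ j $ j * pv \<beta> $ k) * H \<alpha> $ k $ i + pv \<beta> $ j * (pv \<alpha> $ i * Mm \<beta> $ k $ j) * H \<alpha> $ k $ i)"
  unfolding dG_def by (simp add: sum_distrib_left sum_distrib_right sum_negf[symmetric] algebra_simps)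
 also have "(\<Sum>k i j \<beta>. pv \<alpha> $ i * (Mm \<beta> $ j $ j * pv \<beta> $ k) * H \<alpha> $ k $ i + pv \<beta> $ j * (pv \<alpha> $ i * Mm \<beta> $ k $ j) * H \<alpha> $ k $ i)
  = (\<Sum>\<beta> k i j. pv \<alpha> $ i * (Mm \<beta> $ j $ j * pv \<beta> $ k) * H \<alpha> $ k $ i + pv \<beta> $ j * (pv \<alpha> $ i * Mm \<beta> $ k $ j) * H \<alpha> $ k $ i)"
  by (simp only: sum.swap[of _ "UNIV :: 'm set"])
 also have "... = (\<Sum>\<beta>. trace (Mm \<beta>) * (pv \<beta> \<bullet> (H \<alpha> *v pv \<alpha>)) + (Mm \<beta> *v pv \<beta>) \<bullet> (H \<alpha> *v pv \<alpha>))"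
 proof (intro sum.cong refl)
  fix \<beta>
  have "trace (Mm \<beta>) * (pv \<beta> \<bullet> (H \<alpha> *v pv \<alpha>)) = (\<Sum>k i j. pv \<alpha> $ i * (Mm \<beta> $ j $ j * pv \<beta> $ k) * H \<alpha> $ k $ i)"
   unfolding trace_def inner_vec_def matrix_vector_mult_def
   by (simp add: sum_distrib_left sum_distrib_right mult_ac)
  thus "(\<Sum>k i j. pv \<alpha> $ i * (Mm \<beta> $ j $ j * pv \<beta> $ k) * H \<alpha> $ k $ i + pv \<beta> $ j * (pv \<alpha> $ i * Mm \<beta> $ k $ j) * H \<alpha> $ k $ i) =
   trace (Mm \<beta>) * (pv \<beta> \<bullet> (H \<alpha> *v pv \<alpha>)) + (Mm \<beta> *v pv \<beta>) \<bullet> (H \<alpha> *v pv \<alpha>)"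
   unfolding sum.distrib triple_sum_2 by simp
 qed
 finally show ?thesis .
qed

text \<open>The first sum is the scalar curvature, the second is \<open>S\<^sup>\<bottom>\<close>; the terms that contain a single
 trace cancel on exchanging \<open>\<alpha>\<close> and \<open>\<beta>\<close>.\<close>

lemma divergence_algebra:
 "(\<Sum>\<alpha> k i j.
   ((dpv \<alpha> j j * G $ i $ k + pv \<alpha> $ j * dG j i k) - (dpv \<alpha> i j * G $ j $ k + pv \<alpha> $ i * dG j j k)) * H \<alpha> $ k $ i) =
  (\<Sum>\<alpha> \<beta>. Uc \<alpha> \<beta> * (trace (Mm \<alpha>) * trace (Mm \<beta>) - trace (Mm \<alpha> ** Mm \<beta>))) +
  (\<Sum>\<alpha> \<beta>. (Mm \<alpha> *v pv \<alpha>) \<bullet> (H \<beta> *v pv \<beta>) - (Mm \<alpha> *v pv \<beta>) \<bullet> (H \<beta> *v pv \<alpha>))"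
  (is "?L = ?R1 + ?R2")
proof -
 have "?L = (\<Sum>\<alpha>.
   (\<Sum>k i j. dpv \<alpha> j j * G $ i $ k * H \<alpha> $ k $ i) +
   (\<Sum>k i j. pv \<alpha> $ j * dG j i k * H \<alpha> $ k $ i) -
   (\<Sum>k i j. dpv \<alpha> i j * G $ j $ k * H \<alpha> $ k $ i) -
   (\<Sum>k i j. pv \<alpha> $ i * dG j j k * H \<alpha> $ k $ i))"
  by (simp add: sum.distrib[symmetric] sum_subtractf[symmetric] algebra_simps)
 also have "... = (\<Sum>\<alpha> \<beta>.
   Uc \<alpha> \<beta> * (trace (Mm \<alpha>) * trace (Mm \<beta>) - trace (Mm \<alpha> ** Mm \<beta>))
   - trace (Mm \<alpha>) * (pv \<beta> \<bullet> (H \<beta> *v pv \<alpha>)) + trace (Mm \<beta>) * (pv \<beta> \<bullet> (H \<alpha> *v pv \<alpha>))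
   + ((Mm \<beta> *v pv \<beta>) \<bullet> (H \<alpha> *v pv \<alpha>) - 2 * ((Mm \<beta> *v pv \<alpha>) \<bullet> (H \<alpha> *v pv \<beta>)) + (H \<beta> *v pv \<alpha>) \<bullet> (Mm \<alpha> *v pv \<beta>)))"
  unfolding div_term_1 div_term_2 div_term_3 div_term_4 sum_negf[symmetric] sum.distrib[symmetric] sum_subtractf[symmetric]
  by (intro sum.cong refl) (simp add: algebra_simps)
 also have "... = ?R1 - (\<Sum>\<alpha> \<beta>. trace (Mm \<alpha>) * (pv \<beta> \<bullet> (H \<beta> *v pv \<alpha>)))
   + (\<Sum>\<alpha> \<beta>. trace (Mm \<beta>) * (pv \<beta> \<bullet> (H \<alpha> *v pv \<alpha>)))
   + (\<Sum>\<alpha> \<beta>. (Mm \<beta> *v pv \<beta>) \<bullet> (H \<alpha> *v pv \<alpha>) - (Mm \<beta> *v pv \<alpha>) \<bullet> (H \<alpha> *v pv \<beta>))"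
  by (simp add: sum.distrib sum_subtractf M_H_sym[symmetric])
 also have "(\<Sum>\<alpha> \<beta>. trace (Mm \<beta>) * (pv \<beta> \<bullet> (H \<alpha> *v pv \<alpha>))) = (\<Sum>\<alpha> \<beta>. trace (Mm \<alpha>) * (pv \<beta> \<bullet> (H \<beta> *v pv \<alpha>)))"
 proof -
  have "pv \<alpha> \<bullet> (H \<beta> *v pv \<beta>) = pv \<beta> \<bullet> (H \<beta> *v pv \<alpha>)" for \<alpha> \<beta>
   using H_sym[of \<beta> "pv \<beta>" "pv \<alpha>"] by (simp add: inner_commute)
  thus ?thesis by (subst sum.swap) simp
 qed
 also have "(\<Sum>\<alpha> \<beta>. (Mm \<beta> *v pv \<beta>) \<bullet> (H \<alpha> *v pv \<alpha>) - (Mm \<beta> *v pv \<alpha>) \<bullet> (H \<alpha> *v pv \<beta>)) = ?R2"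
  by (rule sum.swap)
 finally show ?thesis by simp
qed

end

end

section \<open>Scalar curvature and normal curvature of a graph\<close>

text \<open>With \<open>g\<close> replaced by the identity this is \<open>\<Sum>\<^sub>\<alpha> (\<Delta>f\<^sup>\<alpha>) Df\<^sup>\<alpha> - D\<^sup>2f\<^sup>\<alpha> Df\<^sup>\<alpha>\<close>, whose divergence is \<open>\<Sum>\<^sub>\<alpha> (\<Delta>f\<^sup>\<alpha>)\<^sup>2 - \<bar>D\<^sup>2f\<^sup>\<alpha>\<bar>\<^sup>2\<close>,
 the scalar curvature to leading order.\<close>

definition flux_field :: "(real^'n => real^'m) => real^'n => real^'n" where
 "flux_field f x = (\<Sum>\<alpha>. trace (inv_metric f x ** hess f \<alpha> x) *\<^sub>R graph_gradient f \<alpha> x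
   - (inv_metric f x ** hess f \<alpha> x) *v graph_gradient f \<alpha> x)"

text \<open>The tangential part of \<open>(0, a)\<close> has coefficients \<open>g\<^sup>-\<^sup>1 \<Sum>\<^sub>\<alpha> a\<^sub>\<alpha> Df\<^sup>\<alpha>\<close> in the coordinate frame.\<close>

lemma inner_normal_part:
 fixes f :: "real^'n => real^'m"
 shows "normal_part f x (0, a) \<bullet> normal_part f x (0, b) =
  (\<Sum>\<alpha> \<beta>. ((if \<alpha> = \<beta> then 1 else 0) - grad_vec f \<alpha> x \<bullet> (inv_metric f x *v grad_vec f \<beta> x)) * a $ \<alpha> * b $ \<beta>)"
  and "normal_part f x (0, a) \<bullet> normal_frame f \<gamma> x = a $ \<gamma>"
proof -
 define G where "G = inv_metric f x"
 define d where "d \<alpha> = grad_vec f \<alpha> x" for \<alpha>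
 have gm: "graph_metric f x = gram d" by (simp add: graph_metric_gram d_def[abs_def])
 define \<tau> where "\<tau> l = tangent_frame f l x" for l
 define s where "s a = (\<Sum>\<alpha>. a $ \<alpha> *\<^sub>R d \<alpha>)" for a :: "real^'m"
 have \<tau>0: "(0, a) \<bullet> \<tau> l = s a $ l" for a l
  by (simp add: \<tau>_def tangent_frame_def s_def d_def grad_vec_def inner_vec_def)
 have \<tau>\<tau>: "\<tau> k \<bullet> \<tau> l = graph_metric f x $ k $ l" for k l
  by (simp add: \<tau>_def tangent_frame_def graph_metric_def inner_axis_axis) (simp add: inner_vec_def)
 define P where "P a = (\<Sum>k. (G *v s a) $ k *\<^sub>R \<tau> k)" for a
 have np: "normal_part f x (0, a) = (0, a) - P a" for a
  unfolding normal_part_def P_def \<tau>_def[symmetric] \<tau>0 G_def[symmetric] matrix_vector_mult_def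
  by (simp add: scaleR_sum_left)
 have P\<tau>: "P a \<bullet> \<tau> l = s a $ l" for a l
 proof -
  have "P a \<bullet> \<tau> l = (\<Sum>k. (G *v s a) $ k * graph_metric f x $ k $ l)"
   by (simp add: P_def inner_sum_left \<tau>\<tau>)
  also have "... = (graph_metric f x *v (G *v s a)) $ l"
   unfolding matrix_vector_mult_def[of "graph_metric f x"]
   using transpose_nth_sym[OF transpose_gram[of d]] by (simp add: gm mult.commute)
  finally show ?thesis by (simp add: matrix_vector_mul_assoc G_def gm matrix_inv_gram)
 qed
 have n\<tau>: "normal_part f x (0, a) \<bullet> \<tau> l = 0" for a l by (simp add: np inner_diff_left \<tau>0 P\<tau>)
 have nP: "normal_part f x (0, a) \<bullet> P b = 0" for a b by (simp add: P_def inner_sum_right n\<tau>)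
 have "normal_part f x (0, a) \<bullet> normal_part f x (0, b) = normal_part f x (0, a) \<bullet> (0, b)"
  by (subst (2) np) (simp add: inner_diff_right nP)
 also have "... = a \<bullet> b - P a \<bullet> (0, b)" by (simp add: np inner_diff_left)
 also have "P a \<bullet> (0, b) = (G *v s a) \<bullet> s b"
  by (simp add: P_def inner_sum_left inner_commute[of "\<tau> _"] \<tau>0 inner_vec_def)
 also have "(G *v s a) \<bullet> s b = (\<Sum>\<alpha> \<beta>. (d \<alpha> \<bullet> (G *v d \<beta>)) * a $ \<alpha> * b $ \<beta>)"
 proof -
  have sG: "transpose G = G" by (simp add: G_def gm transpose_matrix_inv_gram)
  have "(G *v s a) \<bullet> s b = s a \<bullet> (G *v s b)" by (rule matrix_sym_inner[OF sG])
  also have "G *v s b = (\<Sum>\<beta>. b $ \<beta> *\<^sub>R (G *v d \<beta>))"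
   unfolding s_def by (simp add: linear_sum[OF matrix_vector_mul_linear] matrix_vector_mult_scaleR)
  also have "s a \<bullet> (\<Sum>\<beta>. b $ \<beta> *\<^sub>R (G *v d \<beta>)) = (\<Sum>\<beta> \<alpha>. (d \<alpha> \<bullet> (G *v d \<beta>)) * a $ \<alpha> * b $ \<beta>)"
   by (simp add: s_def inner_sum_left inner_sum_right sum_distrib_left mult_ac)
  also have "... = (\<Sum>\<alpha> \<beta>. (d \<alpha> \<bullet> (G *v d \<beta>)) * a $ \<alpha> * b $ \<beta>)" by (rule sum.swap)
  finally show ?thesis .
 qed
 also have "a \<bullet> b = (\<Sum>\<alpha> \<beta>. (if \<alpha> = \<beta> then 1 else 0) * a $ \<alpha> * b $ \<beta>)"
  by (simp add: inner_vec_def if_distrib[of "\<lambda>c. c * _"] cong: if_cong)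
 finally show "normal_part f x (0, a) \<bullet> normal_part f x (0, b) =
  (\<Sum>\<alpha> \<beta>. ((if \<alpha> = \<beta> then 1 else 0) - grad_vec f \<alpha> x \<bullet> (inv_metric f x *v grad_vec f \<beta> x)) * a $ \<alpha> * b $ \<beta>)"
  by (simp add: G_def d_def sum_subtractf[symmetric] algebra_simps)
 have "\<tau> k \<bullet> normal_frame f \<gamma> x = 0" for k
  by (simp add: \<tau>_def tangent_frame_def normal_frame_def inner_axis' inner_axis)
 hence "P a \<bullet> normal_frame f \<gamma> x = 0" by (simp add: P_def inner_sum_left)
 thus "normal_part f x (0, a) \<bullet> normal_frame f \<gamma> x = a $ \<gamma>"
  by (simp add: np inner_diff_left normal_frame_def inner_axis)
qed

text \<open>The coefficients \<open>c\<^sub>i\<^sub>j\<close> of \<open>flux_field\<close> with respect to \<open>\<partial>\<^sub>i h\<close>, where \<open>h = D1 f \<alpha> k\<close> and \<open>a = (\<alpha>, k)\<close>; they are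
 antisymmetric because the difference subtracts the term with \<open>i\<close> and \<open>j\<close> exchanged.\<close>

definition flux_coeff :: "(real^'n => real^'m) => 'm \<times> 'n => 'n => 'n => real^'n => real" where
 "flux_coeff f a i j x = graph_gradient f (fst a) x $ j * inv_metric f x $ i $ (snd a)
   - graph_gradient f (fst a) x $ i * inv_metric f x $ j $ (snd a)"

lemma graph_metric_invertible: "invertible (graph_metric f x)"
 by (simp add: graph_metric_gram invertible_gram)

lemma transpose_inv_metric: "transpose (inv_metric f x) = inv_metric f x"
 unfolding graph_metric_gram by (rule transpose_matrix_inv_gram)

lemma sum_UNIV_prod: "(\<Sum>a. F (fst a) (snd a)) = (\<Sum>\<alpha> k. F \<alpha> k)"
 by (simp add: sum.cartesian_product case_prod_unfold)

context
 fixes f :: "real^'n => real^'m" and D :: "(real^'n) set"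
 assumes f: "\<And>\<alpha>. C2_scalar D (\<lambda>x. f x $ \<alpha>)"
begin

lemma C2_open: "open D"
 using C1_on_openD[OF C2_scalar_C1[OF f]] .

lemma D1_C1: "C1_on D (D1 f \<alpha> i)"
 unfolding D1_def by (rule C2_scalar_pd[OF f])

lemma D2_continuous: "continuous_on D (D2 f \<alpha> i j)"
 unfolding D2_def by (rule C1_on_pd_continuous[OF D1_C1])

lemma hess_continuous: "continuous_on D (\<lambda>x. hess f \<alpha> x $ i $ j)"
 unfolding hess_def using D2_continuous by simp

lemma transpose_hess: "x \<in> D ==> transpose (hess f \<alpha> x) = hess f \<alpha> x"
 unfolding hess_def D2_def D1_def transpose_def by (simp add: pd_symmetric[OF f])

lemma graph_metric_C1: "C1_on D (\<lambda>x. graph_metric f x $ i $ j)"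
 unfolding graph_metric_def by (auto intro!: C1_on_add C1_on_sum C1_on_mult C1_on_const D1_C1 C2_open)

lemma graph_metric_inv_C1: "C1_on D (\<lambda>x. inv_metric f x $ i $ j)"
 by (rule C1_on_matrix_inv[OF C2_open graph_metric_C1 graph_metric_invertible])

lemma graph_gradient_nth: "graph_gradient f \<alpha> x $ i = (\<Sum>j. inv_metric f x $ i $ j * D1 f \<alpha> j x)"
 by (simp add: graph_gradient_def matrix_vector_mult_def)

lemma graph_gradient_C1: "C1_on D (\<lambda>x. graph_gradient f \<alpha> x $ i)"
 unfolding graph_gradient_nth by (intro C1_on_sum C1_on_mult graph_metric_inv_C1 D1_C1 C2_open)

lemma graph_metric_pd:
 assumes x: "x \<in> D"
 shows "pd l (\<lambda>x. graph_metric f x $ i $ j) x = (\<Sum>\<beta>. D2 f \<beta> i l x * D1 f \<beta> j x + D1 f \<beta> i x * D2 f \<beta> j l x)"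
proof -
 note d = C1_on_differentiable[OF D1_C1 x] C1_on_differentiable[OF C1_on_mult[OF D1_C1 D1_C1] x]
 have "pd l (\<lambda>x. graph_metric f x $ i $ j) x = pd l (\<lambda>x. (if i = j then 1 else 0) + (\<Sum>\<beta>. D1 f \<beta> i x * D1 f \<beta> j x)) x"
  by (simp add: graph_metric_def)
 also have "... = pd l (\<lambda>x. \<Sum>\<beta>. D1 f \<beta> i x * D1 f \<beta> j x) x"
  by (subst pd_add) (auto intro!: differentiable_sum d)
 also have "... = (\<Sum>\<beta>. pd l (\<lambda>x. D1 f \<beta> i x * D1 f \<beta> j x) x)"
  by (intro pd_sum d)
 finally show ?thesis by (simp add: pd_mult d D2_def)
qed

lemma pd_graph_metric_inv:
 assumes x: "x \<in> D"
 shows "pd j (\<lambda>x. inv_metric f x $ i $ k) x =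
  dG (inv_metric f x) (\<lambda>\<alpha>. hess f \<alpha> x) (\<lambda>\<alpha>. grad_vec f \<alpha> x) j i k"
proof -
 define G where "G = inv_metric f x"
 have sG: "G $ a $ b = G $ b $ a" for a b
  unfolding G_def graph_metric_gram by (rule transpose_nth_sym[OF transpose_matrix_inv_gram])
 have "pd j (\<lambda>x. inv_metric f x $ i $ k) x =
  - (\<Sum>c d. G $ i $ c * (\<Sum>\<beta>. D2 f \<beta> c j x * D1 f \<beta> d x + D1 f \<beta> c x * D2 f \<beta> d j x) * G $ d $ k)"
  unfolding G_def by (simp add: pd_matrix_inv[OF graph_metric_C1 graph_metric_invertible x] graph_metric_pd x)
 also have "(\<Sum>c d. G $ i $ c * (\<Sum>\<beta>. D2 f \<beta> c j x * D1 f \<beta> d x + D1 f \<beta> c x * D2 f \<beta> d j x) * G $ d $ k) =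
  (\<Sum>c d \<beta>. (G $ i $ c * D2 f \<beta> c j x) * (G $ k $ d * D1 f \<beta> d x) + (G $ i $ c * D1 f \<beta> c x) * (G $ k $ d * D2 f \<beta> d j x))"
  unfolding sum_distrib_left sum_distrib_right
  by (intro sum.cong refl) (simp add: algebra_simps sG[of k])
 also have "... = (\<Sum>\<beta> c d. (G $ i $ c * D2 f \<beta> c j x) * (G $ k $ d * D1 f \<beta> d x) + (G $ i $ c * D1 f \<beta> c x) * (G $ k $ d * D2 f \<beta> d j x))"
  by (simp only: sum.swap[of _ "UNIV :: 'm set"])
 also have "... = (\<Sum>\<beta>. (G ** hess f \<beta> x) $ i $ j * (G *v grad_vec f \<beta> x) $ k + (G *v grad_vec f \<beta> x) $ i * (G ** hess f \<beta> x) $ k $ j)"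
  by (simp add: matrix_matrix_mult_def matrix_vector_mult_def hess_def grad_vec_def sum.distrib sum_product)
 finally show ?thesis
  by (simp add: dG_def Mm_def pv_def G_def)
qed

lemma pd_graph_gradient:
 assumes x: "x \<in> D"
 shows "pd j (\<lambda>x. graph_gradient f \<alpha> x $ i) x =
  dpv (inv_metric f x) (\<lambda>\<alpha>. hess f \<alpha> x) (\<lambda>\<alpha>. grad_vec f \<alpha> x) \<alpha> i j"
proof -
 define G where "G = inv_metric f x"
 define H where "H \<alpha> = hess f \<alpha> x" for \<alpha>
 define d where "d \<alpha> = grad_vec f \<alpha> x" for \<alpha>
 have symG: "transpose G = G" unfolding G_def by (rule transpose_inv_metric)
 have symH: "transpose (H \<alpha>) = H \<alpha>" for \<alpha> unfolding H_def by (rule transpose_hess[OF x])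
 note di = C1_on_differentiable[OF graph_metric_inv_C1 x] C1_on_differentiable[OF D1_C1 x]
  C1_on_differentiable[OF C1_on_mult[OF graph_metric_inv_C1 D1_C1] x]
 have Gpd: "pd j (\<lambda>x. inv_metric f x $ i $ c) x = dG G H d j i c" for c
  using pd_graph_metric_inv[OF x] by (simp add: G_def H_def[abs_def] d_def[abs_def])
 have "pd j (\<lambda>x. graph_gradient f \<alpha> x $ i) x = (\<Sum>c. pd j (\<lambda>x. inv_metric f x $ i $ c * D1 f \<alpha> c x) x)"
  unfolding graph_gradient_nth by (intro pd_sum di)
 also have "... = (\<Sum>c. dG G H d j i c * d \<alpha> $ c + G $ i $ c * H \<alpha> $ c $ j)"
  by (simp add: pd_mult di Gpd) (simp add: G_def H_def d_def hess_def grad_vec_def D2_def)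
 also have "... = (\<Sum>c. dG G H d j i c * d \<alpha> $ c) + Mm G H \<alpha> $ i $ j"
  by (simp add: sum.distrib Mm_def matrix_matrix_mult_def)
 also have "(\<Sum>c. dG G H d j i c * d \<alpha> $ c) =
   - (\<Sum>\<beta> c. Mm G H \<beta> $ i $ j * (d \<alpha> $ c * pv G d \<beta> $ c) + pv G d \<beta> $ i * (Mm G H \<beta> $ c $ j * d \<alpha> $ c))"
  unfolding dG_def by (subst sum.swap) (simp add: sum_distrib_left sum_distrib_right sum_negf[symmetric] algebra_simps)
 also have "... = - (\<Sum>\<beta>. Mm G H \<beta> $ i $ j * (d \<alpha> \<bullet> pv G d \<beta>) + pv G d \<beta> $ i * (H \<beta> *v pv G d \<alpha>) $ j)"
 proof -
  have "(\<Sum>c. Mm G H \<beta> $ c $ j * d \<alpha> $ c) = (H \<beta> *v pv G d \<alpha>) $ j" for \<beta>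
  proof -
   have "(\<Sum>c. Mm G H \<beta> $ c $ j * d \<alpha> $ c) = (Mm G H \<beta> *v axis j 1) \<bullet> d \<alpha>"
    by (simp add: matrix_vector_mult_basis column_def inner_vec_def)
   also have "... = (H \<beta> *v axis j 1) \<bullet> (G *v d \<alpha>)"
    unfolding Mm_def matrix_vector_mul_assoc[symmetric] by (rule matrix_sym_inner[OF symG])
   also have "... = axis j 1 \<bullet> (H \<beta> *v pv G d \<alpha>)" unfolding pv_def by (rule matrix_sym_inner[OF symH])
   finally show ?thesis by (simp add: inner_axis')
  qed
  thus ?thesis by (simp add: sum.distrib sum_distrib_left[symmetric] inner_vec_def)
 qed
 also have "- (\<Sum>\<beta>. Mm G H \<beta> $ i $ j * (d \<alpha> \<bullet> pv G d \<beta>) + pv G d \<beta> $ i * (H \<beta> *v pv G d \<alpha>) $ j) + Mm G H \<alpha> $ i $ j = dpv G H d \<alpha> i j"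
 proof -
  have "(\<Sum>\<beta>. (if \<alpha> = \<beta> then 1 else 0) * Mm G H \<beta> $ i $ j) = Mm G H \<alpha> $ i $ j"
   by (simp add: if_distrib[of "\<lambda>c. c * _"] cong: if_cong)
  thus ?thesis unfolding dpv_def Uc_def by (simp add: left_diff_distrib sum.distrib sum_subtractf algebra_simps)
 qed
 finally show ?thesis by (simp add: G_def H_def[abs_def] d_def[abs_def])
qed

text \<open>Contraction of the Gauss equation.\<close>

lemma scalar_curvature_eq:
 assumes x: "x \<in> D"
 shows "scalar_curvature f x = (\<Sum>\<alpha> \<beta>.
  Uc (inv_metric f x) (\<lambda>\<alpha>. grad_vec f \<alpha> x) \<alpha> \<beta> *
  (trace (inv_metric f x ** hess f \<alpha> x) * trace (inv_metric f x ** hess f \<beta> x)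
   - trace ((inv_metric f x ** hess f \<alpha> x) ** (inv_metric f x ** hess f \<beta> x))))"
proof -
 define G where "G = inv_metric f x"
 define H where "H \<alpha> = hess f \<alpha> x" for \<alpha>
 define U where "U \<alpha> \<beta> = Uc G (\<lambda>\<alpha>. grad_vec f \<alpha> x) \<alpha> \<beta>" for \<alpha> \<beta>
 have symG: "transpose G = G" unfolding G_def by (rule transpose_inv_metric)
 have symH: "transpose (H \<alpha>) = H \<alpha>" for \<alpha> unfolding H_def by (rule transpose_hess[OF x])
 note sG = transpose_nth_sym[OF symG] and sH = transpose_nth_sym[OF symH]
 have B: "second_fundamental_form f i j x \<bullet> second_fundamental_form f k l x = (\<Sum>\<alpha> \<beta>. U \<alpha> \<beta> * (H \<alpha> $ i $ j * H \<beta> $ k $ l))" for i j k l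
  unfolding second_fundamental_form_def inner_normal_part
  by (simp add: U_def Uc_def pv_def G_def H_def hess_def mult.assoc)
 have "scalar_curvature f x = (\<Sum>i j k l \<alpha> \<beta>.
   U \<alpha> \<beta> * (G $ i $ l * G $ j $ k * (H \<alpha> $ i $ l * H \<beta> $ j $ k - H \<alpha> $ i $ k * H \<beta> $ j $ l)))"
  unfolding scalar_curvature_def riemann_def B G_def[symmetric]
  by (intro sum.cong refl) (simp add: sum_distrib_left sum_subtractf[symmetric] algebra_simps)
 also have "... = (\<Sum>\<alpha> \<beta> i j k l.
   U \<alpha> \<beta> * (G $ i $ l * G $ j $ k * (H \<alpha> $ i $ l * H \<beta> $ j $ k - H \<alpha> $ i $ k * H \<beta> $ j $ l)))"
  by (simp only: sum.swap[of _ "UNIV :: 'm set" "UNIV :: 'n set"])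
 also have "... = (\<Sum>\<alpha> \<beta>. U \<alpha> \<beta> * (trace (G ** H \<alpha>) * trace (G ** H \<beta>) - trace ((G ** H \<alpha>) ** (G ** H \<beta>))))"
 proof (intro sum.cong refl)
  fix \<alpha> \<beta>
  have tr: "trace (G ** H \<gamma>) = (\<Sum>i l. G $ i $ l * H \<gamma> $ i $ l)" for \<gamma>
   by (simp add: trace_def matrix_matrix_mult_def sH[of \<gamma>])
  have 1: "trace (G ** H \<alpha>) * trace (G ** H \<beta>) = (\<Sum>i j k l. G $ i $ l * G $ j $ k * (H \<alpha> $ i $ l * H \<beta> $ j $ k))"
  proof -
   have "trace (G ** H \<alpha>) * trace (G ** H \<beta>) = (\<Sum>i j l k. G $ i $ l * G $ j $ k * (H \<alpha> $ i $ l * H \<beta> $ j $ k))"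
    unfolding tr sum_product by (intro sum.cong refl) (simp add: mult_ac)
   also have "... = (\<Sum>i j k l. G $ i $ l * G $ j $ k * (H \<alpha> $ i $ l * H \<beta> $ j $ k))"
    by (intro sum.cong refl sum.swap)
   finally show ?thesis .
  qed
  have 2: "trace ((G ** H \<alpha>) ** (G ** H \<beta>)) = (\<Sum>i j k l. G $ i $ l * G $ j $ k * (H \<alpha> $ i $ k * H \<beta> $ j $ l))"
  proof -
   have "trace ((G ** H \<alpha>) ** (G ** H \<beta>)) = trace ((H \<alpha> ** G) ** (H \<beta> ** G))"
    by (metis matrix_mul_assoc trace_mul_sym)
   also have "... = (\<Sum>i j. (\<Sum>k. H \<alpha> $ i $ k * G $ k $ j) * (\<Sum>l. H \<beta> $ j $ l * G $ l $ i))"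
    by (simp add: trace_def matrix_matrix_mult_def)
   also have "... = (\<Sum>i j k l. G $ i $ l * G $ j $ k * (H \<alpha> $ i $ k * H \<beta> $ j $ l))"
    unfolding sum_product
   proof (intro sum.cong refl)
    fix i j k l
    show "(H \<alpha> $ i $ k * G $ k $ j) * (H \<beta> $ j $ l * G $ l $ i) = G $ i $ l * G $ j $ k * (H \<alpha> $ i $ k * H \<beta> $ j $ l)"
     using sG[of k j] sG[of l i] by simp
   qed
   finally show ?thesis .
  qed
  show "(\<Sum>i j k l.
   U \<alpha> \<beta> * (G $ i $ l * G $ j $ k * (H \<alpha> $ i $ l * H \<beta> $ j $ k - H \<alpha> $ i $ k * H \<beta> $ j $ l))) =
   U \<alpha> \<beta> * (trace (G ** H \<alpha>) * trace (G ** H \<beta>) - trace ((G ** H \<alpha>) ** (G ** H \<beta>)))"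
   unfolding 1 2 sum_subtractf[symmetric] right_diff_distrib[symmetric] sum_distrib_left ..
 qed
 finally show ?thesis by (simp add: G_def H_def U_def)
qed

lemma shape_operator_eq: "shape_operator f \<alpha> x = inv_metric f x ** hess f \<alpha> x"
 by (simp add: shape_operator_def hess_def second_fundamental_form_def inner_normal_part)

lemma S_perp_eq:
 "S_perp f x = (\<Sum>\<alpha> \<beta>.
   ((inv_metric f x ** hess f \<alpha> x) *v graph_gradient f \<alpha> x) \<bullet> (hess f \<beta> x *v graph_gradient f \<beta> x) -
   ((inv_metric f x ** hess f \<alpha> x) *v graph_gradient f \<beta> x) \<bullet> (hess f \<beta> x *v graph_gradient f \<alpha> x))"
proof -
 have "graph_metric f x *v ((inv_metric f x ** A) *v v) = A *v v" for A and v :: "real^'n"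
  unfolding matrix_vector_mul_assoc matrix_mul_assoc graph_metric_gram matrix_inv_gram by simp
 thus ?thesis by (simp add: S_perp_def metric_inner_def shape_operator_eq)
qed

lemma flux_coeff_C1: "C1_on D (flux_coeff f a i j)"
 unfolding flux_coeff_def[abs_def] by (intro C1_on_diff C1_on_mult graph_gradient_C1 graph_metric_inv_C1)

lemma flux_field_coeff:
 "flux_field f x $ j = (\<Sum>a i. flux_coeff f a i j x * pd i (D1 f (fst a) (snd a)) x)"
proof -
 define G where "G = inv_metric f x"
 have "(\<Sum>a i. flux_coeff f a i j x * pd i (D1 f (fst a) (snd a)) x) =
  (\<Sum>\<alpha> k i. (graph_gradient f \<alpha> x $ j * G $ i $ k - graph_gradient f \<alpha> x $ i * G $ j $ k) * hess f \<alpha> x $ k $ i)"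
  unfolding flux_coeff_def
  by (subst sum_UNIV_prod) (simp add: G_def hess_def D2_def)
 also have "... = (\<Sum>\<alpha>. graph_gradient f \<alpha> x $ j * trace (G ** hess f \<alpha> x) - ((G ** hess f \<alpha> x) *v graph_gradient f \<alpha> x) $ j)"
 proof (intro sum.cong refl)
  fix \<alpha>
  have 1: "trace (G ** hess f \<alpha> x) = (\<Sum>k i. G $ i $ k * hess f \<alpha> x $ k $ i)"
   unfolding trace_def matrix_matrix_mult_def by (subst sum.swap) simp
  have 2: "((G ** hess f \<alpha> x) *v graph_gradient f \<alpha> x) $ j = (\<Sum>k i. graph_gradient f \<alpha> x $ i * G $ j $ k * hess f \<alpha> x $ k $ i)"
   unfolding matrix_vector_mult_def matrix_matrix_mult_def
   by (subst sum.swap) (simp add: sum_distrib_left sum_distrib_right mult_ac)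
  show "(\<Sum>k i. (graph_gradient f \<alpha> x $ j * G $ i $ k - graph_gradient f \<alpha> x $ i * G $ j $ k) * hess f \<alpha> x $ k $ i) =
   graph_gradient f \<alpha> x $ j * trace (G ** hess f \<alpha> x) - ((G ** hess f \<alpha> x) *v graph_gradient f \<alpha> x) $ j"
   unfolding 1 2 by (simp add: left_diff_distrib sum_subtractf sum_distrib_left mult.assoc)
 qed
 finally show ?thesis by (simp add: flux_field_def G_def mult.commute)
qed

lemma flux_field_continuous: "continuous_on D (\<lambda>x. flux_field f x $ j)"
 unfolding flux_field_coeff
 by (intro continuous_intros C1_on_continuous[OF flux_coeff_C1] C1_on_pd_continuous[OF D1_C1])

lemma curvature_divergence:
 assumes x: "x \<in> D"
 shows "(\<Sum>a i j. pd j (flux_coeff f a i j) x * pd i (D1 f (fst a) (snd a)) x) = scalar_curvature f x + S_perp f x"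
proof -
 define G where "G = inv_metric f x"
 define H where "H \<alpha> = hess f \<alpha> x" for \<alpha>
 define d where "d \<alpha> = grad_vec f \<alpha> x" for \<alpha>
 have symG: "transpose G = G" unfolding G_def by (rule transpose_inv_metric)
 have symH: "transpose (H \<alpha>) = H \<alpha>" for \<alpha> unfolding H_def by (rule transpose_hess[OF x])
 note di = C1_on_differentiable[OF graph_metric_inv_C1 x] C1_on_differentiable[OF graph_gradient_C1 x]
  C1_on_differentiable[OF C1_on_mult[OF graph_gradient_C1 graph_metric_inv_C1] x]
 have Gpd: "pd j (\<lambda>x. inv_metric f x $ i $ c) x = dG G H d j i c" for i j c
  using pd_graph_metric_inv[OF x] by (simp add: G_def H_def[abs_def] d_def[abs_def])
 have ppd: "pd j (\<lambda>x. graph_gradient f \<alpha> x $ i) x = dpv G H d \<alpha> i j" for \<alpha> i j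
  using pd_graph_gradient[OF x] by (simp add: G_def H_def[abs_def] d_def[abs_def])
 have p: "graph_gradient f \<alpha> x = pv G d \<alpha>" for \<alpha> by (simp add: graph_gradient_def pv_def G_def d_def grad_vec_def)
 have "pd j (flux_coeff f a i j) x = (dpv G H d (fst a) j j * G $ i $ (snd a) + pv G d (fst a) $ j * dG G H d j i (snd a))
   - (dpv G H d (fst a) i j * G $ j $ (snd a) + pv G d (fst a) $ i * dG G H d j j (snd a))" for a i j
  unfolding flux_coeff_def[abs_def] by (simp add: pd_diff pd_mult di Gpd ppd p G_def[symmetric])
 hence "(\<Sum>a i j. pd j (flux_coeff f a i j) x * pd i (D1 f (fst a) (snd a)) x) =
  (\<Sum>a i j. ((dpv G H d (fst a) j j * G $ i $ (snd a) + pv G d (fst a) $ j * dG G H d j i (snd a))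
   - (dpv G H d (fst a) i j * G $ j $ (snd a) + pv G d (fst a) $ i * dG G H d j j (snd a))) * H (fst a) $ (snd a) $ i)"
  by (simp add: H_def hess_def D2_def)
 also have "... = (\<Sum>\<alpha> k i j. ((dpv G H d \<alpha> j j * G $ i $ k + pv G d \<alpha> $ j * dG G H d j i k)
   - (dpv G H d \<alpha> i j * G $ j $ k + pv G d \<alpha> $ i * dG G H d j j k)) * H \<alpha> $ k $ i)"
  by (rule sum_UNIV_prod)
 also have "... = scalar_curvature f x + S_perp f x"
  unfolding divergence_algebra[OF symG symH] scalar_curvature_eq[OF x] S_perp_eq p
  by (simp add: G_def H_def[abs_def] d_def[abs_def] Mm_def)
 finally show ?thesis .
qed

text \<open>\<open>S + S\<^sup>\<bottom>\<close> is the Euclidean divergence of the flux field, weakly, although the field is only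
 continuous.\<close>

theorem weak_divergence_flux_field:
 assumes \<phi>: "C1_on UNIV \<phi>" and K: "compact K" "K \<subseteq> D" "\<And>x. x \<notin> K ==> \<phi> x = 0"
 shows "integrable lborel (\<lambda>x. \<Sum>j. flux_field f x $ j * pd j \<phi> x)"
  and "integrable lborel (\<lambda>x. (scalar_curvature f x + S_perp f x) * \<phi> x)"
  and "(LINT x|lborel. (\<Sum>j. flux_field f x $ j * pd j \<phi> x)) = - (LINT x|lborel. (scalar_curvature f x + S_perp f x) * \<phi> x)"
proof -
 have anti: "flux_coeff f a i j x = - flux_coeff f a j i x" for a i j x by (simp add: flux_coeff_def)
 note W = weak_divergence_antisymmetric[where A = UNIV and c = "flux_coeff f" and h = "\<lambda>a. D1 f (fst a) (snd a)" and D = D,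
   OF flux_coeff_C1 D1_C1 C2_open anti \<phi> K]
 have e: "(\<Sum>a i j. pd j (flux_coeff f a i j) x * pd i (D1 f (fst a) (snd a)) x) * \<phi> x =
   (scalar_curvature f x + S_perp f x) * \<phi> x" for x
  using curvature_divergence[of x] K(2,3) by (cases "x \<in> D") auto
 show "integrable lborel (\<lambda>x. \<Sum>j. flux_field f x $ j * pd j \<phi> x)"
  unfolding flux_field_coeff by (rule W(1))
 show "integrable lborel (\<lambda>x. (scalar_curvature f x + S_perp f x) * \<phi> x)"
  using W(2) unfolding e .
 show "(LINT x|lborel. (\<Sum>j. flux_field f x $ j * pd j \<phi> x)) = - (LINT x|lborel. (scalar_curvature f x + S_perp f x) * \<phi> x)"
  unfolding flux_field_coeff using W(3) unfolding e .
qed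

end

section \<open>The divergence theorem up to the boundary\<close>

lemma set_coord_axis: "set_coord k t y = set_coord k 0 y + t *\<^sub>R axis k 1"
 by (auto simp: vec_eq_iff axis_def)

lemma has_real_derivative_set_coord:
 fixes w :: "real^'n => real"
 assumes "w differentiable (at (set_coord k t y))"
 shows "((\<lambda>t. w (set_coord k t y)) has_real_derivative pd k w (set_coord k t y)) (at t)"
 using has_real_derivative_along_axis[of w "set_coord k 0 y" t k] assms
 by (simp only: set_coord_axis[symmetric])

definition cylinder :: "'n::finite => real^'n => real^'n => (real^'n) set" where
 "cylinder k a b = {y. \<forall>j. j \<noteq> k --> a $ j < y $ j \<and> y $ j < b $ j}"

lemma open_cylinder: "open (cylinder k a b)"
proof -
 have "cylinder k a b = (\<Inter>j\<in>UNIV - {k}. {y. a $ j < y $ j} \<inter> {y. y $ j < b $ j})" by (auto simp: cylinder_def)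
 thus ?thesis by (auto intro!: open_INT open_Int open_Collect_less continuous_intros)
qed

lemma cylinder_set_coord [simp]: "set_coord k t y \<in> cylinder k a b \<longleftrightarrow> y \<in> cylinder k a b"
 by (auto simp: cylinder_def)

lemma cylinder_cbox:
 "y \<in> cylinder k a b ==> a $ k = 0 ==> 0 \<le> t ==> t \<le> b $ k ==> set_coord k t y \<in> cbox a b"
 by (auto simp: cylinder_def mem_box_cart less_imp_le)

lemma box_cylinder: "a $ k = 0 ==> y \<in> box a b \<longleftrightarrow> y \<in> cylinder k a b \<and> 0 < y $ k \<and> y $ k < b $ k"
 by (auto simp: cylinder_def box_vec) metis+

lemma has_derivative_graph_map:
 fixes w :: "real^'n => real"
 assumes "w differentiable (at y)"
 shows "((\<lambda>y. set_coord k (w y) y) has_derivative (\<lambda>v. set_coord k (\<Sum>c. v $ c * pd c w y) v)) (at y)"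
proof (rule has_derivative_vec_components)
 fix j
 show "((\<lambda>y. set_coord k (w y) y $ j) has_derivative (\<lambda>v. set_coord k (\<Sum>c. v $ c * pd c w y) v $ j)) (at y)"
  using has_derivative_pd[OF assms] has_derivative_nth by (cases "j = k") auto
qed

text \<open>A field with weak divergence \<open>s\<close>.  The test functions are supported inside \<open>D\<close>, so \<open>X\<close> may be
 unbounded near the boundary.\<close>

locale weak_field =
 fixes D :: "(real^'n) set" and X :: "real^'n => real^'n" and s :: "real^'n => real"
 assumes D_open: "open D" and X_cont: "\<And>j. continuous_on D (\<lambda>x. X x $ j)"
  and s_int: "set_integrable lborel D s"
  and weak: "\<And>\<phi> K. C1_on UNIV \<phi> ==> compact K ==> K \<subseteq> D ==> (\<And>x. x \<notin> K ==> \<phi> x = 0) ==>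
   (LINT x|lborel. (\<Sum>j. X x $ j * pd j \<phi> x)) = - (LINT x|lborel. s x * \<phi> x)"
begin

definition flux_diff :: "(real^'n => real) => real^'n => real" where
 "flux_diff \<phi> x = (\<Sum>j. X x $ j * pd j \<phi> x)"

lemma flux_diff_continuous: "C1_on V \<phi> ==> V \<subseteq> D ==> continuous_on V (flux_diff \<phi>)"
 unfolding flux_diff_def
 by (intro continuous_intros continuous_on_subset[OF X_cont] C1_on_pd_continuous)

lemma s_test_int:
 assumes \<phi>: "C1_on UNIV \<phi>" and K: "compact K" "\<And>x. x \<notin> K ==> \<phi> x = 0"
 shows "set_integrable lborel D (\<lambda>x. s x * \<phi> x)"
 unfolding set_integrable_def
proof -
 have c: "continuous_on UNIV \<phi>" by (rule C1_on_continuous[OF \<phi>])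
 obtain C where C: "\<And>x. \<bar>\<phi> x\<bar> \<le> C" by (rule compact_support_bounded[OF K(1) continuous_on_subset[OF c] K(2)]) auto
 have i: "integrable lborel (\<lambda>x. indicator D x *\<^sub>R s x)" using s_int by (simp add: set_integrable_def)
 have "integrable lborel (\<lambda>x. (indicator D x *\<^sub>R s x) * \<phi> x)"
 proof (rule Bochner_Integration.integrable_bound)
  show "integrable lborel (\<lambda>x. C * (indicator D x *\<^sub>R s x))" using i by simp
  show "(\<lambda>x. (indicator D x *\<^sub>R s x) * \<phi> x) \<in> borel_measurable lborel"
   using i borel_measurable_continuous_onI[OF c] by measurable
  show "AE x in lborel. norm ((indicator D x *\<^sub>R s x) * \<phi> x) \<le> norm (C * (indicator D x *\<^sub>R s x))"
   using order_trans[OF C abs_ge_self] by (intro AE_I2) (auto simp: abs_mult mult.commute intro!: mult_right_mono)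
 qed
 thus "integrable lborel (\<lambda>x. indicator D x *\<^sub>R (s x * \<phi> x))" by (simp add: mult.assoc)
qed

lemma flux_diff_zero_outside:
 assumes "compact K" "\<And>x. x \<notin> K ==> \<phi> x = 0" "x \<notin> K"
 shows "flux_diff \<phi> x = 0"
 unfolding flux_diff_def using pd_zero_outside[OF compact_imp_closed[OF assms(1)] assms(2,3)] by simp

lemma flux_diff_integrable:
 assumes \<phi>: "C1_on UNIV \<phi>" and K: "compact K" "K \<subseteq> D" "\<And>x. x \<notin> K ==> \<phi> x = 0"
 shows "integrable lborel (flux_diff \<phi>)"
 by (rule integrable_compact_support[OF K(1) _ flux_diff_zero_outside[of K \<phi>, OF K(1,3)]])
  (rule continuous_on_subset[OF flux_diff_continuous[OF C1_on_subset[OF \<phi> D_open]] K(2)], auto)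

text \<open>The divergence theorem for test functions supported in \<open>W\<close>, with \<open>h\<close> the density of the flux of
 \<open>X\<close> through \<open>S\<close> into \<open>D\<close>.\<close>

definition boundary_term_near :: "(real^'n) measure => (real^'n) set => (real^'n => real) => (real^'n) set => bool" where
 "boundary_term_near \<sigma> S h W \<longleftrightarrow> (\<forall>\<phi> K. C1_on UNIV \<phi> --> compact K --> K \<subseteq> W --> (\<forall>x. x \<notin> K --> \<phi> x = 0) -->
   set_integrable lborel D (flux_diff \<phi>) \<and> set_integrable \<sigma> S (\<lambda>x. \<phi> x * h x) \<and>
   (LINT x:D|lborel. flux_diff \<phi> x) + (LINT x:D|lborel. s x * \<phi> x) = - (LINT x:S|\<sigma>. \<phi> x * h x))"

end

text \<open>The boundary contribution of a collar.  The map \<open>y \<mapsto> set_coord k (w y) y\<close> sends the part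
 \<open>y\<^sub>k > 0\<close> of a box into \<open>D\<close> and the face \<open>y\<^sub>k = 0\<close> to the boundary, where its Jacobian \<open>\<partial>\<^sub>k w\<close> may
 vanish and \<open>X\<close> may blow up; only the contravariant density \<open>Y\<close> which represents \<open>X\<close> in the
 coordinates \<open>y\<close> has to extend continuously to the face.  The proof tests with cut-off
 functions of \<open>y\<^sub>k / \<epsilon>\<close>.\<close>

locale collar = weak_field D X s
 for D :: "(real^'n) set" and X s +
 fixes k :: 'n and a b :: "real^'n" and Q w Y W
 assumes a_k: "a $ k = 0" and a_less_b: "\<And>j. a $ j < b $ j"
  and w_C1: "C1_on Q w" and cbox_Q: "cbox a b \<subseteq> Q"
  and inj: "inj_on (\<lambda>y. set_coord k (w y) y) (box a b)" and nz: "\<And>y. y \<in> box a b ==> pd k w y \<noteq> 0"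
  and image_D: "\<And>y. y \<in> box a b ==> set_coord k (w y) y \<in> D"
  and open_W: "open W" and cover: "\<And>x. x \<in> W ==> x \<in> D ==> \<exists>y\<in>box a b. set_coord k (w y) y = x"
  and Y_cont: "\<And>c. continuous_on (cbox a b) (\<lambda>y. Y y $ c)"
  and X_Y: "\<And>y j. y \<in> box a b ==> \<bar>pd k w y\<bar> * X (set_coord k (w y) y) $ j =
   (if j = k then (\<Sum>c. pd c w y * Y y $ c) else Y y $ j)"
  and exhaust: "\<And>x \<epsilon>. x \<in> W ==> x \<notin> D ==> \<epsilon> > 0 ==>
   \<exists>N. open N \<and> x \<in> N \<and> (\<forall>y\<in>box a b. set_coord k (w y) y \<in> N --> y $ k < \<epsilon>)"
begin

lemma box_cbox: "y \<in> box a b ==> y \<in> cbox a b"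
 using box_subset_cbox by blast

lemma w_differentiable: "y \<in> cbox a b ==> w differentiable (at y)"
 using C1_on_differentiable[OF w_C1] cbox_Q by blast

lemma w_continuous: "continuous_on (cbox a b) w" "continuous_on (cbox a b) (pd c w)"
 using continuous_on_subset[OF C1_on_continuous[OF w_C1] cbox_Q] continuous_on_subset[OF C1_on_pd_continuous[OF w_C1] cbox_Q] .

sublocale shear k "box a b" w "pd k w"
proof unfold_locales
 show "((\<lambda>t. w (set_coord k t y)) has_real_derivative pd k w y) (at (y $ k))" if "y \<in> box a b" for y
  using has_real_derivative_set_coord[of w k "y $ k" y] w_differentiable[OF box_cbox[OF that]] by simp
qed (use inj continuous_on_subset[OF w_continuous(1) box_subset_cbox] continuous_on_subset[OF w_continuous(2) box_subset_cbox] in auto)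

lemma \<Phi>_continuous: "continuous_on (cbox a b) \<Phi>"
 unfolding \<Phi>_def[abs_def] by (intro continuous_intros w_continuous)

lemma WD_image: "W \<inter> D \<subseteq> \<Phi> ` box a b"
 using cover by (fastforce simp: \<Phi>_def)

text \<open>Contravariance of the density: the chart exchanges \<open>\<langle>X, D h\<rangle>\<close> and \<open>\<langle>Y, D (h \<circ> \<Phi>)\<rangle>\<close>.\<close>

lemma pd_comp_\<Phi>:
 assumes "h differentiable (at (\<Phi> y))" "y \<in> cbox a b"
 shows "pd c (\<lambda>y. h (\<Phi> y)) y = (if c = k then 0 else pd c h (\<Phi> y)) + pd k h (\<Phi> y) * pd c w y"
 using pd_comp_set_coord[of h k w y c] assms w_differentiable by (simp add: \<Phi>_def)

lemma flux_diff_\<Phi>: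
 assumes h: "h differentiable (at (\<Phi> y))" and y: "y \<in> box a b"
 shows "\<bar>pd k w y\<bar> * flux_diff h (\<Phi> y) = (\<Sum>c. Y y $ c * pd c (\<lambda>y. h (\<Phi> y)) y)"
proof -
 have "\<bar>pd k w y\<bar> * flux_diff h (\<Phi> y) = (\<Sum>j. \<bar>pd k w y\<bar> * X (\<Phi> y) $ j * pd j h (\<Phi> y))"
  unfolding flux_diff_def by (simp add: sum_distrib_left mult.assoc)
 also have "... = (\<Sum>c. pd c w y * Y y $ c) * pd k h (\<Phi> y) + (\<Sum>j\<in>UNIV-{k}. Y y $ j * pd j h (\<Phi> y))"
  using X_Y[OF y] by (subst sum.remove[of _ k]) (auto simp: \<Phi>_def intro!: sum.cong)
 also have "(\<Sum>j\<in>UNIV-{k}. Y y $ j * pd j h (\<Phi> y)) = (\<Sum>j. Y y $ j * (if j = k then 0 else pd j h (\<Phi> y)))"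
  by (subst sum.remove[of UNIV k]) (auto intro!: sum.cong)
 finally show ?thesis
  by (simp add: pd_comp_\<Phi>[OF h box_cbox[OF y]] distrib_left sum.distrib sum_distrib_left mult_ac)
qed

text \<open>The height \<open>y\<^sub>k\<close> above the boundary as a function on the collar.\<close>

definition "inv\<Phi> = the_inv_into (box a b) \<Phi>"
definition "height x = inv\<Phi> x $ k"

lemma inv\<Phi>: "y \<in> box a b ==> inv\<Phi> (\<Phi> y) = y"
 unfolding inv\<Phi>_def by (rule the_inv_into_f_f[OF inj_on_\<Phi>])

lemma height_\<Phi>: "y \<in> box a b ==> height (\<Phi> y) = y $ k"
 by (simp add: height_def inv\<Phi>)

lemma inv\<Phi>_has_derivative:
 assumes y: "y \<in> box a b"
 shows "(inv\<Phi> has_derivative (\<lambda>v. set_coord k ((v $ k - (\<Sum>c\<in>UNIV-{k}. v $ c * pd c w y)) / pd k w y) v)) (at (\<Phi> y))"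
  (is "(_ has_derivative ?L) _")
proof (rule has_derivative_inverse_on[where f = \<Phi> and S = "box a b" and
   f' = "\<lambda>z v. set_coord k (\<Sum>c. v $ c * pd c w z) v" and g' = "\<lambda>_. ?L"])
 show "(\<Phi> has_derivative (\<lambda>v. set_coord k (\<Sum>c. v $ c * pd c w z) v)) (at z)" if "z \<in> box a b" for z
  unfolding \<Phi>_def[abs_def] using has_derivative_graph_map w_differentiable box_cbox that by blast
 show "(\<lambda>v. set_coord k (\<Sum>c. v $ c * pd c w y) v) \<circ> ?L = id"
 proof
  fix v
  have "(\<Sum>c. ?L v $ c * pd c w y) = v $ k"
   using nz[OF y] by (subst sum.remove[of _ k]) auto
  thus "((\<lambda>v. set_coord k (\<Sum>c. v $ c * pd c w y) v) \<circ> ?L) v = id v" by simp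
 qed
qed (use y inv\<Phi> in auto)

lemma height_C1: "C1_on (\<Phi> ` box a b) height"
 unfolding C1_on_iff
proof (intro conjI ballI allI)
 have d: "height differentiable (at (\<Phi> y))" if "y \<in> box a b" for y
  unfolding height_def[abs_def] using bounded_linear.has_derivative[OF bounded_linear_vec_nth inv\<Phi>_has_derivative[OF that]]
  by (rule differentiableI)
 thus "height differentiable (at x)" if "x \<in> \<Phi> ` box a b" for x using that by blast
 have pd: "pd c height (\<Phi> y) = (if c = k then 1 else - pd c w y) / pd k w y" if y: "y \<in> box a b" for c y
 proof -
  have eq: "(if c = k then 0 else pd c height (\<Phi> y)) + pd k height (\<Phi> y) * pd c w y = pd c (\<lambda>y. y $ k) y" for c
   unfolding pd_comp_\<Phi>[OF d[OF y] box_cbox[OF y], symmetric]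
   by (rule pd_cong[OF open_box y]) (rule height_\<Phi>)
  have "pd k height (\<Phi> y) = 1 / pd k w y" using eq[of k] nz[OF y] by (simp add: field_simps)
  thus ?thesis using eq[of c] by (cases "c = k") (simp_all add: eq_neg_iff_add_eq_0)
 qed
 fix c
 have "continuous_on (\<Phi> ` box a b) inv\<Phi>"
  by (rule continuous_at_imp_continuous_on) (auto intro: has_derivative_continuous[OF inv\<Phi>_has_derivative])
 from continuous_on_compose2[OF w_continuous(2) this]
 have p: "continuous_on (\<Phi> ` box a b) (\<lambda>x. pd e w (inv\<Phi> x))" for e using inv\<Phi> box_cbox by fastforce
 have "continuous_on (\<Phi> ` box a b) (\<lambda>x. (if c = k then 1 else - pd c w (inv\<Phi> x)) / pd k w (inv\<Phi> x))"
  using nz inv\<Phi> by (cases "c = k") (auto intro!: continuous_intros p)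
 thus "continuous_on (\<Phi> ` box a b) (pd c height)"
  by (rule continuous_on_eq) (use pd inv\<Phi> in auto)
qed (rule open_\<Phi>_image)

abbreviation "face \<equiv> cylinder k a b"
definition "base y = w (set_coord k 0 y)"

lemma face_cbox_0: "y \<in> face ==> set_coord k 0 y \<in> cbox a b"
 using a_k a_less_b[of k] by (intro cylinder_cbox) auto

text \<open>The cut-off \<open>rise t\<close> rises from \<open>0\<close> at \<open>t = 1\<close> to \<open>1\<close> at \<open>t = 2\<close>; its derivative is the kernel that
 concentrates on the face.\<close>

definition "rise t = 1 - ramp (t - 1)"
definition "rise' t = - ramp' (t - 1)"

lemma rise_deriv: "(rise has_real_derivative rise' t) (at t)"
proof -
 have "((\<lambda>t. 1 - ramp (t - 1)) has_real_derivative (0 - ramp' (t - 1) * (1 - 0))) (at t)"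
  by (intro DERIV_diff DERIV_chain2[OF DERIV_ramp] DERIV_const DERIV_ident)
 thus ?thesis by (simp add: rise_def[abs_def] rise'_def)
qed

lemma rise_eq: "t \<le> 1 ==> rise t = 0" "t \<ge> 2 ==> rise t = 1" "\<bar>rise t\<bar> \<le> 1"
 using ramp_bounds[of "t - 1"] by (simp_all add: rise_def ramp_eq)

lemma rise': "continuous_on UNIV rise'" "t \<notin> {1..2} ==> rise' t = 0" "(LINT t|lborel. rise' t) = 1"
proof -
 show c: "continuous_on UNIV rise'" unfolding rise'_def by (intro continuous_intros continuous_on_compose2[OF continuous_on_ramp'[of UNIV]]) auto
 show 0: "rise' t = 0" if "t \<notin> {1..2}" for t using that by (auto simp: rise'_def intro!: ramp'_eq)
 have "has_bochner_integral lborel (\<lambda>t. rise' t * indicator {1..2} t) (rise 2 - rise 1)"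
  by (rule has_bochner_integral_FTC_Icc_real) (use rise_deriv c in \<open>auto simp: continuous_on_eq_continuous_at\<close>)
 moreover have "(\<lambda>t. rise' t * indicator {1..2} t) = rise'" using 0 by (auto simp: fun_eq_iff indicator_def)
 ultimately show "(LINT t|lborel. rise' t) = 1" by (simp add: has_bochner_integral_integral_eq rise_eq)
qed

context
 fixes \<phi> :: "real^'n => real" and K
 assumes \<phi>: "C1_on UNIV \<phi>" and K: "compact K" "K \<subseteq> W" "\<And>x. x \<notin> K ==> \<phi> x = 0"
begin

lemma \<phi>_continuous: "continuous_on S \<phi>"
 using C1_on_continuous[OF \<phi>] by (rule continuous_on_subset) simp

lemma \<phi>Y_continuous: "continuous_on (cbox a b) (\<lambda>y. \<phi> (\<Phi> y) * Y y $ k)"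
 by (intro continuous_intros Y_cont continuous_on_compose2[OF \<phi>_continuous \<Phi>_continuous, of UNIV]) auto

lemma flux_integrable: "set_integrable lborel D (flux_diff \<phi>)"
proof -
 define g where "g x = indicator D x * flux_diff \<phi> x" for x
 have gm [measurable]: "g \<in> borel_measurable borel"
  unfolding g_def using borel_measurable_continuous_on_indicator[OF _ flux_diff_continuous[OF C1_on_subset[OF \<phi> D_open]]] D_open by simp
 define Z where "Z y = (\<Sum>c. Y y $ c * ((if c = k then 0 else pd c \<phi> (\<Phi> y)) + pd k \<phi> (\<Phi> y) * pd c w y))" for y
 have p: "continuous_on (cbox a b) (\<lambda>y. pd c \<phi> (\<Phi> y))" for c
  by (rule continuous_on_compose2[OF C1_on_pd_continuous[OF \<phi>] \<Phi>_continuous]) auto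
 have "continuous_on (cbox a b) (\<lambda>y. if c = k then 0 else pd c \<phi> (\<Phi> y))" for c by (cases "c = k") (auto intro: p)
 hence "continuous_on (cbox a b) Z"
  unfolding Z_def by (intro continuous_intros Y_cont w_continuous p)
 hence "integrable lborel (\<lambda>y. indicator (cbox a b) y *\<^sub>R Z y)" by (rule borel_integrable_compact[OF compact_cbox])
 hence "integrable lborel (\<lambda>y. indicator (box a b) y *\<^sub>R (indicator (cbox a b) y *\<^sub>R Z y))"
  by (rule integrable_mult_indicator[rotated]) auto
 also have "(\<lambda>y. indicator (box a b) y *\<^sub>R (indicator (cbox a b) y *\<^sub>R Z y)) = (\<lambda>y. indicator (box a b) y * \<bar>pd k w y\<bar> * g (\<Phi> y))"
  using flux_diff_\<Phi>[of \<phi>] C1_on_differentiable[OF \<phi>] box_cbox image_D pd_comp_\<Phi>[of \<phi>]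
  by (auto simp: fun_eq_iff indicator_def Z_def g_def \<Phi>_def)
 finally have "integrable lborel (\<lambda>x. indicator (\<Phi> ` box a b) x * g x)" by (simp only: integral_\<Phi>(1)[OF gm])
 moreover have "(\<lambda>x. indicator (\<Phi> ` box a b) x * g x) = g"
  using WD_image K(2) flux_diff_zero_outside[of K \<phi>, OF K(1,3)] by (auto simp: fun_eq_iff g_def indicator_def)
 ultimately show ?thesis by (simp add: set_integrable_def g_def[abs_def])
qed

text \<open>The weak identity holds for \<open>\<phi>\<close> times a cut-off at height \<open>\<epsilon>\<close>.  As \<open>\<epsilon>\<close> tends to \<open>0\<close> the terms without
 derivatives of the cut-off converge; the remaining one becomes, in the coordinates \<open>y\<close>, the integral
 of a concentrating kernel against the continuous function \<open>\<phi> Y\<^sub>k\<close>.\<close>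

lemma collar_flux:
 "(LINT x:D|lborel. flux_diff \<phi> x) + (LINT x:D|lborel. s x * \<phi> x) =
  - (LINT y|lborel. indicator (slab k) y * (indicator face y * (\<phi> (set_coord k (base y) y) * Y (set_coord k 0 y) $ k)))"
proof -
 define V where "V = \<Phi> ` box a b"
 have oWD: "open (W \<inter> D)" using open_W D_open by auto
 have covV: "W \<inter> D \<subseteq> V" using WD_image by (simp add: V_def)
 have [measurable]: "W \<inter> D \<in> sets borel" using oWD by auto
 define h where "h x = indicator D x *\<^sub>R flux_diff \<phi> x + indicator D x *\<^sub>R (s x * \<phi> x)" for x
 have hi: "integrable lborel h" "(LINT x|lborel. h x) = (LINT x:D|lborel. flux_diff \<phi> x) + (LINT x:D|lborel. s x * \<phi> x)"
  using flux_integrable s_test_int[OF \<phi> K(1,3)]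
  by (simp_all add: h_def[abs_def] set_integrable_def set_lebesgue_integral_def)
 have h0: "h x = 0" if "x \<notin> W \<inter> D" for x
 proof -
  have "x \<notin> K \<or> x \<notin> D" using that K(2) by blast
  thus ?thesis using K(3) flux_diff_zero_outside[of K \<phi>, OF K(1,3)] by (auto simp: h_def)
 qed
 define \<epsilon> where "\<epsilon> m = 1 / real (Suc m)" for m
 have \<epsilon>: "\<epsilon> m > 0" "\<epsilon> \<longlonglongrightarrow> 0" for m unfolding \<epsilon>_def by (auto, real_asymp)
 define \<theta> where "\<theta> m x = indicator (W \<inter> D) x * rise (height x / \<epsilon> m)" for m x
 have C1WD: "C1_on (W \<inter> D) (\<lambda>x. rise (height x / \<epsilon> m))" for m
  unfolding rise_def divide_inverse using oWD C1_on_subset[OF height_C1 oWD WD_image]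
  by (intro C1_on_diff C1_on_const C1_on_ramp C1_on_mult)
 have \<theta>b: "\<bar>\<theta> m x\<bar> \<le> 1" for m x using rise_eq(3) by (auto simp: \<theta>_def indicator_def)
 have \<theta>m [measurable]: "\<theta> m \<in> borel_measurable borel" for m
  using borel_measurable_continuous_on_indicator[OF _ C1_on_continuous[OF C1WD]] oWD by (simp add: \<theta>_def[abs_def])
 have \<theta>h: "integrable lborel (\<lambda>x. \<theta> m x * h x)" for m
  using hi(1) \<theta>b by (intro Bochner_Integration.integrable_bound[OF hi(1)]) (auto simp: abs_mult intro!: mult_left_le_one_le)
 have lim: "(\<lambda>m. LINT x|lborel. \<theta> m x * h x) \<longlonglongrightarrow> (LINT x|lborel. h x)"
 proof (rule integral_dominated_convergence[where w = "\<lambda>x. \<bar>h x\<bar>"])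
  show "AE x in lborel. (\<lambda>m. \<theta> m x * h x) \<longlonglongrightarrow> h x"
  proof (rule AE_I2)
   fix x
   show "(\<lambda>m. \<theta> m x * h x) \<longlonglongrightarrow> h x"
   proof (cases "x \<in> W \<inter> D")
    case True
    then obtain y where y: "y \<in> box a b" "x = \<Phi> y" using WD_image by blast
    hence "0 < height x" using height_\<Phi>[OF y(1)] a_k by (metis box_vec)
    hence "\<forall>\<^sub>F m in sequentially. \<epsilon> m < height x / 2" by (intro order_tendstoD(2)[OF \<epsilon>(2)]) auto
    hence "\<forall>\<^sub>F m in sequentially. \<theta> m x * h x = h x"
    proof eventually_elim
     case (elim m)
     hence "2 \<le> height x / \<epsilon> m" using \<epsilon>(1)[of m] by (simp add: field_simps)
     thus ?case using True by (simp add: \<theta>_def rise_eq)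
    qed
    thus ?thesis by (rule tendsto_eventually)
   qed (simp add: h0)
  qed
 qed (use hi(1) \<theta>h \<theta>b in \<open>auto simp: abs_mult intro!: mult_left_le_one_le\<close>)
 define \<psi> where "\<psi> m x = \<theta> m x * \<phi> x" for m x
 define L where "L m = closure {x. \<psi> m x \<noteq> 0}" for m
 have \<psi>0: "x \<notin> L m ==> \<psi> m x = 0" for m x using closure_subset[of "{x. \<psi> m x \<noteq> 0}"] by (auto simp: L_def)
 have LK: "L m \<subseteq> K" for m
  unfolding L_def using K(3) compact_imp_closed[OF K(1)] by (intro closure_minimal) (auto simp: \<psi>_def)
 have cL: "compact (L m)" for m
  using LK bounded_subset[OF compact_imp_bounded[OF K(1)]] by (simp add: compact_eq_bounded_closed L_def)
 \<comment> \<open>the support of the cut-off function stays away from the boundary\<close>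
 have LD: "L m \<subseteq> D" for m
 proof (rule subsetI, rule ccontr)
  fix x assume x: "x \<in> L m" "x \<notin> D"
  hence "x \<in> W" using LK K(2) by blast
  then obtain N where N: "open N" "x \<in> N" "\<forall>y\<in>box a b. set_coord k (w y) y \<in> N --> y $ k < \<epsilon> m"
   using exhaust[OF _ x(2) \<epsilon>(1)] by metis
  have "\<psi> m z = 0" if "z \<in> N" for z
  proof (cases "z \<in> W \<inter> D")
   case True
   then obtain y where y: "y \<in> box a b" "z = \<Phi> y" using WD_image by blast
   hence "height z < \<epsilon> m" using N(3) that height_\<Phi>[OF y(1)] by (simp add: \<Phi>_def)
   thus ?thesis using \<epsilon>(1)[of m] by (simp add: \<psi>_def \<theta>_def rise_eq)
  qed (simp add: \<psi>_def \<theta>_def)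
  hence "N \<inter> {x. \<psi> m x \<noteq> 0} = {}" by auto
  hence "N \<inter> L m = {}" unfolding L_def using N(1) open_Int_closure_eq_empty by blast
  thus False using x N(2) by blast
 qed
 have \<psi>C1: "C1_on UNIV (\<psi> m)" for m
 proof (rule C1_on_zero_extension[of "W \<inter> D" _ "L m"])
  show "C1_on (W \<inter> D) (\<psi> m)"
   using C1_on_mult[OF C1WD[of m] C1_on_subset[OF \<phi> oWD]] by (subst C1_on_cong) (auto simp: \<psi>_def \<theta>_def)
  show "closed (L m)" by (simp add: L_def)
  show "L m \<subseteq> W \<inter> D" using LK K(2) LD by blast
 qed (rule \<psi>0)
 \<comment> \<open>the term in which the cut-off is differentiated\<close>
 define T where "T m x = indicator V x * (\<phi> x * (rise' (height x / \<epsilon> m) / \<epsilon> m * flux_diff height x))" for m x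
 have split: "flux_diff (\<psi> m) x + s x * \<psi> m x = \<theta> m x * h x + T m x" for m x
 proof (cases "x \<in> W \<inter> D")
  case True
  have d1: "\<phi> differentiable (at x)" by (rule C1_on_differentiable[OF \<phi>]) simp
  have d2: "height differentiable (at x)" by (rule C1_on_differentiable[OF height_C1]) (use True WD_image in blast)
  have c: "((\<lambda>t. rise (t / \<epsilon> m)) has_real_derivative rise' (height x / \<epsilon> m) / \<epsilon> m) (at (height x))"
   using DERIV_chain2[OF rise_deriv, of "\<lambda>t. t / \<epsilon> m" "1 / \<epsilon> m" "height x"] by (simp add: DERIV_cdivide)
  have "pd j (\<psi> m) x = pd j (\<lambda>x. rise (height x / \<epsilon> m) * \<phi> x) x" for j
   by (rule pd_cong[OF oWD True]) (simp add: \<psi>_def \<theta>_def)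
  also have "pd j (\<lambda>x. rise (height x / \<epsilon> m) * \<phi> x) x = rise' (height x / \<epsilon> m) / \<epsilon> m * pd j height x * \<phi> x + rise (height x / \<epsilon> m) * pd j \<phi> x" for j
   by (subst pd_mult[OF differentiable_comp_real[OF d2 c] d1]) (simp add: pd_comp_real[OF d2 c])
  finally have "flux_diff (\<psi> m) x = rise (height x / \<epsilon> m) * flux_diff \<phi> x + \<phi> x * (rise' (height x / \<epsilon> m) / \<epsilon> m * flux_diff height x)"
   unfolding flux_diff_def by (simp add: sum_distrib_left sum.distrib[symmetric] algebra_simps)
  thus ?thesis using True covV by (auto simp: T_def h_def \<psi>_def \<theta>_def algebra_simps)
 next
  case False
  hence "x \<notin> L m" using LD LK K(2) by blast
  moreover have "x \<notin> K \<or> x \<notin> V" using False K(2) image_D by (auto simp: V_def \<Phi>_def)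
  hence "T m x = 0" using K(3) by (auto simp: T_def)
  ultimately show ?thesis using flux_diff_zero_outside[of "L m" "\<psi> m" x, OF cL \<psi>0] \<psi>0 h0[OF False] by simp
 qed
 have Ti: "integrable lborel (T m)" "(LINT x|lborel. T m x) = - (LINT x|lborel. \<theta> m x * h x)" for m
 proof -
  have "set_integrable lborel D (\<lambda>x. s x * \<psi> m x)" by (rule s_test_int[OF \<psi>C1 cL \<psi>0])
  moreover have "(\<lambda>x. indicator D x *\<^sub>R (s x * \<psi> m x)) = (\<lambda>x. s x * \<psi> m x)"
   by (auto simp: fun_eq_iff \<psi>_def \<theta>_def indicator_def)
  ultimately have i: "integrable lborel (flux_diff (\<psi> m))" "integrable lborel (\<lambda>x. s x * \<psi> m x)"
   using flux_diff_integrable[OF \<psi>C1 cL LD \<psi>0] by (simp_all add: set_integrable_def)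
  have e: "T m = (\<lambda>x. flux_diff (\<psi> m) x + s x * \<psi> m x - \<theta> m x * h x)" using split[of m] by (simp add: fun_eq_iff)
  show "integrable lborel (T m)" unfolding e using i \<theta>h by simp
  have "(LINT x|lborel. flux_diff (\<psi> m) x) = - (LINT x|lborel. s x * \<psi> m x)"
   unfolding flux_diff_def by (rule weak[OF \<psi>C1 cL LD \<psi>0])
  thus "(LINT x|lborel. T m x) = - (LINT x|lborel. \<theta> m x * h x)" unfolding e using i \<theta>h by simp
 qed
 define G where "G y = indicator (box a b) y * (\<phi> (\<Phi> y) * Y y $ k)" for y
 define G0 where "G0 y = indicator face y * (\<phi> (set_coord k (base y) y) * Y (set_coord k 0 y) $ k)" for y
 \<comment> \<open>the height is \<open>y\<^sub>k\<close> in the chart, so its derivative along \<open>X\<close> becomes \<open>Y\<^sub>k\<close>\<close>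
 have T\<Phi>: "indicator (box a b) y * \<bar>pd k w y\<bar> * T m (\<Phi> y) = rise' (y $ k / \<epsilon> m) / \<epsilon> m * G y" for m y
 proof (cases "y \<in> box a b")
  case True
  have "\<bar>pd k w y\<bar> * flux_diff height (\<Phi> y) = (\<Sum>c. Y y $ c * pd c (\<lambda>y. y $ k) y)"
   using pd_cong[OF open_box True height_\<Phi>] C1_on_differentiable[OF height_C1, of "\<Phi> y"] True by (subst flux_diff_\<Phi>) auto
  hence "\<bar>pd k w y\<bar> * flux_diff height (\<Phi> y) = Y y $ k" by (simp add: if_distrib[of "\<lambda>x. _ * x"] cong: if_cong)
  thus ?thesis using True height_\<Phi>[OF True] by (simp add: T_def V_def G_def algebra_simps)
 qed (simp add: G_def)
 have Gm: "G \<in> borel_measurable borel"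
  using borel_measurable_continuous_on_indicator[OF _ continuous_on_subset[OF \<phi>Y_continuous box_subset_cbox]] by (simp add: G_def[abs_def])
 obtain B where B: "\<And>y. y \<in> cbox a b ==> \<bar>\<phi> (\<Phi> y) * Y y $ k\<bar> \<le> B" "0 \<le> B"
  using compact_continuous_bounded[OF compact_cbox \<phi>Y_continuous] by blast
 have B: "\<bar>G y\<bar> \<le> B" for y using B box_cbox[of y] by (auto simp: G_def indicator_def)
 have "(\<lambda>m. LINT y|lborel. rise' (y $ k / \<epsilon> m) / \<epsilon> m * G y) \<longlonglongrightarrow> (LINT y|lborel. indicator (slab k) y * G0 y)"
 proof (rule slab_concentration[OF Gm B _ _ rise' \<epsilon>])
  show "G y = 0" if "y \<notin> cbox a b" for y using that box_cbox by (auto simp: G_def indicator_def)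
  fix y :: "real^'n"
  show "((\<lambda>t. G (set_coord k t y)) \<longlongrightarrow> G0 y) (at_right 0)"
  proof (cases "y \<in> face")
   case True
   have bk: "0 < b $ k" using a_k a_less_b[of k] by simp
   have "continuous_on {0..b $ k} (\<lambda>t. \<phi> (\<Phi> (set_coord k t y)) * Y (set_coord k t y) $ k)"
    by (rule continuous_on_compose2[OF \<phi>Y_continuous]) (use cylinder_cbox[OF True a_k] in \<open>auto intro!: continuous_intros\<close>)
   from bspec[OF this[unfolded continuous_on_def], of 0] bk
   have lim: "((\<lambda>t. \<phi> (\<Phi> (set_coord k t y)) * Y (set_coord k t y) $ k) \<longlongrightarrow> G0 y) (at_right 0)"
    using True by (simp add: at_within_Icc_at_right G0_def \<Phi>_def base_def)
   have "set_coord k t y \<in> box a b" if "0 < t" "t < b $ k" for t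
    using True that a_k by (auto simp: box_cylinder)
   hence "\<forall>\<^sub>F t in at_right 0. G (set_coord k t y) = \<phi> (\<Phi> (set_coord k t y)) * Y (set_coord k t y) $ k"
    by (intro eventually_at_rightI[OF _ bk]) (simp add: G_def)
   thus ?thesis using lim by (subst filterlim_cong[OF refl refl])
  next
   case False
   hence "G (set_coord k t y) = 0" for t by (auto simp: G_def cylinder_def indicator_def box_vec split: if_splits)
   thus ?thesis using False by (simp add: G0_def)
  qed
 qed
 moreover have "(LINT x|lborel. T m x) = (LINT y|lborel. rise' (y $ k / \<epsilon> m) / \<epsilon> m * G y)" for m
 proof -
  have "T m = (\<lambda>x. indicator (\<Phi> ` box a b) x * T m x)" by (auto simp: fun_eq_iff T_def V_def indicator_def)
  thus ?thesis using integral_\<Phi>(2)[of "T m"] borel_measurable_integrable[OF Ti(1)] by (simp add: T\<Phi>)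
 qed
 ultimately have "(\<lambda>m. - (LINT x|lborel. \<theta> m x * h x)) \<longlonglongrightarrow> (LINT y|lborel. indicator (slab k) y * G0 y)" by (simp add: Ti(2))
 from LIMSEQ_unique[OF this tendsto_minus[OF lim]] show ?thesis by (simp add: hi(2) G0_def[abs_def])
qed

end

theorem collar_boundary_term:
 assumes ar: "is_area_measure S A" and gp: "graph_patch k face base"
  and PS: "patch_image k face base \<subseteq> S" and SP: "S \<inter> W \<subseteq> patch_image k face base"
  and Yh: "\<And>y. y \<in> face ==> set_coord k (base y) y \<in> W ==> Y (set_coord k 0 y) $ k = area_factor base y * h (set_coord k (base y) y)"
 shows "boundary_term_near A S h W"
 unfolding boundary_term_near_def
proof (intro allI impI)
 fix \<phi> :: "real^'n => real" and K assume \<phi>: "C1_on UNIV \<phi>" and K: "compact K" "K \<subseteq> W" and 0: "\<forall>x. x \<notin> K --> \<phi> x = 0"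
 let ?g = "\<lambda>x. \<phi> x * h x" and ?P = "patch_image k face base" and ?Y = "\<lambda>y. Y (set_coord k 0 y) $ k"
 let ?F = "\<lambda>y. indicator face y * (\<phi> (set_coord k (base y) y) * ?Y y)"
 have Ycont: "continuous_on face ?Y"
  by (rule continuous_on_compose2[OF Y_cont continuous_on_set_coord[OF continuous_on_const continuous_on_id]])
   (use face_cbox_0 in auto)
 have \<phi>c: "continuous_on UNIV \<phi>" by (rule C1_on_continuous[OF \<phi>])
 have Fc: "continuous_on face (\<lambda>y. \<phi> (set_coord k (base y) y) * ?Y y)"
  by (intro continuous_on_mult Ycont continuous_on_compose2[OF \<phi>c, of face] continuous_on_set_coord C1_on_continuous[OF graph_patch_C1[OF gp]] continuous_on_id) auto
 have mF [measurable]: "face \<in> sets borel" and [measurable]: "\<phi> \<in> borel_measurable borel" "?P \<in> sets borel"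
  using graph_patch_open[OF gp] borel_measurable_continuous_onI[OF \<phi>c] patch_image_borel[OF gp] by auto
 have [measurable]: "?F \<in> borel_measurable borel"
  using borel_measurable_continuous_on_indicator[OF mF Fc] by simp
 have hit: "area_factor base y * ?g (set_coord k (base y) y) = \<phi> (set_coord k (base y) y) * ?Y y" if "y \<in> face" for y
  using Yh[OF that] K(2) 0 by (cases "set_coord k (base y) y \<in> K") auto
 let ?q = "\<lambda>x. \<phi> x * ?Y x / area_factor base x"
 have "continuous_on face ?q"
  using area_factor_pos[of base] by (intro continuous_intros continuous_on_subset[OF \<phi>c] Ycont area_factor_continuous[OF gp]) (auto simp: less_imp_neq[symmetric])
 from borel_measurable_continuous_on_indicator[OF mF this]
 have [measurable]: "(\<lambda>x. indicator face x * ?q x) \<in> borel_measurable borel" by simp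
 have "indicator ?P x * (indicator face x * ?q x) = indicator ?P x * ?g x" for x
 proof (cases "x \<in> ?P")
  case True
  hence x: "x \<in> face" "x $ k = base x" using patch_image_iff[OF gp] by auto
  hence "set_coord k (base x) x = x" by (auto simp: vec_eq_iff)
  thus ?thesis using hit[OF x(1)] area_factor_pos[of base x] x(1) by (auto simp: field_simps)
 qed simp
 moreover have "(\<lambda>x. indicator ?P x * (indicator face x * ?q x)) \<in> borel_measurable borel" by measurable
 ultimately have gm: "(\<lambda>x. indicator ?P x * ?g x) \<in> borel_measurable borel" by simp
 have z: "?g x = 0" if "x \<in> S" "x \<notin> ?P" for x using SP that K(2) 0 by auto
 have AI: "set_integrable A S ?g \<longleftrightarrow> integrable lborel (\<lambda>y. indicator (slab k) y * ?F y)"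
  "(LINT x:S|A. ?g x) = (LINT y|lborel. indicator (slab k) y * ?F y)"
 proof -
  have "(\<lambda>y. indicator (face \<inter> slab k) y * (area_factor base y * ?g (set_coord k (base y) y))) = (\<lambda>y. indicator (slab k) y * ?F y)"
   using hit by (auto simp: fun_eq_iff indicator_def)
  thus "set_integrable A S ?g \<longleftrightarrow> integrable lborel (\<lambda>y. indicator (slab k) y * ?F y)"
   "(LINT x:S|A. ?g x) = (LINT y|lborel. indicator (slab k) y * ?F y)"
   using area_integral_patch[OF ar gp PS gm z] by simp_all
 qed
 obtain C where C: "\<And>x. \<bar>\<phi> x\<bar> \<le> C"
  by (rule compact_support_bounded[OF K(1) continuous_on_subset[OF \<phi>c]]) (use 0 in auto)
 obtain C' where C': "\<And>y. y \<in> cbox a b ==> \<bar>Y y $ k\<bar> \<le> C'" using compact_continuous_bounded[OF compact_cbox Y_cont] by metis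
 have "integrable lborel (\<lambda>y. indicator (slab k) y * ?F y)"
 proof (rule integrable_bounded_support[of _ "slab k \<inter> face" "C * C'"])
  show "\<bar>indicator (slab k) y * ?F y\<bar> \<le> C * C'" if "y \<in> slab k \<inter> face" for y
   using that C' face_cbox_0[of y] by (auto simp: abs_mult intro!: mult_mono C order_trans[OF abs_ge_zero C])
  have "slab k \<inter> face \<subseteq> cbox (set_coord k 0 a) (set_coord k 1 b)"
   by (auto simp: slab_def cylinder_def mem_box_cart less_imp_le)
  thus "bounded (slab k \<inter> face)" using bounded_cbox bounded_subset by blast
 qed auto
 thus "set_integrable lborel D (flux_diff \<phi>) \<and> set_integrable A S ?g \<and>
   (LINT x:D|lborel. flux_diff \<phi> x) + (LINT x:D|lborel. s x * \<phi> x) = - (LINT x:S|A. ?g x)"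
  using flux_integrable[OF \<phi> K] collar_flux[OF \<phi> K] 0 unfolding AI by simp
qed

end

context weak_field
begin

lemma flux_diff_add:
 "C1_on UNIV \<phi> ==> C1_on UNIV \<psi> ==> flux_diff (\<lambda>x. \<phi> x + \<psi> x) x = flux_diff \<phi> x + flux_diff \<psi> x"
 unfolding flux_diff_def
 by (simp add: pd_add C1_on_differentiable[where U = UNIV] distrib_left sum.distrib)

text \<open>A test function whose support avoids the boundary may be replaced by its restriction to
 \<open>D\<close>, to which the weak identity applies.\<close>

lemma interior_term:
 assumes \<phi>: "C1_on UNIV \<phi>" and K: "compact K" "\<And>x. x \<notin> K ==> \<phi> x = 0" "K \<inter> frontier D = {}"
 shows "set_integrable lborel D (flux_diff \<phi>)" "(LINT x:D|lborel. flux_diff \<phi> x) + (LINT x:D|lborel. s x * \<phi> x) = 0"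
proof -
 define \<psi> where "\<psi> x = indicator D x * \<phi> x" for x
 have KD: "compact (K \<inter> closure D)" "K \<inter> closure D \<subseteq> D" and \<psi>0: "x \<notin> K \<inter> closure D ==> \<psi> x = 0" for x
  using K D_open closure_subset[of D] by (auto simp: frontier_def interior_open \<psi>_def indicator_def intro: compact_Int_closed)
 have "C1_on D \<psi>"
  using C1_on_subset[OF \<phi> D_open] by (subst C1_on_cong) (auto simp: \<psi>_def)
 hence \<psi>: "C1_on UNIV \<psi>"
  by (rule C1_on_zero_extension[OF _ compact_imp_closed[OF KD(1)] KD(2) \<psi>0])
 have "flux_diff \<psi> x = flux_diff \<phi> x" if "x \<in> D" for x
  unfolding flux_diff_def using pd_cong[OF D_open that, of \<psi> \<phi>] by (simp add: \<psi>_def)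
 hence e: "(\<lambda>x. indicator D x *\<^sub>R flux_diff \<phi> x) = flux_diff \<psi>" "(\<lambda>x. indicator D x *\<^sub>R (s x * \<phi> x)) = (\<lambda>x. s x * \<psi> x)"
  using flux_diff_zero_outside[of _ \<psi>, OF KD(1) \<psi>0] KD(2) by (auto simp: fun_eq_iff indicator_def \<psi>_def)
 show "set_integrable lborel D (flux_diff \<phi>)"
  unfolding set_integrable_def e by (rule flux_diff_integrable[OF \<psi> KD \<psi>0])
 have "(LINT x|lborel. flux_diff \<psi> x) = - (LINT x|lborel. s x * \<psi> x)"
  unfolding flux_diff_def by (rule weak[OF \<psi> KD \<psi>0])
 thus "(LINT x:D|lborel. flux_diff \<phi> x) + (LINT x:D|lborel. s x * \<phi> x) = 0"
  unfolding set_lebesgue_integral_def e by simp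
qed

text \<open>Apply the identity to a test function that is \<open>1\<close> on the closure of \<open>D\<close>; splitting it into functions
 of small support reduces the claim to the local boundary terms and \<open>interior_term\<close>.\<close>

theorem divergence_theorem:
 fixes S :: "'i::finite => (real^'n) set"
 assumes bD: "bounded D" and fr: "frontier D = (\<Union>i. S i)" "\<And>i j. i \<noteq> j ==> S i \<inter> S j = {}" "\<And>i. closed (S i)"
  and loc: "\<And>i x. x \<in> S i ==> \<exists>W. open W \<and> x \<in> W \<and> boundary_term_near (\<sigma> i) (S i) (h i) W"
 shows "set_integrable (\<sigma> i) (S i) (h i)" "(LINT x:D|lborel. s x) = - (\<Sum>i. LINT x:S i|\<sigma> i. h i x)"
proof -
 have cl: "closure D = D \<union> (\<Union>i. S i)"
  using fr(1) D_open closure_subset[of D] by (auto simp: frontier_def interior_open)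
 obtain R where R: "R > 0" "closure D \<subseteq> ball 0 R"
  using bD bounded_closure bounded_subset_ballD by metis
 define \<phi>0 :: "real^'n => real" where "\<phi>0 = bump 0 (2 * R)"
 have \<phi>01: "\<phi>0 x = 1" if "x \<in> ball 0 R" for x unfolding \<phi>0_def using that R(1) by (intro bump_eq_1) auto
 define P where "P \<phi> \<longleftrightarrow> set_integrable lborel D (flux_diff \<phi>) \<and> set_integrable lborel D (\<lambda>x. s x * \<phi> x) \<and>
   (\<forall>i. set_integrable (\<sigma> i) (S i) (\<lambda>x. \<phi> x * h i x)) \<and>
   (LINT x:D|lborel. flux_diff \<phi> x) + (LINT x:D|lborel. s x * \<phi> x) = - (\<Sum>i. LINT x:S i|\<sigma> i. \<phi> x * h i x)" for \<phi>
 have zero: "set_integrable (\<sigma> i) (S i) (\<lambda>x. \<phi> x * h i x)" "(LINT x:S i|\<sigma> i. \<phi> x * h i x) = 0"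
  if "\<And>x. x \<in> S i ==> \<phi> x = 0" for i \<phi>
 proof -
  have "(\<lambda>x. indicator (S i) x *\<^sub>R (\<phi> x * h i x)) = (\<lambda>x. 0)" using that by (auto simp: indicator_def)
  thus "set_integrable (\<sigma> i) (S i) (\<lambda>x. \<phi> x * h i x)" "(LINT x:S i|\<sigma> i. \<phi> x * h i x) = 0"
   by (simp_all add: set_integrable_def set_lebesgue_integral_def)
 qed
 have "P \<phi>0"
 proof (rule C1_local_to_global[OF compact_cball[of 0 "2 * R"]])
  show "C1_on UNIV \<phi>0" unfolding \<phi>0_def by (rule C1_on_bump)
  show "\<phi>0 x = 0" if "x \<notin> cball 0 (2 * R)" for x
   unfolding \<phi>0_def using that R(1) by (intro bump_eq_0) auto
  show "P (\<lambda>x. 0)" by (simp add: P_def set_integrable_def set_lebesgue_integral_def flux_diff_def)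
  fix \<phi> \<psi> :: "real^'n => real" assume C: "C1_on UNIV \<phi>" "C1_on UNIV \<psi>" and "P \<phi>" "P \<psi>"
  moreover have "flux_diff (\<lambda>x. \<phi> x + \<psi> x) = (\<lambda>x. flux_diff \<phi> x + flux_diff \<psi> x)"
   using flux_diff_add[OF C] by (simp add: fun_eq_iff)
  ultimately show "P (\<lambda>x. \<phi> x + \<psi> x)"
   unfolding P_def by (simp add: distrib_left distrib_right set_integral_add sum.distrib)
 next
  fix x :: "real^'n" assume "x \<in> cball 0 (2 * R)"
  consider i where "x \<in> S i" | "x \<in> - frontier D" using fr(1) by blast
  thus "\<exists>r>0. \<forall>\<phi>. C1_on UNIV \<phi> --> (\<forall>y. y \<notin> cball 0 (2 * R) \<inter> cball x r --> \<phi> y = 0) --> P \<phi>"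
  proof cases
   case 1
   then obtain W where W: "open W" "x \<in> W" "boundary_term_near (\<sigma> i) (S i) (h i) W" using loc by blast
   have "open (W - (\<Union>j\<in>- {i}. S j))" "x \<in> W - (\<Union>j\<in>- {i}. S j)"
    using W 1 fr(2)[of i] fr(3) by (auto intro!: open_Diff closed_UN) (metis disjoint_iff)
   then obtain r where r: "r > 0" "cball x r \<subseteq> W - (\<Union>j\<in>- {i}. S j)" using open_contains_cball by metis
   show ?thesis
   proof (intro exI conjI allI impI)
    fix \<phi> :: "real^'n => real" assume \<phi>: "C1_on UNIV \<phi>" "\<forall>y. y \<notin> cball 0 (2 * R) \<inter> cball x r --> \<phi> y = 0"
    have z: "set_integrable (\<sigma> j) (S j) (\<lambda>x. \<phi> x * h j x)" "(LINT x:S j|\<sigma> j. \<phi> x * h j x) = 0" if "j \<noteq> i" for j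
     using zero[of j \<phi>] \<phi>(2) r(2) that by blast+
    have K: "compact (cball 0 (2 * R) \<inter> cball x r)" "cball 0 (2 * R) \<inter> cball x r \<subseteq> W" using r(2) by auto
    have "(\<Sum>j. LINT x:S j|\<sigma> j. \<phi> x * h j x) = (LINT x:S i|\<sigma> i. \<phi> x * h i x)"
     by (subst sum.remove[of _ i]) (auto simp: z)
    thus "P \<phi>"
     unfolding P_def using W(3)[unfolded boundary_term_near_def, rule_format, OF \<phi>(1) K] \<phi>(2) z(1) s_test_int[OF \<phi>(1) K(1)]
     by (metis (no_types, lifting))
   qed (fact r)
  next
   case 2
   then obtain r where r: "r > 0" "cball x r \<subseteq> - frontier D"
    using open_contains_cball[of "- frontier D"] by auto
   show ?thesis
   proof (intro exI conjI allI impI)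
    fix \<phi> :: "real^'n => real" assume \<phi>: "C1_on UNIV \<phi>" "\<forall>y. y \<notin> cball 0 (2 * R) \<inter> cball x r --> \<phi> y = 0"
    have 0: "\<And>y. y \<notin> cball x r ==> \<phi> y = 0" and "cball x r \<inter> frontier D = {}" using \<phi>(2) r(2) by auto
    moreover have z: "set_integrable (\<sigma> i) (S i) (\<lambda>x. \<phi> x * h i x)" "(LINT x:S i|\<sigma> i. \<phi> x * h i x) = 0" for i
     using zero[of i \<phi>] 0 r(2) fr(1) by blast+
    ultimately show "P \<phi>"
     unfolding P_def using interior_term[of \<phi>, OF \<phi>(1) compact_cball 0] s_test_int[of \<phi>, OF \<phi>(1) compact_cball 0] z by simp
   qed (fact r)
  qed
 qed
 moreover have "flux_diff \<phi>0 x = 0" if "x \<in> D" for x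
 proof -
  have x: "x \<in> ball 0 R" using that R(2) closure_subset by blast
  have "pd j \<phi>0 x = pd j (\<lambda>x. 1) x" for j by (rule pd_cong[OF open_ball x]) (simp add: \<phi>01)
  thus ?thesis by (simp add: flux_diff_def)
 qed
 hence "(\<lambda>x. indicator D x *\<^sub>R flux_diff \<phi>0 x) = (\<lambda>x. 0)" by (auto simp: fun_eq_iff indicator_def)
 moreover have "(\<lambda>x. indicator A x *\<^sub>R (\<phi>0 x * g x)) = (\<lambda>x. indicator A x *\<^sub>R g x)"
  "(\<lambda>x. indicator A x *\<^sub>R (g x * \<phi>0 x)) = (\<lambda>x. indicator A x *\<^sub>R g x)" if "A \<subseteq> closure D" for A and g :: "real^'n => real"
  using \<phi>01 R(2) that by (auto simp: fun_eq_iff indicator_def)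
 moreover have "S i \<subseteq> closure D" "D \<subseteq> closure D" for i using cl by auto
 ultimately show "set_integrable (\<sigma> i) (S i) (h i)" "(LINT x:D|lborel. s x) = - (\<Sum>i. LINT x:S i|\<sigma> i. h i x)"
  unfolding P_def set_integrable_def set_lebesgue_integral_def by simp_all
qed

end

section \<open>Boundary charts\<close>

lemma C2_scalar_inner: "open U ==> C2_scalar U (\<lambda>y. e \<bullet> y)"
proof -
 assume U: "open U"
 have "C1_on U (\<lambda>y. \<Sum>i. e $ i * y $ i)" by (intro C1_on_sum C1_on_mult C1_on_const C1_on_nth U)
 hence C1: "C1_on U (\<lambda>y. e \<bullet> y)" by (simp add: inner_vec_def)
 have "pd i (\<lambda>y. e \<bullet> y) y = e $ i" for i y
  using pd_eqI[OF bounded_linear.has_derivative[OF bounded_linear_inner_right has_derivative_ident], of i e y]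
  by (simp add: inner_axis)
 hence "pd i (\<lambda>y. e \<bullet> y) = (\<lambda>y. e $ i)" for i by auto
 thus ?thesis using C1 U by (simp add: C2_scalar_def)
qed

lemma half_box_exists:
 fixes y0 :: "real^'n"
 assumes P: "open P" "y0 \<in> P" and k: "y0 $ k = 0"
 obtains a b where "a $ k < 0" "0 < b $ k" "y0 \<in> box a b" "cbox a b \<subseteq> P" "cbox (set_coord k 0 a) b \<subseteq> cbox a b"
proof -
 obtain e where e: "e > 0" "ball y0 e \<subseteq> P" using P open_contains_ball by blast
 define r where "r = e / (2 * real CARD('n))"
 have r: "r > 0" using e by (simp add: r_def)
 let ?a = "y0 - (\<chi> j. r)" and ?b = "y0 + (\<chi> j. r)"
 have "y \<in> P" if y: "y \<in> cbox ?a ?b" for y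
 proof -
  have "\<bar>(y - y0) $ j\<bar> \<le> r" for j using y by (auto simp: mem_box_cart abs_le_iff dest!: spec[of _ j])
  hence "norm (y - y0) \<le> (\<Sum>j\<in>(UNIV::'n set). r)"
   by (intro order_trans[OF norm_le_l1_cart] sum_mono)
  also have "... < e" using e(1) by (simp add: r_def)
  finally show ?thesis using e(2) by (auto simp: dist_norm norm_minus_commute)
 qed
 moreover have "cbox (set_coord k 0 ?a) ?b \<subseteq> cbox ?a ?b"
  using r k by (auto simp: mem_box_cart split: if_splits) (metis diff_0 less_imp_le neg_le_0_iff_le order_trans)
 ultimately show thesis using r k by (intro that[of ?a ?b]) (auto simp: box_vec)
qed

text \<open>Stopping the parameter at \<open>\<delta>\<close> keeps the curve in \<open>X\<close> for all times, as the definition demands.\<close>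

lemma tangent_space_ray:
 fixes F :: "'a::real_normed_vector => 'b::real_normed_vector"
 assumes Q: "open Q" "y \<in> Q" and X: "\<And>t. 0 \<le> t ==> y + t *\<^sub>R d \<in> Q ==> F (y + t *\<^sub>R d) \<in> X"
  and v: "((\<lambda>t. F (y + t *\<^sub>R d)) has_vector_derivative v) (at 0)"
 shows "v \<in> tangent_space X (F y)"
proof -
 have "open ((\<lambda>t::real. y + t *\<^sub>R d) -` Q)" by (intro open_vimage Q continuous_intros)
 hence "\<exists>\<delta>>0. cball 0 \<delta> \<subseteq> (\<lambda>t::real. y + t *\<^sub>R d) -` Q"
  unfolding open_contains_cball by (rule bspec) (use Q(2) in simp)
 then obtain \<delta> where \<delta>: "\<delta> > 0" "cball 0 \<delta> \<subseteq> (\<lambda>t::real. y + t *\<^sub>R d) -` Q" by blast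
 let ?c = "\<lambda>t. F (y + min t \<delta> *\<^sub>R d)"
 show ?thesis unfolding tangent_space_def
 proof (intro span_base CollectI exI conjI allI impI)
 show "?c 0 = F y" using \<delta>(1) by simp
 show "?c t \<in> X" if "0 \<le> t" for t using \<delta> that by (intro X) (auto simp: subset_iff min_def)
 have "(?c has_vector_derivative v) (at 0)"
  by (rule has_vector_derivative_transform_within_open[OF v, of "{..<\<delta>}"]) (use \<delta>(1) in auto)
 thus "(?c has_vector_derivative v) (at 0 within {0..})" by (rule has_vector_derivative_at_within)
 qed
qed

text \<open>A function that vanishes on the set has vanishing derivative along every curve in the set.\<close>

lemma tangent_space_zero:
 fixes h :: "real^'n => real"
 assumes h: "h differentiable (at x)" and W: "open W" "x \<in> W" and 0: "\<And>y. y \<in> C ==> y \<in> W ==> h y = 0"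
  and v: "v \<in> tangent_space C x"
 shows "(\<Sum>i. v $ i * pd i h x) = 0"
proof -
 have "tangent_space C x \<subseteq> {v. (\<Sum>i. v $ i * pd i h x) = 0}"
  unfolding tangent_space_def
 proof (rule span_minimal, clarify)
  show "subspace {v. (\<Sum>i. v $ i * pd i h x) = 0}"
   by (auto simp: subspace_def distrib_right sum.distrib mult.assoc sum_distrib_left[symmetric])
  fix v c assume c: "x = c 0" "\<forall>t\<ge>0. c t \<in> C" "(c has_vector_derivative v) (at 0 within {0..})"
  have "(c \<longlongrightarrow> c 0) (at 0 within {0..})"
   using has_vector_derivative_continuous[OF c(3)] by (simp add: continuous_within)
  hence "\<forall>\<^sub>F t in at 0 within {0..}. c t \<in> W" using topological_tendstoD[OF _ W(1)] c(1) W(2) by auto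
  moreover have "\<forall>\<^sub>F t in at 0 within {0..}. (t::real) \<in> {0..}" by (simp add: eventually_at_filter)
  ultimately have ev: "\<forall>\<^sub>F t in at 0 within {0..}. 0 = h (c t)" by eventually_elim (use 0 c(2) in auto)
  have "(h has_derivative (\<lambda>v. \<Sum>i. v $ i * pd i h x)) (at (c 0))" using has_derivative_pd[OF h] c(1) by simp
  from has_derivative_compose[OF c(3)[unfolded has_vector_derivative_def] this]
  have "((\<lambda>t. h (c t)) has_vector_derivative (\<Sum>i. v $ i * pd i h x)) (at 0 within {0..})"
   by (simp add: has_vector_derivative_def sum_distrib_left mult.assoc)
  moreover have "((\<lambda>t. h (c t)) has_vector_derivative 0) (at 0 within {0..})"
   unfolding has_vector_derivative_def
   by (rule has_derivative_transform_eventually[of "\<lambda>t. 0", OF _ ev]) (use 0 c W(2) in auto)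
  ultimately show "(\<Sum>i. v $ i * pd i h (c 0)) = 0"
   unfolding c(1)[symmetric] by (rule vector_derivative_unique_within[rotated]) (simp add: at_within_Ici_at_right)
 qed
 thus ?thesis using v by blast
qed

text \<open>Near a boundary point the graph is parametrized by \<open>y \<mapsto> (set_coord k (w y) y, z y)\<close> with
 \<open>y\<^sub>k \<ge> 0\<close>: all horizontal coordinates except the \<open>k\<close>-th are kept, and \<open>y\<^sub>k\<close> measures
 the distance to the boundary inside the manifold.\<close>

locale boundary_chart =
 fixes \<Omega> :: "(real^'n) set" and f :: "real^'n => real^'m" and x0 k \<sigma> a b Q w z W
 assumes open_\<Omega>: "open \<Omega>" and x0: "x0 \<in> frontier \<Omega>"
  and sign: "\<sigma> = 1 \<or> \<sigma> = -1" and a_k: "a $ k = 0" and a_less_b: "\<And>j. a $ j < b $ j" and cQ: "cbox a b \<subseteq> Q"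
  and wC2: "C2_scalar Q w" and zC2: "\<And>\<alpha>. C2_scalar Q (\<lambda>y. z y $ \<alpha>)"
  and inner_points: "\<And>y. y \<in> cbox a b ==> y $ k > 0 ==> set_coord k (w y) y \<in> - closure \<Omega>"
   "\<And>y. y \<in> cbox a b ==> y $ k > 0 ==> \<sigma> * pd k w y > 0"
   "\<And>y. y \<in> Q ==> y $ k > 0 ==> f (set_coord k (w y) y) = z y"
  and face_points: "\<And>y. y \<in> cbox a b ==> y $ k = 0 ==> set_coord k (w y) y \<in> frontier \<Omega>"
   "\<And>y. y \<in> cbox a b ==> y $ k = 0 ==> pd k w y = 0"
   "\<And>y j \<alpha>. y \<in> cbox a b ==> y $ k = 0 ==> j \<noteq> k ==> pd j (\<lambda>y. z y $ \<alpha>) y = 0"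
   "\<And>y. y \<in> cbox a b ==> y $ k = 0 ==> \<exists>\<alpha>. pd k (\<lambda>y. z y $ \<alpha>) y \<noteq> 0"
  and open_W: "open W" and x0W: "x0 \<in> W"
  and covered: "\<And>x. x \<in> W ==> x \<notin> \<Omega> ==> \<exists>y. set_coord k (w y) y = x \<and>
   y \<in> cylinder k a b \<and> 0 \<le> y $ k \<and> y $ k < b $ k"

lemma C2_fst_snd:
 fixes \<psi> :: "real^'n => (real^'n) \<times> (real^'m)"
 assumes "C2_on U \<psi>"
 shows "C2_scalar U (\<lambda>y. fst (\<psi> y) $ i)" "C2_scalar U (\<lambda>y. snd (\<psi> y) $ \<alpha>)"
 using C2_on_component[OF assms bounded_linear_compose[OF bounded_linear_vec_nth bounded_linear_fst]]
  C2_on_component[OF assms bounded_linear_compose[OF bounded_linear_vec_nth bounded_linear_snd]] by simp_all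

lemma immersion_components:
 fixes \<psi> :: "real^'n => (real^'n) \<times> (real^'m)"
 assumes C2: "C2_on U \<psi>" and y: "y \<in> U" and inj: "inj (frechet_derivative \<psi> (at y))"
  and 0: "\<And>i. (\<Sum>c. v $ c * pd c (\<lambda>y. fst (\<psi> y) $ i) y) = 0"
   "\<And>\<alpha>. (\<Sum>c. v $ c * pd c (\<lambda>y. snd (\<psi> y) $ \<alpha>) y) = 0"
 shows "v = 0"
proof -
 obtain \<psi>' where d: "(\<psi> has_derivative \<psi>') (at y)" using C2 y unfolding C2_on_def by blast
 have fr: "frechet_derivative \<psi> (at y) = \<psi>'" using frechet_derivative_at[OF d] by simp
 have "((\<lambda>y. fst (\<psi> y) $ i) has_derivative (\<lambda>v. fst (\<psi>' v) $ i)) (at y)" for i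
  using bounded_linear.has_derivative[OF bounded_linear_compose[OF bounded_linear_vec_nth bounded_linear_fst] d] .
 from has_derivative_unique[OF this C1_on_has_derivative_pd[OF C2_scalar_C1[OF C2_fst_snd(1)[OF C2]] y]]
 have "fst (\<psi>' v) $ i = 0" for i using 0(1)[of i] by metis
 moreover have "((\<lambda>y. snd (\<psi> y) $ \<alpha>) has_derivative (\<lambda>v. snd (\<psi>' v) $ \<alpha>)) (at y)" for \<alpha>
  using bounded_linear.has_derivative[OF bounded_linear_compose[OF bounded_linear_vec_nth bounded_linear_snd] d] .
 from has_derivative_unique[OF this C1_on_has_derivative_pd[OF C2_scalar_C1[OF C2_fst_snd(2)[OF C2]] y]]
 have "snd (\<psi>' v) $ \<alpha> = 0" for \<alpha> using 0(2)[of \<alpha>] by metis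
 ultimately have "\<psi>' v = 0" by (simp add: prod_eq_iff vec_eq_iff)
 moreover have "\<psi>' 0 = 0" using has_derivative_bounded_linear[OF d] by (simp add: linear_simps)
 ultimately show ?thesis using inj unfolding fr inj_def by metis
qed

text \<open>In a given chart \<open>\<psi> = (X, Z)\<close> replace the \<open>k\<close>-th horizontal coordinate by the distance \<open>e \<bullet> y\<close> to the
 boundary.  The resulting map \<open>\<theta>\<close> is a local diffeomorphism for a suitable \<open>k\<close>: since \<open>Z\<close> is constant
 along the boundary, \<open>X\<close> alone immerses the boundary as a hypersurface, and \<open>k\<close> is chosen transversal
 to it.  The new chart is \<open>\<psi>\<close> composed with the inverse of \<open>\<theta>\<close>.\<close>

theorem boundary_chart_exists:
 fixes \<Omega> :: "(real^'n) set" and f :: "real^'n => real^'m"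
 assumes \<Omega>: "open \<Omega>" and fc: "continuous_on (- \<Omega>) f"
  and const: "\<And>C. C \<in> components (frontier \<Omega>) ==> f constant_on C"
  and fC2: "\<And>\<alpha>. C2_scalar (- closure \<Omega>) (\<lambda>x. f x $ \<alpha>)"
  and sub: "C2_submanifold_with_boundary (graph_over (- \<Omega>) f) (graph_over (frontier \<Omega>) f)"
  and tang: "\<And>C. C \<in> components (frontier \<Omega>) ==> \<exists>L. subspace L \<and> dim L = 1 \<and>
    (\<forall>x\<in>C. tangent_space (graph_over (- \<Omega>) f) (x, f x) = tangent_space C x \<times> L)"
  and x0: "x0 \<in> frontier \<Omega>" and B: "open B" "x0 \<in> B"
 obtains k \<sigma> a b Q w z W where "boundary_chart \<Omega> f x0 k \<sigma> a b Q w z W" "\<And>y. y \<in> Q ==> set_coord k (w y) y \<in> B"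
proof -
 let ?M = "graph_over (- \<Omega>) f" and ?B = "graph_over (frontier \<Omega>) f"
 have fr\<Omega>: "frontier \<Omega> \<subseteq> - \<Omega>" "- \<Omega> - frontier \<Omega> = - closure \<Omega>"
  using \<Omega> closure_subset[of \<Omega>] by (auto simp: frontier_def interior_open)
 have q: "(x0, f x0) \<in> ?M" "(x0, f x0) \<in> ?B" using x0 fr\<Omega> by (auto simp: graph_over_def)
 obtain U V \<psi> \<phi> and e :: "real^'n" where c: "open V" "(x0, f x0) \<in> V" "e \<noteq> 0" "C2_on U \<psi>"
  "\<forall>y\<in>U. inj (frechet_derivative \<psi> (at y))"
  "homeomorphism (U \<inter> {y. 0 \<le> e \<bullet> y}) (?M \<inter> V) \<psi> \<phi>" "\<psi> ` (U \<inter> {y. e \<bullet> y = 0}) = ?B \<inter> V"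
  using sub[unfolded C2_submanifold_with_boundary_def, THEN conjunct2, THEN bspec, OF q(1)] by (elim exE conjE) (rule that, assumption+)
 define X where "X y = fst (\<psi> y)" for y
 define Z where "Z y = snd (\<psi> y)" for y
 have oU: "open U" using c(4) by (auto simp: C2_on_def)
 have XC2: "C2_scalar U (\<lambda>y. X y $ i)" and ZC2: "C2_scalar U (\<lambda>y. Z y $ \<alpha>)" for i \<alpha>
  using C2_fst_snd[OF c(4)] by (simp_all add: X_def Z_def)
 have imm: "v = 0" if "y \<in> U" "\<And>i. (\<Sum>c. v $ c * pd c (\<lambda>y. X y $ i) y) = 0" "\<And>\<alpha>. (\<Sum>c. v $ c * pd c (\<lambda>y. Z y $ \<alpha>) y) = 0" for v y
  by (rule immersion_components[OF c(4) that(1) c(5)[THEN bspec, OF that(1)]]) (use that in \<open>simp_all add: X_def Z_def\<close>)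
 have Xc: "continuous_on U X" by (rule C1_vec_continuous[OF C2_scalar_C1[OF XC2]])
 have hom: "\<phi> (\<psi> y) = y" "\<psi> y \<in> ?M" "\<psi> y \<in> V" if "y \<in> U" "0 \<le> e \<bullet> y" for y
  using c(6) that unfolding homeomorphism_def by blast+
 have hom': "\<psi> (\<phi> p) = p" "\<phi> p \<in> U" "0 \<le> e \<bullet> \<phi> p" if "p \<in> ?M" "p \<in> V" for p
  using c(6) that unfolding homeomorphism_def by blast+
 have graph: "X y \<notin> \<Omega>" "Z y = f (X y)" if "y \<in> U" "0 \<le> e \<bullet> y" for y
  using hom(2)[OF that] by (auto simp: X_def Z_def graph_over_def)
 have bdry: "X y \<in> frontier \<Omega>" if "y \<in> U" "e \<bullet> y = 0" for y
 proof -
  have "\<psi> y \<in> ?B" using c(7) that by blast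
  thus ?thesis by (auto simp: X_def graph_over_def)
 qed
 have inter: "X y \<notin> frontier \<Omega>" if "y \<in> U" "0 < e \<bullet> y" for y
 proof
  assume "X y \<in> frontier \<Omega>"
  moreover have "\<psi> y = (X y, f (X y))" using graph(2)[of y] that by (simp add: X_def Z_def prod_eq_iff)
  ultimately have "\<psi> y \<in> ?B \<inter> V" using hom(3)[of y] that by (auto simp: graph_over_def)
  hence "\<psi> y \<in> \<psi> ` (U \<inter> {y. e \<bullet> y = 0})" using c(7) by simp
  then obtain y' where y': "y' \<in> U" "e \<bullet> y' = 0" "\<psi> y = \<psi> y'" by blast
  have "y = \<phi> (\<psi> y)" using hom(1)[of y] that by simp
  also have "... = y'" using hom(1)[of y'] y'(1,2) by (simp add: y'(3))
  finally show False using y'(2) that by simp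
 qed
 define y0 where "y0 = \<phi> (x0, f x0)"
 have y0: "y0 \<in> U" "\<psi> y0 = (x0, f x0)" "e \<bullet> y0 = 0"
 proof -
  show 1: "y0 \<in> U" "\<psi> y0 = (x0, f x0)" using hom'[OF q(1) c(2)] by (simp_all add: y0_def)
  have "0 \<le> e \<bullet> y0" using hom'(3)[OF q(1) c(2)] by (simp add: y0_def)
  moreover have "X y0 = x0" using 1(2) by (simp add: X_def)
  ultimately show "e \<bullet> y0 = 0" using inter[OF 1(1)] x0 by (metis order_le_less)
 qed
 have Xy0: "X y0 = x0" using y0 by (simp add: X_def)
 \<comment> \<open>the boundary near the point lies in a single component, on which \<open>f\<close> is constant\<close>
 have "open (U \<inter> X -` B)" by (rule continuous_open_preimage[OF Xc oU B(1)])
 moreover have "y0 \<in> U \<inter> X -` B" using y0(1) Xy0 B(2) by simp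
 ultimately have "\<exists>e>0. ball y0 e \<subseteq> U \<inter> X -` B" unfolding open_contains_ball by (rule bspec)
 then obtain \<rho> where \<rho>: "\<rho> > 0" "ball y0 \<rho> \<subseteq> U" "ball y0 \<rho> \<subseteq> X -` B"
  by (elim exE conjE le_infE) (rule that)
 have Zconst: "Z y = f x0" if "y \<in> ball y0 \<rho>" "e \<bullet> y = 0" for y
 proof -
  let ?H = "ball y0 \<rho> \<inter> {y. e \<bullet> y = 0}"
  have "convex ?H" by (intro convex_Int convex_ball convex_hyperplane)
  hence "connected (X ` ?H)"
   using \<rho>(2) by (intro connected_continuous_image continuous_on_subset[OF Xc] convex_connected) auto
  moreover have "X ` ?H \<subseteq> frontier \<Omega>" using bdry \<rho>(2) by blast
  moreover have x0H: "x0 \<in> X ` ?H" using Xy0 y0(3) \<rho>(1) by (auto intro!: image_eqI[of _ _ y0])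
  ultimately have sub: "X ` ?H \<subseteq> connected_component_set (frontier \<Omega>) x0" by (intro connected_component_maximal)
  have "connected_component_set (frontier \<Omega>) x0 \<in> components (frontier \<Omega>)" using x0 by (rule componentsI)
  hence "f constant_on connected_component_set (frontier \<Omega>) x0" by (rule const)
  then obtain c where c: "\<And>x. x \<in> connected_component_set (frontier \<Omega>) x0 ==> f x = c" unfolding constant_on_def by blast
  have "X y \<in> X ` ?H" using that by blast
  hence "f (X y) = c" by (intro c subsetD[OF sub])
  moreover have "f x0 = c" by (intro c subsetD[OF sub x0H])
  ultimately have "f (X y) = f x0" by simp
  moreover have "Z y = f (X y)" using graph(2)[of y] that \<rho>(2) by auto
  ultimately show ?thesis by simp
 qed
 have Ztang: "(\<Sum>c. v $ c * pd c (\<lambda>y. Z y $ \<alpha>) y0) = 0" if v: "e \<bullet> v = 0" for v \<alpha>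
 proof -
  have d: "((\<lambda>y. Z y $ \<alpha>) has_derivative (\<lambda>v. \<Sum>c. v $ c * pd c (\<lambda>y. Z y $ \<alpha>) y0)) (at y0)"
   by (rule C1_on_has_derivative_pd[OF C2_scalar_C1[OF ZC2] y0(1)])
  have l: "((\<lambda>t::real. y0 + t *\<^sub>R v) has_derivative (\<lambda>t. t *\<^sub>R v)) (at 0)" by (auto intro!: derivative_eq_intros)
  have "((\<lambda>t. Z (y0 + t *\<^sub>R v) $ \<alpha>) has_derivative (\<lambda>t. \<Sum>c. (t *\<^sub>R v) $ c * pd c (\<lambda>y. Z y $ \<alpha>) y0)) (at 0)"
   by (rule has_derivative_compose[OF l]) (use d in simp)
  moreover have "((\<lambda>t. Z (y0 + t *\<^sub>R v) $ \<alpha>) has_derivative (\<lambda>t. 0)) (at 0)"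
  proof (rule has_derivative_transform_within_open[of "\<lambda>t. f x0 $ \<alpha>" _ 0 UNIV "{t. y0 + t *\<^sub>R v \<in> ball y0 \<rho>}"])
   have "open ((\<lambda>t::real. y0 + t *\<^sub>R v) -` ball y0 \<rho>)" by (intro open_vimage open_ball continuous_intros)
   thus "open {t::real. y0 + t *\<^sub>R v \<in> ball y0 \<rho>}" by (simp add: vimage_def)
   show "f x0 $ \<alpha> = Z (y0 + t *\<^sub>R v) $ \<alpha>" if "t \<in> {t. y0 + t *\<^sub>R v \<in> ball y0 \<rho>}" for t
    using Zconst[of "y0 + t *\<^sub>R v"] that v y0(3) by (simp add: inner_add_right)
  qed (use \<rho>(1) in auto)
  ultimately have "(\<lambda>t. \<Sum>c. (t *\<^sub>R v) $ c * pd c (\<lambda>y. Z y $ \<alpha>) y0) = (\<lambda>t. 0)" by (rule has_derivative_unique)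
  from fun_cong[OF this, of 1] show ?thesis by simp
 qed
 \<comment> \<open>a coordinate \<open>k\<close> which is transversal to the boundary hypersurface\<close>
 define A where "A v = (\<chi> i. \<Sum>c. v $ c * pd c (\<lambda>y. X y $ i) y0)" for v
 have linA: "linear A"
  by (rule linearI) (auto simp: A_def vec_eq_iff sum.distrib distrib_right sum_distrib_left mult_ac)
 have "dim (A ` {v. e \<bullet> v = 0}) \<le> dim {v. e \<bullet> v = 0}" by (rule dim_image_le[OF linA])
 also have "... < DIM(real^'n)" using dim_hyperplane[OF c(3)] by simp
 finally obtain N where N: "N \<noteq> 0" "\<And>p. p \<in> span (A ` {v. e \<bullet> v = 0}) ==> orthogonal N p"
  using orthogonal_to_subspace_exists by blast
 then obtain k where k: "N $ k \<noteq> 0" by (metis vec_eq_iff zero_index)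
 define \<theta> where "\<theta> y = set_coord k (e \<bullet> y) (X y)" for y
 have \<theta>C2: "C2_scalar U (\<lambda>y. \<theta> y $ j)" for j
  using XC2[of j] C2_scalar_inner[OF oU, of e] by (cases "j = k") (simp_all add: \<theta>_def)
 have \<theta>inj: "v = 0" if v0: "\<forall>j. (\<Sum>i. v $ i * pd i (\<lambda>y. \<theta> y $ j) y0) = 0" for v
 proof -
  have pe: "pd i (\<lambda>y. e \<bullet> y) y0 = e $ i" for i
   using pd_eqI[OF bounded_linear.has_derivative[OF bounded_linear_inner_right has_derivative_ident], of i e y0]
   by (simp add: inner_axis)
  have "(\<Sum>i. v $ i * e $ i) = 0" using spec[OF v0, of k] by (simp add: \<theta>_def pe)
  hence ev: "e \<bullet> v = 0" by (simp add: inner_vec_def mult.commute)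
  have Av: "A v $ j = 0" if "j \<noteq> k" for j using spec[OF v0, of j] that by (simp add: \<theta>_def A_def)
  have "A v \<in> span (A ` {v. e \<bullet> v = 0})" using ev by (intro span_base) auto
  hence "N \<bullet> A v = 0" using N(2) by (simp add: orthogonal_def)
  also have "N \<bullet> A v = N $ k * A v $ k"
   unfolding inner_vec_def by (subst sum.remove[of _ k]) (auto simp: Av)
  finally have "A v $ k = 0" using k by simp
  hence "A v $ j = 0" for j using Av by (cases "j = k") auto
  thus ?thesis using imm[OF y0(1), of v] Ztang[OF ev] by (simp add: A_def)
 qed
 obtain U' V' g where g: "open U'" "U' \<subseteq> U" "y0 \<in> U'" "open V'" "\<theta> y0 \<in> V'" "homeomorphism U' V' \<theta> g"
  "\<And>j. C2_scalar V' (\<lambda>y. g y $ j)"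
  by (rule C2_inverse_function[OF \<theta>C2 y0(1) \<theta>inj]) (assumption, rule that)
 have gV: "g y \<in> U'" "\<theta> (g y) = y" if "y \<in> V'" for y using g(6) that unfolding homeomorphism_def by auto
 have g\<theta>: "g (\<theta> u) = u" "\<theta> u \<in> V'" if "u \<in> U'" for u using g(6) that unfolding homeomorphism_def by auto
 have gc: "continuous_on V' g" using g(6) unfolding homeomorphism_def by auto
 define Q where "Q = V' \<inter> g -` ball y0 \<rho>"
 have oQ: "open Q" unfolding Q_def by (rule continuous_open_preimage[OF gc g(4) open_ball])
 have QV: "Q \<subseteq> V'" by (auto simp: Q_def)
 define w where "w y = X (g y) $ k" for y
 define z where "z y = Z (g y)" for y
 have gU: "g ` Q \<subseteq> U" using gV g(2) QV by blast
 have gC2: "C2_scalar Q (\<lambda>y. g y $ j)" for j by (rule C2_scalar_subset[OF g(7) oQ QV])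
 have wC2: "C2_scalar Q w" unfolding w_def by (rule C2_scalar_comp[OF XC2 gC2 gU])
 have zC2: "C2_scalar Q (\<lambda>y. z y $ \<alpha>)" for \<alpha> unfolding z_def by (rule C2_scalar_comp[OF ZC2 gC2 gU])
 have Xg: "X (g y) = set_coord k (w y) y" "e \<bullet> g y = y $ k" if "y \<in> V'" for y
 proof -
  have "\<theta> (g y) $ j = y $ j" for j using gV(2)[OF that] by simp
  hence th: "(if j = k then e \<bullet> g y else X (g y) $ j) = y $ j" for j by (simp add: \<theta>_def)
  show "e \<bullet> g y = y $ k" using th[of k] by simp
  have "X (g y) $ j = y $ j" if "j \<noteq> k" for j using th[of j] that by simp
  thus "X (g y) = set_coord k (w y) y" by (auto simp: vec_eq_iff w_def)
 qed
 have D: "set_coord k (w y) y \<in> - closure \<Omega>" "f (set_coord k (w y) y) = z y" if "y \<in> V'" "y $ k > 0" for y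
 proof -
  have u: "g y \<in> U" "0 < e \<bullet> g y" using gV g(2) Xg that by auto
  show "set_coord k (w y) y \<in> - closure \<Omega>" using graph(1)[of "g y"] inter[of "g y"] u fr\<Omega>(2) Xg(1)[OF that(1)] by auto
  show "f (set_coord k (w y) y) = z y" using graph(2)[of "g y"] u Xg(1)[OF that(1)] by (simp add: z_def)
 qed
 have F: "set_coord k (w y) y \<in> frontier \<Omega>" "f (set_coord k (w y) y) = z y" if "y \<in> V'" "y $ k = 0" for y
 proof -
  have u: "g y \<in> U" "0 = e \<bullet> g y" using gV g(2) Xg that by auto
  show "set_coord k (w y) y \<in> frontier \<Omega>" using bdry[of "g y"] u Xg(1)[OF that(1)] by simp
  show "f (set_coord k (w y) y) = z y" using graph(2)[of "g y"] u Xg(1)[OF that(1)] by (simp add: z_def)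
 qed
 \<comment> \<open>neighbourhoods in the parameter space give neighbourhoods in the complement of \<open>\<Omega>\<close>\<close>
 have nbhd: "\<exists>W. open W \<and> (\<forall>x\<in>W. x \<notin> \<Omega> --> (\<exists>y\<in>Q'. 0 \<le> y $ k \<and> set_coord k (w y) y = x)) \<and>
   (\<forall>y\<in>Q'. 0 \<le> y $ k --> set_coord k (w y) y \<in> W)" if Q': "open Q'" "Q' \<subseteq> V'" for Q'
 proof -
  have O': "open (U' \<inter> \<theta> -` Q')"
   by (rule continuous_open_preimage[OF _ g(1) Q'(1)]) (use g(6) in \<open>auto simp: homeomorphism_def\<close>)
  have "continuous_on (?M \<inter> V) \<phi>" using c(6) by (simp add: homeomorphism_def)
  then obtain V2 where V2: "open V2" "V2 \<inter> (?M \<inter> V) = \<phi> -` (U' \<inter> \<theta> -` Q') \<inter> (?M \<inter> V)"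
   using O' unfolding continuous_on_open_invariant by metis
  have "continuous_on (- \<Omega>) (\<lambda>x. (x, f x))" by (intro continuous_intros fc)
  then obtain W where W: "open W" "W \<inter> - \<Omega> = (\<lambda>x. (x, f x)) -` (V \<inter> V2) \<inter> - \<Omega>"
   using open_Int[OF c(1) V2(1)] unfolding continuous_on_open_invariant by metis
  have 1: "\<exists>y\<in>Q'. 0 \<le> y $ k \<and> set_coord k (w y) y = x" if x: "x \<in> W" "x \<notin> \<Omega>" for x
  proof -
   have p: "(x, f x) \<in> ?M" "(x, f x) \<in> V" "(x, f x) \<in> V2" using x W(2) by (auto simp: graph_over_def)
   hence "\<phi> (x, f x) \<in> U'" "\<theta> (\<phi> (x, f x)) \<in> Q'" using V2(2) by blast+
   moreover define y where "y = \<theta> (\<phi> (x, f x))"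
   ultimately have y: "y \<in> Q'" "y \<in> V'" "g y = \<phi> (x, f x)" using Q' g\<theta> by auto
   have "X (g y) = x" using hom'(1)[OF p(1,2)] y(3) by (simp add: X_def)
   moreover have "0 \<le> e \<bullet> g y" using hom'(3)[OF p(1,2)] y(3) by simp
   ultimately show ?thesis using Xg[OF y(2)] y(1) by auto
  qed
  have 2: "set_coord k (w y) y \<in> W" if y: "y \<in> Q'" "0 \<le> y $ k" for y
  proof -
   have yV: "y \<in> V'" using Q' y by blast
   have u: "g y \<in> U'" "g y \<in> U" "0 \<le> e \<bullet> g y" using gV[OF yV] g(2) Xg[OF yV] y by auto
   have "\<psi> (g y) = (X (g y), f (X (g y)))" using graph(2)[OF u(2,3)] by (simp add: X_def Z_def prod_eq_iff)
   moreover have "\<psi> (g y) \<in> V2"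
    using V2(2) hom[OF u(2,3)] u(1) gV(2)[OF yV] y(1) by auto
   ultimately show ?thesis using W(2) hom(3)[OF u(2,3)] graph(1)[OF u(2,3)] Xg(1)[OF yV] by auto
  qed
  show ?thesis using W(1) 1 2 by blast
 qed
 have \<theta>y0: "\<theta> y0 = set_coord k 0 x0" by (simp add: \<theta>_def y0(3) Xy0)
 have y0Q: "\<theta> y0 \<in> Q" using g g\<theta>(1)[OF g(3)] \<rho>(1) by (auto simp: Q_def)
 note wd = C2_scalar_differentiable[OF wC2] and zd = C2_scalar_differentiable[OF zC2]
 have zb: "pd j (\<lambda>y. z y $ \<alpha>) y = 0" if y: "y \<in> Q" "y $ k = 0" and j: "j \<noteq> k" for y j \<alpha>
 proof -
  have sy: "set_coord k 0 y = y" using y(2) by (auto simp: vec_eq_iff)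
  have "open ((\<lambda>y. set_coord k 0 y) -` Q)" by (rule open_vimage[OF oQ]) (intro continuous_intros)
  hence "pd j (\<lambda>y. z (set_coord k 0 y) $ \<alpha>) y = pd j (\<lambda>y. f x0 $ \<alpha>) y"
  proof (rule pd_cong)
   fix y assume "y \<in> (\<lambda>y. set_coord k 0 y) -` Q"
   thus "z (set_coord k 0 y) $ \<alpha> = f x0 $ \<alpha>"
    using Zconst[of "g (set_coord k 0 y)"] Xg(2)[of "set_coord k 0 y"] by (simp add: Q_def z_def)
  qed (use y sy in simp)
  thus ?thesis
   using pd_comp_set_coord[of "\<lambda>y. z y $ \<alpha>" k "\<lambda>_. 0" y j] zd[OF y(1)] j by (simp add: sy)
 qed
 have immk: "pd k w y \<noteq> 0 \<or> (\<exists>\<alpha>. pd k (\<lambda>y. z y $ \<alpha>) y \<noteq> 0)" if y: "y \<in> Q" for y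
 proof (rule ccontr)
  assume "\<not> ?thesis"
  hence w0: "pd k w y = 0" and z0: "pd k (\<lambda>y. z y $ \<alpha>) y = 0" for \<alpha> by auto
  have gy: "g y \<in> U" using gU y by blast
  have gd: "(\<lambda>y. g y $ j) differentiable (at y)" for j by (rule C2_scalar_differentiable[OF gC2 y])
  define v where "v = (\<chi> c. pd k (\<lambda>y. g y $ c) y)"
  have ch: "(\<Sum>c. v $ c * pd c h (g y)) = pd k (\<lambda>y. h (g y)) y" if "C2_scalar U h" for h
   using pd_comp[OF C2_scalar_differentiable[OF that gy] gd, of k] by (simp add: v_def mult.commute)
  have "(\<Sum>c. v $ c * pd c (\<lambda>y. X y $ i) (g y)) = 0" for i
  proof -
   have "pd k (\<lambda>y. X (g y) $ i) y = pd k (\<lambda>y. set_coord k (w y) y $ i) y"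
    by (rule pd_cong[OF oQ y]) (use Xg QV in auto)
   also have "... = 0" using w0 by (cases "i = k") (simp_all)
   finally show ?thesis using ch[OF XC2[of i]] by simp
  qed
  moreover have "(\<Sum>c. v $ c * pd c (\<lambda>y. Z y $ \<alpha>) (g y)) = 0" for \<alpha>
   using ch[OF ZC2[of \<alpha>]] z0[of \<alpha>] by (simp add: z_def)
  ultimately have "v = 0" by (rule imm[OF gy])
  moreover have "pd k (\<lambda>y. \<theta> (g y) $ k) y = pd k (\<lambda>y. y $ k) y"
   by (rule pd_cong[OF oQ y]) (use gV QV in auto)
  ultimately show False using ch[OF \<theta>C2[of k]] by simp
 qed
 \<comment> \<open>tangency to the cylinder makes the chart vertical along the boundary\<close>
 have wb: "pd k w y = 0" if y: "y \<in> Q" "y $ k = 0" for y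
 proof -
  define x1 where "x1 = set_coord k (w y) y"
  have yV: "y \<in> V'" using y QV by blast
  have x1: "x1 \<in> frontier \<Omega>" "f x1 = z y" using F[OF yV y(2)] by (simp_all add: x1_def)
  define C where "C = connected_component_set (frontier \<Omega>) x1"
  have C: "C \<in> components (frontier \<Omega>)" "x1 \<in> C" using x1 by (auto simp: C_def componentsI)
  obtain L where L: "tangent_space ?M (x1, f x1) = tangent_space C x1 \<times> L" using tang[OF C(1)] C(2) by blast
  define v where "v = (pd k w y *\<^sub>R axis k (1::real), \<chi> \<alpha>. pd k (\<lambda>y. z y $ \<alpha>) y)"
  have "v \<in> tangent_space ?M (set_coord k (w y) y, z y)"
  proof (rule tangent_space_ray[OF oQ y(1), of "axis k 1" "\<lambda>y. (set_coord k (w y) y, z y)"])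
   fix t :: real assume t: "0 \<le> t" "y + t *\<^sub>R axis k 1 \<in> Q"
   let ?l = "y + t *\<^sub>R axis k 1"
   have "?l \<in> V'" "?l $ k = t" using t QV y(2) by auto
   hence "f (set_coord k (w ?l) ?l) = z ?l \<and> set_coord k (w ?l) ?l \<notin> \<Omega>"
    using t D[of ?l] F[of ?l] fr\<Omega> closure_subset[of \<Omega>] by (cases "t = 0") auto
   thus "(set_coord k (w ?l) ?l, z ?l) \<in> ?M" by (auto simp: graph_over_def)
  next
    have dw: "((\<lambda>t. w (y + t *\<^sub>R axis k 1)) has_real_derivative pd k w y) (at 0)"
     using has_real_derivative_along_axis[of w y 0 k] wd[OF y(1)] by simp
    have dz: "((\<lambda>t. z (y + t *\<^sub>R axis k 1) $ \<alpha>) has_real_derivative pd k (\<lambda>y. z y $ \<alpha>) y) (at 0)" for \<alpha>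
     using has_real_derivative_along_axis[of "\<lambda>y. z y $ \<alpha>" y 0 k] zd[OF y(1)] by simp
    show "((\<lambda>t. (set_coord k (w (y + t *\<^sub>R axis k 1)) (y + t *\<^sub>R axis k 1), z (y + t *\<^sub>R axis k 1))) has_vector_derivative v) (at 0)"
     unfolding v_def
    proof (rule has_vector_derivative_Pair)
     show "((\<lambda>t. set_coord k (w (y + t *\<^sub>R axis k 1)) (y + t *\<^sub>R axis k 1)) has_vector_derivative pd k w y *\<^sub>R axis k 1) (at 0)"
     proof -
      have e: "set_coord k (w (y + t *\<^sub>R axis k 1)) (y + t *\<^sub>R axis k 1) = set_coord k 0 y + w (y + t *\<^sub>R axis k 1) *\<^sub>R axis k 1" for t
       by (auto simp: vec_eq_iff axis_def)
      have "((\<lambda>t. set_coord k 0 y + w (y + t *\<^sub>R axis k 1) *\<^sub>R axis k (1::real)) has_vector_derivative (0 + pd k w y *\<^sub>R axis k 1)) (at 0)"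
       by (intro has_vector_derivative_add has_vector_derivative_const has_vector_derivative_scaleR[OF dw has_vector_derivative_const, simplified])
      thus ?thesis unfolding e by simp
     qed
     show "((\<lambda>t. z (y + t *\<^sub>R axis k 1)) has_vector_derivative (\<chi> \<alpha>. pd k (\<lambda>y. z y $ \<alpha>) y)) (at 0)"
      unfolding has_vector_derivative_def
      by (subst has_derivative_componentwise_within)
       (use dz in \<open>auto simp: Basis_vec_def inner_axis has_field_derivative_def mult.commute[of _ "pd _ _ _"]\<close>)
    qed
  qed
  hence vC: "pd k w y *\<^sub>R axis k 1 \<in> tangent_space C x1" using L x1(2) by (simp add: v_def x1_def)
  obtain W where W: "open W" "\<And>x. x \<in> W ==> x \<notin> \<Omega> ==> \<exists>y\<in>Q. 0 \<le> y $ k \<and> set_coord k (w y) y = x"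
   "\<And>y. y \<in> Q ==> 0 \<le> y $ k ==> set_coord k (w y) y \<in> W" using nbhd[OF oQ QV] by blast
  \<comment> \<open>near \<open>x1\<close> the boundary is the graph of the restriction of \<open>w\<close> to \<open>y\<^sub>k = 0\<close>, so it has no vertical tangent\<close>
  have gr: "x $ k - w (set_coord k 0 x) = 0" if x: "x \<in> C" "x \<in> W" for x
  proof -
   have xf: "x \<in> frontier \<Omega>" using x(1) in_components_subset[OF C(1)] by blast
   then obtain y' where y': "y' \<in> Q" "0 \<le> y' $ k" "set_coord k (w y') y' = x" using W(2)[of x] x fr\<Omega> by blast
   have "y' $ k = 0" using D(1)[of y'] y' QV xf by (cases "y' $ k = 0") (auto simp: frontier_def)
   hence "y' = set_coord k 0 x" unfolding y'(3)[symmetric] by (auto simp: vec_eq_iff)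
   thus ?thesis using arg_cong[OF y'(3), of "\<lambda>x. x $ k"] by simp
  qed
  have x1W: "x1 \<in> W" using W(3)[OF y(1)] y(2) by (simp add: x1_def)
  have sy: "set_coord k 0 x1 = y" using y(2) by (auto simp: x1_def vec_eq_iff)
  have d: "(\<lambda>x. x $ k) differentiable (at x1)" "(\<lambda>x. w (set_coord k 0 x)) differentiable (at x1)"
   using has_derivative_comp_pd[of w "\<lambda>x. set_coord k 0 x" x1] differentiable_set_coord[of "\<lambda>_. 0" x1 k] wd[OF y(1)] has_derivative_nth
   by (auto simp: sy intro: differentiableI)
  have "pd i (\<lambda>x. x $ k - w (set_coord k 0 x)) x1 = 1" if "i = k" for i
   using pd_diff[OF d, of k] pd_comp_set_coord[of w k "\<lambda>_. 0" x1 k] wd[OF y(1)] that by (simp add: sy)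
  with tangent_space_zero[OF differentiable_diff[OF d] W(1) x1W gr vC]
  show ?thesis by (simp add: axis_def if_distrib[of "\<lambda>x. _ * x"] if_distrib[of "\<lambda>x. x * _"] cong: if_cong)
 qed
 have wnz: "pd k w y \<noteq> 0" if y: "y \<in> Q" "y $ k > 0" for y
 proof
  assume w0: "pd k w y = 0"
  let ?Q = "Q \<inter> {y. y $ k > 0}"
  have oQ': "open ?Q" using oQ by (intro open_Int open_Collect_less continuous_intros)
  have yV: "y \<in> V'" using y QV by blast
  have "pd k (\<lambda>y. z y $ \<alpha>) y = 0" for \<alpha>
  proof -
   have "pd k (\<lambda>y. z y $ \<alpha>) y = pd k (\<lambda>y. f (set_coord k (w y) y) $ \<alpha>) y"
    by (rule pd_cong[OF oQ']) (use y D QV in auto)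
   also have "... = 0"
    using pd_comp_set_coord[of "\<lambda>x. f x $ \<alpha>" k w y k] C2_scalar_differentiable[OF fC2 D(1)[OF yV y(2)]] wd[OF y(1)] w0 by simp
   finally show ?thesis .
  qed
  thus False using immk[OF y(1)] w0 by blast
 qed
 obtain a0 b where box: "a0 $ k < 0" "0 < b $ k" "\<theta> y0 \<in> box a0 b" "cbox a0 b \<subseteq> Q" "cbox (set_coord k 0 a0) b \<subseteq> cbox a0 b"
  by (rule half_box_exists[OF oQ y0Q, of k]) (simp add: \<theta>y0, rule that)
 define a where "a = set_coord k 0 a0"
 have ak: "a $ k = 0" by (simp add: a_def)
 have ab: "a $ j < b $ j" for j using box(2,3) by (auto simp: a_def box_vec intro: less_trans)
 have abQ: "cbox a b \<subseteq> Q" using box(4,5) by (auto simp: a_def)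
 \<comment> \<open>for \<open>y\<^sub>k > 0\<close> the derivative \<open>\<partial>\<^sub>k w\<close> has no zero, hence a constant sign\<close>
 have pos: "convex (cbox a b \<inter> {y. y $ k > 0})"
  using convex_halfspace_gt[of 0 "axis k (1::real)"] by (intro convex_Int convex_box) (simp add: inner_axis')
 have "\<exists>\<sigma>. (\<sigma> = 1 \<or> \<sigma> = -1) \<and> (\<forall>y\<in>cbox a b. y $ k > 0 --> \<sigma> * pd k w y > 0)"
 proof (rule ccontr)
  assume *: "\<not> ?thesis"
  have "\<not> (\<forall>y\<in>cbox a b. y $ k > 0 --> 1 * pd k w y > 0)" "\<not> (\<forall>y\<in>cbox a b. y $ k > 0 --> (-1) * pd k w y > 0)"
   using * by blast+
  then obtain y y' where yy: "y \<in> cbox a b" "y $ k > 0" "pd k w y \<le> 0" "y' \<in> cbox a b" "y' $ k > 0" "0 \<le> pd k w y'"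
   by (auto simp: not_less)
  have "connected (pd k w ` (cbox a b \<inter> {y. y $ k > 0}))"
   using abQ by (intro connected_continuous_image convex_connected pos continuous_on_subset[OF C1_on_pd_continuous[OF C2_scalar_C1[OF wC2]]]) auto
  hence "0 \<in> pd k w ` (cbox a b \<inter> {y. y $ k > 0})"
   using yy connectedD_interval[of _ "pd k w y" "pd k w y'" 0] by blast
  thus False using wnz abQ by force
 qed
 then obtain \<sigma> where \<sigma>: "\<sigma> = 1 \<or> \<sigma> = -1" "\<forall>y\<in>cbox a b. y $ k > 0 --> \<sigma> * pd k w y > 0" by blast
 have bQ: "box a0 b \<subseteq> V'" using box(4) QV box_subset_cbox by blast
 obtain W where W: "open W" "\<And>x. x \<in> W ==> x \<notin> \<Omega> ==> \<exists>y\<in>box a0 b. 0 \<le> y $ k \<and> set_coord k (w y) y = x"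
  "\<And>y. y \<in> box a0 b ==> 0 \<le> y $ k ==> set_coord k (w y) y \<in> W" using nbhd[OF open_box bQ] by blast
 have "x0 \<in> W"
 proof -
  have "set_coord k (w (\<theta> y0)) (\<theta> y0) \<in> W" using W(3)[OF box(3)] by (simp add: \<theta>y0)
  moreover have "set_coord k (w (\<theta> y0)) (\<theta> y0) = x0" using Xg(1)[of "\<theta> y0"] g g\<theta>(1)[OF g(3)] Xy0 by simp
  ultimately show ?thesis by simp
 qed
 moreover have "\<exists>y. set_coord k (w y) y = x \<and> y \<in> cylinder k a b \<and> 0 \<le> y $ k \<and> y $ k < b $ k"
  if "x \<in> W" "x \<notin> \<Omega>" for x
  using W(2)[OF that] by (auto simp: box_vec a_def cylinder_def)
 ultimately have "boundary_chart \<Omega> f x0 k \<sigma> a b Q w z W"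
  using \<Omega> x0 \<sigma> ak ab abQ QV wC2 zC2 D F(1) wb zb immk W(1) by unfold_locales (blast | metis subsetD)+
 moreover have "set_coord k (w y) y \<in> B" if "y \<in> Q" for y
 proof -
  have "X (g y) \<in> B" using that \<rho>(3) by (auto simp: Q_def)
  thus ?thesis using Xg(1)[of y] that QV by auto
 qed
 ultimately show thesis by (rule that)
qed

section \<open>The boundary as a hypersurface and its mean curvature\<close>

context boundary_chart
begin

abbreviation U :: "(real^'n) set" where "U \<equiv> cylinder k a b"
definition u :: "real^'n => real" where "u y = w (set_coord k 0 y)"
definition \<Phi> :: "real^'n => real^'n" where "\<Phi> y = set_coord k (w y) y"

lemmas interior_chart = inner_points[folded \<Phi>_def]
 and boundary_values = face_points[folded \<Phi>_def]
 and covering = covered[folded \<Phi>_def]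

lemma \<sigma>: "\<sigma> = 1 \<or> \<sigma> = -1" "\<sigma> * \<sigma> = 1" "\<bar>\<sigma>\<bar> = 1" "\<sigma> \<noteq> 0"
 using sign by auto

lemma ak: "a $ k = 0" "b $ k > 0" "a $ j < b $ j"
 using a_k a_less_b[of k] a_less_b[of j] by auto

lemmas U_cbox = cylinder_cbox[of _ k a b, OF _ ak(1)]
 and box_U = box_cylinder[of a k _ b, OF ak(1)]

lemma U_cbox': "y \<in> U ==> 0 \<le> y $ k ==> y $ k \<le> b $ k ==> y \<in> cbox a b"
 using U_cbox[of y "y $ k"] by simp

lemma set_coord_Q: "y \<in> U ==> set_coord k 0 y \<in> Q"
 using U_cbox[of y 0] ak cQ by auto

lemma u_C2: "C2_scalar U u"
proof -
 have "C2_scalar U (\<lambda>y. set_coord k 0 y $ j)" for j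
 proof (cases "j = k")
  case True
  have "pd i (\<lambda>y::real^'n. 0::real) = (\<lambda>y. 0)" for i by auto
  thus ?thesis using True by (simp add: C2_scalar_def open_cylinder)
 qed (use C2_scalar_nth[OF open_cylinder] in simp)
 from C2_scalar_comp[OF wC2 this] show ?thesis using set_coord_Q unfolding u_def[abs_def] by blast
qed

lemma u_patch: "graph_patch k U u"
 unfolding graph_patch_def using C2_scalar_C1[OF u_C2] by (auto simp: u_def)

lemma pd_u: assumes y: "y \<in> U" and j: "j \<noteq> k" shows "pd j u y = pd j w (set_coord k 0 y)"
 unfolding u_def[abs_def]
 using pd_comp_set_coord[of w k "\<lambda>_. 0" y j] C2_scalar_differentiable[OF wC2 set_coord_Q[OF y]] j by simp

lemma pd_k_u: "y \<in> U ==> pd k u y = 0"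
 by (rule pd_graph_patch(1)[OF u_patch])

lemma pd_pd_u: assumes y: "y \<in> U" and j: "j \<noteq> k" "i \<noteq> k" shows "pd i (pd j u) y = pd i (pd j w) (set_coord k 0 y)"
proof -
 have "pd i (pd j u) y = pd i (\<lambda>y. pd j w (set_coord k 0 y)) y"
  by (rule pd_cong[OF open_cylinder y]) (simp add: pd_u j)
 thus ?thesis
  using pd_comp_set_coord[of "pd j w" k "\<lambda>_. 0" y i] C1_on_differentiable[OF C2_scalar_pd[OF wC2] set_coord_Q[OF y]] j by simp
qed

lemma pd_k_pd_u: "y \<in> U ==> pd k (pd j u) y = 0" "y \<in> U ==> pd j (pd k u) y = 0"
proof -
 assume y: "y \<in> U"
 have "pd j (pd k u) y = pd j (\<lambda>y. 0) y" by (rule pd_cong[OF open_cylinder y]) (simp add: pd_k_u)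
 thus "pd j (pd k u) y = 0" by simp
 thus "pd k (pd j u) y = 0" using pd_symmetric[OF u_C2 y] by simp
qed

lemma w_mono: assumes y: "y \<in> U" and st: "0 \<le> s" "s < t" "t \<le> b $ k"
 shows "\<sigma> * w (set_coord k s y) < \<sigma> * w (set_coord k t y)"
proof -
 have "\<exists>d. ((\<lambda>t. \<sigma> * w (set_coord k t y)) has_real_derivative d) (at r) \<and> (s < r --> r < t --> 0 < d)" if "s \<le> r" "r \<le> t" for r
 proof -
  have r: "set_coord k r y \<in> cbox a b" using U_cbox[OF y] that st by auto
  hence "w differentiable (at (set_coord k r y))" using C2_scalar_differentiable[OF wC2] cQ by blast
  hence "((\<lambda>t. \<sigma> * w (set_coord k t y)) has_real_derivative \<sigma> * pd k w (set_coord k r y)) (at r)"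
   by (intro DERIV_cmult has_real_derivative_set_coord)
  thus ?thesis using interior_chart(2)[OF r] that st by auto
 qed
 thus ?thesis
  by (intro DERIV_pos_imp_increasing_open[OF st(2)] continuous_at_imp_continuous_on) (auto intro: DERIV_isCont less_imp_le)+
qed

lemma inj_on_\<Phi>: "inj_on \<Phi> (box a b)"
proof (rule inj_onI)
 fix x y assume xy: "x \<in> box a b" "y \<in> box a b" "\<Phi> x = \<Phi> y"
 have j: "x $ j = y $ j" if "j \<noteq> k" for j using arg_cong[OF xy(3), of "\<lambda>v. v $ j"] that by (simp add: \<Phi>_def)
 hence e: "y = set_coord k (y $ k) x" by (auto simp: vec_eq_iff)
 have "w x = w y" using arg_cong[OF xy(3), of "\<lambda>v. v $ k"] by (simp add: \<Phi>_def)
 hence "x $ k = y $ k"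
  using w_mono[of x "x $ k" "y $ k"] w_mono[of x "y $ k" "x $ k"] xy(1,2) e by (force simp: box_U neq_iff)
 thus "x = y" using j by (metis vec_eq_iff)
qed

lemma w_line_continuous: "y \<in> U ==> continuous_on {0..b $ k} (\<lambda>t. w (set_coord k t y))"
proof -
 assume y: "y \<in> U"
 have "isCont (\<lambda>t. w (set_coord k t y)) r" if "r \<in> {0..b $ k}" for r
 proof -
  have "set_coord k r y \<in> Q" using U_cbox[OF y] that cQ by auto
  hence "w differentiable (at (set_coord k r y))" by (rule C2_scalar_differentiable[OF wC2])
  thus ?thesis using DERIV_isCont has_real_derivative_set_coord by blast
 qed
 thus ?thesis by (intro continuous_at_imp_continuous_on ballI)
qed

definition top :: "real^'n => real" where "top y = w (set_coord k (b $ k) y)"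

lemma top_continuous: "continuous_on U top"
proof -
 have "continuous_on U (\<lambda>y. set_coord k (b $ k) y)" by (intro continuous_on_set_coord continuous_intros)
 moreover have "set_coord k (b $ k) ` U \<subseteq> Q" using U_cbox[of _ "b $ k"] ak(2) cQ by fastforce
 ultimately show ?thesis unfolding top_def using continuous_on_compose2[OF C1_on_continuous[OF C2_scalar_C1[OF wC2]]] by blast
qed

lemma u_less_top: "y \<in> U ==> \<sigma> * u y < \<sigma> * top y"
 using w_mono[of y 0 "b $ k"] ak(2) by (simp add: u_def top_def)

lemma u_continuous: "continuous_on U u"
 by (rule C1_on_continuous[OF C2_scalar_C1[OF u_C2]])

lemma outside: assumes x: "x \<in> U" "\<sigma> * u x < \<sigma> * x $ k" "\<sigma> * x $ k < \<sigma> * top x"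
 shows "x \<in> - closure \<Omega>"
proof -
 have "\<exists>t\<ge>0. t \<le> b $ k \<and> \<sigma> * w (set_coord k t x) = \<sigma> * x $ k"
  using x ak(2) w_line_continuous[OF x(1)]
  by (intro IVT') (auto simp: u_def top_def intro!: continuous_intros)
 then obtain t where t: "0 \<le> t" "t \<le> b $ k" "\<sigma> * w (set_coord k t x) = \<sigma> * x $ k" by blast
 hence tx: "w (set_coord k t x) = x $ k" using \<sigma>(4) by simp
 have "t \<noteq> 0" using t(3) x(2) by (auto simp: u_def)
 hence "\<Phi> (set_coord k t x) \<in> - closure \<Omega>" using interior_chart(1)[OF U_cbox[OF x(1) t(1,2)]] t(1) by simp
 thus ?thesis by (simp add: \<Phi>_def tx)
qed

lemma inside: assumes x: "x \<in> W" "x \<in> U" "\<sigma> * x $ k < \<sigma> * u x"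
 shows "x \<in> \<Omega>"
proof (rule ccontr)
 assume "x \<notin> \<Omega>"
 then obtain y where y: "\<Phi> y = x" "y \<in> U" "0 \<le> y $ k" "y $ k < b $ k" using covering x(1) by blast
 have "\<sigma> * u y \<le> \<sigma> * w y"
 proof (cases "y $ k = 0")
  case True
  hence "set_coord k 0 y = y" by (auto simp: vec_eq_iff)
  thus ?thesis by (simp add: u_def)
 next
  case False
  thus ?thesis using w_mono[OF y(2), of 0 "y $ k"] y(3,4) by (simp add: u_def)
 qed
 moreover have "u x = u y" "x $ k = w y" by (simp_all add: u_def flip: y(1) add: \<Phi>_def)
 ultimately show False using x(3) by simp
qed

lemma patch_frontier: "patch_image k U u \<subseteq> frontier \<Omega>"
proof
 fix x assume "x \<in> patch_image k U u"
 hence x: "x \<in> U" "x $ k = u x" using patch_image_iff[OF u_patch] by auto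
 hence "\<Phi> (set_coord k 0 x) \<in> frontier \<Omega>" using boundary_values(1)[OF U_cbox[OF x(1)]] ak(2) by auto
 moreover have "\<Phi> (set_coord k 0 x) = x" using x(2) by (auto simp: \<Phi>_def u_def[symmetric] vec_eq_iff)
 ultimately show "x \<in> frontier \<Omega>" by simp
qed

lemma frontier_notin: "x \<in> frontier \<Omega> ==> x \<notin> \<Omega>" "x \<in> frontier \<Omega> ==> x \<in> closure \<Omega>"
 using open_\<Omega> by (auto simp: frontier_def interior_open)

lemma frontier_patch: assumes "x \<in> frontier \<Omega>" "x \<in> W"
 shows "x \<in> patch_image k U u"
proof -
 obtain y where y: "\<Phi> y = x" "y \<in> U" "0 \<le> y $ k" "y $ k < b $ k" using covering assms frontier_notin(1) by blast
 have "y $ k = 0"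
 proof (rule ccontr)
  assume "y $ k \<noteq> 0"
  hence "\<Phi> y \<in> - closure \<Omega>" using interior_chart(1)[of y] y U_cbox'[of y] by auto
  thus False using y(1) frontier_notin(2)[OF assms(1)] by simp
 qed
 hence "set_coord k 0 y = y" by (auto simp: vec_eq_iff)
 hence "x \<in> U \<and> x $ k = u x" using y(2) by (auto simp: u_def \<Phi>_def simp flip: y(1))
 thus ?thesis using patch_image_iff[OF u_patch] by blast
qed

text \<open>The neighbourhood of \<open>x0\<close> which lies below the top of the collar.\<close>

definition W1 :: "(real^'n) set" where "W1 = {x \<in> W \<inter> U. \<sigma> * x $ k < \<sigma> * top x}"

lemma W1: "open W1" "x0 \<in> W1" "W1 \<subseteq> W" "W1 \<subseteq> U"
proof -
 have "open ((W \<inter> U) \<inter> (\<lambda>x. \<sigma> * top x - \<sigma> * x $ k) -` {0<..})"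
  using open_W open_cylinder top_continuous
  by (intro continuous_open_preimage continuous_intros open_greaterThan) (auto intro: continuous_on_subset)
 also have "(W \<inter> U) \<inter> (\<lambda>x. \<sigma> * top x - \<sigma> * x $ k) -` {0<..} = W1" by (auto simp: W1_def)
 finally show "open W1" .
 have "x0 \<in> U" "x0 $ k = u x0" using frontier_patch[OF x0 x0W] patch_image_iff[OF u_patch] by auto
 thus "x0 \<in> W1" using x0W u_less_top by (simp add: W1_def)
qed (auto simp: W1_def)

lemma W1_cases: assumes "x \<in> W1"
 shows "\<sigma> * x $ k < \<sigma> * u x ==> x \<in> \<Omega>" "\<sigma> * x $ k > \<sigma> * u x ==> x \<in> - closure \<Omega>"
  "x \<in> frontier \<Omega> \<longleftrightarrow> x $ k = u x"
proof -
 show "\<sigma> * x $ k < \<sigma> * u x ==> x \<in> \<Omega>" "\<sigma> * x $ k > \<sigma> * u x ==> x \<in> - closure \<Omega>"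
  using assms inside outside by (auto simp: W1_def)
 show "x \<in> frontier \<Omega> \<longleftrightarrow> x $ k = u x"
  using assms W1(3,4) frontier_patch[of x] patch_frontier patch_image_iff[OF u_patch, of x] by blast
qed

lemma inverse_image_in_box: assumes "x \<in> W1" "x \<in> - closure \<Omega>"
 shows "\<exists>y\<in>box a b. \<Phi> y = x"
proof -
 have "x \<notin> \<Omega>" using assms(2) closure_subset[of \<Omega>] by blast
 then obtain y where y: "\<Phi> y = x" "y \<in> U" "0 \<le> y $ k" "y $ k < b $ k" using covering assms(1) W1(3) by blast
 have "y $ k \<noteq> 0"
 proof
  assume "y $ k = 0"
  hence "\<Phi> y \<in> frontier \<Omega>" using boundary_values(1)[of y] y U_cbox'[of y] by auto
  thus False using y(1) frontier_notin(2) assms(2) by blast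
 qed
 thus ?thesis using y box_U by force
qed

text \<open>Points on or behind the boundary lie strictly below the level surface \<open>y\<^sub>k = \<epsilon>\<close> of the collar.\<close>

lemma collar_exhausts: assumes "x \<in> W1" "x \<notin> - closure \<Omega>" "\<epsilon> > 0"
 shows "\<exists>N. open N \<and> x \<in> N \<and> (\<forall>y\<in>box a b. \<Phi> y \<in> N --> y $ k < \<epsilon>)"
proof -
 define e where "e = min \<epsilon> (b $ k)"
 have e: "0 < e" "e \<le> b $ k" "e \<le> \<epsilon>" using assms(3) ak(2) by (auto simp: e_def)
 define N where "N = U \<inter> (\<lambda>x. \<sigma> * w (set_coord k e x) - \<sigma> * x $ k) -` {0<..}"
 have "continuous_on U (\<lambda>x. w (set_coord k e x))"
 proof -
  have "set_coord k e ` U \<subseteq> Q" using U_cbox[of _ e] e cQ by fastforce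
  thus ?thesis
   by (rule continuous_on_compose2[OF C1_on_continuous[OF C2_scalar_C1[OF wC2]] continuous_on_set_coord[OF continuous_on_const continuous_on_id]])
 qed
 hence "open N" unfolding N_def using open_cylinder by (intro continuous_open_preimage continuous_intros open_greaterThan)
 moreover have "x \<in> N"
 proof -
  have "\<not> \<sigma> * x $ k > \<sigma> * u x" using W1_cases(2)[OF assms(1)] assms(2) by blast
  moreover have "\<sigma> * u x < \<sigma> * w (set_coord k e x)" using w_mono[of x 0 e] e assms(1) W1(4) by (auto simp: u_def)
  ultimately show ?thesis using assms(1) W1(4) by (auto simp: N_def)
 qed
 moreover have "y $ k < \<epsilon>" if y: "y \<in> box a b" "\<Phi> y \<in> N" for y
 proof (rule ccontr)
  assume "\<not> y $ k < \<epsilon>"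
  hence "e \<le> y $ k" using e by simp
  hence "\<sigma> * w (set_coord k e y) \<le> \<sigma> * w (set_coord k (y $ k) y)"
   using w_mono[of y e "y $ k"] y(1) e by (cases "e = y $ k") (auto simp: box_U)
  thus False using y(2) by (auto simp: N_def \<Phi>_def)
 qed
 ultimately show ?thesis by blast
qed

end

lemma has_derivative_ray: "((\<lambda>t::real. p + t *\<^sub>R v) has_derivative (\<lambda>t. t *\<^sub>R v)) (at 0 within S)"
 by (auto intro!: derivative_eq_intros)

context boundary_chart
begin

text \<open>The unit normal of the graph of \<open>u\<close> that points into \<open>\<Omega>\<close>, extended independently of \<open>x\<^sub>k\<close>.\<close>

definition nrm :: "real^'n => real^'n" where
 "nrm y = (\<chi> j. \<sigma> * (pd j u y - (if j = k then 1 else 0)) / area_factor u y)"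

lemma nrm_nth: "nrm y $ j = \<sigma> * (pd j u y - (if j = k then 1 else 0)) / area_factor u y"
 by (simp add: nrm_def)

lemma area_factor_C1: "C1_on U (area_factor u)"
 unfolding area_factor_def[abs_def]
 by (intro C1_on_sqrt C1_on_add C1_on_sum C1_on_power C1_on_const open_cylinder C2_scalar_pd[OF u_C2])
  (simp add: add_pos_nonneg sum_nonneg)

lemma nrm_C1: "C1_on U nrm"
proof (rule C1_on_vec)
 fix j
 have "area_factor u y \<noteq> 0" for y using area_factor_pos[of u y] by simp
 thus "C1_on U (\<lambda>y. nrm y $ j)"
  unfolding nrm_nth
  by (intro C1_on_divide C1_on_mult C1_on_diff C1_on_const open_cylinder C2_scalar_pd[OF u_C2] area_factor_C1) simp
qed

lemma sum_k_split: "(\<Sum>j. g j) = g k + (\<Sum>j\<in>UNIV - {k}. g j)" for g :: "'n => real"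
 by (rule sum.remove) auto

lemma nrm_norm: assumes y: "y \<in> U" shows "norm (nrm y) = 1"
proof -
 have "(norm (nrm y))\<^sup>2 = (\<Sum>j. (\<sigma> * (pd j u y - (if j = k then 1 else 0)) / area_factor u y)\<^sup>2)"
  unfolding dot_square_norm[symmetric] inner_vec_def by (simp add: nrm_nth power2_eq_square)
 also have "... = (\<Sum>j. (pd j u y - (if j = k then 1 else 0))\<^sup>2) / (area_factor u y)\<^sup>2"
  using \<sigma>(2) by (simp add: power_divide power_mult_distrib sum_divide_distrib flip: power2_eq_square)
 also have "(\<Sum>j. (pd j u y - (if j = k then 1 else 0))\<^sup>2) = (area_factor u y)\<^sup>2"
  unfolding area_factor_sq sum_k_split by (simp add: pd_k_u[OF y] cong: sum.cong_simp)
 finally have "(norm (nrm y))\<^sup>2 = 1" using area_factor_pos[of u y] by simp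
 thus ?thesis by (simp add: power2_eq_1_iff) (metis norm_ge_zero neg_0_le_iff_le not_one_le_zero)
qed

lemma height_derivative:
 assumes "p \<in> U" shows "((\<lambda>x. x $ k - u x) has_derivative (\<lambda>v. v $ k - (\<Sum>j. v $ j * pd j u p))) (at p)"
 by (intro has_derivative_diff has_derivative_nth C1_on_has_derivative_pd[OF C2_scalar_C1[OF u_C2] assms])

lemma nrm_inner: assumes "y \<in> U"
 shows "nrm y \<bullet> v = - \<sigma> / area_factor u y * (v $ k - (\<Sum>j. v $ j * pd j u y))"
proof -
 have "nrm y \<bullet> v = (\<Sum>j. \<sigma> / area_factor u y * (v $ j * pd j u y - (if j = k then v $ j else 0)))"
  by (auto simp: inner_vec_def nrm_nth field_simps intro!: sum.cong)
 also have "... = \<sigma> / area_factor u y * ((\<Sum>j. v $ j * pd j u y) - v $ k)"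
  unfolding sum_distrib_left[symmetric] by (simp add: sum_subtractf)
 finally show ?thesis by (simp add: right_diff_distrib)
qed

lemma tangent_orthogonal:
 assumes p: "p \<in> W1" "p \<in> frontier \<Omega>" and v: "v \<in> tangent_space (frontier \<Omega>) p"
 shows "nrm p \<bullet> v = 0"
proof -
 have pU: "p \<in> U" using p W1 by blast
 have d: "(\<lambda>x. x $ k) differentiable (at p)" "u differentiable (at p)"
  using has_derivative_nth C2_scalar_differentiable[OF u_C2 pU] by (auto intro: differentiableI)
 have "(\<Sum>i. v $ i * pd i (\<lambda>x. x $ k - u x) p) = 0"
  by (rule tangent_space_zero[OF differentiable_diff[OF d] W1(1) p(1) _ v]) (simp add: W1_cases(3))
 hence "v $ k - (\<Sum>j. v $ j * pd j u p) = 0"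
  by (simp add: pd_diff[OF d] right_diff_distrib sum_subtractf if_distrib[of "\<lambda>x. _ * x"] cong: if_cong)
 thus ?thesis by (simp add: nrm_inner[OF pU])
qed

lemma tangent_vector:
 assumes p: "p \<in> W1" "p \<in> frontier \<Omega>" and j: "j \<noteq> k"
 shows "axis j 1 + pd j u p *\<^sub>R axis k 1 \<in> tangent_space (frontier \<Omega>) p"
proof -
 have pU: "p \<in> U" and "p $ k = u p" using p W1 W1_cases(3) by auto
 hence Fp: "set_coord k (u p) p = p" by (auto simp: vec_eq_iff)
 have "axis j 1 + pd j u p *\<^sub>R axis k 1 \<in> tangent_space (frontier \<Omega>) (set_coord k (u p) p)"
 proof (rule tangent_space_ray[OF open_cylinder pU, of "axis j 1" "\<lambda>y. set_coord k (u y) y"])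
  show "set_coord k (u (p + t *\<^sub>R axis j 1)) (p + t *\<^sub>R axis j 1) \<in> frontier \<Omega>" if "p + t *\<^sub>R axis j 1 \<in> U" for t
   using that patch_frontier by (auto simp: patch_image_def)
  have du: "((\<lambda>t. u (p + t *\<^sub>R axis j 1)) has_real_derivative pd j u p) (at 0)"
   using has_real_derivative_along_axis[of u p 0 j] C2_scalar_differentiable[OF u_C2 pU] by simp
  have e: "set_coord k (u (p + t *\<^sub>R axis j 1)) (p + t *\<^sub>R axis j 1)
    = set_coord k 0 p + t *\<^sub>R axis j 1 + u (p + t *\<^sub>R axis j 1) *\<^sub>R axis k 1" for t
   using j by (auto simp: vec_eq_iff axis_def)
  have "((\<lambda>t. set_coord k 0 p + t *\<^sub>R axis j 1 + u (p + t *\<^sub>R axis j 1) *\<^sub>R axis k (1::real))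
    has_vector_derivative (0 + axis j 1 + pd j u p *\<^sub>R axis k 1)) (at 0)"
   by (intro has_vector_derivative_add has_vector_derivative_const has_vector_derivative_scaleR[OF du has_vector_derivative_const, simplified])
    (auto simp: has_vector_derivative_def intro!: derivative_eq_intros)
  thus "((\<lambda>t. set_coord k (u (p + t *\<^sub>R axis j 1)) (p + t *\<^sub>R axis j 1)) has_vector_derivative (axis j 1 + pd j u p *\<^sub>R axis k 1)) (at 0)"
   unfolding e by simp
 qed
 thus ?thesis by (simp only: Fp)
qed

text \<open>Along \<open>s \<cdot> nrm\<close> the height above the boundary has derivative \<open>-s \<surd>(1 + \<bar>Du\<bar>\<^sup>2)\<close>.\<close>

lemma height_along_normal:
 assumes p: "p \<in> W1" "p \<in> frontier \<Omega>" and s: "s * s = (1::real)"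
 shows "\<forall>\<^sub>F t in at_right 0. p + t *\<^sub>R (s *\<^sub>R nrm p) \<in> W1 \<and>
  s * \<sigma> * ((p + t *\<^sub>R (s *\<^sub>R nrm p)) $ k - u (p + t *\<^sub>R (s *\<^sub>R nrm p))) < 0"
proof -
 let ?v = "s *\<^sub>R nrm p"
 have pU: "p \<in> U" and pk: "p $ k = u p" using p W1 W1_cases(3) by auto
 have af: "area_factor u p > 0" by (rule area_factor_pos)
 define g where "g t = s * \<sigma> * ((p + t *\<^sub>R ?v) $ k - u (p + t *\<^sub>R ?v))" for t
 have "((\<lambda>t. (p + t *\<^sub>R ?v) $ k - u (p + t *\<^sub>R ?v)) has_derivative
   (\<lambda>t. (t *\<^sub>R ?v) $ k - (\<Sum>j. (t *\<^sub>R ?v) $ j * pd j u p))) (at 0)"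
  by (rule has_derivative_compose[OF has_derivative_ray]) (use height_derivative[OF pU] in simp)
 hence "((\<lambda>t. (p + t *\<^sub>R ?v) $ k - u (p + t *\<^sub>R ?v)) has_real_derivative
   (?v $ k - (\<Sum>j. ?v $ j * pd j u p))) (at 0)"
  unfolding has_field_derivative_def by (rule has_derivative_eq_rhs) (auto simp: fun_eq_iff algebra_simps sum_distrib_left)
 from DERIV_cmult[OF this, of "s * \<sigma>"]
 have gd: "(g has_real_derivative s * \<sigma> * (?v $ k - (\<Sum>j. ?v $ j * pd j u p))) (at 0)"
  unfolding g_def .
 have "nrm p \<bullet> nrm p = 1" using nrm_norm[OF pU] by (simp add: dot_square_norm)
 hence "s * s = nrm p \<bullet> ?v * s" using s by simp
 also have "... = - (s * \<sigma> * (?v $ k - (\<Sum>j. ?v $ j * pd j u p))) / area_factor u p"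
  unfolding nrm_inner[OF pU] by simp
 finally have "s * \<sigma> * (?v $ k - (\<Sum>j. ?v $ j * pd j u p)) = - area_factor u p"
  using s af by (simp add: field_simps)
 then obtain d where d: "d > 0" "\<And>t. 0 < t ==> t < d ==> g t < g 0"
  using DERIV_neg_dec_right[OF gd] af by auto
 have "\<forall>\<^sub>F t in at_right 0. g t < 0"
  using d by (auto simp: eventually_at_right_field g_def pk)
 moreover have "((\<lambda>t. p + t *\<^sub>R ?v) \<longlongrightarrow> p + 0 *\<^sub>R ?v) (at_right 0)" by (intro tendsto_intros)
 hence "\<forall>\<^sub>F t in at_right 0. p + t *\<^sub>R ?v \<in> W1" using topological_tendstoD[OF _ W1(1)] p(1) by simp
 ultimately show ?thesis by eventually_elim (simp add: g_def)
qed

text \<open>Orthogonality to the tangent vectors leaves \<open>\<plusminus>nrm p\<close>; the side on which \<open>\<Omega>\<close> lies decides the sign.\<close>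

lemma inward_unit_normal_unique:
 assumes p: "p \<in> W1" "p \<in> frontier \<Omega>"
 shows "inward_unit_normal \<Omega> p v \<longleftrightarrow> v = nrm p"
proof
 have pU: "p \<in> U" using p W1 by blast
 have af: "area_factor u p > 0" by (rule area_factor_pos)
 assume v: "inward_unit_normal \<Omega> p v"
 have vj: "v $ j = - v $ k * pd j u p" if "j \<noteq> k" for j
 proof -
  have "v \<bullet> (axis j 1 + pd j u p *\<^sub>R axis k 1) = 0"
   using v tangent_vector[OF p that] by (auto simp: inward_unit_normal_def)
  thus ?thesis by (simp add: inner_add_right inner_axis mult.commute)
 qed
 define s where "s = - v $ k * \<sigma> * area_factor u p"
 have vs: "v = s *\<^sub>R nrm p"
 proof (simp add: vec_eq_iff, intro allI)
  fix j
  show "v $ j = s * nrm p $ j"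
   using vj[of j] af \<sigma>(2) pd_k_u[OF pU] by (cases "j = k") (simp_all add: s_def nrm_nth)
 qed
 have "\<bar>s\<bar> = 1" using v nrm_norm[OF pU] by (simp add: vs inward_unit_normal_def)
 hence "s = 1 \<or> s = -1" by linarith
 thus "v = nrm p"
 proof
  assume s: "s = -1"
  have "\<forall>\<^sub>F t in at_right 0. p + t *\<^sub>R v \<in> \<Omega>" using v by (simp add: inward_unit_normal_def)
  moreover have "\<forall>\<^sub>F t in at_right 0. p + t *\<^sub>R v \<in> W1 \<and>
    -1 * \<sigma> * ((p + t *\<^sub>R v) $ k - u (p + t *\<^sub>R v)) < 0"
   using height_along_normal[OF p, of "-1"] unfolding vs s by simp
  ultimately have "\<forall>\<^sub>F t in at_right (0::real). False"
  proof eventually_elim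
   case (elim t)
   let ?x = "p + t *\<^sub>R v"
   have "\<sigma> * ?x $ k > \<sigma> * u ?x" using elim by (simp add: right_diff_distrib)
   hence "?x \<in> - closure \<Omega>" using W1_cases(2) elim by blast
   thus ?case using elim closure_subset by blast
  qed
  thus ?thesis by simp
 qed (simp add: vs)
next
 have pU: "p \<in> U" using p W1 by blast
 assume v: "v = nrm p"
 have "\<forall>\<^sub>F t in at_right 0. p + t *\<^sub>R nrm p \<in> \<Omega>"
  using height_along_normal[OF p, of 1] by (simp, elim eventually_mono) (auto intro!: W1_cases(1) simp: algebra_simps)
 thus "inward_unit_normal \<Omega> p v"
  unfolding inward_unit_normal_def v using nrm_norm[OF pU] tangent_orthogonal[OF p] by blast
qed

text \<open>Two unit fields that agree on the boundary have the same divergence there: their difference has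
 derivative \<open>0\<close> in tangential directions, and its normal derivative is orthogonal to the normal.\<close>

lemma normal_divergence_unique:
 assumes p: "p \<in> W1" "p \<in> frontier \<Omega>" and V: "p \<in> V" "C1_on V N" "\<forall>y\<in>V. norm (N y) = 1"
  "\<forall>y\<in>V \<inter> frontier \<Omega>. inward_unit_normal \<Omega> y (N y)"
 shows "(\<Sum>i. pd i (\<lambda>y. N y $ i) p) = (\<Sum>i. pd i (\<lambda>y. nrm y $ i) p)"
proof -
 define V' where "V' = V \<inter> W1"
 have oV: "open V'" "p \<in> V'" using C1_on_openD[OF V(2)] W1(1) p(1) V(1) by (auto simp: V'_def)
 have V'U: "V' \<subseteq> U" "V' \<subseteq> V" "V' \<subseteq> W1" using W1 by (auto simp: V'_def)
 have pU: "p \<in> U" and pk: "p $ k = u p" using p W1 W1_cases(3) by auto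
 have NC: "C1_on V' (\<lambda>y. N y $ i)" "C1_on V' (\<lambda>y. nrm y $ i)" for i
  using C1_on_bounded_linear[OF C1_on_subset[OF V(2) oV(1) V'U(2)] bounded_linear_vec_nth]
   C1_on_bounded_linear[OF C1_on_subset[OF nrm_C1 oV(1) V'U(1)] bounded_linear_vec_nth] by blast+
 note Nd = C1_on_differentiable[OF NC(1) oV(2)] C1_on_differentiable[OF NC(2) oV(2)]
 have eq: "N y = nrm y" if "y \<in> V'" "y \<in> frontier \<Omega>" for y
  using that V(4) inward_unit_normal_unique[of y] V'U by blast
 define e where "e i y = N y $ i - nrm y $ i" for i y
 have eC: "C1_on V' (e i)" for i unfolding e_def by (intro C1_on_diff NC)
 have pde: "pd j (e i) p = pd j (\<lambda>y. N y $ i) p - pd j (\<lambda>y. nrm y $ i) p" for i j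
  unfolding e_def[abs_def] by (rule pd_diff[OF Nd])
 \<comment> \<open>the difference vanishes on the boundary, hence so do its tangential derivatives\<close>
 have tan: "pd j (e i) p = - pd j u p * pd k (e i) p" if j: "j \<noteq> k" for i j
 proof -
  define F where "F y = set_coord k (u y) y" for y
  have Fp: "F p = p" using pk by (auto simp: F_def vec_eq_iff)
  have ud: "u differentiable (at p)" by (rule C2_scalar_differentiable[OF u_C2 pU])
  have Fc: "continuous_on U F" unfolding F_def by (intro continuous_on_set_coord u_continuous continuous_intros)
  have oG: "open (U \<inter> F -` V')" by (rule continuous_open_preimage[OF Fc open_cylinder oV(1)])
  have "pd j (\<lambda>y. e i (F y)) p = pd j (\<lambda>y. 0) p"
  proof (rule pd_cong[OF oG])
   show "p \<in> U \<inter> F -` V'" using pU Fp oV by simp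
   fix y assume y: "y \<in> U \<inter> F -` V'"
   hence "F y \<in> frontier \<Omega>" using patch_frontier by (auto simp: F_def patch_image_def)
   thus "e i (F y) = 0" using eq[of "F y"] y by (simp add: e_def)
  qed
  also have "pd j (\<lambda>y. e i (F y)) p = pd j (e i) p + pd k (e i) p * pd j u p"
   unfolding F_def using pd_comp_set_coord[of "e i" k u p j] C1_on_differentiable[OF eC oV(2)] Fp ud j by (simp add: F_def)
  finally show ?thesis by (simp add: algebra_simps)
 qed
 \<comment> \<open>both fields have unit length, so their derivatives are orthogonal to them\<close>
 have unit: "(\<Sum>i. nrm p $ i * pd k (\<lambda>y. K y $ i) p) = 0"
  if K: "\<And>i. C1_on V' (\<lambda>y. K y $ i)" "\<And>y. y \<in> V' ==> norm (K y) = 1" "K p = nrm p" for K :: "real^'n => real^'n"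
 proof -
  have Kd: "(\<lambda>y. K y $ i) differentiable (at p)" for i by (rule C1_on_differentiable[OF K(1) oV(2)])
  have "pd k (\<lambda>y. \<Sum>i. K y $ i * K y $ i) p = pd k (\<lambda>y. 1) p"
  proof (rule pd_cong[OF oV])
   fix y assume "y \<in> V'"
   hence "K y \<bullet> K y = 1" using K(2) by (simp add: dot_square_norm)
   thus "(\<Sum>i. K y $ i * K y $ i) = 1" by (simp add: inner_vec_def)
  qed
  moreover have "pd k (\<lambda>y. \<Sum>i. K y $ i * K y $ i) p = (\<Sum>i. 2 * (nrm p $ i * pd k (\<lambda>y. K y $ i) p))"
   using Kd by (subst pd_sum) (auto simp: pd_mult K(3) intro!: differentiable_mult)
  ultimately show ?thesis by (simp add: sum_distrib_left[symmetric])
 qed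
 have 0: "(\<Sum>i. nrm p $ i * pd k (e i) p) = 0"
  using unit[OF NC(1)] unit[OF NC(2)] V(3) V'U nrm_norm eq[OF oV(2) p(2)]
  by (simp add: pde right_diff_distrib sum_subtractf subset_iff)
 have "(\<Sum>i. pd i (e i) p) = pd k (e k) p - (\<Sum>i\<in>UNIV - {k}. pd i u p * pd k (e i) p)"
  unfolding sum_k_split by (simp add: tan sum_negf cong: sum.cong_simp)
 also have "... = - (\<Sum>i. (pd i u p - (if i = k then 1 else 0)) * pd k (e i) p)"
  unfolding sum_k_split by (simp add: pd_k_u[OF pU])
 also have "(\<Sum>i. (pd i u p - (if i = k then 1 else 0)) * pd k (e i) p) = \<sigma> * area_factor u p * (\<Sum>i. nrm p $ i * pd k (e i) p)"
  unfolding sum_distrib_left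
 proof (rule sum.cong[OF refl])
  fix i
  have "\<sigma> * area_factor u p * (nrm p $ i * pd k (e i) p) = (\<sigma> * \<sigma>) * (pd i u p - (if i = k then 1 else 0)) * pd k (e i) p"
   using area_factor_pos[of u p] by (simp add: nrm_nth)
  thus "(pd i u p - (if i = k then 1 else 0)) * pd k (e i) p = \<sigma> * area_factor u p * (nrm p $ i * pd k (e i) p)"
   by (simp only: \<sigma>(2) mult_1_left)
 qed
 finally show ?thesis using 0 by (simp add: pde sum_subtractf)
qed

lemma mean_curvature_divergence:
 assumes p: "p \<in> W1" "p \<in> frontier \<Omega>"
 shows "mean_curvature \<Omega> p = - (\<Sum>i. pd i (\<lambda>y. nrm y $ i) p)"
 unfolding mean_curvature_def
proof (rule the_equality)
 have "p \<in> W1 \<and> C1_on W1 nrm \<and> (\<forall>y\<in>W1. norm (nrm y) = 1) \<and> (\<forall>y\<in>W1 \<inter> frontier \<Omega>. inward_unit_normal \<Omega> y (nrm y))"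
  using p(1) C1_on_subset[OF nrm_C1 W1(1) W1(4)] nrm_norm W1(4) inward_unit_normal_unique by blast
 thus "\<exists>U N. p \<in> U \<and> C1_on U N \<and> (\<forall>y\<in>U. norm (N y) = 1) \<and> (\<forall>y\<in>U \<inter> frontier \<Omega>. inward_unit_normal \<Omega> y (N y)) \<and>
   - (\<Sum>i. pd i (\<lambda>y. nrm y $ i) p) = - (\<Sum>i. pd i (\<lambda>y. N y $ i) p)" by blast
next
 fix h assume "\<exists>U N. p \<in> U \<and> C1_on U N \<and> (\<forall>y\<in>U. norm (N y) = 1) \<and> (\<forall>y\<in>U \<inter> frontier \<Omega>. inward_unit_normal \<Omega> y (N y)) \<and>
   h = - (\<Sum>i. pd i (\<lambda>y. N y $ i) p)"
 thus "h = - (\<Sum>i. pd i (\<lambda>y. nrm y $ i) p)" using normal_divergence_unique[OF p] by auto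
qed

lemma mean_curvature_patch:
 assumes p: "p \<in> W1" "p \<in> frontier \<Omega>"
 shows "area_factor u p * mean_curvature \<Omega> p = - \<sigma> * ((\<Sum>i. pd i (pd i u) p)
  - (\<Sum>i j. pd i u p * pd j u p * pd i (pd j u) p) / (area_factor u p)\<^sup>2)"
proof -
 have pU: "p \<in> U" using p W1 by blast
 let ?A = "area_factor u" and ?c = "\<lambda>i. if i = k then 1 else 0 :: real"
 have A: "?A p > 0" by (rule area_factor_pos)
 have ud: "pd j u differentiable (at p)" for j by (rule C1_on_differentiable[OF C2_scalar_pd[OF u_C2] pU])
 have pdA: "pd i ?A p = (\<Sum>j. pd j u p * pd i (pd j u) p) / ?A p" for i
 proof -
  let ?s = "\<lambda>x. 1 + (\<Sum>j. (pd j u x)\<^sup>2)"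
  have sd: "?s differentiable (at p)"
   by (rule C1_on_differentiable[OF _ pU]) (intro C1_on_add C1_on_sum C1_on_power C1_on_const open_cylinder C2_scalar_pd[OF u_C2])
  have "?s p > 0" by (simp add: add_pos_nonneg sum_nonneg)
  from pd_comp_real[OF sd DERIV_real_sqrt[OF this], of i]
  have "pd i ?A p = inverse (?A p) / 2 * pd i ?s p" unfolding area_factor_def[abs_def] .
  also have "pd i ?s p = (\<Sum>j. 2 * (pd j u p * pd i (pd j u) p))"
  proof -
   have "pd i ?s p = pd i (\<lambda>x. 1) p + pd i (\<lambda>x. \<Sum>j. pd j u x * pd j u x) p"
    unfolding power2_eq_square using ud by (intro pd_add) (auto intro!: differentiable_sum differentiable_mult)
   also have "pd i (\<lambda>x. \<Sum>j. pd j u x * pd j u x) p = (\<Sum>j. 2 * (pd j u p * pd i (pd j u) p))"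
    using ud by (subst pd_sum) (auto simp: pd_mult intro!: differentiable_mult)
   finally show ?thesis by simp
  qed
  finally show ?thesis using A by (simp add: sum_distrib_left[symmetric] field_simps)
 qed
 have Ad: "?A differentiable (at p)" by (rule C1_on_differentiable[OF area_factor_C1 pU])
 have inv: "pd i (\<lambda>x. inverse (?A x)) p = - (inverse (?A p))\<^sup>2 * pd i ?A p" for i
  using pd_comp_real[OF Ad DERIV_inverse, of i] A by (simp add: power2_eq_square)
 have invd: "(\<lambda>x. inverse (?A x)) differentiable (at p)"
  using A by (intro differentiable_comp_real[OF Ad DERIV_inverse]) simp
 have pdn: "pd i (\<lambda>y. nrm y $ i) p = \<sigma> * (pd i (pd i u) p / ?A p - (pd i u p - ?c i) * pd i ?A p / (?A p)\<^sup>2)" for i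
 proof -
  have "pd i (\<lambda>y. nrm y $ i) p = pd i (\<lambda>y. \<sigma> * ((pd i u y - ?c i) * inverse (?A y))) p"
   by (simp add: nrm_nth divide_inverse mult.assoc)
  also have "... = \<sigma> * pd i (\<lambda>y. (pd i u y - ?c i) * inverse (?A y)) p"
   using ud invd by (subst pd_mult) (auto intro!: differentiable_mult differentiable_diff)
  also have "pd i (\<lambda>y. (pd i u y - ?c i) * inverse (?A y)) p = pd i (\<lambda>y. pd i u y - ?c i) p * inverse (?A p) + (pd i u p - ?c i) * pd i (\<lambda>y. inverse (?A y)) p"
   using ud invd by (intro pd_mult) (auto intro!: differentiable_diff)
  also have "pd i (\<lambda>y. pd i u y - ?c i) p = pd i (pd i u) p - pd i (\<lambda>y. ?c i) p"
   using ud by (intro pd_diff) auto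
  finally show ?thesis unfolding inv by (simp add: divide_inverse power_inverse algebra_simps)
 qed
 have kA: "pd k ?A p = 0" unfolding pdA by (simp add: pd_k_pd_u[OF pU])
 have trm: "?A p * pd i (\<lambda>y. nrm y $ i) p = \<sigma> * (pd i (pd i u) p - (\<Sum>j. pd i u p * pd j u p * pd i (pd j u) p) / (?A p)\<^sup>2)" for i
 proof -
  have "(pd i u p - ?c i) * pd i ?A p = pd i u p * pd i ?A p" using kA by auto
  hence "?A p * pd i (\<lambda>y. nrm y $ i) p = \<sigma> * (pd i (pd i u) p - pd i u p * pd i ?A p / ?A p)"
   unfolding pdn using A by (simp add: field_simps power2_eq_square)
  also have "pd i u p * pd i ?A p / ?A p = (\<Sum>j. pd i u p * pd j u p * pd i (pd j u) p) / (?A p)\<^sup>2"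
   unfolding pdA by (simp add: sum_distrib_left power2_eq_square mult.assoc)
  finally show ?thesis .
 qed
 have "?A p * mean_curvature \<Omega> p = - (\<Sum>i. ?A p * pd i (\<lambda>y. nrm y $ i) p)"
  unfolding mean_curvature_divergence[OF p] by (simp add: sum_distrib_left)
 also have "... = - (\<sigma> * ((\<Sum>i. pd i (pd i u) p) - (\<Sum>i j. pd i u p * pd j u p * pd i (pd j u) p) / (?A p)\<^sup>2))"
  unfolding trm by (simp add: sum_distrib_left[symmetric] sum_subtractf sum_divide_distrib)
 finally show ?thesis by simp
qed

end

section \<open>The flux in a boundary chart\<close>

lemma matrix_scaleR: "(c *\<^sub>R A) ** B = c *\<^sub>R (A ** B)" "A ** (c *\<^sub>R B) = c *\<^sub>R (A ** B)"
 for A B :: "real^'n^'n"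
 by (simp_all add: matrix_matrix_mult_def vec_eq_iff sum_distrib_left mult_ac)

lemma trace_conjugate:
 fixes A B :: "real^'n^'n"
 assumes "A ** B = mat 1"
 shows "trace (B ** M ** A) = trace M"
proof -
 have "trace (B ** M ** A) = trace (A ** (B ** M))" by (rule trace_mul_sym)
 also have "A ** (B ** M) = M" using assms by (simp add: matrix_mul_assoc)
 finally show ?thesis .
qed

lemma trace_scaleR: "trace (c *\<^sub>R A) = c * trace A" for A :: "real^'n^'n"
 by (simp add: trace_def sum_distrib_left)

text \<open>The vector \<open>tr(g\<^sup>-\<^sup>1 H) g\<^sup>-\<^sup>1 d - g\<^sup>-\<^sup>1 H g\<^sup>-\<^sup>1 d\<close> is natural under a linear change of coordinates \<open>A\<close>; the
 factor \<open>c\<close> will be the determinant of the Jacobian.\<close>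

lemma flux_change_of_coordinates:
 fixes A g H :: "real^'n^'n" and d :: "real^'n" and c :: real
 assumes A: "invertible A" and g: "invertible g"
 defines "h \<equiv> transpose A ** g ** A" and "K \<equiv> c *\<^sub>R (transpose A ** H ** A)"
 shows "A *v (trace (matrix_inv h ** K) *\<^sub>R (matrix_inv h *v (transpose A *v d)) - (matrix_inv h ** K) *v (matrix_inv h *v (transpose A *v d)))
  = c *\<^sub>R (trace (matrix_inv g ** H) *\<^sub>R (matrix_inv g *v d) - (matrix_inv g ** H) *v (matrix_inv g *v d))"
  and "invertible h"
proof -
 let ?B = "matrix_inv A" and ?G = "matrix_inv g"
 have B: "A ** ?B = mat 1" "?B ** A = mat 1" using matrix_inv_mult[OF A] .
 have G: "g ** ?G = mat 1" "?G ** g = mat 1" using matrix_inv_mult[OF g] .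
 have BT: "transpose A ** transpose ?B = mat 1" "transpose ?B ** transpose A = mat 1"
  using B by (simp_all flip: matrix_transpose_mul add: transpose_mat)
 have hinv: "h ** (?B ** ?G ** transpose ?B) = mat 1"
 proof -
  have "h ** (?B ** ?G ** transpose ?B) = transpose A ** (g ** (A ** ?B) ** ?G) ** transpose ?B"
   by (simp add: h_def matrix_mul_assoc)
  thus ?thesis by (simp add: B G BT)
 qed
 hence hi: "matrix_inv h = ?B ** ?G ** transpose ?B" by (rule matrix_inv_unique)
 show "invertible h" using hinv invertible_right_inverse by blast
 have hK: "matrix_inv h ** K = c *\<^sub>R (?B ** (?G ** H) ** A)"
 proof -
  have "matrix_inv h ** K = c *\<^sub>R (?B ** ?G ** (transpose ?B ** transpose A) ** H ** A)"
   by (simp add: hi K_def matrix_scaleR matrix_mul_assoc)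
  thus ?thesis by (simp add: BT matrix_mul_assoc)
 qed
 have hd: "matrix_inv h *v (transpose A *v d) = ?B *v (?G *v d)"
 proof -
  have "matrix_inv h *v (transpose A *v d) = ?B *v (?G *v ((transpose ?B ** transpose A) *v d))"
   by (simp add: hi matrix_vector_mul_assoc matrix_mul_assoc del: transpose_matrix_vector)
  thus ?thesis by (simp add: BT del: transpose_matrix_vector)
 qed
 have t: "trace (matrix_inv h ** K) = c * trace (?G ** H)"
  unfolding hK trace_scaleR trace_conjugate[OF B(1)] ..
 have AB: "A *v (?B *v v) = v" for v by (simp add: matrix_vector_mul_assoc B)
 have "(matrix_inv h ** K) *v (matrix_inv h *v (transpose A *v d)) = c *\<^sub>R (?B *v ((?G ** H) *v (?G *v d)))"
 proof -
  have "(matrix_inv h ** K) *v (matrix_inv h *v (transpose A *v d)) = c *\<^sub>R ((?B ** (?G ** H) ** A) *v (?B *v (?G *v d)))"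
   unfolding hK hd by (simp add: scaleR_matrix_vector_assoc)
  also have "(?B ** (?G ** H) ** A) *v (?B *v (?G *v d)) = ?B *v ((?G ** H) *v (A *v (?B *v (?G *v d))))"
   by (simp add: matrix_vector_mul_assoc matrix_mul_assoc)
  finally show ?thesis by (simp add: AB)
 qed
 thus "A *v (trace (matrix_inv h ** K) *\<^sub>R (matrix_inv h *v (transpose A *v d)) - (matrix_inv h ** K) *v (matrix_inv h *v (transpose A *v d)))
  = c *\<^sub>R (trace (?G ** H) *\<^sub>R (?G *v d) - (?G ** H) *v (?G *v d))"
  by (simp add: t hd matrix_vector_mult_diff_distrib matrix_vector_mult_scaleR AB scaleR_diff_right
    del: transpose_matrix_vector)
qed

text \<open>The Sherman--Morrison formula, simplified by \<open>d e = e\<close>.\<close>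

lemma diagonal_plus_rank_one_inverse:
 fixes d e :: "'n::finite => real"
 assumes d: "\<And>i. d i \<noteq> 0" "\<And>i. d i * e i = e i" and q: "q = 1 + (\<Sum>i. (e i)\<^sup>2)"
 shows "(\<chi> i j. (if i = j then d i else 0) + e i * e j) ** (\<chi> i j. (if i = j then 1 / d i else 0) - e i * e j / q) = mat 1"
proof -
 have q0: "q > 0" unfolding q by (simp add: add_pos_nonneg sum_nonneg)
 have de: "e i / d i = e i" for i using d(1)[of i] d(2)[of i] by (simp add: divide_eq_eq mult.commute)
 have "(\<Sum>l. ((if i = l then d i else 0) + e i * e l) * ((if l = j then 1 / d l else 0) - e l * e j / q)) = (if i = j then 1 else 0)" for i j
 proof -
  have "(\<Sum>l. ((if i = l then d i else 0) + e i * e l) * ((if l = j then 1 / d l else 0) - e l * e j / q))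
   = (\<Sum>l. (if l = i then d i * ((if i = j then 1 / d i else 0) - e i * e j / q) else 0)
     + (if l = j then e i * (e j / d j) else 0) - e i * e j / q * (e l)\<^sup>2)"
   by (intro sum.cong refl) (auto simp: algebra_simps power2_eq_square)
  also have "... = d i * ((if i = j then 1 / d i else 0) - e i * e j / q) + e i * (e j / d j) - e i * e j / q * (q - 1)"
   unfolding sum.distrib sum_subtractf sum_distrib_left[symmetric] by (simp add: q)
  also have "... = (if i = j then 1 else 0) - (d i * e i) * e j / q + e i * e j - e i * e j / q * (q - 1)"
   unfolding de using d(1) by (simp add: right_diff_distrib)
  also have "... = (if i = j then 1 else 0)" unfolding d(2) using q0 by (simp add: field_simps)
  finally show ?thesis .
 qed
 thus ?thesis by (simp add: matrix_matrix_mult_def mat_def vec_eq_iff)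
qed

context boundary_chart
begin

text \<open>The objects of the graph in the coordinates \<open>y\<close>: the Jacobian of \<open>\<Phi>\<close>, the derivatives of \<open>z\<close> and \<open>w\<close>
 and the induced metric.  The Hessian of \<open>f\<^sup>\<alpha>\<close>, pulled back and multiplied by \<open>\<partial>\<^sub>k w\<close>, is
 \<open>\<partial>\<^sub>k w D\<^sup>2z\<^sup>\<alpha> - \<partial>\<^sub>k z\<^sup>\<alpha> D\<^sup>2w\<close>, which makes sense on the boundary although \<open>D\<^sup>2f\<close> does not.\<close>

definition jac :: "real^'n => real^'n^'n" where
 "jac y = (\<chi> i c. if i = k then pd c w y else if i = c then 1 else 0)"
definition dz :: "'m => real^'n => real^'n" where "dz \<alpha> y = (\<chi> c. pd c (\<lambda>y. z y $ \<alpha>) y)"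
definition ddz :: "'m => real^'n => real^'n^'n" where "ddz \<alpha> y = (\<chi> i j. pd j (pd i (\<lambda>y. z y $ \<alpha>)) y)"
definition ddw :: "real^'n => real^'n^'n" where "ddw y = (\<chi> i j. pd j (pd i w) y)"

definition chart_metric :: "real^'n => real^'n^'n" where
 "chart_metric y = (\<chi> i j. (if i = j \<and> i \<noteq> k then 1 else 0) + pd i w y * pd j w y + (\<Sum>\<alpha>. dz \<alpha> y $ i * dz \<alpha> y $ j))"

definition chart_hess :: "'m => real^'n => real^'n^'n" where
 "chart_hess \<alpha> y = pd k w y *\<^sub>R ddz \<alpha> y - (dz \<alpha> y $ k) *\<^sub>R ddw y"

definition chart_flux :: "real^'n => real^'n" where
 "chart_flux y = \<sigma> *\<^sub>R (\<Sum>\<alpha>. trace (matrix_inv (chart_metric y) ** chart_hess \<alpha> y) *\<^sub>R (matrix_inv (chart_metric y) *v dz \<alpha> y)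
   - (matrix_inv (chart_metric y) ** chart_hess \<alpha> y) *v (matrix_inv (chart_metric y) *v dz \<alpha> y))"

lemma open_Q: "open Q" using wC2 C2_scalar_C1 C1_on_openD by blast

lemma \<Phi>_C1: "C1_on Q (\<lambda>y. \<Phi> y $ j)"
 using C2_scalar_C1[OF wC2] open_Q by (cases "j = k") (simp_all add: \<Phi>_def)

lemma pd_\<Phi>: "pd c (\<lambda>y. \<Phi> y $ j) y = jac y $ j $ c"
 by (cases "j = k") (auto simp: \<Phi>_def jac_def)

lemma jac_transpose_mult: "(transpose (jac y) *v v) $ c = (\<Sum>j. jac y $ j $ c * v $ j)"
 by (simp add: matrix_vector_mult_def transpose_def)

lemma invertible_jac: assumes "pd k w y \<noteq> 0" shows "invertible (jac y)"
proof -
 have "v = 0" if "jac y *v v = 0" for v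
 proof -
  have *: "(\<Sum>c. jac y $ j $ c * v $ c) = 0" for j
   using that by (simp add: matrix_vector_mult_def vec_eq_iff)
  have j: "v $ j = 0" if "j \<noteq> k" for j
   using *[of j] that by (simp add: jac_def if_distrib[of "\<lambda>x. x * _"] cong: if_cong)
  have "pd k w y * v $ k = 0" using *[of k] unfolding sum_k_split by (simp add: jac_def j)
  hence "v $ k = 0" using assms by simp
  hence "v $ i = 0" for i using j by (cases "i = k") auto
  thus "v = 0" by (simp add: vec_eq_iff)
 qed
 hence "\<exists>B. B ** jac y = mat 1" using matrix_left_invertible_ker by blast
 thus ?thesis using invertible_left_inverse by blast
qed

context
 assumes fC2: "\<And>\<alpha>. C2_scalar (- closure \<Omega>) (\<lambda>x. f x $ \<alpha>)"
begin

definition G0 :: "(real^'n) set" where "G0 = {y \<in> Q. y $ k > 0 \<and> \<Phi> y \<in> - closure \<Omega>}"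

lemma open_G0: "open G0"
proof -
 have "open (Q \<inter> \<Phi> -` (- closure \<Omega>))"
  by (rule continuous_open_preimage[OF C1_vec_continuous[OF \<Phi>_C1] open_Q]) (rule open_Compl[OF closed_closure])
 hence "open (Q \<inter> \<Phi> -` (- closure \<Omega>) \<inter> {y. y $ k > 0})"
  by (rule open_Int) (intro open_Collect_less continuous_intros)
 also have "Q \<inter> \<Phi> -` (- closure \<Omega>) \<inter> {y. y $ k > 0} = G0" by (auto simp: G0_def)
 finally show ?thesis .
qed

lemma dz_interior: assumes y: "y \<in> G0"
 shows "dz \<alpha> y = transpose (jac y) *v grad_vec f \<alpha> (\<Phi> y)"
proof -
 have yQ: "y \<in> Q" "\<Phi> y \<in> - closure \<Omega>" using y by (auto simp: G0_def)
 have "pd c (\<lambda>y. z y $ \<alpha>) y = (\<Sum>j. D1 f \<alpha> j (\<Phi> y) * jac y $ j $ c)" for c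
 proof -
  have "pd c (\<lambda>y. z y $ \<alpha>) y = pd c (\<lambda>y. f (\<Phi> y) $ \<alpha>) y"
   by (rule pd_cong[OF open_G0 y]) (auto simp: G0_def interior_chart(3))
  also have "... = (\<Sum>j. pd j (\<lambda>x. f x $ \<alpha>) (\<Phi> y) * pd c (\<lambda>y. \<Phi> y $ j) y)"
   by (rule pd_comp[where h = "\<lambda>x. f x $ \<alpha>"])
    (use C2_scalar_differentiable[OF fC2 yQ(2)] C1_on_differentiable[OF \<Phi>_C1 yQ(1)] in auto)
  finally show ?thesis by (simp add: pd_\<Phi> D1_def)
 qed
 thus ?thesis
  by (simp add: vec_eq_iff jac_transpose_mult dz_def grad_vec_def mult.commute del: transpose_matrix_vector)
qed

text \<open>The chain rule for \<open>z = f \<circ> \<Phi>\<close>; only the \<open>k\<close>-th component of \<open>\<Phi>\<close> has second derivatives.\<close>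

lemma ddz_interior: assumes y: "y \<in> G0"
 shows "ddz \<alpha> y = transpose (jac y) ** hess f \<alpha> (\<Phi> y) ** jac y + D1 f \<alpha> k (\<Phi> y) *\<^sub>R ddw y"
proof -
 have yQ: "y \<in> Q" "\<Phi> y \<in> - closure \<Omega>" using y by (auto simp: G0_def)
 have D1d: "D1 f \<alpha> j differentiable (at (\<Phi> y))" for j
  by (rule C1_on_differentiable[OF D1_C1[OF fC2] yQ(2)])
 have \<Phi>d: "(\<lambda>y. \<Phi> y $ l) differentiable (at y)" for l by (rule C1_on_differentiable[OF \<Phi>_C1 yQ(1)])
 have cd: "(\<lambda>y. D1 f \<alpha> j (\<Phi> y)) differentiable (at y)" for j
  using has_derivative_comp_pd[OF D1d \<Phi>d] by (rule differentiableI)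
 have jd: "(\<lambda>y. jac y $ j $ c) differentiable (at y)" for j c
  using C1_on_differentiable[OF C2_scalar_pd[OF wC2] yQ(1)] by (cases "j = k") (simp_all add: jac_def)
 have pj: "pd d (\<lambda>y. jac y $ j $ c) y = (if j = k then ddw y $ c $ d else 0)" for j c d
  by (cases "j = k") (simp_all add: jac_def ddw_def)
 have "pd d (pd c (\<lambda>y. z y $ \<alpha>)) y = (transpose (jac y) ** hess f \<alpha> (\<Phi> y) ** jac y) $ c $ d + D1 f \<alpha> k (\<Phi> y) * ddw y $ c $ d" for c d
 proof -
  have "pd d (pd c (\<lambda>y. z y $ \<alpha>)) y = pd d (\<lambda>y. \<Sum>j. D1 f \<alpha> j (\<Phi> y) * jac y $ j $ c) y"
  proof (rule pd_cong[OF open_G0 y])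
   fix y assume "y \<in> G0"
   from arg_cong[OF dz_interior[OF this, of \<alpha>], of "\<lambda>v. v $ c"]
   show "pd c (\<lambda>y. z y $ \<alpha>) y = (\<Sum>j. D1 f \<alpha> j (\<Phi> y) * jac y $ j $ c)"
    by (simp add: jac_transpose_mult dz_def grad_vec_def mult.commute del: transpose_matrix_vector)
  qed
  also have "... = (\<Sum>j. pd d (\<lambda>y. D1 f \<alpha> j (\<Phi> y)) y * jac y $ j $ c + D1 f \<alpha> j (\<Phi> y) * pd d (\<lambda>y. jac y $ j $ c) y)"
   using cd jd by (subst pd_sum) (auto simp: pd_mult intro!: differentiable_mult)
  also have "... = (\<Sum>j. (\<Sum>l. D2 f \<alpha> j l (\<Phi> y) * jac y $ l $ d) * jac y $ j $ c) + D1 f \<alpha> k (\<Phi> y) * ddw y $ c $ d"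
   by (simp add: pd_comp[where h = "D1 f \<alpha> _", OF D1d \<Phi>d] pd_\<Phi> D2_def pj sum.distrib if_distrib[of "\<lambda>x. _ * x"] cong: if_cong)
  also have "(\<Sum>j. (\<Sum>l. D2 f \<alpha> j l (\<Phi> y) * jac y $ l $ d) * jac y $ j $ c) = (transpose (jac y) ** hess f \<alpha> (\<Phi> y) ** jac y) $ c $ d"
   unfolding matrix_mul_assoc[symmetric]
   by (simp add: matrix_matrix_mult_def transpose_def hess_def mult.commute)
  finally show ?thesis .
 qed
 thus ?thesis by (simp add: vec_eq_iff ddz_def)
qed

lemma chart_metric_interior: assumes y: "y \<in> G0"
 shows "chart_metric y = transpose (jac y) ** graph_metric f (\<Phi> y) ** jac y"
proof -
 let ?A = "jac y" and ?x = "\<Phi> y"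
 have "(transpose ?A ** graph_metric f ?x ** ?A) $ b $ c = chart_metric y $ b $ c" for b c
 proof -
  have "(transpose ?A ** graph_metric f ?x ** ?A) $ b $ c = (\<Sum>i. ?A $ i $ b * (\<Sum>j. graph_metric f ?x $ i $ j * ?A $ j $ c))"
   unfolding matrix_mul_assoc[symmetric] by (simp add: matrix_matrix_mult_def transpose_def)
  also have "... = (\<Sum>i. ?A $ i $ b * (?A $ i $ c + (\<Sum>\<alpha>. D1 f \<alpha> i ?x * (\<Sum>j. D1 f \<alpha> j ?x * ?A $ j $ c))))"
  proof (intro sum.cong refl arg_cong2[where f = "(*)"])
   fix i
   have "(\<Sum>j. graph_metric f ?x $ i $ j * ?A $ j $ c) = (\<Sum>j. (if j = i then ?A $ i $ c else 0) + (\<Sum>\<alpha>. D1 f \<alpha> i ?x * D1 f \<alpha> j ?x * ?A $ j $ c))"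
    by (intro sum.cong refl) (auto simp: graph_metric_def distrib_right sum_distrib_right)
   also have "... = ?A $ i $ c + (\<Sum>\<alpha> j. D1 f \<alpha> i ?x * D1 f \<alpha> j ?x * ?A $ j $ c)"
    unfolding sum.distrib by (subst sum.swap) simp
   finally show "(\<Sum>j. graph_metric f ?x $ i $ j * ?A $ j $ c) = ?A $ i $ c + (\<Sum>\<alpha>. D1 f \<alpha> i ?x * (\<Sum>j. D1 f \<alpha> j ?x * ?A $ j $ c))"
    by (simp add: sum_distrib_left mult.assoc)
  qed
  also have "... = (\<Sum>i. ?A $ i $ b * ?A $ i $ c) + (\<Sum>i \<alpha>. ?A $ i $ b * D1 f \<alpha> i ?x * (\<Sum>j. D1 f \<alpha> j ?x * ?A $ j $ c))"
   by (simp add: distrib_left sum.distrib sum_distrib_left mult.assoc)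
  also have "(\<Sum>i \<alpha>. ?A $ i $ b * D1 f \<alpha> i ?x * (\<Sum>j. D1 f \<alpha> j ?x * ?A $ j $ c)) = (\<Sum>\<alpha>. dz \<alpha> y $ b * dz \<alpha> y $ c)"
   unfolding dz_interior[OF y] jac_transpose_mult by (subst sum.swap) (simp add: grad_vec_def sum_distrib_right[symmetric] mult.commute)
  also have "(\<Sum>i. ?A $ i $ b * ?A $ i $ c) = pd b w y * pd c w y + (\<Sum>i\<in>UNIV - {k}. if i = b then (if b = c then 1 else 0) else 0)"
   unfolding sum_k_split by (intro arg_cong2[where f = "(+)"] sum.cong) (auto simp: jac_def)
  also have "(\<Sum>i\<in>UNIV - {k}. if i = b then (if b = c then 1 else 0) else 0) = (if b = c \<and> b \<noteq> k then 1 else (0::real))" by simp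
  finally show ?thesis by (simp add: chart_metric_def)
 qed
 thus ?thesis by (simp add: vec_eq_iff)
qed

lemma chart_hess_interior: assumes y: "y \<in> G0"
 shows "chart_hess \<alpha> y = pd k w y *\<^sub>R (transpose (jac y) ** hess f \<alpha> (\<Phi> y) ** jac y)"
proof -
 have "dz \<alpha> y $ k = (\<Sum>j. if j = k then pd k w y * D1 f \<alpha> k (\<Phi> y) else 0)"
  unfolding dz_interior[OF y] jac_transpose_mult by (intro sum.cong) (auto simp: jac_def grad_vec_def)
 hence "dz \<alpha> y $ k = pd k w y * D1 f \<alpha> k (\<Phi> y)" by simp
 thus ?thesis by (simp add: chart_hess_def ddz_interior[OF y] scaleR_add_right)
qed

lemma G0I: "y \<in> cbox a b ==> y $ k > 0 ==> y \<in> G0"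
 using cQ interior_chart(1) by (auto simp: G0_def)

text \<open>The chart flux is the vector density of \<open>flux_field\<close> in the coordinates \<open>y\<close>.\<close>

lemma chart_flux_interior: assumes y: "y \<in> cbox a b" "y $ k > 0"
 shows "jac y *v chart_flux y = \<bar>pd k w y\<bar> *\<^sub>R flux_field f (\<Phi> y)" "invertible (chart_metric y)"
proof -
 have G: "y \<in> G0" using y by (rule G0I)
 have pos: "\<sigma> * pd k w y > 0" using interior_chart(2) y by blast
 hence "invertible (jac y)" by (intro invertible_jac) auto
 note F = flux_change_of_coordinates[OF this graph_metric_invertible[of f "\<Phi> y"], folded chart_metric_interior[OF G]]
 show "invertible (chart_metric y)" by (rule F(2))
 have a: "\<sigma> * pd k w y = \<bar>pd k w y\<bar>" using pos \<sigma>(1) by auto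
 have "jac y *v chart_flux y = \<sigma> *\<^sub>R (\<Sum>\<alpha>. jac y *v (trace (matrix_inv (chart_metric y) ** chart_hess \<alpha> y) *\<^sub>R (matrix_inv (chart_metric y) *v dz \<alpha> y)
   - (matrix_inv (chart_metric y) ** chart_hess \<alpha> y) *v (matrix_inv (chart_metric y) *v dz \<alpha> y)))"
  by (simp add: chart_flux_def matrix_vector_mult_scaleR linear_sum[OF matrix_vector_mul_linear])
 also have "... = \<sigma> *\<^sub>R (\<Sum>\<alpha>. pd k w y *\<^sub>R (trace (inv_metric f (\<Phi> y) ** hess f \<alpha> (\<Phi> y)) *\<^sub>R (inv_metric f (\<Phi> y) *v grad_vec f \<alpha> (\<Phi> y))
   - (inv_metric f (\<Phi> y) ** hess f \<alpha> (\<Phi> y)) *v (inv_metric f (\<Phi> y) *v grad_vec f \<alpha> (\<Phi> y))))"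
  unfolding chart_hess_interior[OF G] dz_interior[OF G] F(1) ..
 also have "... = (\<sigma> * pd k w y) *\<^sub>R flux_field f (\<Phi> y)"
  by (simp add: flux_field_def graph_gradient_def grad_vec_def scaleR_sum_right)
 finally show "jac y *v chart_flux y = \<bar>pd k w y\<bar> *\<^sub>R flux_field f (\<Phi> y)" unfolding a .
qed

end

lemma dz_boundary: assumes y: "y \<in> cbox a b" "y $ k = 0"
 shows "dz \<alpha> y $ c = (if c = k then dz \<alpha> y $ k else 0)" "(\<Sum>\<alpha>. (dz \<alpha> y $ k)\<^sup>2) > 0"
proof -
 show "dz \<alpha> y $ c = (if c = k then dz \<alpha> y $ k else 0)"
  using boundary_values(3)[OF y] by (simp add: dz_def)
 obtain \<beta> where "dz \<beta> y $ k \<noteq> 0" using boundary_values(4)[OF y] by (auto simp: dz_def)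
 thus "(\<Sum>\<alpha>. (dz \<alpha> y $ k)\<^sup>2) > 0"
  by (intro sum_pos2[of _ \<beta>]) auto
qed

text \<open>On the boundary \<open>\<partial>\<^sub>k w\<close> and the tangential derivatives of \<open>z\<close> vanish, so the metric is that of the
 graph of \<open>u\<close> plus an orthogonal vertical direction of squared length \<open>\<Sum>\<^sub>\<alpha> (\<partial>\<^sub>k z\<^sup>\<alpha>)\<^sup>2\<close>.\<close>

lemma chart_metric_boundary: assumes y: "y \<in> cbox a b" "y $ k = 0"
 defines "d \<equiv> \<lambda>i. if i = k then (\<Sum>\<alpha>. (dz \<alpha> y $ k)\<^sup>2) else 1"
 defines "q \<equiv> 1 + (\<Sum>i. (pd i w y)\<^sup>2)"
 shows "matrix_inv (chart_metric y) = (\<chi> i j. (if i = j then 1 / d i else 0) - pd i w y * pd j w y / q)"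
  "invertible (chart_metric y)"
proof -
 have "chart_metric y = (\<chi> i j. (if i = j then d i else 0) + pd i w y * pd j w y)"
 proof -
  have "(\<Sum>\<alpha>. dz \<alpha> y $ i * dz \<alpha> y $ j) = (if i = k \<and> j = k then d k else 0)" for i j
  proof (cases "i = k \<and> j = k")
   case True
   thus ?thesis by (simp add: d_def power2_eq_square)
  next
   case False
   hence "dz \<alpha> y $ i * dz \<alpha> y $ j = 0" for \<alpha>
    using dz_boundary(1)[OF y, of \<alpha> i] dz_boundary(1)[OF y, of \<alpha> j] by auto
   hence "(\<Sum>\<alpha>. dz \<alpha> y $ i * dz \<alpha> y $ j) = 0" by (intro sum.neutral ballI)
   thus ?thesis using False by auto
  qed
  thus ?thesis by (auto simp: chart_metric_def vec_eq_iff d_def)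
 qed
 moreover have "d i \<noteq> 0" "d i * pd i w y = pd i w y" for i
  using dz_boundary(2)[OF y] boundary_values(2)[OF y] by (auto simp: d_def)
 ultimately have i: "chart_metric y ** (\<chi> i j. (if i = j then 1 / d i else 0) - pd i w y * pd j w y / q) = mat 1"
  using diagonal_plus_rank_one_inverse[of d "\<lambda>i. pd i w y" q] q_def by simp
 show "matrix_inv (chart_metric y) = (\<chi> i j. (if i = j then 1 / d i else 0) - pd i w y * pd j w y / q)"
  by (rule matrix_inv_unique[OF i])
 show "invertible (chart_metric y)" using i invertible_right_inverse by blast
qed

text \<open>With \<open>\<zeta>\<^sub>\<alpha> = \<partial>\<^sub>k z\<^sup>\<alpha>\<close> the summand for \<open>\<alpha>\<close> is \<open>\<zeta>\<^sub>\<alpha>\<^sup>2 / \<Sum>\<^sub>\<beta> \<zeta>\<^sub>\<beta>\<^sup>2\<close> times one expression in \<open>w\<close>, so the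
 vertical direction drops out.\<close>

lemma chart_flux_boundary: assumes y: "y \<in> cbox a b" "y $ k = 0"
 shows "chart_flux y $ k = - \<sigma> * (\<Sum>i\<in>UNIV - {k}. ddw y $ i $ i - (\<Sum>j. pd i w y * pd j w y * ddw y $ j $ i) / (1 + (\<Sum>i. (pd i w y)\<^sup>2)))"
  (is "_ = - \<sigma> * ?T")
proof -
 let ?M = "matrix_inv (chart_metric y)" and ?\<zeta> = "\<lambda>\<alpha>. dz \<alpha> y $ k" and ?q = "1 + (\<Sum>i. (pd i w y)\<^sup>2)"
 define \<mu> where "\<mu> = (\<Sum>\<alpha>. (?\<zeta> \<alpha>)\<^sup>2)"
 have l: "\<mu> > 0" using dz_boundary(2)[OF y] by (simp add: \<mu>_def)
 have M: "?M $ i $ j = (if i = j then 1 / (if i = k then \<mu> else 1) else 0) - pd i w y * pd j w y / ?q" for i j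
  unfolding chart_metric_boundary(1)[OF y] by (simp add: \<mu>_def)
 have wk: "pd k w y = 0" by (rule boundary_values(2)[OF y])
 have Mdz: "(?M *v dz \<alpha> y) $ i = (if i = k then ?\<zeta> \<alpha> / \<mu> else 0)" for \<alpha> i
 proof -
  have "(?M *v dz \<alpha> y) $ i = (\<Sum>j. ?M $ i $ j * (if j = k then ?\<zeta> \<alpha> else 0))"
   unfolding matrix_vector_mult_def by (simp add: dz_boundary(1)[OF y, symmetric])
  also have "... = ?M $ i $ k * ?\<zeta> \<alpha>" by (simp add: if_distrib[of "\<lambda>x. _ * x"] cong: if_cong)
  finally show ?thesis by (simp add: M wk)
 qed
 have K: "chart_hess \<alpha> y = (- ?\<zeta> \<alpha>) *\<^sub>R ddw y" for \<alpha> by (simp add: chart_hess_def wk)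
 have T: "trace (?M ** ddw y) - (?M ** ddw y) $ k $ k = ?T"
 proof -
  have "trace (?M ** ddw y) - (?M ** ddw y) $ k $ k = (\<Sum>i\<in>UNIV - {k}. \<Sum>j. ?M $ i $ j * ddw y $ j $ i)"
   unfolding trace_def sum_k_split[of "\<lambda>i. (?M ** ddw y) $ i $ i"] by (simp add: matrix_matrix_mult_def)
  also have "... = ?T"
  proof (rule sum.cong[OF refl])
   fix i assume "i \<in> UNIV - {k}"
   hence "(\<Sum>j. ?M $ i $ j * ddw y $ j $ i) = (\<Sum>j. (if j = i then ddw y $ i $ i else 0) - pd i w y * pd j w y * ddw y $ j $ i / ?q)"
    by (intro sum.cong) (auto simp: M left_diff_distrib)
   thus "(\<Sum>j. ?M $ i $ j * ddw y $ j $ i) = ddw y $ i $ i - (\<Sum>j. pd i w y * pd j w y * ddw y $ j $ i) / ?q"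
    by (simp add: sum_subtractf sum_divide_distrib)
  qed
  finally show ?thesis .
 qed
 have "chart_flux y $ k = \<sigma> * (\<Sum>\<alpha>. trace (?M ** chart_hess \<alpha> y) * (?\<zeta> \<alpha> / \<mu>) - ((?M ** chart_hess \<alpha> y) *v (?M *v dz \<alpha> y)) $ k)"
  by (simp add: chart_flux_def Mdz)
 also have "... = \<sigma> * (\<Sum>\<alpha>. - ((?\<zeta> \<alpha>)\<^sup>2 / \<mu>) * ?T)"
 proof (intro arg_cong[where f = "\<lambda>x. \<sigma> * x"] sum.cong refl)
  fix \<alpha>
  have "((?M ** chart_hess \<alpha> y) *v (?M *v dz \<alpha> y)) $ k = (\<Sum>j. (?M ** chart_hess \<alpha> y) $ k $ j * (if j = k then ?\<zeta> \<alpha> / \<mu> else 0))"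
   unfolding matrix_vector_mult_def[of "?M ** chart_hess \<alpha> y"] by (simp add: Mdz)
  also have "... = (?M ** chart_hess \<alpha> y) $ k $ k * (?\<zeta> \<alpha> / \<mu>)" by (simp add: if_distrib[of "\<lambda>x. _ * x"] cong: if_cong)
  finally have "trace (?M ** chart_hess \<alpha> y) * (?\<zeta> \<alpha> / \<mu>) - ((?M ** chart_hess \<alpha> y) *v (?M *v dz \<alpha> y)) $ k =
   (?\<zeta> \<alpha> / \<mu>) * ((- ?\<zeta> \<alpha>) * (trace (?M ** ddw y) - (?M ** ddw y) $ k $ k))"
   unfolding K matrix_scaleR trace_scaleR by (simp add: algebra_simps)
  thus "trace (?M ** chart_hess \<alpha> y) * (?\<zeta> \<alpha> / \<mu>) - ((?M ** chart_hess \<alpha> y) *v (?M *v dz \<alpha> y)) $ k = - ((?\<zeta> \<alpha>)\<^sup>2 / \<mu>) * ?T"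
   unfolding T by (simp add: power2_eq_square)
 qed
 also have "... = - \<sigma> * ?T * ((\<Sum>\<alpha>. (?\<zeta> \<alpha>)\<^sup>2) / \<mu>)"
  by (simp add: sum_distrib_right[symmetric] sum_negf sum_divide_distrib[symmetric])
 also have "(\<Sum>\<alpha>. (?\<zeta> \<alpha>)\<^sup>2) / \<mu> = 1" using l by (simp add: \<mu>_def)
 finally show ?thesis by simp
qed

end

context boundary_chart
begin

text \<open>On the face the tangential derivatives of \<open>w\<close> are those of \<open>u\<close>, and the two explicit formulas coincide.\<close>

lemma chart_flux_mean_curvature:
 assumes y: "y \<in> U" and p: "set_coord k (u y) y \<in> W1"
 shows "chart_flux (set_coord k 0 y) $ k = area_factor u y * mean_curvature \<Omega> (set_coord k (u y) y)"
proof -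
 let ?p = "set_coord k (u y) y" and ?y = "set_coord k 0 y"
 have pf: "?p \<in> frontier \<Omega>" using patch_frontier y by (auto simp: patch_image_def)
 have pU: "?p \<in> U" using y by simp
 have yc: "?y \<in> cbox a b" using U_cbox[OF y, of 0] ak by simp
 have w0: "pd k w ?y = 0" by (rule boundary_values(2)[OF yc]) simp
 have s0: "set_coord k 0 ?p = ?y" by (simp add: vec_eq_iff)
 have u1: "pd j u ?p = pd j w ?y" for j
  using pd_u[OF pU, of j] pd_k_u[OF pU] w0 s0 by (cases "j = k") simp_all
 have u2: "pd i (pd j u) ?p = (if i = k \<or> j = k then 0 else ddw ?y $ j $ i)" for i j
  using pd_pd_u[OF pU, of j i] pd_k_pd_u[OF pU] s0 by (auto simp: ddw_def)
 have A: "(area_factor u ?p)\<^sup>2 = 1 + (\<Sum>i. (pd i w ?y)\<^sup>2)" by (simp add: area_factor_sq u1)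
 have "(\<Sum>i. pd i (pd i u) ?p) = (\<Sum>i\<in>UNIV - {k}. ddw ?y $ i $ i)"
  unfolding sum_k_split[of "\<lambda>i. pd i (pd i u) ?p"] by (simp add: u2)
 moreover have "(\<Sum>i j. pd i u ?p * pd j u ?p * pd i (pd j u) ?p) = (\<Sum>i\<in>UNIV - {k}. \<Sum>j. pd i w ?y * pd j w ?y * ddw ?y $ j $ i)"
 proof -
  have "(\<Sum>j. pd i u ?p * pd j u ?p * pd i (pd j u) ?p) = (if i = k then 0 else (\<Sum>j. pd i w ?y * pd j w ?y * ddw ?y $ j $ i))" for i
   by (auto simp: u1 u2 w0 intro!: sum.neutral sum.cong)
  thus ?thesis unfolding sum_k_split[of "\<lambda>i. \<Sum>j. pd i u ?p * pd j u ?p * pd i (pd j u) ?p"] by simp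
 qed
 ultimately have "area_factor u ?p * mean_curvature \<Omega> ?p = chart_flux ?y $ k"
  unfolding mean_curvature_patch[OF p pf] A using chart_flux_boundary[OF yc]
  by (simp add: sum_subtractf sum_divide_distrib)
 thus ?thesis using area_factor_indep[OF u_patch y] by simp
qed

lemma chart_entries_C1:
 "C1_on Q (\<lambda>y. chart_metric y $ i $ j)" "continuous_on Q (\<lambda>y. chart_hess \<alpha> y $ i $ j)" "continuous_on Q (\<lambda>y. dz \<alpha> y $ i)"
proof -
 have dz: "C1_on Q (\<lambda>y. dz \<alpha> y $ i)" for \<alpha> i unfolding dz_def using C2_scalar_pd[OF zC2] by simp
 thus "continuous_on Q (\<lambda>y. dz \<alpha> y $ i)" by (rule C1_on_continuous)
 show "C1_on Q (\<lambda>y. chart_metric y $ i $ j)"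
  unfolding chart_metric_def vec_lambda_beta
  by (intro C1_on_add C1_on_mult C1_on_sum C1_on_const dz open_Q C2_scalar_pd[OF wC2])
 show "continuous_on Q (\<lambda>y. chart_hess \<alpha> y $ i $ j)"
  unfolding chart_hess_def ddz_def ddw_def
  using C1_on_pd_continuous[OF C2_scalar_pd[OF wC2]] C1_on_pd_continuous[OF C2_scalar_pd[OF zC2]]
   C1_on_pd_continuous[OF C2_scalar_C1[OF wC2]] C1_on_continuous[OF dz]
  by (simp add: continuous_on_diff continuous_on_mult)
qed

lemma chart_flux_continuous:
 assumes fC2: "\<And>\<alpha>. C2_scalar (- closure \<Omega>) (\<lambda>x. f x $ \<alpha>)"
 shows "continuous_on (cbox a b) (\<lambda>y. chart_flux y $ c)"
proof -
 define Q0 where "Q0 = Q \<inter> (\<lambda>y. det (chart_metric y)) -` (- {0})"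
 have oQ0: "open Q0" unfolding Q0_def
  by (intro continuous_open_preimage open_Q C1_on_continuous[OF C1_on_det] chart_entries_C1(1)) auto
 have Q0Q: "Q0 \<subseteq> Q" by (auto simp: Q0_def)
 have inv: "invertible (chart_metric y)" if "y \<in> Q0" for y using that by (simp add: Q0_def invertible_det_nz)
 have sub: "cbox a b \<subseteq> Q0"
 proof
  fix y assume y: "y \<in> cbox a b"
  hence "a $ k \<le> y $ k" by (simp add: mem_box_cart)
  hence "invertible (chart_metric y)"
   using chart_flux_interior(2)[OF fC2 y] chart_metric_boundary(2)[OF y] ak(1) by (cases "y $ k = 0") auto
  thus "y \<in> Q0" using y cQ by (auto simp: Q0_def invertible_det_nz)
 qed
 have M: "continuous_on (cbox a b) (\<lambda>y. matrix_inv (chart_metric y) $ i $ j)" for i j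
  using C1_on_continuous[OF C1_on_matrix_inv[OF oQ0 C1_on_subset[OF chart_entries_C1(1) oQ0 Q0Q] inv]] sub
  by (rule continuous_on_subset)
 note K = continuous_on_subset[OF chart_entries_C1(2) cQ] and d = continuous_on_subset[OF chart_entries_C1(3) cQ]
 show ?thesis
  unfolding chart_flux_def trace_def matrix_matrix_mult_def matrix_vector_mult_def
  by (simp, intro continuous_intros M K d)
qed

lemma boundary_term:
 assumes fC2: "\<And>\<alpha>. C2_scalar (- closure \<Omega>) (\<lambda>x. f x $ \<alpha>)"
  and wf: "weak_field D (flux_field f) s"
  and W2: "open W2" "W2 \<subseteq> W1" "\<And>x. x \<in> W2 ==> x \<in> D \<longleftrightarrow> x \<in> - closure \<Omega>"
  and img: "\<And>y. y \<in> box a b ==> \<Phi> y \<in> D"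
  and ar: "is_area_measure (frontier \<Omega>) A"
 shows "weak_field.boundary_term_near D (flux_field f) s A (frontier \<Omega>) (mean_curvature \<Omega>) W2"
proof -
 interpret weak_field D "flux_field f" s by (rule wf)
 have pos: "\<sigma> * pd k w y > 0" if "y \<in> box a b" for y
  using interior_chart(2)[of y] that box_subset_cbox[of a b] box_U by blast
 interpret C: collar D "flux_field f" s k a b Q w chart_flux W2
 proof unfold_locales
  show "inj_on (\<lambda>y. set_coord k (w y) y) (box a b)" using inj_on_\<Phi> by (simp add: \<Phi>_def[abs_def])
  show "pd k w y \<noteq> 0" if "y \<in> box a b" for y using pos[OF that] by auto
  show "set_coord k (w y) y \<in> D" if "y \<in> box a b" for y using img[OF that] by (simp add: \<Phi>_def)
  show "\<exists>y\<in>box a b. set_coord k (w y) y = x" if "x \<in> W2" "x \<in> D" for x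
   using inverse_image_in_box[of x] that W2 by (auto simp: \<Phi>_def)
  show "\<bar>pd k w y\<bar> * flux_field f (set_coord k (w y) y) $ j = (if j = k then (\<Sum>c. pd c w y * chart_flux y $ c) else chart_flux y $ j)"
   if "y \<in> box a b" for y j
  proof -
   have "(\<Sum>c. jac y $ j $ c * chart_flux y $ c) = \<bar>pd k w y\<bar> * flux_field f (\<Phi> y) $ j"
    using arg_cong[OF chart_flux_interior(1)[OF fC2, of y], of "\<lambda>v. v $ j"] that box_subset_cbox[of a b] box_U
    by (auto simp: matrix_vector_mult_def)
   thus ?thesis by (auto simp: \<Phi>_def jac_def if_distrib[of "\<lambda>x. x * _"] cong: if_cong)
  qed
  show "\<exists>N. open N \<and> x \<in> N \<and> (\<forall>y\<in>box a b. set_coord k (w y) y \<in> N --> y $ k < \<epsilon>)"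
   if "x \<in> W2" "x \<notin> D" "\<epsilon> > 0" for x \<epsilon>
   using collar_exhausts[of x \<epsilon>] that W2 by (auto simp: \<Phi>_def)
 qed (use ak(1,3) C2_scalar_C1[OF wC2] cQ W2(1) chart_flux_continuous[OF fC2] in auto)
 have e: "C.base = u" by (simp add: C.base_def u_def fun_eq_iff)
 show ?thesis
  by (rule C.collar_boundary_term[OF ar, unfolded e, OF u_patch patch_frontier])
   (use frontier_patch chart_flux_mean_curvature W2(2) W1(3) in blast)+
qed

end

section \<open>The flux through a sphere\<close>

context weak_field
begin

text \<open>A collar of the sphere: \<open>y\<^sub>k\<close> is the depth below the cap \<open>x\<^sub>k = u\<close> in the direction of the \<open>k\<close>-th axis, and
 \<open>t\<close> is the sign of the cap.\<close>

lemma sphere_boundary_term: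
 assumes R: "R > 0" and x0: "x0 \<in> sphere 0 R" and W0: "open W0" "x0 \<in> W0" "\<And>x. x \<in> W0 ==> x \<in> D \<longleftrightarrow> norm x < R"
  and Xc: "\<And>j. continuous_on W0 (\<lambda>x. X x $ j)"
 shows "\<exists>W. open W \<and> x0 \<in> W \<and> boundary_term_near (area_measure (sphere 0 R)) (sphere 0 R) (\<lambda>x. - (X x \<bullet> x) / R) W"
proof -
 have "x0 \<noteq> 0" using x0 R by auto
 then obtain k where k: "x0 $ k \<noteq> 0" by (metis vec_eq_iff zero_index)
 define t where "t = sgn (x0 $ k)"
 have t: "t\<^sup>2 = 1" "t * x0 $ k > 0" "t * t = 1" "\<bar>t\<bar> = 1" "t = 1 \<or> t = -1" using k by (auto simp: t_def sgn_real_def)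
 have tt: "t * (t * x) = x" for x using t(3) by (simp add: mult.assoc[symmetric])
 define u where "u = sphere_height R k t"
 define v where "v y = t * u y" for y
 define Q where "Q = sphere_shadow R k"
 have oQ: "open Q" unfolding Q_def by (rule open_sphere_shadow)
 have uC1: "C1_on Q u" unfolding u_def Q_def by (rule sphere_height_C1)
 have vpos: "v y > 0" if "y \<in> Q" for y using sphere_height_sgn[OF _ t(1)] that by (simp add: v_def u_def Q_def)
 have vu: "u y = t * v y" for y by (simp add: v_def tt)
 have vsq: "(v y)\<^sup>2 = R\<^sup>2 - (\<Sum>j\<in>UNIV - {k}. (y $ j)\<^sup>2)" if "y \<in> Q" for y
  using sphere_height_sq[OF _ t(1)] that t(1) by (simp add: v_def u_def Q_def power_mult_distrib)
 have indep: "u (set_coord k s y) = u y" "v (set_coord k s y) = v y" "set_coord k s y \<in> Q \<longleftrightarrow> y \<in> Q" for s y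
  by (simp_all add: u_def v_def Q_def sphere_height_indep sphere_shadow_indep)
 have vc: "continuous_on Q v" unfolding v_def by (intro continuous_intros C1_on_continuous[OF uC1])
 define w where "w y = u y - t * y $ k" for y
 define \<Phi> where "\<Phi> y = set_coord k (w y) y" for y
 have wC1: "C1_on Q w" unfolding w_def by (intro C1_on_diff C1_on_mult C1_on_const C1_on_nth oQ uC1)
 have ud: "u differentiable (at y)" if "y \<in> Q" for y using C1_on_differentiable[OF uC1 that] .
 have pdw: "pd c w y = (if c = k then - t else pd c u y)" if "y \<in> Q" for c y
 proof -
  have "pd c w y = pd c u y - pd c (\<lambda>y. t * y $ k) y"
   unfolding w_def using ud[OF that] by (intro pd_diff) (auto intro!: differentiable_mult has_derivative_nth[THEN differentiableI])
  also have "pd c (\<lambda>y. t * y $ k) y = t * (if c = k then 1 else 0)"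
   by (subst pd_mult) (auto intro!: has_derivative_nth[THEN differentiableI])
  finally show ?thesis using sphere_height_pd[of y R k t k] that t(1) by (auto simp: u_def Q_def)
 qed
 have \<Phi>k: "\<Phi> y $ k = t * (v y - y $ k)" for y by (simp add: \<Phi>_def w_def vu right_diff_distrib)
 have \<Phi>c: "continuous_on Q \<Phi>" unfolding \<Phi>_def by (intro continuous_on_set_coord C1_on_continuous[OF wC1] continuous_on_id)
 have "x0 \<in> patch_image k Q u" unfolding u_def Q_def sphere_patch_image[OF t(1) R] using x0 t(2) by simp
 hence x0Q: "x0 \<in> Q" "x0 $ k = u x0" using patch_image_iff[OF sphere_patch] by (auto simp: u_def Q_def)
 define y0 where "y0 = set_coord k 0 x0"
 have y0: "y0 \<in> Q" "\<Phi> y0 = x0" "y0 $ k = 0"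
  using x0Q indep by (auto simp: y0_def \<Phi>_def w_def vec_eq_iff)
 define P where "P = (Q \<inter> (\<lambda>y. v y - y $ k) -` {0<..}) \<inter> (Q \<inter> \<Phi> -` W0)"
 have oP: "open P" unfolding P_def
  by (intro open_Int continuous_open_preimage vc \<Phi>c oQ W0 continuous_intros open_greaterThan)
 have "y0 \<in> P" using y0 vpos[OF y0(1)] W0(2) by (simp add: P_def)
 then obtain a0 b where box: "0 < b $ k" "y0 \<in> box a0 b" "cbox a0 b \<subseteq> P" "cbox (set_coord k 0 a0) b \<subseteq> cbox a0 b"
  by (rule half_box_exists[OF oP _ y0(3)]) (rule that)
 define a where "a = set_coord k 0 a0"
 define \<delta> where "\<delta> = b $ k"
 have \<delta>: "\<delta> > 0" using box(1) by (simp add: \<delta>_def)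
 have ab: "a $ k = 0" "b $ k = \<delta>" "a $ j < b $ j" for j
  using box(1,2) by (auto simp: a_def \<delta>_def box_vec intro: less_trans)
 have cP: "cbox a b \<subseteq> P" using box(3,4) by (auto simp: a_def)
 have cQ: "cbox a b \<subseteq> Q" using cP by (auto simp: P_def)
 have bc: "box a b \<subseteq> cbox a b" by (rule box_subset_cbox)
 define U where "U = cylinder k a b"
 have U_cbox: "set_coord k s y \<in> cbox a b" if "y \<in> U" "0 \<le> s" "s \<le> \<delta>" for y s
  using that cylinder_cbox[of y k a b s] ab by (simp add: U_def)
 have UQ: "y \<in> Q" if "y \<in> U" for y using U_cbox[OF that, of 0] cQ \<delta> indep(3) by auto
 have oU: "open U" unfolding U_def by (rule open_cylinder)
 have box_U: "y \<in> box a b \<longleftrightarrow> y \<in> U \<and> 0 < y $ k \<and> y $ k < \<delta>" for y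
  using box_cylinder[of a k y b] ab by (simp add: U_def)
 have \<delta>v: "\<delta> < v y" if "y \<in> U" for y
  using U_cbox[OF that, of \<delta>] cP \<delta> by (auto simp: P_def indep)
 define W where "W = W0 \<inter> (U \<inter> (\<lambda>x. t * x $ k - (v x - \<delta>)) -` {0<..})"
 have vU: "continuous_on U v" using continuous_on_subset[OF vc] UQ by blast
 have oW: "open W" unfolding W_def
  by (intro open_Int W0 continuous_open_preimage oU open_greaterThan continuous_intros vU)
 have "x0 \<in> U" using box(2) by (simp add: U_def cylinder_def a_def box_vec y0_def) metis
 hence x0W: "x0 \<in> W" using W0(2) \<delta> x0Q(2) by (simp add: W_def v_def)
 have normsq: "(norm x)\<^sup>2 = (x $ k)\<^sup>2 + R\<^sup>2 - (v x)\<^sup>2" if "x \<in> Q" for x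
  using norm_sq_split[of x k] vsq[OF that] by simp
 have norm_less: "norm x < R \<longleftrightarrow> \<bar>x $ k\<bar> < v x" if "x \<in> Q" for x
 proof -
  have "norm x < R \<longleftrightarrow> (norm x)\<^sup>2 < R\<^sup>2" using R power_strict_mono[of "norm x" R 2] power2_less_imp_less[of "norm x" R] by auto
  also have "... \<longleftrightarrow> \<bar>x $ k\<bar>\<^sup>2 < (v x)\<^sup>2" using normsq[OF that] by simp
  also have "... \<longleftrightarrow> \<bar>x $ k\<bar> < v x" using vpos[OF that] power_strict_mono[of "\<bar>x $ k\<bar>" "v x" 2] power2_less_imp_less[of "\<bar>x $ k\<bar>" "v x"] by auto
  finally show ?thesis .
 qed
 have atx: "\<bar>t * x\<bar> = \<bar>x\<bar>" for x by (simp add: abs_mult t(4))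
 have \<Phi>Q: "\<Phi> y \<in> Q \<longleftrightarrow> y \<in> Q" "v (\<Phi> y) = v y" for y by (simp_all add: \<Phi>_def indep)
 have inner_eq: "X x \<bullet> x = X x $ k * x $ k + (\<Sum>j\<in>UNIV - {k}. X x $ j * x $ j)" for x
  unfolding inner_vec_def by (subst sum.remove[of _ k]) auto
 \<comment> \<open>the density of \<open>X\<close>, solved for with \<open>\<partial>\<^sub>k w = - t\<close>\<close>
 define Y where "Y y = (\<chi> c. if c = k then - t * (X (\<Phi> y) $ k - (\<Sum>j\<in>UNIV - {k}. pd j u y * X (\<Phi> y) $ j)) else X (\<Phi> y) $ c)" for y
 interpret C: collar D X s k a b Q w Y W
 proof unfold_locales
  show "inj_on (\<lambda>y. set_coord k (w y) y) (box a b)"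
  proof (rule inj_onI)
   fix x y assume "set_coord k (w x) x = set_coord k (w y) y"
   hence xy: "\<Phi> x = \<Phi> y" by (simp add: \<Phi>_def)
   have j: "x $ j = y $ j" if "j \<noteq> k" for j using arg_cong[OF xy, of "\<lambda>v. v $ j"] that by (simp add: \<Phi>_def)
   have e: "t * (v x - x $ k) = t * (v y - y $ k)" using \<Phi>k[of x] \<Phi>k[of y] xy by metis
   have "v x = v y" using \<Phi>Q(2)[of x] \<Phi>Q(2)[of y] xy by simp
   moreover have "v x - x $ k = v y - y $ k" using mult_left_cancel[THEN iffD1, OF _ e] t(4) by auto
   ultimately have "x $ k = y $ k" by linarith
   thus "x = y" using j by (metis vec_eq_iff)
  qed
  show "pd k w y \<noteq> 0" if "y \<in> box a b" for y using t(4) bc cQ pdw[of y k] that by auto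
  show "set_coord k (w y) y \<in> D" if y: "y \<in> box a b" for y
  proof -
   have yP: "y \<in> P" "y \<in> Q" using y bc cP cQ by blast+
   hence "\<Phi> y \<in> W0" by (simp add: P_def)
   moreover have "norm (\<Phi> y) < R" using yP y by (auto simp: norm_less \<Phi>Q \<Phi>k atx P_def box_U)
   ultimately show ?thesis using W0(3) by (simp add: \<Phi>_def)
  qed
  show "open W" by (rule oW)
  show "\<exists>y\<in>box a b. set_coord k (w y) y = x" if x: "x \<in> W" "x \<in> D" for x
  proof
   have xU: "x \<in> U" "x \<in> W0" "t * x $ k > v x - \<delta>" using x by (auto simp: W_def)
   let ?y = "set_coord k (v x - t * x $ k) x"
   have "\<bar>t * x $ k\<bar> < v x" using norm_less[OF UQ[OF xU(1)]] W0(3)[OF xU(2)] x(2) by (simp add: atx)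
   thus "?y \<in> box a b" using xU by (auto simp: box_U) (simp add: U_def)
   have "w ?y = x $ k" by (simp add: w_def indep vu right_diff_distrib tt)
   thus "set_coord k (w ?y) ?y = x" by (auto simp: vec_eq_iff)
  qed
  show "continuous_on (cbox a b) (\<lambda>y. Y y $ c)" for c
  proof -
   have "continuous_on (cbox a b) (\<lambda>y. X (\<Phi> y) $ j)" for j
    by (rule continuous_on_compose2[OF Xc continuous_on_subset[OF \<Phi>c cQ]]) (use cP in \<open>auto simp: P_def\<close>)
   moreover have "continuous_on (cbox a b) (pd j u)" for j
    by (rule continuous_on_subset[OF C1_on_pd_continuous[OF uC1] cQ])
   ultimately show ?thesis by (cases "c = k") (simp_all add: Y_def continuous_on_minus continuous_on_mult continuous_on_diff continuous_on_sum)
  qed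
  show "\<bar>pd k w y\<bar> * X (set_coord k (w y) y) $ j = (if j = k then (\<Sum>c. pd c w y * Y y $ c) else Y y $ j)"
   if "y \<in> box a b" for y j
  proof -
   have yQ: "y \<in> Q" using that bc cQ by blast
   have "(\<Sum>c. pd c w y * Y y $ c) = pd k w y * Y y $ k + (\<Sum>c\<in>UNIV-{k}. pd c w y * Y y $ c)"
    by (rule sum.remove) auto
   thus ?thesis using t(4) by (simp add: pdw[OF yQ] Y_def tt \<Phi>_def)
  qed
  show "\<exists>N. open N \<and> x \<in> N \<and> (\<forall>y\<in>box a b. set_coord k (w y) y \<in> N --> y $ k < \<epsilon>)"
   if x: "x \<in> W" "x \<notin> D" and \<epsilon>: "\<epsilon> > 0" for x \<epsilon>
  proof (intro exI conjI ballI impI)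
   let ?N = "U \<inter> (\<lambda>x. t * x $ k - (v x - \<epsilon>)) -` {0<..}"
   show "open ?N" by (intro continuous_open_preimage oU open_greaterThan continuous_intros vU)
   have xU: "x \<in> U" "x \<in> W0" "t * x $ k > v x - \<delta>" using x by (auto simp: W_def)
   hence "t * x $ k > 0" using \<delta>v[OF xU(1)] by simp
   moreover have "\<not> \<bar>t * x $ k\<bar> < v x" using norm_less[OF UQ[OF xU(1)]] W0(3)[OF xU(2)] x(2) by (simp add: atx)
   ultimately show "x \<in> ?N" using xU(1) \<epsilon> by simp
   show "y $ k < \<epsilon>" if "y \<in> box a b" "set_coord k (w y) y \<in> ?N" for y
    using that \<Phi>k[of y] \<Phi>Q(2)[of y] by (simp add: \<Phi>_def[symmetric] tt)
  qed
 qed (use ab wC1 cQ oW in auto)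
 have w0: "cylinder k a b = U" "C.base = u" by (simp_all add: U_def C.base_def fun_eq_iff w_def indep)
 have gp: "graph_patch k U u"
  unfolding graph_patch_def using C1_on_subset[OF uC1 oU] UQ by (auto simp: indep U_def)
 have "boundary_term_near (area_measure (sphere 0 R)) (sphere 0 R) (\<lambda>x. - (X x \<bullet> x) / R) W"
 proof (rule C.collar_boundary_term[OF is_area_measure_sphere[OF R], unfolded w0, OF gp])
  show "patch_image k U u \<subseteq> sphere 0 R"
  proof -
   have "patch_image k U u \<subseteq> patch_image k Q u" using UQ by (auto simp: patch_image_def)
   thus ?thesis using sphere_patch_image[OF t(1) R, of k] by (auto simp: u_def Q_def)
  qed
  show "sphere 0 R \<inter> W \<subseteq> patch_image k U u"
  proof
   fix x assume x: "x \<in> sphere 0 R \<inter> W"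
   hence xU: "x \<in> U" "t * x $ k > v x - \<delta>" by (auto simp: W_def)
   hence "t * x $ k > 0" using \<delta>v[OF xU(1)] by simp
   hence "x \<in> patch_image k Q u" using x sphere_patch_image[OF t(1) R, of k] by (auto simp: u_def Q_def)
   hence "x $ k = u x" using patch_image_iff[OF sphere_patch] by (auto simp: u_def Q_def)
   thus "x \<in> patch_image k U u" using xU(1) patch_image_iff[OF gp] by blast
  qed
  fix y assume yU: "y \<in> U"
  let ?x = "set_coord k (u y) y"
  have yQ: "y \<in> Q" and vy: "v y > 0" using UQ[OF yU] vpos by auto
  have yQ0: "set_coord k 0 y \<in> Q" using yQ indep by simp
  have \<Phi>0: "\<Phi> (set_coord k 0 y) = ?x" by (auto simp: \<Phi>_def w_def indep vec_eq_iff)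
  have uv: "\<bar>u y\<bar> = v y" using vy by (simp add: vu atx)
  have pu: "pd j u (set_coord k 0 y) = - y $ j * t / v y" if "j \<noteq> k" for j
  proof -
   have "pd j u (set_coord k 0 y) = - y $ j / u y"
    using sphere_height_pd[of "set_coord k 0 y" R k t j] yQ0 t(1) that indep(1) by (simp add: u_def Q_def)
   also have "... = - y $ j * t / v y" using t(5) by (auto simp: vu)
   finally show ?thesis .
  qed
  have "Y (set_coord k 0 y) $ k = - t * X ?x $ k + t * (\<Sum>j\<in>UNIV - {k}. (- y $ j * t / v y) * X ?x $ j)"
   by (simp add: Y_def \<Phi>0 pu right_diff_distrib cong: sum.cong_simp)
  also have "... = - (t * X ?x $ k + (\<Sum>j\<in>UNIV - {k}. X ?x $ j * y $ j) / v y)"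
  proof -
   have "t * (\<Sum>j\<in>UNIV - {k}. (- y $ j * t / v y) * X ?x $ j) = (\<Sum>j\<in>UNIV - {k}. - (t * t) * (X ?x $ j * y $ j) / v y)"
    by (simp add: sum_distrib_left mult_ac)
   thus ?thesis using t(3) by (simp add: sum_negf sum_divide_distrib)
  qed
  also have "... = - (X ?x \<bullet> ?x) / v y"
   using vy by (simp add: inner_eq vu field_simps cong: sum.cong_simp)
  also have "... = area_factor u y * (- (X ?x \<bullet> ?x) / R)"
   using sphere_area_factor[of y R k t] yQ t(1) R uv by (simp add: u_def Q_def)
  finally show "Y (set_coord k 0 y) $ k = area_factor u y * (- (X ?x \<bullet> ?x) / R)" .
 qed
 thus ?thesis using oW x0W by blast
qed

end

text \<open>For \<open>i \<noteq> j\<close> exchange the derivatives in \<open>\<partial>\<^sub>j a \<cdot> \<partial>\<^sub>i x\<^sub>i\<close>; the result contains \<open>\<partial>\<^sub>j x\<^sub>i = 0\<close>.\<close>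

lemma integral_pd_zero:
 fixes a :: "real^'n => real"
 assumes n: "CARD('n) \<ge> 2" and a: "C1_on UNIV a" "compact K" "\<And>x. x \<notin> K ==> a x = 0"
 shows "(LINT x|lborel. pd j a x) = 0"
proof -
 have "\<exists>i. i \<noteq> j"
 proof (rule ccontr)
  assume "\<not> ?thesis"
  hence "(UNIV :: 'n set) = {j}" by auto
  hence "CARD('n) = card {j}" by simp
  thus False using n by simp
 qed
 then obtain i where "i \<noteq> j" by blast
 thus ?thesis using integral_pd_swap[OF a(1) C1_on_nth[OF open_UNIV] a(2) subset_UNIV a(3), of j i i] by simp
qed

lemma weak_field_identity:
 fixes D :: "(real^'n) set"
 assumes n: "CARD('n) \<ge> 2" and D: "open D" "bounded D"
 shows "weak_field D (\<lambda>x. x) (\<lambda>_. real CARD('n))"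
proof
 show "set_integrable lborel D (\<lambda>_. real CARD('n))"
  using D emeasure_bounded_finite[OF D(2)] by (simp add: set_integrable_def)
 fix \<phi> :: "real^'n => real" and K assume \<phi>: "C1_on UNIV \<phi>" and K: "compact K" "\<And>x. x \<notin> K ==> \<phi> x = 0"
 have d: "(\<lambda>x. x $ j) differentiable (at x)" "\<phi> differentiable (at x)" for j x
  using has_derivative_nth C1_on_differentiable[OF \<phi>] by (auto intro: differentiableI)
 have e: "pd j (\<lambda>x. x $ j * \<phi> x) x = \<phi> x + x $ j * pd j \<phi> x" for j x by (simp add: pd_mult[OF d])
 have i: "integrable lborel \<phi>" "integrable lborel (\<lambda>x. x $ j * pd j \<phi> x)" for j
  using pd_zero_outside[OF compact_imp_closed[OF K(1)] K(2)] K(2)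
  by (intro integrable_compact_support[OF K(1)] continuous_intros continuous_on_subset[OF C1_on_continuous[OF \<phi>]]
   continuous_on_subset[OF C1_on_pd_continuous[OF \<phi>]]; simp)+
 have "(LINT x|lborel. \<phi> x) + (LINT x|lborel. x $ j * pd j \<phi> x) = 0" for j
  using integral_pd_zero[OF n C1_on_mult[OF C1_on_nth[OF open_UNIV] \<phi>] K(1), of j j] K(2) i by (simp add: e)
 hence "(LINT x|lborel. x $ j * pd j \<phi> x) = - (LINT x|lborel. \<phi> x)" for j by (metis add.commute eq_neg_iff_add_eq_0)
 thus "(LINT x|lborel. (\<Sum>j. x $ j * pd j \<phi> x)) = - (LINT x|lborel. real CARD('n) * \<phi> x)"
  using i by (simp add: Bochner_Integration.integral_sum)
qed (use D in \<open>auto intro: continuous_intros\<close>)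

text \<open>The divergence theorem for the field \<open>X(x) = x\<close> on the ball.\<close>

lemma sphere_area:
 assumes n: "CARD('n::finite) \<ge> 2" and r: "r > 0"
 defines "S \<equiv> sphere (0 :: real^'n) r" and "\<sigma> \<equiv> area_measure (sphere (0 :: real^'n) r)"
 shows "emeasure \<sigma> S < \<infinity>" "measure \<sigma> S = real CARD('n) * unit_ball_vol (real CARD('n)) * r ^ (CARD('n) - 1)"
proof -
 have ss: "sets \<sigma> = sets borel" using is_area_measure_sphere[OF r, where 'n = 'n] by (simp add: is_area_measure_def \<sigma>_def)
 hence S: "S \<in> sets \<sigma>" by (simp add: S_def borel_closed)
 interpret weak_field "ball (0 :: real^'n) r" "\<lambda>x. x" "\<lambda>_. real CARD('n)" by (rule weak_field_identity[OF n]) auto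
 have "\<exists>W. open W \<and> x \<in> W \<and> boundary_term_near \<sigma> S (\<lambda>x. - (x \<bullet> x) / r) W" if "x \<in> S" for x
  unfolding \<sigma>_def S_def by (rule sphere_boundary_term[OF r _ open_UNIV]) (use that in \<open>auto simp: S_def intro: continuous_intros\<close>)
 hence dt: "set_integrable \<sigma> S (\<lambda>x. - (x \<bullet> x) / r)" "(LINT x:ball (0 :: real^'n) r|lborel. real CARD('n)) = - (LINT x:S|\<sigma>. - (x \<bullet> x) / r)"
  using divergence_theorem[of "\<lambda>_::unit. S" "\<lambda>_. \<sigma>" "\<lambda>_ x. - (x \<bullet> x) / r"] r by (auto simp: S_def UNIV_unit)
 have e: "(\<lambda>x. indicator S x *\<^sub>R (- (x \<bullet> x) / r)) = (\<lambda>x. - r * indicator S x)"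
  using r by (auto simp: fun_eq_iff indicator_def S_def power2_norm_eq_inner[symmetric] power2_eq_square)
 have i: "integrable \<sigma> (\<lambda>x. - r * indicator S x)" using dt(1) unfolding set_integrable_def e .
 thus fin: "emeasure \<sigma> S < \<infinity>" using r S by (simp add: integrable_indicator_iff)
 have "real CARD('n) * measure lborel (ball (0 :: real^'n) r) = r * measure \<sigma> S"
  using dt(2) S fin unfolding set_lebesgue_integral_def e by (simp add: emeasure_bounded_finite mult.commute)
 also have "measure lborel (ball (0 :: real^'n) r) = unit_ball_vol (real CARD('n)) * r ^ CARD('n)"
  using r emeasure_ball[of r "0 :: real^'n"] by (simp add: measure_def)
 finally show "measure \<sigma> S = real CARD('n) * unit_ball_vol (real CARD('n)) * r ^ (CARD('n) - 1)"
  using r by (simp add: power_eq_if field_simps)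
qed

lemma sphere_integral_bound:
 fixes g :: "real^'n => real"
 assumes n: "CARD('n) \<ge> 2" and r: "r > 0" and g: "continuous_on (sphere 0 r) g" and B: "\<And>x. x \<in> sphere 0 r ==> \<bar>g x\<bar> \<le> B"
 shows "set_integrable (area_measure (sphere 0 r)) (sphere 0 r) g"
  "\<bar>LINT x:sphere 0 r|area_measure (sphere 0 r). g x\<bar> \<le> \<bar>B\<bar> * (real CARD('n) * unit_ball_vol (real CARD('n)) * r ^ (CARD('n) - 1))"
proof -
 let ?\<sigma> = "area_measure (sphere (0 :: real^'n) r)" and ?S = "sphere (0 :: real^'n) r"
 have s: "sets ?\<sigma> = sets borel" using is_area_measure_sphere[OF r, where 'n = 'n] by (simp add: is_area_measure_def)
 have S: "?S \<in> sets ?\<sigma>" unfolding s by (rule borel_closed) simp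
 note A = sphere_area[OF n r]
 have m: "(\<lambda>x. indicator ?S x *\<^sub>R g x) \<in> borel_measurable ?\<sigma>"
  using borel_measurable_continuous_on_indicator[OF _ g] by (simp add: measurable_cong_sets[OF s refl] borel_closed)
 show i: "set_integrable ?\<sigma> ?S g"
  unfolding set_integrable_def
  by (rule integrableI_bounded_set[OF S m A(1), of "\<bar>B\<bar>"]) (use B in \<open>force intro!: AE_I2\<close>)+
 have "\<bar>LINT x:?S|?\<sigma>. g x\<bar> \<le> (LINT x:?S|?\<sigma>. norm (g x))" using set_integral_norm_bound[OF i] by simp
 also have "... \<le> (LINT x:?S|?\<sigma>. \<bar>B\<bar>)"
 proof (rule set_integral_mono)
  show "set_integrable ?\<sigma> ?S (\<lambda>x. norm (g x))" using i by (rule set_integrable_norm)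
  show "set_integrable ?\<sigma> ?S (\<lambda>x. \<bar>B\<bar>)" unfolding set_integrable_def using S A(1) by simp
 qed (use B in force)
 also have "... = \<bar>B\<bar> * measure ?\<sigma> ?S" using S A(1) by (simp add: set_lebesgue_integral_def)
 finally show "\<bar>LINT x:?S|?\<sigma>. g x\<bar> \<le> \<bar>B\<bar> * (real CARD('n) * unit_ball_vol (real CARD('n)) * r ^ (CARD('n) - 1))"
  by (simp add: A(2))
qed

section \<open>Decay at infinity\<close>

abbreviation decay :: "real => (real^'n => real) set" where
 "decay q \<equiv> O[at_infinity](\<lambda>x. norm x powr (- q))"

lemma decay_mult: "F \<in> decay q ==> G \<in> decay r ==> (\<lambda>x. F x * G x) \<in> decay (q + r)"
 using landau_o.big.mult[of F at_infinity "\<lambda>x. norm x powr (- q)" G "\<lambda>x. norm x powr (- r)"]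
 by (simp add: powr_add[symmetric])

lemma decay_sum_mult:
 "(\<And>k. F k \<in> decay q) ==> (\<And>k. G k \<in> decay r) ==> s = q + r ==> (\<lambda>x. \<Sum>k\<in>A. F k x * G k x) \<in> decay s"
 by (simp only:) (intro big_sum_in_bigo decay_mult)

lemma decay_matrix:
 assumes A: "\<And>i j. (\<lambda>x. A x $ i $ j) \<in> decay q" and s: "s = q + r"
 shows "(\<And>i j. (\<lambda>x. B x $ i $ j) \<in> decay r) ==> (\<lambda>x. (A x ** B x) $ i $ l) \<in> decay s"
  and "(\<And>i. (\<lambda>x. v x $ i) \<in> decay r) ==> (\<lambda>x. (A x *v v x) $ i) \<in> decay s"
 unfolding matrix_matrix_mult_def matrix_vector_mult_def vec_lambda_beta by (rule decay_sum_mult[OF A _ s]; assumption)+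

lemma decay_inner:
 "(\<And>i. (\<lambda>x. v x $ i) \<in> decay q) ==> (\<And>i. (\<lambda>x. w x $ i) \<in> decay r) ==> s = q + r ==> (\<lambda>x. v x \<bullet> w x) \<in> decay s"
 unfolding inner_vec_def inner_real_def by (rule decay_sum_mult)

lemma decay_0:
 assumes "\<And>x. \<bar>F x\<bar> \<le> 1"
 shows "F \<in> decay 0"
proof (rule bigoI[of _ 1])
 have "\<forall>\<^sub>F x in at_infinity. 1 \<le> norm x" for x :: "real^'n" by (auto simp: eventually_at_infinity)
 thus "\<forall>\<^sub>F x in at_infinity. norm (F x) \<le> 1 * norm (norm x powr (- 0))"
  by eventually_elim (use assms in auto)
qed

lemma decay_bound:
 assumes "F \<in> decay q"
 obtains C R where "C > 0" "R > 0" "\<And>x. R \<le> norm x ==> \<bar>F x\<bar> \<le> C * norm x powr (- q)"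
proof -
 obtain C where C: "C > 0" "\<forall>\<^sub>F x in at_infinity. norm (F x) \<le> C * norm (norm x powr (- q))"
  using assms by (rule landau_o.bigE)
 then obtain R where "\<And>x. R \<le> norm x ==> norm (F x) \<le> C * norm (norm x powr (- q))"
  unfolding eventually_at_infinity by blast
 thus thesis by (intro that[of C "max R 1"]) (use C(1) in auto)
qed

text \<open>The integrand of the mass is the flux of the vector field \<open>\<Sum>\<^sub>\<alpha> (tr H) Df - H Df\<close>, which is the
 leading part of \<open>flux_field\<close>.\<close>

definition mass_field :: "(real^'n => real^'m) => real^'n => real^'n" where
 "mass_field f x = (\<Sum>\<alpha>. trace (hess f \<alpha> x) *\<^sub>R grad_vec f \<alpha> x - hess f \<alpha> x *v grad_vec f \<alpha> x)"

lemma mass_field_eq: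
 assumes f: "\<And>\<alpha>. C2_scalar D (\<lambda>x. f x $ \<alpha>)" and x: "x \<in> D"
 shows "(\<Sum>i. pd i (\<lambda>y. graph_metric f y $ i $ j) x - pd j (\<lambda>y. graph_metric f y $ i $ i) x) = mass_field f x $ j"
proof -
 have sym: "D2 f \<alpha> i j x = D2 f \<alpha> j i x" for \<alpha> i j
  using transpose_nth_sym[OF transpose_hess[OF f x, of \<alpha>], of i j] by (simp add: hess_def)
 have "(\<Sum>i. pd i (\<lambda>y. graph_metric f y $ i $ j) x - pd j (\<lambda>y. graph_metric f y $ i $ i) x) =
  (\<Sum>i \<alpha>. D2 f \<alpha> i i x * D1 f \<alpha> j x - D2 f \<alpha> j i x * D1 f \<alpha> i x)"
  unfolding graph_metric_pd[OF f x] sum_subtractf[symmetric]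
 proof (intro sum.cong refl)
  fix i \<alpha>
  show "D2 f \<alpha> i i x * D1 f \<alpha> j x + D1 f \<alpha> i x * D2 f \<alpha> j i x - (D2 f \<alpha> i j x * D1 f \<alpha> i x + D1 f \<alpha> i x * D2 f \<alpha> i j x) =
   D2 f \<alpha> i i x * D1 f \<alpha> j x - D2 f \<alpha> j i x * D1 f \<alpha> i x"
   using sym[of \<alpha> i j] by (simp add: algebra_simps)
 qed
 also have "... = (\<Sum>\<alpha> i. D2 f \<alpha> i i x * D1 f \<alpha> j x - D2 f \<alpha> j i x * D1 f \<alpha> i x)" by (rule sum.swap)
 also have "... = mass_field f x $ j"
  by (simp add: mass_field_def trace_def hess_def grad_vec_def matrix_vector_mult_def sum_subtractf sum_distrib_right)
 finally show ?thesis .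
qed

lemma mass_field_continuous:
 assumes f: "\<And>\<alpha>. C2_scalar D (\<lambda>x. f x $ \<alpha>)"
 shows "continuous_on D (\<lambda>x. mass_field f x $ j)"
proof -
 have G: "continuous_on D (\<lambda>x. grad_vec f \<alpha> x $ i)" for \<alpha> i
  unfolding grad_vec_def using C1_on_continuous[OF D1_C1[OF f]] by simp
 show ?thesis unfolding mass_field_def trace_def matrix_vector_mult_def
  by (simp add: continuous_on_sum continuous_on_diff continuous_on_mult hess_continuous[OF f] G)
qed

definition flat_rate :: "(real^'n => real^'m) => real => bool" where
 "flat_rate f p \<longleftrightarrow>
  (\<forall>\<alpha> i. D1 f \<alpha> i \<in> O[at_infinity](\<lambda>x. norm x powr (- p / 2))) \<and>
  (\<forall>\<alpha> i j. D2 f \<alpha> i j \<in> O[at_infinity](\<lambda>x. norm x powr (- p / 2 - 1)))"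

context
 fixes f :: "real^'n => real^'m" and D p
 assumes f: "\<And>\<alpha>. C2_scalar D (\<lambda>x. f x $ \<alpha>)"
  and rate: "flat_rate f p"
begin

lemma grad_decay: "(\<lambda>x. grad_vec f \<alpha> x $ i) \<in> decay (p / 2)" and hess_decay: "(\<lambda>x. hess f \<alpha> x $ i $ j) \<in> decay (p / 2 + 1)"
 using rate by (simp_all add: flat_rate_def grad_vec_def hess_def)

lemma metric_inv_decay: "(\<lambda>x. inv_metric f x $ i $ j) \<in> decay 0"
 unfolding graph_metric_gram by (intro decay_0 matrix_inv_gram_entry)

lemma graph_gradient_decay: "(\<lambda>x. graph_gradient f \<alpha> x $ i) \<in> decay (p / 2)"
 unfolding graph_gradient_def grad_vec_def[symmetric] by (rule decay_matrix(2)[OF metric_inv_decay _ grad_decay]) simp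

lemma S_perp_decay: "S_perp f \<in> decay (2 * p + 2)"
proof -
 have GH: "(\<lambda>x. (inv_metric f x ** hess f \<alpha> x) $ i $ j) \<in> decay (p / 2 + 1)" for \<alpha> i j
  by (rule decay_matrix(1)[OF metric_inv_decay _ hess_decay]) simp
 have "(\<lambda>x. ((inv_metric f x ** hess f \<alpha> x) *v graph_gradient f \<beta> x) $ i) \<in> decay (p + 1)"
  "(\<lambda>x. (hess f \<alpha> x *v graph_gradient f \<beta> x) $ i) \<in> decay (p + 1)" for \<alpha> \<beta> i
  by (rule decay_matrix(2)[OF GH _ graph_gradient_decay] decay_matrix(2)[OF hess_decay _ graph_gradient_decay]; simp)+
 hence "(\<lambda>x. ((inv_metric f x ** hess f \<alpha> x) *v graph_gradient f \<alpha>' x) \<bullet> (hess f \<beta> x *v graph_gradient f \<beta>' x)) \<in> decay (2 * p + 2)" for \<alpha> \<alpha>' \<beta> \<beta>'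
  by (rule decay_inner) simp
 thus ?thesis
  unfolding S_perp_eq[OF f, abs_def] by (intro big_sum_in_bigo sum_in_bigo)
qed

lemma matrix_add_rdistrib: "(A + B) ** C = A ** C + B ** (C :: real^'n^'n)"
 by (simp add: matrix_matrix_mult_def vec_eq_iff distrib_right sum.distrib)

text \<open>With \<open>g\<^sup>-\<^sup>1 = 1 + E\<close> each term of the difference contains the factor \<open>E = O(\<bar>x\<bar>\<^sup>-\<^sup>p)\<close>.\<close>

lemma flux_mass_decay: "(\<lambda>x. (flux_field f x - mass_field f x) \<bullet> x / norm x) \<in> decay (2 * p + 1)"
proof -
 let ?H = "hess f" and ?p = "graph_gradient f" and ?v = "grad_vec f"
 define E where "E x = inv_metric f x - mat 1" for x
 have G: "inv_metric f x = mat 1 + E x" for x by (simp add: E_def)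
 have E: "(\<lambda>x. E x $ i $ j) \<in> decay p" for i j
 proof -
  have "E x = - (inv_metric f x ** (graph_metric f x - mat 1))" for x
   using matrix_inv_mult(2)[OF graph_metric_invertible[of f x]]
    matrix_add_ldistrib[of "inv_metric f x" "graph_metric f x - mat 1" "mat 1"]
   by (simp add: E_def algebra_simps)
  hence e: "E x $ i $ j = - (\<Sum>k. inv_metric f x $ i $ k * (\<Sum>\<alpha>. ?v \<alpha> x $ k * ?v \<alpha> x $ j))" for x
   by (simp add: matrix_matrix_mult_def graph_metric_gram gram_def mat_def)
  have "(\<lambda>x. \<Sum>k. inv_metric f x $ i $ k * (\<Sum>\<alpha>. ?v \<alpha> x $ k * ?v \<alpha> x $ j)) \<in> decay p"
   by (intro decay_sum_mult[OF metric_inv_decay decay_sum_mult[OF grad_decay grad_decay refl]]) simp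
  thus ?thesis unfolding e by simp
 qed
 have p: "?p \<alpha> x = ?v \<alpha> x + E x *v ?v \<alpha> x" for \<alpha> x
  by (simp add: graph_gradient_def grad_vec_def G matrix_vector_mult_add_rdistrib)
 have EH: "(\<lambda>x. (E x ** ?H \<alpha> x) $ i $ j) \<in> decay (3 * p / 2 + 1)" for \<alpha> i j
  by (rule decay_matrix(1)[OF E _ hess_decay]) simp
 have Ev: "(\<lambda>x. (E x *v ?v \<alpha> x) $ i) \<in> decay (3 * p / 2)" for \<alpha> i
  by (rule decay_matrix(2)[OF E _ grad_decay]) simp
 have tr: "(\<lambda>x. trace (E x ** ?H \<alpha> x)) \<in> decay (3 * p / 2 + 1)" "(\<lambda>x. trace (?H \<alpha> x)) \<in> decay (p / 2 + 1)" for \<alpha>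
  unfolding trace_def by (intro big_sum_in_bigo EH hess_decay)+
 have terms: "(\<lambda>x. trace (E x ** ?H \<alpha> x) * ?p \<alpha> x $ j) \<in> decay (2 * p + 1)"
  "(\<lambda>x. trace (?H \<alpha> x) * (E x *v ?v \<alpha> x) $ j) \<in> decay (2 * p + 1)"
  "(\<lambda>x. ((E x ** ?H \<alpha> x) *v ?p \<alpha> x) $ j) \<in> decay (2 * p + 1)"
  "(\<lambda>x. (?H \<alpha> x *v (E x *v ?v \<alpha> x)) $ j) \<in> decay (2 * p + 1)" for \<alpha> j
  using decay_mult[OF tr(1)[of \<alpha>] graph_gradient_decay[of \<alpha> j]] decay_mult[OF tr(2)[of \<alpha>] Ev[of \<alpha> j]]
   decay_matrix(2)[OF EH _ graph_gradient_decay, of "2 * p + 1" \<alpha> \<alpha> j] decay_matrix(2)[OF hess_decay _ Ev, of "2 * p + 1" \<alpha> \<alpha> j]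
  by (simp_all add: algebra_simps)
 have eq: "(flux_field f x - mass_field f x) $ j = (\<Sum>\<alpha>. (trace (E x ** ?H \<alpha> x) * ?p \<alpha> x $ j + trace (?H \<alpha> x) * (E x *v ?v \<alpha> x) $ j)
   - (((E x ** ?H \<alpha> x) *v ?p \<alpha> x) $ j + (?H \<alpha> x *v (E x *v ?v \<alpha> x)) $ j))" for x j
 proof -
  have "(trace ((mat 1 + E x) ** ?H \<alpha> x) *\<^sub>R ?p \<alpha> x - ((mat 1 + E x) ** ?H \<alpha> x) *v ?p \<alpha> x) - (trace (?H \<alpha> x) *\<^sub>R ?v \<alpha> x - ?H \<alpha> x *v ?v \<alpha> x) =
   (trace (E x ** ?H \<alpha> x) *\<^sub>R ?p \<alpha> x + trace (?H \<alpha> x) *\<^sub>R (E x *v ?v \<alpha> x)) - ((E x ** ?H \<alpha> x) *v ?p \<alpha> x + ?H \<alpha> x *v (E x *v ?v \<alpha> x))" for \<alpha>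
   unfolding matrix_add_rdistrib matrix_mul_lid trace_add matrix_vector_mult_add_rdistrib
   by (simp add: p matrix_vector_right_distrib algebra_simps)
  thus ?thesis by (simp add: flux_field_def mass_field_def G sum_subtractf[symmetric])
 qed
 have F: "(\<lambda>x. (flux_field f x - mass_field f x) $ j) \<in> decay (2 * p + 1)" for j
  unfolding eq by (intro big_sum_in_bigo sum_in_bigo terms)
 have "(\<lambda>x. x $ j / norm x) \<in> decay 0" for j :: 'n
  using component_le_norm_cart[of _ j] by (intro decay_0) (auto simp: divide_le_eq_1)
 hence "(\<lambda>x. \<Sum>j. (flux_field f x - mass_field f x) $ j * (x $ j / norm x)) \<in> decay (2 * p + 1)"
  by (rule decay_sum_mult[OF F]) simp
 thus ?thesis by (simp add: inner_vec_def sum_divide_distrib)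
qed

end

section \<open>Integrability at infinity\<close>

lemma dyadic_shell:
 fixes R t :: real
 assumes "R > 0" "R \<le> t"
 shows "\<exists>i. 2 ^ i * R \<le> t \<and> t \<le> 2 ^ Suc i * R"
proof -
 have "\<exists>n. t < 2 ^ n * R"
 proof -
  obtain n where "t / R < 2 ^ n" using real_arch_pow[of 2 "t / R"] by auto
  thus ?thesis using assms(1) by (auto simp: field_simps)
 qed
 hence "t < 2 ^ (LEAST n. t < 2 ^ n * R) * R" by (rule LeastI_ex)
 moreover obtain i where i: "(LEAST n. t < 2 ^ n * R) = Suc i"
 proof (cases "LEAST n. t < 2 ^ n * R")
  case 0
  thus ?thesis using calculation assms by simp
 qed
 moreover have "\<not> t < 2 ^ i * R" by (rule not_less_Least) (simp add: i)
 ultimately show ?thesis by (metis less_imp_le not_less)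
qed

text \<open>Dyadic shells bound the integral by a geometric series of ratio \<open>2\<^sup>n\<^sup>-\<^sup>q\<close>.\<close>

lemma nn_integral_power_decay:
 assumes R: "R > 0" and q: "q > real CARD('n)"
 shows "(\<integral>\<^sup>+x. ennreal (indicator {x :: real^'n. R \<le> norm x} x * norm x powr (- q)) \<partial>lborel) < \<infinity>"
proof -
 let ?n = "CARD('n)"
 define c where "c i = (2 ^ i * R) powr (- q)" for i :: nat
 define B where "B i = cball (0 :: real^'n) (2 ^ Suc i * R)" for i
 have le: "ennreal (indicator {x :: real^'n. R \<le> norm x} x * norm x powr (- q)) \<le> (suminf (\<lambda>i. ennreal (c i) * indicator (B i) x))" for x :: "real^'n"
 proof (cases "R \<le> norm x")
  case True
  then obtain i where i: "2 ^ i * R \<le> norm x" "norm x \<le> 2 ^ Suc i * R" using dyadic_shell[OF R] by blast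
  have "norm x powr (- q) \<le> c i"
   unfolding c_def using i(1) R q by (intro powr_mono2') auto
  hence "ennreal (indicator {x :: real^'n. R \<le> norm x} x * norm x powr (- q)) \<le> ennreal (c i) * indicator (B i) x"
   using True i(2) by (simp add: B_def ennreal_leI)
  also have "... = (\<Sum>j\<in>{i}. ennreal (c j) * indicator (B j) x)" by (simp only: sum.insert sum.empty finite.emptyI empty_iff not_False_eq_True add_0_right)
  also have "... \<le> (suminf (\<lambda>j. ennreal (c j) * indicator (B j) x))" by (rule sum_le_suminf) auto
  finally show ?thesis .
 qed simp
 define \<rho> where "\<rho> = 2 powr (real ?n - q)"
 have \<rho>: "0 \<le> \<rho>" "\<rho> < 1" using q by (auto simp: \<rho>_def powr_less_one)
 define K where "K = unit_ball_vol ?n * 2 ^ ?n * R powr (real ?n - q)"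
 have trm: "ennreal (c i) * emeasure lborel (B i) = ennreal (K * \<rho> ^ i)" for i
 proof -
  have p: "2 ^ i * R > 0" using R by simp
  have "ennreal (c i) * emeasure lborel (B i) = ennreal (c i * (unit_ball_vol ?n * (2 * (2 ^ i * R)) ^ ?n))"
   using R by (simp add: B_def c_def emeasure_cball ennreal_mult' mult.assoc)
  also have "c i * (unit_ball_vol ?n * (2 * (2 ^ i * R)) ^ ?n) = unit_ball_vol ?n * 2 ^ ?n * ((2 ^ i * R) powr (- q) * (2 ^ i * R) powr real ?n)"
   unfolding c_def power_mult_distrib[of 2] powr_realpow[OF p, of ?n] by (simp add: mult_ac)
  also have "(2 ^ i * R) powr (- q) * (2 ^ i * R) powr real ?n = (2 ^ i * R) powr (real ?n - q)"
   by (simp add: powr_add[symmetric])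
  also have "... = \<rho> ^ i * R powr (real ?n - q)"
  proof -
   have "(2 ^ i) powr (real ?n - q) = \<rho> ^ i"
    by (simp add: \<rho>_def powr_realpow[symmetric] powr_powr mult.commute)
   thus ?thesis using R by (simp add: powr_mult)
  qed
  finally show ?thesis by (simp add: K_def mult_ac)
 qed
 have "(\<integral>\<^sup>+x. ennreal (indicator {x :: real^'n. R \<le> norm x} x * norm x powr (- q)) \<partial>lborel) \<le> (\<integral>\<^sup>+x. (suminf (\<lambda>i. ennreal (c i) * indicator (B i) x)) \<partial>lborel)"
  by (intro nn_integral_mono le)
 also have "... = (suminf (\<lambda>i. \<integral>\<^sup>+x. ennreal (c i) * indicator (B i) x \<partial>lborel))"
  by (intro nn_integral_suminf borel_measurable_times_ennreal) (auto simp: B_def intro!: borel_measurable_indicator)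
 also have "... = (suminf (\<lambda>i. ennreal (c i) * emeasure lborel (B i)))" by (simp add: nn_integral_cmult_indicator B_def)
 also have "... = (suminf (\<lambda>i. ennreal (K * \<rho> ^ i)))" by (simp only: trm)
 also have "... < \<infinity>"
 proof -
  have "summable (\<lambda>i. K * \<rho> ^ i)" using \<rho> by (intro summable_mult summable_geometric) auto
  hence "(suminf (\<lambda>i. ennreal (K * \<rho> ^ i))) = ennreal (suminf (\<lambda>i. K * \<rho> ^ i))"
   using \<rho>(1) by (intro suminf_ennreal2) (auto simp: K_def)
  thus ?thesis by simp
 qed
 finally show ?thesis .
qed

lemma set_integrable_power_decay:
 fixes g :: "real^'n => real"
 assumes R: "R > 0" and q: "q > real CARD('n)" and m: "set_borel_measurable lborel E g"
  and b: "\<And>x. x \<in> E ==> R \<le> norm x \<and> \<bar>g x\<bar> \<le> C * norm x powr (- q)"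
 shows "set_integrable lborel E g"
proof -
 let ?h = "\<lambda>x :: real^'n. indicator {x. R \<le> norm x} x * norm x powr (- q)"
 have hm: "?h \<in> borel_measurable lborel" by measurable
 have h: "integrable lborel (\<lambda>x. \<bar>C\<bar> * ?h x)"
  by (intro integrable_mult_right integrableI_nonneg hm nn_integral_power_decay[OF R q]) auto
 show ?thesis
  unfolding set_integrable_def
 proof (rule Bochner_Integration.integrable_bound[OF h])
  show "(\<lambda>x. indicator E x *\<^sub>R g x) \<in> borel_measurable lborel" using m by (simp add: set_borel_measurable_def)
  show "AE x in lborel. norm (indicator E x *\<^sub>R g x) \<le> norm (\<bar>C\<bar> * ?h x)"
  proof (rule AE_I2)
   fix x
   show "norm (indicator E x *\<^sub>R g x) \<le> norm (\<bar>C\<bar> * ?h x)"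
   proof (cases "x \<in> E")
    case True
    have "\<bar>g x\<bar> \<le> C * norm x powr (- q)" using b[OF True] by blast
    also have "... \<le> \<bar>C\<bar> * norm x powr (- q)" by (intro mult_right_mono) auto
    finally show ?thesis using True b[OF True] by simp
   qed simp
  qed
 qed
qed

lemma S_perp_continuous:
 assumes f: "\<And>\<alpha>. C2_scalar D (\<lambda>x. f x $ \<alpha>)"
 shows "continuous_on D (S_perp f)"
proof -
 note G = C1_on_continuous[OF graph_metric_inv_C1[OF f]] and p = C1_on_continuous[OF graph_gradient_C1[OF f]]
 show ?thesis
  unfolding S_perp_eq[OF f, abs_def] inner_vec_def matrix_vector_mult_def matrix_matrix_mult_def
  by (simp add: continuous_on_sum continuous_on_diff continuous_on_mult hess_continuous[OF f] G p)
qed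

text \<open>Near \<open>\<Omega>\<close> the function is bounded, since it extends continuously by \<open>0\<close> to a compact set; far away
 it decays faster than \<open>\<bar>x\<bar>\<^sup>-\<^sup>n\<close>.\<close>

lemma S_perp_integrable:
 fixes f :: "real^'n => real^'m"
 assumes \<Omega>: "open \<Omega>" "bounded \<Omega>" and f: "\<And>\<alpha>. C2_scalar (- closure \<Omega>) (\<lambda>x. f x $ \<alpha>)"
  and p: "p > (real CARD('n) - 2) / 2"
  and rate: "flat_rate f p"
  and lim: "\<And>z. z \<in> frontier \<Omega> ==> (S_perp f \<longlongrightarrow> 0) (at z within - closure \<Omega>)"
 shows "set_integrable lborel (- closure \<Omega>) (S_perp f)"
proof -
 let ?D = "- closure \<Omega>"
 have oD: "open ?D" by (rule open_Compl[OF closed_closure])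
 note Sc = S_perp_continuous[OF f]
 obtain C R where RC: "C > 0" "R > 0" "\<And>x. R \<le> norm x ==> \<bar>S_perp f x\<bar> \<le> C * norm x powr (- (2 * p + 2))"
  by (rule decay_bound[OF S_perp_decay[OF f rate]]) (rule that)
 \<comment> \<open>\<open>S\<^sup>\<bottom>\<close> extends by \<open>0\<close> to a continuous function on the closed exterior\<close>
 define F where "F x = (if x \<in> ?D then S_perp f x else 0)" for x
 have "continuous_on (- \<Omega>) F"
  unfolding continuous_on_def
 proof
  fix z assume z: "z \<in> - \<Omega>"
  have l: "(S_perp f \<longlongrightarrow> F z) (at z within ?D)"
   using z Sc lim \<Omega>(1) by (cases "z \<in> ?D") (auto simp: F_def continuous_on_def frontier_def interior_open)
  show "(F \<longlongrightarrow> F z) (at z within - \<Omega>)"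
  proof (cases "z \<in> ?D")
   case True
   have ev: "\<forall>\<^sub>F x in at z. S_perp f x = F x"
    using eventually_at_in_open'[OF oD True] by eventually_elim (simp add: F_def)
   have "(S_perp f \<longlongrightarrow> F z) (at z)" using l unfolding at_within_open[OF True oD] .
   thus ?thesis by (rule Lim_at_imp_Lim_at_within[OF Lim_transform_eventually[OF _ ev]])
  next
   case False
   show ?thesis
   proof (rule tendstoI)
    fix e :: real assume e: "e > 0"
    have "\<forall>\<^sub>F x in at z. x \<in> ?D --> dist (S_perp f x) 0 < e"
     using tendstoD[OF l e] False unfolding eventually_at_filter by (auto simp: F_def elim!: eventually_mono)
    thus "\<forall>\<^sub>F x in at z within - \<Omega>. dist (F x) (F z) < e"
     unfolding eventually_at_filter by eventually_elim (use False e in \<open>auto simp: F_def\<close>)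
   qed
  qed
 qed
 hence Fc: "continuous_on (cball 0 R - \<Omega>) F" by (rule continuous_on_subset) blast
 have mD: "set_borel_measurable lborel ?D (S_perp f)"
  unfolding set_borel_measurable_def using borel_measurable_continuous_on_indicator[OF _ Sc] oD by simp
 have m: "set_borel_measurable lborel E (S_perp f)" if "E \<subseteq> ?D" "E \<in> sets borel" for E
  using set_borel_measurable_subset[OF mD _ that(1)] that(2) by simp
 have near: "set_integrable lborel (?D \<inter> cball 0 R) (S_perp f)"
 proof -
  have "set_integrable lborel (cball 0 R - \<Omega>) F"
   using borel_integrable_compact[OF compact_diff[OF compact_cball \<Omega>(1)] Fc] by (simp add: set_integrable_def)
  hence "set_integrable lborel (?D \<inter> cball 0 R) F"
   by (rule set_integrable_subset) (use oD closure_subset[of \<Omega>] in auto)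
  thus ?thesis by (subst set_integrable_cong[OF refl refl, of _ _ F]) (auto simp: F_def)
 qed
 have far: "set_integrable lborel (?D - cball 0 R) (S_perp f)"
 proof (rule set_integrable_power_decay[OF RC(2), where C = C and q = "2 * p + 2"])
  show "real CARD('n) < 2 * p + 2" using p by (simp add: field_simps)
  show "set_borel_measurable lborel (?D - cball 0 R) (S_perp f)" using oD by (intro m) auto
 qed (use RC(3) in auto)
 have "?D = (?D \<inter> cball 0 R) \<union> (?D - cball 0 R)" by blast
 thus ?thesis using set_integrable_Un[OF near far] oD by auto
qed

section \<open>The mass formula\<close>

abbreviation sphere_flux :: "(real^'n => real^'n) => real => real" where
 "sphere_flux X R \<equiv> LINT x:sphere 0 R|area_measure (sphere 0 R). X x \<bullet> x / R"

locale flat_graph =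
 fixes \<Omega> :: "(real^'n) set" and f :: "real^'n => real^'m"
 assumes dimension: "CARD('n) \<ge> 2" and open_\<Omega>: "open \<Omega>" and bounded_\<Omega>: "bounded \<Omega>" and f_cont: "continuous_on (- \<Omega>) f"
  and f_const: "\<And>C. C \<in> components (frontier \<Omega>) ==> f constant_on C"
  and af: "asymptotically_flat (- closure \<Omega>) f"
  and submanifold: "C2_submanifold_with_boundary (graph_over (- \<Omega>) f) (graph_over (frontier \<Omega>) f)"
  and S_perp_lim: "\<And>z. z \<in> frontier \<Omega> ==> (S_perp f \<longlongrightarrow> 0) (at z within - closure \<Omega>)"
  and tangency: "\<And>C. C \<in> components (frontier \<Omega>) ==>
      \<exists>L. subspace L \<and> dim L = 1 \<and>
       (\<forall>x\<in>C. tangent_space (graph_over (- \<Omega>) f) (x, f x) = tangent_space C x \<times> L)"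
begin

abbreviation total_curvature :: real where
 "total_curvature \<equiv> LINT x:frontier \<Omega>|area_measure (frontier \<Omega>). mean_curvature \<Omega> x"

definition curv :: "real^'n => real" where "curv x = scalar_curvature f x + S_perp f x"

lemma open_ext: "open (- closure \<Omega>)" by (rule open_Compl[OF closed_closure])

lemma f_C2: "C2_scalar (- closure \<Omega>) (\<lambda>x. f x $ \<alpha>)"
 using af C2_on_component[OF _ bounded_linear_vec_nth] unfolding asymptotically_flat_def by blast

lemma S_int: "set_integrable lborel (- closure \<Omega>) (scalar_curvature f)"
 using af by (simp add: asymptotically_flat_def)

text \<open>Some exponent as in the definition of asymptotic flatness.\<close>

definition p :: real where
 "p = (SOME p. p > (real CARD('n) - 2) / 2 \<and> flat_rate f p)"

lemma p: "p > (real CARD('n) - 2) / 2" "flat_rate f p"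
proof -
 have "\<exists>p. p > (real CARD('n) - 2) / 2 \<and> flat_rate f p"
  using af unfolding asymptotically_flat_def flat_rate_def by blast
 from someI_ex[OF this] show "p > (real CARD('n) - 2) / 2" "flat_rate f p"
  unfolding p_def[symmetric] by blast+
qed

lemma curv_int: "set_integrable lborel (- closure \<Omega>) curv"
 unfolding curv_def[abs_def]
 by (rule set_integral_add(1)[OF S_int S_perp_integrable[OF open_\<Omega> bounded_\<Omega> f_C2 p S_perp_lim]])

lemma chart_at:
 assumes "x0 \<in> frontier \<Omega>" "open B" "x0 \<in> B"
 obtains k \<sigma> a b Q w z W where "boundary_chart \<Omega> f x0 k \<sigma> a b Q w z W" "\<And>y. y \<in> Q ==> set_coord k (w y) y \<in> B"
 by (rule boundary_chart_exists[OF open_\<Omega> f_cont _ f_C2 submanifold _ assms])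
  (rule f_const tangency that, assumption+)+

lemma C1_hypersurface_frontier: "C1_hypersurface (frontier \<Omega>)"
 unfolding C1_hypersurface_def
proof
 fix x0 assume x0: "x0 \<in> frontier \<Omega>"
 obtain k \<sigma> a b Q w z W where bp: "boundary_chart \<Omega> f x0 k \<sigma> a b Q w z W"
  by (rule chart_at[OF x0 open_UNIV UNIV_I]) (rule that)
 interpret boundary_chart \<Omega> f x0 k \<sigma> a b Q w z W by (rule bp)
 show "\<exists>W k U u. open W \<and> x0 \<in> W \<and> graph_patch k U u \<and> patch_image k U u \<subseteq> frontier \<Omega> \<and> frontier \<Omega> \<inter> W \<subseteq> patch_image k U u"
  using open_W x0W u_patch patch_frontier frontier_patch by blast
qed

lemma compact_frontier: "compact (frontier \<Omega>)"
 by (rule compact_frontier_bounded[OF bounded_\<Omega>])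

lemma area_frontier: "is_area_measure (frontier \<Omega>) (area_measure (frontier \<Omega>))"
 by (rule is_area_measure_area_measure[OF compact_frontier C1_hypersurface_frontier])

text \<open>Every boundary point is a limit of exterior points, as its chart contains points with \<open>y\<^sub>k > 0\<close>.\<close>

lemma frontier_accessible:
 assumes "x0 \<in> frontier \<Omega>" "open B" "x0 \<in> B"
 shows "B \<inter> - closure \<Omega> \<noteq> {}"
proof -
 obtain k \<sigma> a b Q w z W where bp: "boundary_chart \<Omega> f x0 k \<sigma> a b Q w z W" and B: "\<And>y. y \<in> Q ==> set_coord k (w y) y \<in> B"
  by (rule chart_at[OF assms]) (rule that)
 interpret boundary_chart \<Omega> f x0 k \<sigma> a b Q w z W by (rule bp)
 have b: "b \<in> cbox a b" using ak(3) by (auto simp: mem_box_cart less_imp_le)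
 hence "\<Phi> b \<in> - closure \<Omega>" using interior_chart(1) ak(2) by blast
 moreover have "\<Phi> b \<in> B" using B b cQ by (auto simp: \<Phi>_def)
 ultimately show ?thesis by blast
qed

lemma frontier_truncated:
 assumes R: "closure \<Omega> \<subseteq> ball 0 R" "R > 0"
 shows "frontier (- closure \<Omega> \<inter> ball 0 R) = frontier \<Omega> \<union> sphere 0 R"
proof -
 let ?D = "- closure \<Omega> \<inter> ball 0 R"
 have oD: "open ?D" using open_ext by blast
 have fr: "frontier ?D = closure ?D - ?D" unfolding frontier_def interior_open[OF oD] ..
 have "closure ?D \<subseteq> - \<Omega> \<inter> cball 0 R"
  using open_\<Omega> closure_subset[of \<Omega>] by (intro closure_minimal closed_Int closed_Compl) (auto simp: closed_Compl)
 hence "frontier ?D \<subseteq> frontier \<Omega> \<union> sphere 0 R"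
  unfolding fr using open_\<Omega> by (auto simp: frontier_def interior_open)
 moreover have "frontier \<Omega> \<subseteq> closure ?D"
 proof
  fix x assume x: "x \<in> frontier \<Omega>"
  show "x \<in> closure ?D"
   unfolding closure_iff_nhds_not_empty
  proof (intro allI impI)
   fix A B assume "B \<subseteq> A" "open B" "x \<in> B"
   moreover have "x \<in> ball 0 R" using x R(1) by (auto simp: frontier_def)
   ultimately show "?D \<inter> A \<noteq> {}" using frontier_accessible[OF x, of "B \<inter> ball 0 R"] by blast
  qed
 qed
 moreover have "sphere 0 R \<subseteq> closure ?D"
 proof
  fix x :: "real^'n" assume x: "x \<in> sphere 0 R"
  hence "x \<in> - closure \<Omega> \<inter> closure (ball 0 R)" using R by auto
  thus "x \<in> closure ?D" using open_Int_closure_subset[OF open_ext] by blast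
 qed
 moreover have "frontier \<Omega> \<inter> ?D = {}" "sphere 0 R \<inter> ?D = {}" by (auto simp: frontier_def)
 ultimately show ?thesis unfolding fr by blast
qed

lemma weak_field_flux:
 assumes D: "open D" "D \<subseteq> - closure \<Omega>"
 shows "weak_field D (flux_field f) curv"
proof
 have fD: "C2_scalar D (\<lambda>x. f x $ \<alpha>)" for \<alpha> by (rule C2_scalar_subset[OF f_C2 D])
 show "open D" by (rule D)
 show "continuous_on D (\<lambda>x. flux_field f x $ j)" for j by (rule flux_field_continuous[OF fD])
 show "set_integrable lborel D curv" by (rule set_integrable_subset[OF curv_int _ D(2)]) (use D in simp)
 fix \<phi> K assume "C1_on UNIV \<phi>" "compact K" "K \<subseteq> D" "\<And>x. x \<notin> K ==> \<phi> x = (0::real)"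
 thus "(LINT x|lborel. (\<Sum>j. flux_field f x $ j * pd j \<phi> x)) = - (LINT x|lborel. curv x * \<phi> x)"
  unfolding curv_def using weak_divergence_flux_field(3)[OF fD, of \<phi> K] by blast
qed

text \<open>The boundary consists of \<open>\<Sigma>\<close> (index \<open>True\<close>) and the sphere (index \<open>False\<close>).\<close>

theorem truncated_mass_identity:
 assumes R: "closure \<Omega> \<subseteq> ball 0 R" "R > 0"
 shows "set_integrable (area_measure (frontier \<Omega>)) (frontier \<Omega>) (mean_curvature \<Omega>)"
  "set_integrable (area_measure (sphere 0 R)) (sphere 0 R) (\<lambda>x. flux_field f x \<bullet> x / R)"
  "(LINT x:- closure \<Omega> \<inter> ball 0 R|lborel. curv x) =
   - total_curvature
   + sphere_flux (flux_field f) R"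
proof -
 let ?D = "- closure \<Omega> \<inter> ball 0 R"
 have oD: "open ?D" using open_ext by blast
 have wf: "weak_field ?D (flux_field f) curv" by (rule weak_field_flux[OF oD]) simp
 interpret weak_field ?D "flux_field f" curv by (rule wf)
 note fr = frontier_truncated[OF R]
 have bD: "bounded ?D" by (rule bounded_subset[OF bounded_ball[of 0 R]]) simp
 have loc1: "\<exists>W. open W \<and> x \<in> W \<and> boundary_term_near (area_measure (frontier \<Omega>)) (frontier \<Omega>) (mean_curvature \<Omega>) W"
  if x: "x \<in> frontier \<Omega>" for x
 proof -
  have xR: "x \<in> ball 0 R" using x R by (auto simp: frontier_def)
  obtain k \<sigma> a b Q w z W where bp: "boundary_chart \<Omega> f x k \<sigma> a b Q w z W" and B: "\<And>y. y \<in> Q ==> set_coord k (w y) y \<in> ball 0 R"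
   by (rule chart_at[OF x open_ball xR]) (rule that)
  interpret bp: boundary_chart \<Omega> f x k \<sigma> a b Q w z W by (rule bp)
  show ?thesis
  proof (intro exI conjI)
   show "open (bp.W1 \<inter> ball 0 R)" using bp.W1 by blast
   show "x \<in> bp.W1 \<inter> ball 0 R" using bp.W1 xR by blast
   show "boundary_term_near (area_measure (frontier \<Omega>)) (frontier \<Omega>) (mean_curvature \<Omega>) (bp.W1 \<inter> ball 0 R)"
   proof (rule bp.boundary_term[OF f_C2 wf _ _ _ _ area_frontier])
    fix y assume y: "y \<in> box a b"
    hence yc: "y \<in> cbox a b" "y $ k > 0" using box_subset_cbox bp.box_U by blast+
    hence "y \<in> Q" using bp.cQ by blast
    thus "bp.\<Phi> y \<in> ?D" using bp.interior_chart(1)[OF yc] B by (simp add: bp.\<Phi>_def)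
   qed (use bp.W1 in auto)
  qed
 qed
 have loc2: "\<exists>W. open W \<and> x \<in> W \<and> boundary_term_near (area_measure (sphere 0 R)) (sphere 0 R) (\<lambda>x. - (flux_field f x \<bullet> x) / R) W"
  if x: "x \<in> sphere 0 R" for x
  by (rule sphere_boundary_term[OF R(2) x open_ext _ _ flux_field_continuous[OF f_C2]]) (use x R in auto)
 define S where "S i = (if i then frontier \<Omega> else sphere 0 R)" for i
 define h where "h i = (if i then mean_curvature \<Omega> else (\<lambda>x. - (flux_field f x \<bullet> x) / R))" for i
 have "S i \<inter> S j = {}" if "i \<noteq> j" for i j using that R by (auto simp: S_def frontier_def)
 moreover have "frontier ?D = (\<Union>i. S i)" unfolding fr by (simp add: S_def UNIV_bool Un_commute)
 moreover have "\<exists>W. open W \<and> x \<in> W \<and> boundary_term_near (area_measure (S i)) (S i) (h i) W" if "x \<in> S i" for i x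
  using loc1[of x] loc2[of x] that by (cases i) (simp_all add: S_def h_def)
 ultimately have dt: "set_integrable (area_measure (S i)) (S i) (h i)"
  "(LINT x:?D|lborel. curv x) = - (\<Sum>i. LINT x:S i|area_measure (S i). h i x)" for i
  using divergence_theorem[OF bD, of S "\<lambda>i. area_measure (S i)" h] by (simp_all add: S_def)
 show "set_integrable (area_measure (frontier \<Omega>)) (frontier \<Omega>) (mean_curvature \<Omega>)"
  using dt(1)[of True] by (simp add: S_def h_def)
 have e: "(\<lambda>x. - (flux_field f x \<bullet> x) / R) = (\<lambda>x. - (flux_field f x \<bullet> x / R))" by simp
 show "set_integrable (area_measure (sphere 0 R)) (sphere 0 R) (\<lambda>x. flux_field f x \<bullet> x / R)"
  using dt(1)[of False] unfolding S_def h_def e set_integrable_def by simp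
 show "(LINT x:?D|lborel. curv x) = - total_curvature
   + sphere_flux (flux_field f) R"
  using dt(2) by (simp add: S_def h_def UNIV_bool e set_lebesgue_integral_def)
qed

lemma ADM_flux_mass_field:
 assumes R: "closure \<Omega> \<subseteq> ball 0 R" "R > 0"
 shows "ADM_flux f R = 1 / (2 * (real CARD('n) - 1) * unit_sphere_area TYPE('n)) *
  sphere_flux (mass_field f) R"
proof -
 let ?e = "\<lambda>x. \<Sum>i j. (pd i (\<lambda>y. graph_metric f y $ i $ j) x - pd j (\<lambda>y. graph_metric f y $ i $ i) x) * (x $ j / R)"
 have "?e x = mass_field f x \<bullet> x / R"
  if "x \<in> sphere 0 R" for x
 proof -
  have x: "x \<in> - closure \<Omega>" using that R by auto
  have "?e x =
   (\<Sum>j. (\<Sum>i. pd i (\<lambda>y. graph_metric f y $ i $ j) x - pd j (\<lambda>y. graph_metric f y $ i $ i) x) * (x $ j / R))"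
   by (subst sum.swap) (simp only: sum_distrib_right)
  also have "... = mass_field f x \<bullet> x / R"
   unfolding mass_field_eq[OF f_C2 x] by (simp add: inner_vec_def sum_divide_distrib)
  finally show ?thesis .
 qed
 hence "(\<lambda>x. indicator (sphere 0 R) x *\<^sub>R ?e x)
  = (\<lambda>x. indicator (sphere 0 R) x *\<^sub>R (mass_field f x \<bullet> x / R))"
  by (auto simp: fun_eq_iff indicator_def)
 thus ?thesis unfolding ADM_flux_def set_lebesgue_integral_def by simp
qed

text \<open>The two fields differ by \<open>O(R\<^sup>-\<^sup>2\<^sup>p\<^sup>-\<^sup>1)\<close> on a sphere of area \<open>O(R\<^sup>n\<^sup>-\<^sup>1)\<close>, and \<open>n - 2 - 2p < 0\<close>.\<close>

lemma flux_difference_vanishes: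
 "((\<lambda>R. sphere_flux (flux_field f) R -
  sphere_flux (mass_field f) R) \<longlongrightarrow> 0) at_top"
proof -
 let ?F = "\<lambda>R. sphere_flux (flux_field f) R"
  and ?M = "\<lambda>R. sphere_flux (mass_field f) R"
 obtain K R0 where K: "K > 0" "R0 > 0" "\<And>x. R0 \<le> norm x ==> \<bar>(flux_field f x - mass_field f x) \<bullet> x / norm x\<bar> \<le> K * norm x powr (- (2 * p + 1))"
  by (rule decay_bound[OF flux_mass_decay[OF f_C2 p(2)]]) (rule that)
 obtain R1 where R1: "R1 > 0" "closure \<Omega> \<subseteq> ball 0 R1" using bounded_\<Omega> bounded_closure bounded_subset_ballD by metis
 define A where "A = real CARD('n) * unit_ball_vol (real CARD('n))"
 have bound: "\<bar>?F R - ?M R\<bar> \<le> K * A * R powr (real CARD('n) - 2 - 2 * p)" if R: "R \<ge> max R0 R1" for R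
 proof -
  have Rp: "R > 0" and RR: "R0 \<le> R" "closure \<Omega> \<subseteq> ball 0 R" using R R1 by auto
  let ?g = "\<lambda>x. (flux_field f x - mass_field f x) \<bullet> x / R"
  have sub: "sphere 0 R \<subseteq> - closure \<Omega>" using RR(2) by auto
  note Fc = continuous_on_subset[OF flux_field_continuous[OF f_C2] sub] and Mc = continuous_on_subset[OF mass_field_continuous[OF f_C2] sub]
  have gc: "continuous_on (sphere 0 R) ?g" and mc: "continuous_on (sphere 0 R) (\<lambda>x. mass_field f x \<bullet> x / R)"
   unfolding inner_vec_def using Fc Mc Rp
   by (simp_all add: continuous_on_divide continuous_on_sum continuous_on_mult continuous_on_diff continuous_on_component)
  have i1: "set_integrable (area_measure (sphere 0 R)) (sphere 0 R) (\<lambda>x. flux_field f x \<bullet> x / R)"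
   by (rule truncated_mass_identity(2)[OF RR(2) Rp])
  obtain B where "\<And>x. x \<in> sphere 0 R ==> \<bar>mass_field f x \<bullet> x / R\<bar> \<le> B"
   using compact_continuous_bounded[OF compact_sphere mc] by blast
  hence i2: "set_integrable (area_measure (sphere 0 R)) (sphere 0 R) (\<lambda>x. mass_field f x \<bullet> x / R)"
   by (rule sphere_integral_bound(1)[OF dimension Rp mc])
  have "?F R - ?M R = (LINT x:sphere 0 R|area_measure (sphere 0 R). ?g x)"
   unfolding inner_diff_left diff_divide_distrib by (rule set_integral_diff(2)[OF i1 i2, symmetric])
  also have "\<bar>...\<bar> \<le> \<bar>K * R powr (- (2 * p + 1))\<bar> * (A * R ^ (CARD('n) - 1))"
   unfolding A_def by (rule sphere_integral_bound(2)[OF dimension Rp gc]) (use K(3) RR(1) in force)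
  also have "... = K * A * (R powr (- (2 * p + 1)) * R ^ (CARD('n) - 1))" using K(1) by (simp add: abs_mult mult_ac)
  also have "R powr (- (2 * p + 1)) * R ^ (CARD('n) - 1) = R powr (real CARD('n) - 2 - 2 * p)"
   using Rp dimension by (simp add: powr_realpow[symmetric] powr_add[symmetric] algebra_simps)
  finally show ?thesis .
 qed
 have neg: "real CARD('n) - 2 - 2 * p < 0" using p(1) by (simp add: field_simps)
 have "((\<lambda>R. R powr (real CARD('n) - 2 - 2 * p)) \<longlongrightarrow> 0) at_top"
  by (rule tendsto_neg_powr[OF neg filterlim_ident])
 hence "((\<lambda>R. K * A * R powr (real CARD('n) - 2 - 2 * p)) \<longlongrightarrow> 0) at_top"
  using tendsto_mult_right_zero by blast
 thus ?thesis
 proof (rule Lim_null_comparison[rotated])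
  show "\<forall>\<^sub>F R in at_top. norm (?F R - ?M R) \<le> K * A * R powr (real CARD('n) - 2 - 2 * p)"
   using eventually_ge_at_top[of "max R0 R1"] unfolding real_norm_def by eventually_elim (rule bound)
 qed
qed

lemma truncated_integral_limit:
 "((\<lambda>R. LINT x:- closure \<Omega> \<inter> ball 0 R|lborel. curv x) \<longlongrightarrow> (LINT x:- closure \<Omega>|lborel. curv x)) at_top"
 unfolding set_lebesgue_integral_def
proof (rule integral_dominated_convergence_at_top)
 let ?D = "- closure \<Omega>"
 show "integrable lborel (\<lambda>x. norm (indicator ?D x *\<^sub>R curv x))"
  using curv_int unfolding set_integrable_def by (rule integrable_norm)
 show "(\<lambda>x. indicator ?D x *\<^sub>R curv x) \<in> borel_measurable lborel"
  using curv_int unfolding set_integrable_def by (rule borel_measurable_integrable)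
 have "set_integrable lborel (?D \<inter> ball 0 R) curv" for R
  by (rule set_integrable_subset[OF curv_int]) (use open_ext in auto)
 thus "(\<lambda>x. indicator (?D \<inter> ball 0 R) x *\<^sub>R curv x) \<in> borel_measurable lborel" for R
  unfolding set_integrable_def by (rule borel_measurable_integrable)
 show "\<forall>\<^sub>F R in at_top. AE x in lborel. norm (indicator (?D \<inter> ball 0 R) x *\<^sub>R curv x) \<le> norm (indicator ?D x *\<^sub>R curv x)"
  by (intro always_eventually allI AE_I2) (auto simp: indicator_def)
 show "AE x in lborel. ((\<lambda>R. indicator (?D \<inter> ball 0 R) x *\<^sub>R curv x) \<longlongrightarrow> indicator ?D x *\<^sub>R curv x) at_top"
 proof (rule AE_I2)
  fix x :: "real^'n"
  have "\<forall>\<^sub>F R in at_top. indicator (?D \<inter> ball 0 R) x *\<^sub>R curv x = indicator ?D x *\<^sub>R curv x"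
   using eventually_gt_at_top[of "norm x"] by eventually_elim (simp add: indicator_def)
  thus "((\<lambda>R. indicator (?D \<inter> ball 0 R) x *\<^sub>R curv x) \<longlongrightarrow> indicator ?D x *\<^sub>R curv x) at_top"
   by (rule tendsto_eventually)
 qed
qed

lemma ADM_flux_limit:
 "(ADM_flux f \<longlongrightarrow> 1 / (2 * (real CARD('n) - 1) * unit_sphere_area TYPE('n)) *
  ((LINT x:- closure \<Omega>|lborel. curv x) + total_curvature)) at_top"
proof -
 let ?c = "1 / (2 * (real CARD('n) - 1) * unit_sphere_area TYPE('n))"
  and ?H = "total_curvature"
 let ?F = "\<lambda>R. sphere_flux (flux_field f) R"
  and ?M = "\<lambda>R. sphere_flux (mass_field f) R"
  and ?I = "\<lambda>R. LINT x:- closure \<Omega> \<inter> ball 0 R|lborel. curv x"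
 obtain R1 where R1: "R1 > 0" "closure \<Omega> \<subseteq> ball 0 R1" using bounded_\<Omega> bounded_closure bounded_subset_ballD by metis
 have "((\<lambda>R. ?c * (?I R + ?H - (?F R - ?M R))) \<longlongrightarrow> ?c * ((LINT x:- closure \<Omega>|lborel. curv x) + ?H - 0)) at_top"
  by (intro tendsto_intros truncated_integral_limit flux_difference_vanishes)
 moreover have "\<forall>\<^sub>F R in at_top. ?c * (?I R + ?H - (?F R - ?M R)) = ADM_flux f R"
  using eventually_ge_at_top[of R1]
 proof eventually_elim
  case (elim R)
  hence R: "closure \<Omega> \<subseteq> ball 0 R" "R > 0" using R1 by auto
  show ?case using truncated_mass_identity(3)[OF R] ADM_flux_mass_field[OF R] by simp
 qed
 ultimately show ?thesis by (simp add: tendsto_cong)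
qed

text \<open>The density \<open>\<surd>G\<close> of \<open>dM\<close> cancels against \<open>1 / \<surd>G\<close>.\<close>

lemma graph_volume_integral:
 "set_integrable (graph_volume (- closure \<Omega>) f) (- closure \<Omega>) (\<lambda>x. curv x * (1 / sqrt (det (graph_metric f x))))"
 "(LINT x:- closure \<Omega>|graph_volume (- closure \<Omega>) f. curv x * (1 / sqrt (det (graph_metric f x)))) = (LINT x:- closure \<Omega>|lborel. curv x)"
proof -
 let ?D = "- closure \<Omega>" and ?q = "\<lambda>x. sqrt (det (graph_metric f x))"
 have q: "?q x > 0" for x unfolding graph_metric_gram using det_gram_pos by simp
 have dc: "continuous_on ?D (\<lambda>x. det (graph_metric f x))"
  by (intro C1_on_continuous[OF C1_on_det] open_ext graph_metric_C1[OF f_C2])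
 have qc: "continuous_on ?D ?q" "continuous_on ?D (\<lambda>x. 1 / ?q x)"
  using q by (auto intro!: continuous_intros dc simp: less_imp_neq[symmetric])
 have Db: "?D \<in> sets borel" using open_ext by simp
 have m1: "(\<lambda>x. indicator ?D x * ?q x) \<in> borel_measurable lborel"
  using borel_measurable_continuous_on_indicator[OF Db qc(1)] by simp
 have m2: "(\<lambda>x. indicator ?D x * (1 / ?q x)) \<in> borel_measurable lborel"
  using borel_measurable_continuous_on_indicator[OF Db qc(2)] by simp
 have m3: "(\<lambda>x. indicator ?D x *\<^sub>R curv x) \<in> borel_measurable lborel"
  using curv_int unfolding set_integrable_def by (rule borel_measurable_integrable)
 let ?h = "\<lambda>x. indicator ?D x *\<^sub>R (curv x * (1 / ?q x))"
 have "(\<lambda>x. (indicator ?D x *\<^sub>R curv x) * (indicator ?D x * (1 / ?q x))) \<in> borel_measurable lborel"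
  by (rule borel_measurable_times[OF m3 m2])
 also have "(\<lambda>x. (indicator ?D x *\<^sub>R curv x) * (indicator ?D x * (1 / ?q x))) = ?h" by (auto simp: indicator_def)
 finally have m4: "?h \<in> borel_measurable lborel" .
 have nn: "AE x in lborel. 0 \<le> indicator ?D x * ?q x" using q by (intro AE_I2) (simp add: less_imp_le)
 have e: "(\<lambda>x. (indicator ?D x * ?q x) *\<^sub>R ?h x) = (\<lambda>x. indicator ?D x *\<^sub>R curv x)"
  using q by (auto simp: fun_eq_iff indicator_def less_imp_neq[symmetric])
 show "set_integrable (graph_volume ?D f) ?D (\<lambda>x. curv x * (1 / ?q x))"
  unfolding set_integrable_def graph_volume_def integrable_density[OF m4 m1 nn] e
  using curv_int by (simp add: set_integrable_def)
 show "(LINT x:?D|graph_volume ?D f. curv x * (1 / ?q x)) = (LINT x:?D|lborel. curv x)"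
  unfolding set_lebesgue_integral_def graph_volume_def integral_density[OF m4 m1 nn] e ..
qed

end

theorem theorem1p3:
  fixes \<Omega> :: "(real^'n::finite) set"
    and f :: "real^'n \<Rightarrow> real^'m::finite"
  assumes "CARD('n) \<ge> 2"
    and "open \<Omega>" and "bounded \<Omega>"
    and "continuous_on (- \<Omega>) f"
    and "\<And>C. C \<in> components (frontier \<Omega>) \<Longrightarrow> f constant_on C"
    and "asymptotically_flat (- closure \<Omega>) f"
    and "C2_submanifold_with_boundary (graph_over (- \<Omega>) f) (graph_over (frontier \<Omega>) f)"
    and "\<And>z. z \<in> frontier \<Omega> \<Longrightarrow> (S_perp f \<longlongrightarrow> 0) (at z within - closure \<Omega>)"
    and "\<And>C. C \<in> components (frontier \<Omega>) \<Longrightarrow>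
           \<exists>L. subspace L \<and> dim L = 1 \<and>
             (\<forall>x\<in>C. tangent_space (graph_over (- \<Omega>) f) (x, f x) = tangent_space C x \<times> L)"
  shows "(\<exists>l. (ADM_flux f \<longlongrightarrow> l) at_top) \<and>
    set_integrable (graph_volume (- closure \<Omega>) f) (- closure \<Omega>)
      (\<lambda>x. (scalar_curvature f x + S_perp f x) * (1 / sqrt (det (graph_metric f x)))) \<and>
    set_integrable (area_measure (frontier \<Omega>)) (frontier \<Omega>) (mean_curvature \<Omega>) \<and>
    ADM_mass f = 1 / (2 * (real CARD('n) - 1) * unit_sphere_area TYPE('n)) *
      ((LINT x:- closure \<Omega>|graph_volume (- closure \<Omega>) f.
          (scalar_curvature f x + S_perp f x) * (1 / sqrt (det (graph_metric f x)))) +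
       (LINT x:frontier \<Omega>|area_measure (frontier \<Omega>). mean_curvature \<Omega> x))"
proof -
  interpret flat_graph \<Omega> f
    using assms by unfold_locales
  obtain R where R: "R > 0" "closure \<Omega> \<subseteq> ball 0 R" using bounded_\<Omega> bounded_closure bounded_subset_ballD by metis
  show ?thesis
    using ADM_flux_limit tendsto_Lim[OF _ ADM_flux_limit] graph_volume_integral truncated_mass_identity(1)[OF R(2,1)]
    unfolding ADM_mass_def curv_def by auto
qed

end
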